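(* Let $X$ be a connected smooth manifold, $Q$ a finite quiver, $M=\{M_a\}_{a\in Q_1}$ a collection of smooth vector bundles on $X$, and $\mathcal{R}=(\mathcal{E},\phi)$ an $M$-twisted smooth $Q$-bundle over $X$. Fix a collection of smooth connections $\nabla_1=\{\nabla_a\}_{a\in Q_1}$ on $\{M_a\}_{a\in Q_1}$. Then the following statements are equivalent: (1) The short exact sequence of $M$-twisted quiver bundles $$0\longrightarrow T_X^*\otimes\mathcal{R}\overset{\alpha}{\longrightarrow}J^1\mathcal{R}\overset{\beta}{\longrightarrow}\mathcal{R}\longrightarrow0$$ (where $J^1\mathcal{R}$ is the first jet $M$-twisted quiver bundle with respect to $\nabla_1$) splits. (2) $\mathcal{R}$ admits a smooth relative connection such that the collection of connections on the bundles $M_a$ coincides with $\nabla_1$. (3) The Atiyah class of $\mathcal{R}$ vanishes.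
   Context: A quiver $Q=(Q_0,Q_1,s,t)$ is a directed graph with vertices $Q_0$, arrows $Q_1$, source and target maps $s,t$. $\mathcal{C}^\infty_X$ is the sheaf of smooth functions; vector bundles are identified with locally free sheaves of finite rank, and tensor products are over $\mathcal{C}^\infty_X$. An $M$-twisted $Q$-bundle $\mathcal{R}=(\mathcal{E},\phi)$ assigns a smooth vector bundle $\mathcal{E}_i$ to each $i\in Q_0$ and a morphism $\phi_a:\mathcal{E}_{s(a)}\otimes M_a\to\mathcal{E}_{t(a)}$ to each $a\in Q_1$. A morphism $(\mathcal{E},\phi)\to(\mathcal{E}',\phi')$ is a collection of $\mathcal{C}^\infty_X$-linear maps $f_i:\mathcal{E}_i\to\mathcal{E}_i'$ with $f_{t(a)}\circ\phi_a=\phi_a'\circ(f_{s(a)}\otimes\mathrm{id}_{M_a})$ for all $a$. Replacing vector bundles $\mathcal E_i$ by sheaves of $\mathcal{C}^\infty_X$-modules gives the category of $M$-twisted $Q$-sheaves (equivalently modules over the $M$-twisted path algebra); $\mathrm{Hom}$ and $\mathrm{Ext}^1$ below are taken in this category. A smooth relative connection on $\mathcal{R}$ consists of smooth connections $\nabla_i:\mathcal{E}_i\to T_X^*\otimes\mathcal{E}_i$ ($i\in Q_0$) and $\nabla_a:M_a\to T_X^*\otimes M_a$ ($a\in Q_1$) such that $\nabla_{t(a)}\circ\phi_a=(\mathrm{id}_{T_X^*}\otimes\phi_a)\circ(\nabla_{s(a)}\otimes\nabla_a)$ for all $a\in Q_1$, where $\nabla_{s(a)}\otimes\nabla_a:=\nabla_{s(a)}\otimes\mathrm{id}_{M_a}+\mathrm{id}_{\mathcal{E}_{s(a)}}\otimes\nabla_a$.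 $T_X^*\otimes\mathcal{R}:=(\{T_X^*\otimes\mathcal{E}_i\},\{\mathrm{id}_{T_X^*}\otimes\phi_a\})$. First jet $M$-twisted quiver bundle $J^1\mathcal{R}$ with respect to $\nabla_1$: for $i\in Q_0$, $J^1\mathcal{E}_i:=\mathcal{E}_i\oplus(T_X^*\otimes\mathcal{E}_i)$ as a sheaf of abelian groups, with $\mathcal{C}^\infty_X$-module structure $f\cdot(s,\tau):=(fs,\,f\tau+df\otimes s)$; for $a\in Q_1$, the structure map $\tilde\phi_a:J^1\mathcal{E}_{s(a)}\otimes M_a\to J^1\mathcal{E}_{t(a)}$ is $$\tilde\phi_a((s,\tau)\otimes m)=\big(\phi_a(s\otimes m),\ (\mathrm{id}_{T_X^*}\otimes\phi_a)(\tau\otimes m+s\otimes\nabla_am)\big),$$ using $\mathcal{E}_{s(a)}\otimes T_X^*\otimes M_a\simeq T_X^*\otimes\mathcal{E}_{s(a)}\otimes M_a$. The morphisms $\alpha,\beta$ are given by $\alpha_i(\tau)=(0,\tau)$ and $\beta_i(s,\tau)=s$. Atiyah class of $\mathcal{R}$: the image $\delta(\mathrm{id}_{\mathcal{R}})\in\mathrm{Ext}^1(\mathcal{R},T_X^*\otimes\mathcal{R})$ of $\mathrm{id}_{\mathcal{R}}\in\mathrm{Hom}(\mathcal{R},\mathcal{R})$ under the connecting map $\delta$ of the long exact sequence obtained by applying $\mathrm{Hom}(\mathcal{R},-)$ to the short exact sequence in (1). *)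

theory Defs
  imports
    "HOL-Analysis.Analysis"
    "HOL-Algebra.Module"
    "HOL-Algebra.Free_Abelian_Groups"
    "Graph_Theory.Digraph"
begin

section \<open>Smooth manifolds and smooth functions\<close>

text \<open>
  \<open>Ck_on k f S\<close>, for open \<open>S\<close> in a finite-dimensional space: \<open>f\<close> is of class \<open>C\<^sup>k\<close> on \<open>S\<close>.
\<close>

primrec Ck_on ::
  "nat \<Rightarrow> ('b::real_normed_vector \<Rightarrow> 'c::real_normed_vector) \<Rightarrow> 'b set \<Rightarrow> bool" where
  "Ck_on 0 f S \<longleftrightarrow> continuous_on S f"
| "Ck_on (Suc k) f S \<longleftrightarrow>
     (\<forall>x\<in>S. f differentiable (at x)) \<and>
     (\<forall>e. Ck_on k (\<lambda>x. frechet_derivative f (at x) e) S)"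

definition smooth_on ::
  "'b set \<Rightarrow> ('b::real_normed_vector \<Rightarrow> 'c::real_normed_vector) \<Rightarrow> bool" where
  "smooth_on S f \<longleftrightarrow> (\<forall>k. Ck_on k f S)"

text \<open>
  A manifold is carried by a whole type \<open>'x\<close>; Hausdorff and second countable are type classes.
  A chart is a domain together with a coordinate map, of which only the values on the domain matter.
  The model space is a finite-dimensional normed space (not \<open>euclidean_space\<close>, which would
  exclude dimension 0).
\<close>

type_synonym ('x, 'b) atlas = "('x set \<times> ('x \<Rightarrow> 'b)) set"

definition smooth_manifold ::
  "('x::{t2_space,second_countable_topology}, 'b::real_normed_vector) atlas \<Rightarrow> bool" where
  "smooth_manifold A \<longleftrightarrow>
     (\<exists>B::'b set. finite B \<and> span B = UNIV) \<and>
     (\<Union>(U, c)\<in>A. U) = UNIV \<and>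
     (\<forall>(U, c)\<in>A. open U \<and> open (c ` U) \<and> homeomorphism U (c ` U) c (inv_into U c)) \<and>
     (\<forall>(U, c)\<in>A. \<forall>(V, d)\<in>A. smooth_on (c ` (U \<inter> V)) (d \<circ> inv_into U c))"

text \<open>
  A smooth function on an open \<open>U\<close> is represented by its extension by 0, so that equality
  of sections is equality of functions and restriction is \<open>cut\<close>.
\<close>

definition cut :: "'x set \<Rightarrow> ('x \<Rightarrow> real) \<Rightarrow> 'x \<Rightarrow> real" where
  "cut V f = (\<lambda>x. if x \<in> V then f x else 0)"

definition smooth_fun ::
  "('x::{t2_space,second_countable_topology}, 'b::real_normed_vector) atlas \<Rightarrow> 'x set
     \<Rightarrow> ('x \<Rightarrow> real) set" where
  "smooth_fun A U = {f. (\<forall>x. x \<notin> U \<longrightarrow> f x = 0) \<and>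
     (\<forall>(V, c)\<in>A. smooth_on (c ` (U \<inter> V)) (f \<circ> inv_into V c))}"

definition Cinf ::
  "('x::{t2_space,second_countable_topology}, 'b::real_normed_vector) atlas \<Rightarrow> 'x set
     \<Rightarrow> ('x \<Rightarrow> real) ring" where
  "Cinf A U =
     \<lparr>carrier = smooth_fun A U,
      mult = (\<lambda>f g x. f x * g x), one = cut U (\<lambda>x. 1),
      ring.zero = (\<lambda>x. 0), add = (\<lambda>f g x. f x + g x)\<rparr>"


section \<open>Sheaves of modules over the sheaf of smooth functions\<close>

record ('x, 's) mod_sheaf =
  Sec :: "'x set \<Rightarrow> ('x \<Rightarrow> real, 's) module"
  Res :: "'x set \<Rightarrow> 'x set \<Rightarrow> 's \<Rightarrow> 's"   \<comment> \<open>\<open>Res F U V\<close> restricts from \<open>U\<close> to \<open>V\<close>\<close>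

abbreviation sections :: "('x, 's) mod_sheaf \<Rightarrow> 'x set \<Rightarrow> 's set" where
  "sections F U \<equiv> carrier (Sec F U)"

definition module_presheaf ::
  "('x::{t2_space,second_countable_topology}, 'b::real_normed_vector) atlas
     \<Rightarrow> ('x, 's) mod_sheaf \<Rightarrow> bool" where
  "module_presheaf A F \<longleftrightarrow>
     (\<forall>U. open U \<longrightarrow> Module.module (Cinf A U) (Sec F U)) \<and>
     (\<forall>U. open U \<longrightarrow> (\<forall>s\<in>sections F U. Res F U U s = s)) \<and>
     (\<forall>U V W. open U \<and> open V \<and> open W \<and> V \<subseteq> U \<and> W \<subseteq> V \<longrightarrow>
        (\<forall>s\<in>sections F U. Res F V W (Res F U V s) = Res F U W s)) \<and>
     (\<forall>U V. open U \<and> open V \<and> V \<subseteq> U \<longrightarrow>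
        (\<forall>s\<in>sections F U. Res F U V s \<in> sections F V) \<and>
        (\<forall>s\<in>sections F U. \<forall>t\<in>sections F U.
           Res F U V (s \<oplus>\<^bsub>Sec F U\<^esub> t) = Res F U V s \<oplus>\<^bsub>Sec F V\<^esub> Res F U V t) \<and>
        (\<forall>f\<in>smooth_fun A U. \<forall>s\<in>sections F U.
           Res F U V (f \<odot>\<^bsub>Sec F U\<^esub> s) = cut V f \<odot>\<^bsub>Sec F V\<^esub> Res F U V s))"

definition module_sheaf ::
  "('x::{t2_space,second_countable_topology}, 'b::real_normed_vector) atlas
     \<Rightarrow> ('x, 's) mod_sheaf \<Rightarrow> bool" where
  "module_sheaf A F \<longleftrightarrow> module_presheaf A F \<and>
     (\<forall>\<U>. (\<forall>U\<in>\<U>. open U) \<longrightarrow>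
        (\<forall>s\<in>sections F (\<Union>\<U>). \<forall>t\<in>sections F (\<Union>\<U>).
           (\<forall>U\<in>\<U>. Res F (\<Union>\<U>) U s = Res F (\<Union>\<U>) U t) \<longrightarrow> s = t) \<and>
        (\<forall>p. (\<forall>U\<in>\<U>. p U \<in> sections F U) \<and>
             (\<forall>U\<in>\<U>. \<forall>V\<in>\<U>. Res F U (U \<inter> V) (p U) = Res F V (U \<inter> V) (p V)) \<longrightarrow>
           (\<exists>s\<in>sections F (\<Union>\<U>). \<forall>U\<in>\<U>. Res F (\<Union>\<U>) U s = p U)))"

text \<open>
  A map of sheaves is a family of maps indexed by the open sets; its values at non-open sets and
  off the carriers are irrelevant. \<open>additive_map_on\<close> is a morphism of sheaves of abelian groups
  on the open subspace \<open>U0\<close>, \<open>sheaf_hom_on\<close> a morphism of sheaves of modules.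
\<close>

definition additive_map_on ::
  "'x::topological_space set \<Rightarrow> ('x, 's) mod_sheaf \<Rightarrow> ('x, 't) mod_sheaf
     \<Rightarrow> ('x set \<Rightarrow> 's \<Rightarrow> 't) \<Rightarrow> bool" where
  "additive_map_on U0 F G h \<longleftrightarrow>
     (\<forall>U. open U \<and> U \<subseteq> U0 \<longrightarrow>
        (\<forall>s\<in>sections F U. h U s \<in> sections G U) \<and>
        (\<forall>s\<in>sections F U. \<forall>t\<in>sections F U.
           h U (s \<oplus>\<^bsub>Sec F U\<^esub> t) = h U s \<oplus>\<^bsub>Sec G U\<^esub> h U t)) \<and>
     (\<forall>U V. open U \<and> open V \<and> V \<subseteq> U \<and> U \<subseteq> U0 \<longrightarrow>
        (\<forall>s\<in>sections F U. h V (Res F U V s) = Res G U V (h U s)))"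

definition sheaf_hom_on ::
  "('x::{t2_space,second_countable_topology}, 'b::real_normed_vector) atlas \<Rightarrow> 'x set
     \<Rightarrow> ('x, 's) mod_sheaf \<Rightarrow> ('x, 't) mod_sheaf \<Rightarrow> ('x set \<Rightarrow> 's \<Rightarrow> 't) \<Rightarrow> bool" where
  "sheaf_hom_on A U0 F G h \<longleftrightarrow> additive_map_on U0 F G h \<and>
     (\<forall>U. open U \<and> U \<subseteq> U0 \<longrightarrow> (\<forall>f\<in>smooth_fun A U. \<forall>s\<in>sections F U.
        h U (f \<odot>\<^bsub>Sec F U\<^esub> s) = f \<odot>\<^bsub>Sec G U\<^esub> h U s))"

abbreviation "additive_map \<equiv> additive_map_on UNIV"

abbreviation "sheaf_hom A \<equiv> sheaf_hom_on A UNIV"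

definition free_sheaf ::
  "('x::{t2_space,second_countable_topology}, 'b::real_normed_vector) atlas \<Rightarrow> nat
     \<Rightarrow> ('x, nat \<Rightarrow> 'x \<Rightarrow> real) mod_sheaf" where
  "free_sheaf A n =
     \<lparr>Sec = (\<lambda>U.
        \<lparr>carrier = {c. (\<forall>i<n. c i \<in> smooth_fun A U) \<and> (\<forall>i\<ge>n. c i = (\<lambda>x. 0))},
         mult = undefined, one = undefined,
         ring.zero = (\<lambda>i x. 0), add = (\<lambda>c d i x. c i x + d i x),
         smult = (\<lambda>f c i x. f x * c i x)\<rparr>),
      Res = (\<lambda>U V c i. cut V (c i))\<rparr>"

text \<open>Vector bundles are identified with locally free sheaves of finite rank.\<close>

definition vector_bundle ::
  "('x::{t2_space,second_countable_topology}, 'b::real_normed_vector) atlas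
     \<Rightarrow> ('x, 's) mod_sheaf \<Rightarrow> bool" where
  "vector_bundle A F \<longleftrightarrow> module_sheaf A F \<and>
     (\<forall>x. \<exists>U n \<psi>. open U \<and> x \<in> U \<and> sheaf_hom_on A U (free_sheaf A n) F \<psi> \<and>
        (\<forall>V. open V \<and> V \<subseteq> U \<longrightarrow>
           bij_betw (\<psi> V) (sections (free_sheaf A n) V) (sections F V)))"


section \<open>Sheafification\<close>

text \<open>A germ at \<open>x\<close> is an equivalence class of pairs (open neighbourhood, section over it).\<close>

definition germ ::
  "('x::topological_space, 's) mod_sheaf \<Rightarrow> 'x \<Rightarrow> 'x set \<Rightarrow> 's \<Rightarrow> ('x set \<times> 's) set" where
  "germ P x U s = {(V, t). open V \<and> x \<in> V \<and> t \<in> sections P V \<and>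
     (\<exists>W. open W \<and> x \<in> W \<and> W \<subseteq> U \<inter> V \<and> Res P U W s = Res P V W t)}"

text \<open>
  Sections of the sheafification over \<open>U\<close> are families of germs that locally come from sections
  of the presheaf. The value outside \<open>U\<close> is the empty set, which is not a germ. The unions below
  are over all representatives of germs and are unions of equal sets.
\<close>

definition sheafify ::
  "('x::topological_space, 's) mod_sheaf \<Rightarrow> ('x, 'x \<Rightarrow> ('x set \<times> 's) set) mod_sheaf" where
  "sheafify P =
     \<lparr>Sec = (\<lambda>U.
        \<lparr>carrier = {\<sigma>. (\<forall>x. x \<notin> U \<longrightarrow> \<sigma> x = {}) \<and>
           (\<forall>x\<in>U. \<exists>V s. open V \<and> x \<in> V \<and> V \<subseteq> U \<and> s \<in> sections P V \<and>
              (\<forall>y\<in>V. \<sigma> y = germ P y V s))},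
         mult = undefined, one = undefined,
         ring.zero = (\<lambda>x. if x \<in> U then germ P x U \<zero>\<^bsub>Sec P U\<^esub> else {}),
         add = (\<lambda>\<sigma> \<tau> x. \<Union>(V, s)\<in>\<sigma> x. \<Union>(W, t)\<in>\<tau> x.
            germ P x (V \<inter> W) (Res P V (V \<inter> W) s \<oplus>\<^bsub>Sec P (V \<inter> W)\<^esub> Res P W (V \<inter> W) t)),
         smult = (\<lambda>f \<sigma> x. \<Union>(V, s)\<in>\<sigma> x.
            germ P x (U \<inter> V) (cut (U \<inter> V) f \<odot>\<^bsub>Sec P (U \<inter> V)\<^esub> Res P V (U \<inter> V) s))\<rparr>),
      Res = (\<lambda>U V \<sigma> x. if x \<in> V then \<sigma> x else {})\<rparr>"


section \<open>Tensor products\<close>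

text \<open>
  The tensor product of modules over a commutative ring \<open>R\<close>: the free abelian group on pairs modulo
  the subgroup generated by the biadditivity and balancing relations.
\<close>

definition tensor_free ::
  "('r, 's) module \<Rightarrow> ('r, 't) module \<Rightarrow> (('s \<times> 't) \<Rightarrow>\<^sub>0 int) monoid" where
  "tensor_free M N = free_Abelian_group (carrier M \<times> carrier N)"

definition tensor_relations ::
  "'r ring \<Rightarrow> ('r, 's) module \<Rightarrow> ('r, 't) module \<Rightarrow> (('s \<times> 't) \<Rightarrow>\<^sub>0 int) set" where
  "tensor_relations R M N = generate (tensor_free M N)
     ({frag_of (x \<oplus>\<^bsub>M\<^esub> x', y) - frag_of (x, y) - frag_of (x', y) | x x' y.
         x \<in> carrier M \<and> x' \<in> carrier M \<and> y \<in> carrier N} \<union>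
      {frag_of (x, y \<oplus>\<^bsub>N\<^esub> y') - frag_of (x, y) - frag_of (x, y') | x y y'.
         x \<in> carrier M \<and> y \<in> carrier N \<and> y' \<in> carrier N} \<union>
      {frag_of (r \<odot>\<^bsub>M\<^esub> x, y) - frag_of (x, r \<odot>\<^bsub>N\<^esub> y) | r x y.
         r \<in> carrier R \<and> x \<in> carrier M \<and> y \<in> carrier N})"

definition tensor_coset ::
  "'r ring \<Rightarrow> ('r, 's) module \<Rightarrow> ('r, 't) module \<Rightarrow> (('s \<times> 't) \<Rightarrow>\<^sub>0 int)
     \<Rightarrow> (('s \<times> 't) \<Rightarrow>\<^sub>0 int) set" where
  "tensor_coset R M N c = tensor_relations R M N #>\<^bsub>tensor_free M N\<^esub> c"

definition tensor_module ::
  "'r ring \<Rightarrow> ('r, 's) module \<Rightarrow> ('r, 't) module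
     \<Rightarrow> ('r, (('s \<times> 't) \<Rightarrow>\<^sub>0 int) set) module" where
  "tensor_module R M N = (let G = tensor_free M N Mod tensor_relations R M N in
     \<lparr>carrier = carrier G, mult = undefined, one = undefined,
      ring.zero = \<one>\<^bsub>G\<^esub>, add = mult G,
      smult = (\<lambda>r C. \<Union>c\<in>C. tensor_coset R M N (frag_extend (\<lambda>(x, y). frag_of (r \<odot>\<^bsub>M\<^esub> x, y)) c))\<rparr>)"

definition tensor_presheaf ::
  "('x::{t2_space,second_countable_topology}, 'b::real_normed_vector) atlas
     \<Rightarrow> ('x, 's) mod_sheaf \<Rightarrow> ('x, 't) mod_sheaf
     \<Rightarrow> ('x, (('s \<times> 't) \<Rightarrow>\<^sub>0 int) set) mod_sheaf" where
  "tensor_presheaf A F G =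
     \<lparr>Sec = (\<lambda>U. tensor_module (Cinf A U) (Sec F U) (Sec G U)),
      Res = (\<lambda>U V C. \<Union>c\<in>C. tensor_coset (Cinf A V) (Sec F V) (Sec G V)
               (frag_extend (\<lambda>(s, t). frag_of (Res F U V s, Res G U V t)) c))\<rparr>"

type_synonym ('x, 's, 't) tensor_sec = "'x \<Rightarrow> ('x set \<times> (('s \<times> 't) \<Rightarrow>\<^sub>0 int) set) set"

definition tensor ::
  "('x::{t2_space,second_countable_topology}, 'b::real_normed_vector) atlas
     \<Rightarrow> ('x, 's) mod_sheaf \<Rightarrow> ('x, 't) mod_sheaf \<Rightarrow> ('x, ('x, 's, 't) tensor_sec) mod_sheaf" where
  "tensor A F G = sheafify (tensor_presheaf A F G)"

definition pure ::
  "('x::{t2_space,second_countable_topology}, 'b::real_normed_vector) atlas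
     \<Rightarrow> ('x, 's) mod_sheaf \<Rightarrow> ('x, 't) mod_sheaf \<Rightarrow> 'x set \<Rightarrow> 's \<Rightarrow> 't
     \<Rightarrow> ('x, 's, 't) tensor_sec" where
  "pure A F G U s t = (\<lambda>x. if x \<in> U
     then germ (tensor_presheaf A F G) x U
            (tensor_coset (Cinf A U) (Sec F U) (Sec G U) (frag_of (s, t)))
     else {})"

text \<open>
  Maps out of a tensor product are given by their values on pure tensors, which generate the
  tensor product locally as a sheaf of abelian groups; such a map is therefore unique if it exists.
\<close>

definition tensor_lift ::
  "('x::{t2_space,second_countable_topology}, 'b::real_normed_vector) atlas
     \<Rightarrow> ('x, 's) mod_sheaf \<Rightarrow> ('x, 't) mod_sheaf \<Rightarrow> ('x, 'u) mod_sheaf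
     \<Rightarrow> ('x set \<Rightarrow> 's \<Rightarrow> 't \<Rightarrow> 'u) \<Rightarrow> 'x set \<Rightarrow> ('x, 's, 't) tensor_sec \<Rightarrow> 'u" where
  "tensor_lift A F G H b = (SOME h. additive_map (tensor A F G) H h \<and>
     (\<forall>U. open U \<longrightarrow> (\<forall>s\<in>sections F U. \<forall>t\<in>sections G U. h U (pure A F G U s t) = b U s t)))"

definition tensor_map ::
  "('x::{t2_space,second_countable_topology}, 'b::real_normed_vector) atlas
     \<Rightarrow> ('x, 's) mod_sheaf \<Rightarrow> ('x, 't) mod_sheaf \<Rightarrow> ('x, 's') mod_sheaf \<Rightarrow> ('x, 't') mod_sheaf
     \<Rightarrow> ('x set \<Rightarrow> 's \<Rightarrow> 's') \<Rightarrow> ('x set \<Rightarrow> 't \<Rightarrow> 't')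
     \<Rightarrow> 'x set \<Rightarrow> ('x, 's, 't) tensor_sec \<Rightarrow> ('x, 's', 't') tensor_sec" where
  "tensor_map A F G F' G' f g =
     tensor_lift A F G (tensor A F' G') (\<lambda>U s t. pure A F' G' U (f U s) (g U t))"

text \<open>The canonical isomorphism \<open>(F \<otimes> G) \<otimes> H \<simeq> F \<otimes> (G \<otimes> H)\<close>.\<close>

definition tensor_assoc ::
  "('x::{t2_space,second_countable_topology}, 'b::real_normed_vector) atlas
     \<Rightarrow> ('x, 's) mod_sheaf \<Rightarrow> ('x, 't) mod_sheaf \<Rightarrow> ('x, 'u) mod_sheaf
     \<Rightarrow> 'x set \<Rightarrow> ('x, ('x, 's, 't) tensor_sec, 'u) tensor_sec
     \<Rightarrow> ('x, 's, ('x, 't, 'u) tensor_sec) tensor_sec" where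
  "tensor_assoc A F G H = (SOME h.
     additive_map (tensor A (tensor A F G) H) (tensor A F (tensor A G H)) h \<and>
     (\<forall>U. open U \<longrightarrow> (\<forall>s\<in>sections F U. \<forall>t\<in>sections G U. \<forall>u\<in>sections H U.
        h U (pure A (tensor A F G) H U (pure A F G U s t) u) =
          pure A F (tensor A G H) U s (pure A G H U t u))))"

text \<open>The canonical isomorphism \<open>F \<otimes> (G \<otimes> H) \<simeq> G \<otimes> (F \<otimes> H)\<close>.\<close>

definition tensor_swap ::
  "('x::{t2_space,second_countable_topology}, 'b::real_normed_vector) atlas
     \<Rightarrow> ('x, 's) mod_sheaf \<Rightarrow> ('x, 't) mod_sheaf \<Rightarrow> ('x, 'u) mod_sheaf
     \<Rightarrow> 'x set \<Rightarrow> ('x, 's, ('x, 't, 'u) tensor_sec) tensor_sec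
     \<Rightarrow> ('x, 't, ('x, 's, 'u) tensor_sec) tensor_sec" where
  "tensor_swap A F G H = (SOME h.
     additive_map (tensor A F (tensor A G H)) (tensor A G (tensor A F H)) h \<and>
     (\<forall>U. open U \<longrightarrow> (\<forall>s\<in>sections F U. \<forall>t\<in>sections G U. \<forall>u\<in>sections H U.
        h U (pure A F (tensor A G H) U s (pure A G H U t u)) =
          pure A G (tensor A F H) U t (pure A F H U s u))))"


section \<open>The cotangent sheaf and the exterior derivative\<close>

definition smooth_at ::
  "('x::{t2_space,second_countable_topology}, 'b::real_normed_vector) atlas \<Rightarrow> 'x
     \<Rightarrow> ('x \<Rightarrow> real) set" where
  "smooth_at A x = {f. \<exists>U. open U \<and> x \<in> U \<and> cut U f \<in> smooth_fun A U}"

text \<open>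
  Tangent vectors at \<open>x\<close> are the derivations at \<open>x\<close> of germs of smooth functions, regarded as functionals
  that are invariant under change of the function away from \<open>x\<close>, and extended by 0 to functions
  that are not smooth near \<open>x\<close>. Similarly covectors are extended by 0 off the tangent space.
\<close>

definition tangent_space ::
  "('x::{t2_space,second_countable_topology}, 'b::real_normed_vector) atlas \<Rightarrow> 'x
     \<Rightarrow> (('x \<Rightarrow> real) \<Rightarrow> real) set" where
  "tangent_space A x = {v.
     (\<forall>f\<in>smooth_at A x. \<forall>g\<in>smooth_at A x.
        v (\<lambda>y. f y + g y) = v f + v g \<and>
        v (\<lambda>y. f y * g y) = f x * v g + g x * v f \<and>
        ((\<exists>U. open U \<and> x \<in> U \<and> (\<forall>y\<in>U. f y = g y)) \<longrightarrow> v f = v g)) \<and>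
     (\<forall>r. \<forall>f\<in>smooth_at A x. v (\<lambda>y. r * f y) = r * v f) \<and>
     (\<forall>f. f \<notin> smooth_at A x \<longrightarrow> v f = 0)}"

definition cotangent_space ::
  "('x::{t2_space,second_countable_topology}, 'b::real_normed_vector) atlas \<Rightarrow> 'x
     \<Rightarrow> ((('x \<Rightarrow> real) \<Rightarrow> real) \<Rightarrow> real) set" where
  "cotangent_space A x = {l.
     (\<forall>v\<in>tangent_space A x. \<forall>w\<in>tangent_space A x. l (\<lambda>f. v f + w f) = l v + l w) \<and>
     (\<forall>r. \<forall>v\<in>tangent_space A x. l (\<lambda>f. r * v f) = r * l v) \<and>
     (\<forall>v. v \<notin> tangent_space A x \<longrightarrow> l v = 0)}"

text \<open>The constant coordinate vector field in direction \<open>e\<close> of a chart \<open>(V, c)\<close>, at a point \<open>x\<close> of \<open>V\<close>.\<close>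

definition coord_vector ::
  "('x::{t2_space,second_countable_topology}, 'b::real_normed_vector) atlas
     \<Rightarrow> 'x set \<Rightarrow> ('x \<Rightarrow> 'b) \<Rightarrow> 'b \<Rightarrow> 'x \<Rightarrow> ('x \<Rightarrow> real) \<Rightarrow> real" where
  "coord_vector A V c e x f = (if f \<in> smooth_at A x
     then frechet_derivative (f \<circ> inv_into V c) (at (c x)) e else 0)"

type_synonym 'x form = "'x \<Rightarrow> (('x \<Rightarrow> real) \<Rightarrow> real) \<Rightarrow> real"

definition cotangent ::
  "('x::{t2_space,second_countable_topology}, 'b::real_normed_vector) atlas
     \<Rightarrow> ('x, 'x form) mod_sheaf" where
  "cotangent A =
     \<lparr>Sec = (\<lambda>U.
        \<lparr>carrier = {\<omega>. (\<forall>x. x \<notin> U \<longrightarrow> \<omega> x = (\<lambda>v. 0)) \<and>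
           (\<forall>x\<in>U. \<omega> x \<in> cotangent_space A x) \<and>
           (\<forall>(V, c)\<in>A. \<forall>e.
              cut (U \<inter> V) (\<lambda>x. \<omega> x (coord_vector A V c e x)) \<in> smooth_fun A (U \<inter> V))},
         mult = undefined, one = undefined,
         ring.zero = (\<lambda>x v. 0), add = (\<lambda>\<omega> \<eta> x v. \<omega> x v + \<eta> x v),
         smult = (\<lambda>f \<omega> x v. f x * \<omega> x v)\<rparr>),
      Res = (\<lambda>U V \<omega> x. if x \<in> V then \<omega> x else (\<lambda>v. 0))\<rparr>"

definition ext_deriv ::
  "('x::{t2_space,second_countable_topology}, 'b::real_normed_vector) atlas \<Rightarrow> 'x set
     \<Rightarrow> ('x \<Rightarrow> real) \<Rightarrow> 'x form" where
  "ext_deriv A U f = (\<lambda>x v. if x \<in> U \<and> v \<in> tangent_space A x then v f else 0)"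


section \<open>Twisted quiver sheaves\<close>

text \<open>
  A quiver is a \<open>pre_digraph\<close>, with \<open>tail\<close> and \<open>head\<close> as source and target.
  The twisting sheaves are a family \<open>M\<close> indexed by the arrows.
\<close>

record ('x, 's, 'm, 'v, 'a) qsheaf =
  Ob :: "'v \<Rightarrow> ('x, 's) mod_sheaf"
  Ar :: "'a \<Rightarrow> 'x set \<Rightarrow> ('x, 's, 'm) tensor_sec \<Rightarrow> 's"

definition twisted_qsheaf ::
  "('x::{t2_space,second_countable_topology}, 'b::real_normed_vector) atlas
     \<Rightarrow> ('v, 'a) pre_digraph \<Rightarrow> ('a \<Rightarrow> ('x, 'm) mod_sheaf)
     \<Rightarrow> ('x, 's, 'm, 'v, 'a) qsheaf \<Rightarrow> bool" where
  "twisted_qsheaf A Q M R \<longleftrightarrow>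
     (\<forall>i\<in>verts Q. module_sheaf A (Ob R i)) \<and>
     (\<forall>a\<in>arcs Q. sheaf_hom A (tensor A (Ob R (tail Q a)) (M a)) (Ob R (head Q a)) (Ar R a))"

definition twisted_qbundle ::
  "('x::{t2_space,second_countable_topology}, 'b::real_normed_vector) atlas
     \<Rightarrow> ('v, 'a) pre_digraph \<Rightarrow> ('a \<Rightarrow> ('x, 'm) mod_sheaf)
     \<Rightarrow> ('x, 's, 'm, 'v, 'a) qsheaf \<Rightarrow> bool" where
  "twisted_qbundle A Q M R \<longleftrightarrow>
     twisted_qsheaf A Q M R \<and> (\<forall>i\<in>verts Q. vector_bundle A (Ob R i))"

definition qmorphism ::
  "('x::{t2_space,second_countable_topology}, 'b::real_normed_vector) atlas
     \<Rightarrow> ('v, 'a) pre_digraph \<Rightarrow> ('a \<Rightarrow> ('x, 'm) mod_sheaf)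
     \<Rightarrow> ('x, 's, 'm, 'v, 'a) qsheaf \<Rightarrow> ('x, 't, 'm, 'v, 'a) qsheaf
     \<Rightarrow> ('v \<Rightarrow> 'x set \<Rightarrow> 's \<Rightarrow> 't) \<Rightarrow> bool" where
  "qmorphism A Q M R R' f \<longleftrightarrow>
     (\<forall>i\<in>verts Q. sheaf_hom A (Ob R i) (Ob R' i) (f i)) \<and>
     (\<forall>a\<in>arcs Q. \<forall>U. open U \<longrightarrow> (\<forall>z\<in>sections (tensor A (Ob R (tail Q a)) (M a)) U.
        f (head Q a) U (Ar R a U z) =
        Ar R' a U (tensor_map A (Ob R (tail Q a)) (M a) (Ob R' (tail Q a)) (M a)
                     (f (tail Q a)) (\<lambda>U m. m) U z)))"

text \<open>
  Kernels and images are computed at each vertex. The image sheaf of the injective map \<open>\<alpha>\<close> is given by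
  its images on sections, while surjectivity of \<open>\<beta>\<close> is meant locally.
\<close>

definition short_exact ::
  "('x::{t2_space,second_countable_topology}, 'b::real_normed_vector) atlas
     \<Rightarrow> ('v, 'a) pre_digraph \<Rightarrow> ('a \<Rightarrow> ('x, 'm) mod_sheaf)
     \<Rightarrow> ('x, 'n, 'm, 'v, 'a) qsheaf \<Rightarrow> ('x, 'e, 'm, 'v, 'a) qsheaf \<Rightarrow> ('x, 's, 'm, 'v, 'a) qsheaf
     \<Rightarrow> ('v \<Rightarrow> 'x set \<Rightarrow> 'n \<Rightarrow> 'e) \<Rightarrow> ('v \<Rightarrow> 'x set \<Rightarrow> 'e \<Rightarrow> 's) \<Rightarrow> bool" where
  "short_exact A Q M N P R \<alpha> \<beta> \<longleftrightarrow>
     twisted_qsheaf A Q M N \<and> twisted_qsheaf A Q M P \<and> twisted_qsheaf A Q M R \<and>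
     qmorphism A Q M N P \<alpha> \<and> qmorphism A Q M P R \<beta> \<and>
     (\<forall>i\<in>verts Q. \<forall>U. open U \<longrightarrow>
        inj_on (\<alpha> i U) (sections (Ob N i) U) \<and>
        \<alpha> i U ` sections (Ob N i) U =
          {p \<in> sections (Ob P i) U. \<beta> i U p = \<zero>\<^bsub>Sec (Ob R i) U\<^esub>} \<and>
        (\<forall>s\<in>sections (Ob R i) U. \<forall>x\<in>U. \<exists>V p. open V \<and> x \<in> V \<and> V \<subseteq> U \<and>
           p \<in> sections (Ob P i) V \<and> \<beta> i V p = Res (Ob R i) U V s))"

definition split_short_exact ::
  "('x::{t2_space,second_countable_topology}, 'b::real_normed_vector) atlas
     \<Rightarrow> ('v, 'a) pre_digraph \<Rightarrow> ('a \<Rightarrow> ('x, 'm) mod_sheaf)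
     \<Rightarrow> ('x, 'n, 'm, 'v, 'a) qsheaf \<Rightarrow> ('x, 'e, 'm, 'v, 'a) qsheaf \<Rightarrow> ('x, 's, 'm, 'v, 'a) qsheaf
     \<Rightarrow> ('v \<Rightarrow> 'x set \<Rightarrow> 'n \<Rightarrow> 'e) \<Rightarrow> ('v \<Rightarrow> 'x set \<Rightarrow> 'e \<Rightarrow> 's) \<Rightarrow> bool" where
  "split_short_exact A Q M N P R \<alpha> \<beta> \<longleftrightarrow> short_exact A Q M N P R \<alpha> \<beta> \<and>
     (\<exists>\<sigma>. qmorphism A Q M R P \<sigma> \<and>
        (\<forall>i\<in>verts Q. \<forall>U. open U \<longrightarrow> (\<forall>s\<in>sections (Ob R i) U. \<beta> i U (\<sigma> i U s) = s)))"


section \<open>Ext and the connecting map\<close>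

text \<open>
  \<open>Ext\<^sup>1\<close> is the Yoneda Ext of the abelian category of twisted quiver sheaves: equivalence classes of
  extensions \<open>0 \<rightarrow> N \<rightarrow> P \<rightarrow> R \<rightarrow> 0\<close>. Its zero is the class of the direct sum, and the connecting
  map of a short exact sequence sends a morphism to the class of the pullback of the sequence.
\<close>

type_synonym ('x, 'n, 'e, 's, 'm, 'v, 'a) extension =
  "('x, 'e, 'm, 'v, 'a) qsheaf \<times> ('v \<Rightarrow> 'x set \<Rightarrow> 'n \<Rightarrow> 'e) \<times> ('v \<Rightarrow> 'x set \<Rightarrow> 'e \<Rightarrow> 's)"

definition is_extension ::
  "('x::{t2_space,second_countable_topology}, 'b::real_normed_vector) atlas
     \<Rightarrow> ('v, 'a) pre_digraph \<Rightarrow> ('a \<Rightarrow> ('x, 'm) mod_sheaf)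
     \<Rightarrow> ('x, 's, 'm, 'v, 'a) qsheaf \<Rightarrow> ('x, 'n, 'm, 'v, 'a) qsheaf
     \<Rightarrow> ('x, 'n, 'e, 's, 'm, 'v, 'a) extension \<Rightarrow> bool" where
  "is_extension A Q M R N X = (case X of (P, \<alpha>, \<beta>) \<Rightarrow> short_exact A Q M N P R \<alpha> \<beta>)"

definition ext_equiv ::
  "('x::{t2_space,second_countable_topology}, 'b::real_normed_vector) atlas
     \<Rightarrow> ('v, 'a) pre_digraph \<Rightarrow> ('a \<Rightarrow> ('x, 'm) mod_sheaf)
     \<Rightarrow> ('x, 's, 'm, 'v, 'a) qsheaf \<Rightarrow> ('x, 'n, 'm, 'v, 'a) qsheaf
     \<Rightarrow> ('x, 'n, 'e, 's, 'm, 'v, 'a) extension \<Rightarrow> ('x, 'n, 'f, 's, 'm, 'v, 'a) extension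
     \<Rightarrow> bool" where
  "ext_equiv A Q M R N X Y = (case X of (P, \<alpha>, \<beta>) \<Rightarrow> case Y of (P', \<alpha>', \<beta>') \<Rightarrow>
     (\<exists>\<theta>. qmorphism A Q M P P' \<theta> \<and>
        (\<forall>i\<in>verts Q. \<forall>U. open U \<longrightarrow>
           bij_betw (\<theta> i U) (sections (Ob P i) U) (sections (Ob P' i) U) \<and>
           (\<forall>n\<in>sections (Ob N i) U. \<theta> i U (\<alpha> i U n) = \<alpha>' i U n) \<and>
           (\<forall>p\<in>sections (Ob P i) U. \<beta>' i U (\<theta> i U p) = \<beta> i U p))))"

text \<open>
  To form a set of classes, the sections of the middle terms are taken in a fixed type. No
  extension is lost: a section of \<open>P\<close> is determined by its germs, and each stalk of \<open>P\<close> is, as a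
  set, in bijection with the product of the stalks of \<open>N\<close> and \<open>R\<close>; so every extension is equivalent
  to one with this section type. \<open>ext_class\<close> accepts extensions with any section type.
\<close>

type_synonym ('x, 'n, 's) ext_sec = "'x \<Rightarrow> ('x set \<times> 'n) set \<times> ('x set \<times> 's) set"

definition ext_class ::
  "('x::{t2_space,second_countable_topology}, 'b::real_normed_vector) atlas
     \<Rightarrow> ('v, 'a) pre_digraph \<Rightarrow> ('a \<Rightarrow> ('x, 'm) mod_sheaf)
     \<Rightarrow> ('x, 's, 'm, 'v, 'a) qsheaf \<Rightarrow> ('x, 'n, 'm, 'v, 'a) qsheaf
     \<Rightarrow> ('x, 'n, 'e, 's, 'm, 'v, 'a) extension
     \<Rightarrow> ('x, 'n, ('x, 'n, 's) ext_sec, 's, 'm, 'v, 'a) extension set" where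
  "ext_class A Q M R N X = {Y. is_extension A Q M R N Y \<and> ext_equiv A Q M R N X Y}"

definition Ext1 ::
  "('x::{t2_space,second_countable_topology}, 'b::real_normed_vector) atlas
     \<Rightarrow> ('v, 'a) pre_digraph \<Rightarrow> ('a \<Rightarrow> ('x, 'm) mod_sheaf)
     \<Rightarrow> ('x, 's, 'm, 'v, 'a) qsheaf \<Rightarrow> ('x, 'n, 'm, 'v, 'a) qsheaf
     \<Rightarrow> ('x, 'n, ('x, 'n, 's) ext_sec, 's, 'm, 'v, 'a) extension set set" where
  "Ext1 A Q M R N = ext_class A Q M R N `
     {X :: ('x, 'n, ('x, 'n, 's) ext_sec, 's, 'm, 'v, 'a) extension. is_extension A Q M R N X}"

text \<open>The subsheaf of the direct sum \<open>F \<oplus> G\<close> whose sections over \<open>U\<close> satisfy \<open>C U\<close>.\<close>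

definition prod_sheaf ::
  "('x, 's) mod_sheaf \<Rightarrow> ('x, 't) mod_sheaf \<Rightarrow> ('x set \<Rightarrow> 's \<Rightarrow> 't \<Rightarrow> bool)
     \<Rightarrow> ('x, 's \<times> 't) mod_sheaf" where
  "prod_sheaf F G C =
     \<lparr>Sec = (\<lambda>U.
        \<lparr>carrier = {(s, t). s \<in> sections F U \<and> t \<in> sections G U \<and> C U s t},
         mult = undefined, one = undefined,
         ring.zero = (\<zero>\<^bsub>Sec F U\<^esub>, \<zero>\<^bsub>Sec G U\<^esub>),
         add = (\<lambda>(s, t) (s', t'). (s \<oplus>\<^bsub>Sec F U\<^esub> s', t \<oplus>\<^bsub>Sec G U\<^esub> t')),
         smult = (\<lambda>f (s, t). (f \<odot>\<^bsub>Sec F U\<^esub> s, f \<odot>\<^bsub>Sec G U\<^esub> t))\<rparr>),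
      Res = (\<lambda>U V (s, t). (Res F U V s, Res G U V t))\<rparr>"

definition prod_qsheaf ::
  "('x::{t2_space,second_countable_topology}, 'b::real_normed_vector) atlas
     \<Rightarrow> ('v, 'a) pre_digraph \<Rightarrow> ('a \<Rightarrow> ('x, 'm) mod_sheaf)
     \<Rightarrow> ('x, 's, 'm, 'v, 'a) qsheaf \<Rightarrow> ('x, 't, 'm, 'v, 'a) qsheaf
     \<Rightarrow> ('v \<Rightarrow> 'x set \<Rightarrow> 's \<Rightarrow> 't \<Rightarrow> bool) \<Rightarrow> ('x, 's \<times> 't, 'm, 'v, 'a) qsheaf" where
  "prod_qsheaf A Q M P S C =
     (let D = (\<lambda>i. prod_sheaf (Ob P i) (Ob S i) (C i)) in
     \<lparr>Ob = D,
      Ar = (\<lambda>a U z. let i = tail Q a in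
        (Ar P a U (tensor_map A (D i) (M a) (Ob P i) (M a) (\<lambda>U. fst) (\<lambda>U m. m) U z),
         Ar S a U (tensor_map A (D i) (M a) (Ob S i) (M a) (\<lambda>U. snd) (\<lambda>U m. m) U z)))\<rparr>)"

definition trivial_extension ::
  "('x::{t2_space,second_countable_topology}, 'b::real_normed_vector) atlas
     \<Rightarrow> ('v, 'a) pre_digraph \<Rightarrow> ('a \<Rightarrow> ('x, 'm) mod_sheaf)
     \<Rightarrow> ('x, 's, 'm, 'v, 'a) qsheaf \<Rightarrow> ('x, 'n, 'm, 'v, 'a) qsheaf
     \<Rightarrow> ('x, 'n, 'n \<times> 's, 's, 'm, 'v, 'a) extension" where
  "trivial_extension A Q M R N =
     (prod_qsheaf A Q M N R (\<lambda>i U n s. True),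
      \<lambda>i U n. (n, \<zero>\<^bsub>Sec (Ob R i) U\<^esub>),
      \<lambda>i U. snd)"

definition pullback_extension ::
  "('x::{t2_space,second_countable_topology}, 'b::real_normed_vector) atlas
     \<Rightarrow> ('v, 'a) pre_digraph \<Rightarrow> ('a \<Rightarrow> ('x, 'm) mod_sheaf)
     \<Rightarrow> ('x, 'n, 'e, 's, 'm, 'v, 'a) extension
     \<Rightarrow> ('x, 't, 'm, 'v, 'a) qsheaf \<Rightarrow> ('v \<Rightarrow> 'x set \<Rightarrow> 't \<Rightarrow> 's)
     \<Rightarrow> ('x, 'n, 'e \<times> 't, 't, 'm, 'v, 'a) extension" where
  "pullback_extension A Q M X S f = (case X of (P, \<alpha>, \<beta>) \<Rightarrow>
     (prod_qsheaf A Q M P S (\<lambda>i U p s. \<beta> i U p = f i U s),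
      \<lambda>i U n. (\<alpha> i U n, \<zero>\<^bsub>Sec (Ob S i) U\<^esub>),
      \<lambda>i U. snd))"

definition Ext1_zero ::
  "('x::{t2_space,second_countable_topology}, 'b::real_normed_vector) atlas
     \<Rightarrow> ('v, 'a) pre_digraph \<Rightarrow> ('a \<Rightarrow> ('x, 'm) mod_sheaf)
     \<Rightarrow> ('x, 's, 'm, 'v, 'a) qsheaf \<Rightarrow> ('x, 'n, 'm, 'v, 'a) qsheaf
     \<Rightarrow> ('x, 'n, ('x, 'n, 's) ext_sec, 's, 'm, 'v, 'a) extension set" where
  "Ext1_zero A Q M R N = ext_class A Q M R N (trivial_extension A Q M R N)"

text \<open>
  \<open>connecting_map A Q M N X S\<close> is the map \<open>Hom(S, R) \<rightarrow> Ext\<^sup>1(S, N)\<close> for an extension \<open>X\<close> of \<open>R\<close> by \<open>N\<close>.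
\<close>

definition connecting_map ::
  "('x::{t2_space,second_countable_topology}, 'b::real_normed_vector) atlas
     \<Rightarrow> ('v, 'a) pre_digraph \<Rightarrow> ('a \<Rightarrow> ('x, 'm) mod_sheaf)
     \<Rightarrow> ('x, 'n, 'm, 'v, 'a) qsheaf \<Rightarrow> ('x, 'n, 'e, 's, 'm, 'v, 'a) extension
     \<Rightarrow> ('x, 't, 'm, 'v, 'a) qsheaf \<Rightarrow> ('v \<Rightarrow> 'x set \<Rightarrow> 't \<Rightarrow> 's)
     \<Rightarrow> ('x, 'n, ('x, 'n, 't) ext_sec, 't, 'm, 'v, 'a) extension set" where
  "connecting_map A Q M N X S f = ext_class A Q M S N (pullback_extension A Q M X S f)"


section \<open>Connections\<close>

text \<open>
  Linearity over the real numbers is the Leibniz rule for constant functions.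
\<close>

definition connection ::
  "('x::{t2_space,second_countable_topology}, 'b::real_normed_vector) atlas
     \<Rightarrow> ('x, 's) mod_sheaf \<Rightarrow> ('x set \<Rightarrow> 's \<Rightarrow> ('x, 'x form, 's) tensor_sec) \<Rightarrow> bool" where
  "connection A E D \<longleftrightarrow> additive_map E (tensor A (cotangent A) E) D \<and>
     (\<forall>U. open U \<longrightarrow> (\<forall>f\<in>smooth_fun A U. \<forall>s\<in>sections E U.
        D U (f \<odot>\<^bsub>Sec E U\<^esub> s) =
          (f \<odot>\<^bsub>Sec (tensor A (cotangent A) E) U\<^esub> D U s)
            \<oplus>\<^bsub>Sec (tensor A (cotangent A) E) U\<^esub> pure A (cotangent A) E U (ext_deriv A U f) s))"

text \<open>
  The connection \<open>D \<otimes> id + id \<otimes> D'\<close> on \<open>E \<otimes> M\<close>. The two summands are not separately well defined on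
  the tensor product, so the sum is lifted as a whole; both are moved to \<open>T\<^sup>* \<otimes> (E \<otimes> M)\<close> first.
\<close>

definition tensor_connection ::
  "('x::{t2_space,second_countable_topology}, 'b::real_normed_vector) atlas
     \<Rightarrow> ('x, 's) mod_sheaf \<Rightarrow> ('x, 'm) mod_sheaf
     \<Rightarrow> ('x set \<Rightarrow> 's \<Rightarrow> ('x, 'x form, 's) tensor_sec)
     \<Rightarrow> ('x set \<Rightarrow> 'm \<Rightarrow> ('x, 'x form, 'm) tensor_sec)
     \<Rightarrow> 'x set \<Rightarrow> ('x, 's, 'm) tensor_sec \<Rightarrow> ('x, 'x form, ('x, 's, 'm) tensor_sec) tensor_sec" where
  "tensor_connection A E M D D' = (let T = cotangent A; H = tensor A T (tensor A E M) in
     tensor_lift A E M H (\<lambda>U s m.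
       tensor_assoc A T E M U (pure A (tensor A T E) M U (D U s) m)
         \<oplus>\<^bsub>Sec H U\<^esub> tensor_swap A E T M U (pure A E (tensor A T M) U s (D' U m))))"

text \<open>\<open>id \<otimes> \<phi>\<^sub>a : T\<^sup>* \<otimes> (E\<^sub>s \<otimes> M\<^sub>a) \<rightarrow> T\<^sup>* \<otimes> E\<^sub>t\<close>\<close>

definition cotangent_arrow ::
  "('x::{t2_space,second_countable_topology}, 'b::real_normed_vector) atlas
     \<Rightarrow> ('v, 'a) pre_digraph \<Rightarrow> ('a \<Rightarrow> ('x, 'm) mod_sheaf)
     \<Rightarrow> ('x, 's, 'm, 'v, 'a) qsheaf \<Rightarrow> 'a \<Rightarrow> 'x set
     \<Rightarrow> ('x, 'x form, ('x, 's, 'm) tensor_sec) tensor_sec \<Rightarrow> ('x, 'x form, 's) tensor_sec" where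
  "cotangent_arrow A Q M R a =
     tensor_map A (cotangent A) (tensor A (Ob R (tail Q a)) (M a)) (cotangent A) (Ob R (head Q a))
       (\<lambda>U \<omega>. \<omega>) (Ar R a)"

definition relative_connection ::
  "('x::{t2_space,second_countable_topology}, 'b::real_normed_vector) atlas
     \<Rightarrow> ('v, 'a) pre_digraph \<Rightarrow> ('a \<Rightarrow> ('x, 'm) mod_sheaf)
     \<Rightarrow> ('x, 's, 'm, 'v, 'a) qsheaf
     \<Rightarrow> ('v \<Rightarrow> 'x set \<Rightarrow> 's \<Rightarrow> ('x, 'x form, 's) tensor_sec)
     \<Rightarrow> ('a \<Rightarrow> 'x set \<Rightarrow> 'm \<Rightarrow> ('x, 'x form, 'm) tensor_sec) \<Rightarrow> bool" where
  "relative_connection A Q M R D0 D1 \<longleftrightarrow>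
     (\<forall>i\<in>verts Q. connection A (Ob R i) (D0 i)) \<and>
     (\<forall>a\<in>arcs Q. connection A (M a) (D1 a)) \<and>
     (\<forall>a\<in>arcs Q. \<forall>U. open U \<longrightarrow> (\<forall>z\<in>sections (tensor A (Ob R (tail Q a)) (M a)) U.
        D0 (head Q a) U (Ar R a U z) =
        cotangent_arrow A Q M R a U
          (tensor_connection A (Ob R (tail Q a)) (M a) (D0 (tail Q a)) (D1 a) U z)))"


section \<open>The jet sequence and the Atiyah class\<close>

definition cotangent_qsheaf ::
  "('x::{t2_space,second_countable_topology}, 'b::real_normed_vector) atlas
     \<Rightarrow> ('v, 'a) pre_digraph \<Rightarrow> ('a \<Rightarrow> ('x, 'm) mod_sheaf)
     \<Rightarrow> ('x, 's, 'm, 'v, 'a) qsheaf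
     \<Rightarrow> ('x, ('x, 'x form, 's) tensor_sec, 'm, 'v, 'a) qsheaf" where
  "cotangent_qsheaf A Q M R =
     \<lparr>Ob = (\<lambda>i. tensor A (cotangent A) (Ob R i)),
      Ar = (\<lambda>a U z. cotangent_arrow A Q M R a U
              (tensor_assoc A (cotangent A) (Ob R (tail Q a)) (M a) U z))\<rparr>"

definition jet_sheaf ::
  "('x::{t2_space,second_countable_topology}, 'b::real_normed_vector) atlas
     \<Rightarrow> ('x, 's) mod_sheaf \<Rightarrow> ('x, 's \<times> ('x, 'x form, 's) tensor_sec) mod_sheaf" where
  "jet_sheaf A E = (let T = cotangent A; N = tensor A T E in
     \<lparr>Sec = (\<lambda>U.
        \<lparr>carrier = sections E U \<times> sections N U,
         mult = undefined, one = undefined,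
         ring.zero = (\<zero>\<^bsub>Sec E U\<^esub>, \<zero>\<^bsub>Sec N U\<^esub>),
         add = (\<lambda>(s, \<tau>) (s', \<tau>'). (s \<oplus>\<^bsub>Sec E U\<^esub> s', \<tau> \<oplus>\<^bsub>Sec N U\<^esub> \<tau>')),
         smult = (\<lambda>f (s, \<tau>). (f \<odot>\<^bsub>Sec E U\<^esub> s,
           (f \<odot>\<^bsub>Sec N U\<^esub> \<tau>) \<oplus>\<^bsub>Sec N U\<^esub> pure A T E U (ext_deriv A U f) s))\<rparr>),
      Res = (\<lambda>U V (s, \<tau>). (Res E U V s, Res N U V \<tau>))\<rparr>)"

definition jet_qsheaf ::
  "('x::{t2_space,second_countable_topology}, 'b::real_normed_vector) atlas
     \<Rightarrow> ('v, 'a) pre_digraph \<Rightarrow> ('a \<Rightarrow> ('x, 'm) mod_sheaf)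
     \<Rightarrow> ('x, 's, 'm, 'v, 'a) qsheaf
     \<Rightarrow> ('a \<Rightarrow> 'x set \<Rightarrow> 'm \<Rightarrow> ('x, 'x form, 'm) tensor_sec)
     \<Rightarrow> ('x, 's \<times> ('x, 'x form, 's) tensor_sec, 'm, 'v, 'a) qsheaf" where
  "jet_qsheaf A Q M R D1 =
     \<lparr>Ob = (\<lambda>i. jet_sheaf A (Ob R i)),
      Ar = (\<lambda>a. let T = cotangent A; E = Ob R (tail Q a); E' = Ob R (head Q a);
                    H = tensor A T (tensor A E (M a)) in
        tensor_lift A (jet_sheaf A E) (M a) (jet_sheaf A E') (\<lambda>U (s, \<tau>) m.
          (Ar R a U (pure A E (M a) U s m),
           cotangent_arrow A Q M R a U
             (tensor_assoc A T E (M a) U (pure A (tensor A T E) (M a) U \<tau> m)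
                \<oplus>\<^bsub>Sec H U\<^esub> tensor_swap A E T (M a) U (pure A E (tensor A T (M a)) U s (D1 a U m))))))\<rparr>"

definition jet_alpha ::
  "('x, 's, 'm, 'v, 'a) qsheaf
     \<Rightarrow> 'v \<Rightarrow> 'x set \<Rightarrow> ('x, 'x form, 's) tensor_sec \<Rightarrow> 's \<times> ('x, 'x form, 's) tensor_sec" where
  "jet_alpha R i U \<tau> = (\<zero>\<^bsub>Sec (Ob R i) U\<^esub>, \<tau>)"

definition jet_beta ::
  "'v \<Rightarrow> 'x set \<Rightarrow> 's \<times> ('x, 'x form, 's) tensor_sec \<Rightarrow> 's" where
  "jet_beta i U p = fst p"

definition atiyah_class ::
  "('x::{t2_space,second_countable_topology}, 'b::real_normed_vector) atlas
     \<Rightarrow> ('v, 'a) pre_digraph \<Rightarrow> ('a \<Rightarrow> ('x, 'm) mod_sheaf)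
     \<Rightarrow> ('x, 's, 'm, 'v, 'a) qsheaf
     \<Rightarrow> ('a \<Rightarrow> 'x set \<Rightarrow> 'm \<Rightarrow> ('x, 'x form, 'm) tensor_sec)
     \<Rightarrow> ('x, ('x, 'x form, 's) tensor_sec, ('x, ('x, 'x form, 's) tensor_sec, 's) ext_sec,
         's, 'm, 'v, 'a) extension set" where
  "atiyah_class A Q M R D1 =
     connecting_map A Q M (cotangent_qsheaf A Q M R)
       (jet_qsheaf A Q M R D1, jet_alpha R, jet_beta) R (\<lambda>i U s. s)"

end

theory Submission
  imports Defs
begin

text \<open>
  A section of \<open>\<beta>\<close> at a vertex has the form \<open>s \<mapsto> (s, \<nabla> s)\<close>, and it is linear for the module structure
  of the jet sheaf exactly if \<open>\<nabla>\<close> satisfies the Leibniz rule. Compatibility with the arrows is the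
  equation that defines a relative connection: since sections of a tensor product are locally sums of
  pure tensors, both equations need only be compared on pure tensors, where they coincide.
  The Atiyah class is the class of the pullback of the jet sequence along the identity, and an
  extension is equivalent to the trivial one if and only if it splits.
\<close>

section \<open>Functions of class \<open>C\<^sup>k\<close>\<close>

text \<open>Most of the work lies in the tensor product. \<open>tensor_lift\<close>,
  \<open>tensor_assoc\<close> and \<open>tensor_swap\<close> are picked by \<open>SOME\<close>, so
  nothing is known about them until a map with the prescribed values on pure tensors has been
  constructed. The universal property is proved for additive balanced maps rather than linear ones,
  because a connection is not linear over smooth functions. Neither summand of \<nabla> \<otimes> id
  + id \<otimes> \<nabla> is balanced: moving f across the tensor sign changes the two by opposite
  amounts, df \<otimes> s \<otimes> m up to sign, and only the sum descends to the tensor product.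
  The scalar action on jets makes the same cancellation work for the structure maps of the jet
  bundle. The module laws of the jet sheaf need df to be a smooth form in every chart. This takes a
  chain rule over a model space of which only a finite spanning set is known, hence the detour
  through coordinate functionals.\<close>

lemma frechet_derivative_cong_open:
  assumes "open S" "x \<in> S" "\<And>y. y \<in> S \<Longrightarrow> f y = g y"
  shows "frechet_derivative f (at x) = frechet_derivative g (at x)"
proof -
  have "(f has_derivative D) (at x) \<longleftrightarrow> (g has_derivative D) (at x)" for D
    using has_derivative_transform_within_open[of f D x UNIV S g]
      has_derivative_transform_within_open[of g D x UNIV S f] assms by auto
  then show ?thesis
    unfolding frechet_derivative_def by simp
qed

text \<open>Openness of \<open>S\<close> makes derivatives at points of \<open>S\<close> depend on
  the values on \<open>S\<close> alone, so the induction can pass from the two functions to their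
  two derivatives.\<close>

lemma Ck_on_cong:
  assumes "open S" "\<And>y. y \<in> S \<Longrightarrow> f y = g y" "Ck_on k f S"
  shows "Ck_on k g S"
  using assms(2,3)
proof (induction k arbitrary: f g)
  case 0
  then show ?case by (simp cong: continuous_on_cong)
next
  case (Suc k)
  have "g differentiable (at x)" if x: "x \<in> S" for x
  proof -
    obtain D where "(f has_derivative D) (at x)"
      using Suc.prems(2) x by (auto simp: differentiable_def)
    then have "(g has_derivative D) (at x)"
      using has_derivative_transform_within_open[of f D x UNIV S g] x assms(1) Suc.prems(1) by simp
    then show ?thesis unfolding differentiable_def by blast
  qed
  moreover have "Ck_on k (\<lambda>x. frechet_derivative g (at x) e) S" for e
  proof (rule Suc.IH[of "\<lambda>x. frechet_derivative f (at x) e"])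
    show "Ck_on k (\<lambda>x. frechet_derivative f (at x) e) S" using Suc.prems(2) by simp
    show "frechet_derivative f (at y) e = frechet_derivative g (at y) e" if "y \<in> S" for y
      using frechet_derivative_cong_open[OF assms(1) that Suc.prems(1)] by simp
  qed
  ultimately show ?case by simp
qed

lemma Ck_on_subset: "Ck_on k f S \<Longrightarrow> T \<subseteq> S \<Longrightarrow> Ck_on k f T"
  by (induction k arbitrary: f) (auto intro: continuous_on_subset)

lemma Ck_on_SucD: "Ck_on (Suc k) f S \<Longrightarrow> Ck_on k f S"
proof (induction k arbitrary: f)
  case 0
  then show ?case
    by (auto intro!: continuous_at_imp_continuous_on differentiable_imp_continuous_within)
next
  case (Suc k)
  have "\<forall>e. Ck_on k (\<lambda>x. frechet_derivative f (at x) e) S"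
    using Suc.prems Suc.IH by (metis Ck_on.simps(2))
  then show ?case using Suc.prems by simp
qed

lemma Ck_on_const: "Ck_on k (\<lambda>x. r) S"
  by (induction k arbitrary: r) (auto)

lemma Ck_on_add:
  assumes "open S" "Ck_on k f S" "Ck_on k g S"
  shows "Ck_on k (\<lambda>x. f x + g x) S"
  using assms(2,3)
proof (induction k arbitrary: f g)
  case 0
  then show ?case by (auto intro: continuous_intros)
next
  case (Suc k)
  have "Ck_on k (\<lambda>x. frechet_derivative (\<lambda>x. f x + g x) (at x) e) S" for e
  proof (rule Ck_on_cong[OF assms(1)])
    show "Ck_on k (\<lambda>x. frechet_derivative f (at x) e + frechet_derivative g (at x) e) S"
      using Suc by simp
    show "frechet_derivative f (at x) e + frechet_derivative g (at x) e =
        frechet_derivative (\<lambda>x. f x + g x) (at x) e" if "x \<in> S" for x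
    proof -
      have "((\<lambda>x. f x + g x) has_derivative (\<lambda>h. frechet_derivative f (at x) h
          + frechet_derivative g (at x) h)) (at x)"
        using Suc.prems that by (intro has_derivative_add) (auto simp: frechet_derivative_works[symmetric])
      from fun_cong[OF frechet_derivative_at[OF this], of e] show ?thesis .
    qed
  qed
  then show ?case using Suc.prems by (auto intro: differentiable_add)
qed

text \<open>In each summand of the product rule one factor is not differentiated. The induction
  hypothesis wants it in class \<open>k\<close>, and \<open>Ck_on_SucD\<close> lowers it from class
  \<open>Suc k\<close>.\<close>

lemma Ck_on_mult:
  fixes f g :: "'b::real_normed_vector \<Rightarrow> real"
  assumes "open S" "Ck_on k f S" "Ck_on k g S"
  shows "Ck_on k (\<lambda>x. f x * g x) S"
  using assms(2,3)
proof (induction k arbitrary: f g)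
  case 0
  then show ?case by (auto intro: continuous_intros)
next
  case (Suc k)
  have "Ck_on k (\<lambda>x. frechet_derivative (\<lambda>x. f x * g x) (at x) e) S" for e
  proof (rule Ck_on_cong[OF assms(1)])
    show "Ck_on k (\<lambda>x. f x * frechet_derivative g (at x) e + frechet_derivative f (at x) e * g x) S"
      using Suc.prems Ck_on_SucD[OF Suc.prems(1)] Ck_on_SucD[OF Suc.prems(2)]
      by (intro Ck_on_add[OF assms(1)] Suc.IH) simp_all
    show "f x * frechet_derivative g (at x) e + frechet_derivative f (at x) e * g x =
        frechet_derivative (\<lambda>x. f x * g x) (at x) e" if x: "x \<in> S" for x
    proof -
      have "((\<lambda>x. f x * g x) has_derivative (\<lambda>h. f x * frechet_derivative g (at x) h
          + frechet_derivative f (at x) h * g x)) (at x)"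
        using Suc.prems x by (intro has_derivative_mult) (auto simp: frechet_derivative_works[symmetric])
      from fun_cong[OF frechet_derivative_at[OF this], of e] show ?thesis .
    qed
  qed
  then show ?case using Suc.prems by (auto intro: differentiable_mult)
qed

lemma Ck_on_sum:
  assumes "open S" "finite I" "\<And>i. i \<in> I \<Longrightarrow> Ck_on k (f i) S"
  shows "Ck_on k (\<lambda>x. \<Sum>i\<in>I. f i x) S"
  using assms(2,3)
  by (induction I rule: finite_induct) (auto intro!: Ck_on_const Ck_on_add[OF assms(1)])

lemma Ck_on_bounded_linear:
  assumes "open S" "bounded_linear L" "Ck_on k f S"
  shows "Ck_on k (\<lambda>x. L (f x)) S"
  using assms(3)
proof (induction k arbitrary: f)
  case 0
  then show ?case by (auto intro: bounded_linear.continuous_on assms)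
next
  case (Suc k)
  have D: "((\<lambda>x. L (f x)) has_derivative (\<lambda>h. L (frechet_derivative f (at x) h))) (at x)" if "x \<in> S" for x
    using Suc.prems that
    by (intro bounded_linear.has_derivative[OF assms(2)]) (auto simp: frechet_derivative_works[symmetric])
  have "Ck_on k (\<lambda>x. frechet_derivative (\<lambda>x. L (f x)) (at x) e) S" for e
  proof (rule Ck_on_cong[OF assms(1)])
    show "Ck_on k (\<lambda>x. L (frechet_derivative f (at x) e)) S"
      using Suc by simp
    show "L (frechet_derivative f (at x) e) = frechet_derivative (\<lambda>x. L (f x)) (at x) e" if "x \<in> S" for x
      using fun_cong[OF frechet_derivative_at[OF D[OF that]], of e] .
  qed
  then show ?case using D by (auto simp: differentiable_def)
qed

text \<open>\<open>Ck_on\<close> differentiates along fixed vectors, so the chain rule has to expand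
  the derivative of the inner map in a fixed basis. The type class supplies none; it is extracted
  from the spanning set. Boundedness of the coordinate functionals is the equivalence of norms in
  finite dimension.\<close>

lemma finite_dim_coordinates:
  fixes B :: "'b::real_normed_vector set"
  assumes "finite B" "span B = UNIV"
  obtains I :: "'b set" and p :: "'b \<Rightarrow> 'b \<Rightarrow> real"
  where "finite I" "\<And>b. b \<in> I \<Longrightarrow> bounded_linear (p b)" "\<And>v. v = (\<Sum>b\<in>I. p b v *\<^sub>R b)"
proof -
  obtain I where I: "I \<subseteq> B" "independent I" "span I = (UNIV :: 'b set)"
    using maximal_independent_subset[of B] assms(2) by (metis span_mono span_span top.extremum_uniqueI)
  have fin: "finite I" using I(1) assms(1) finite_subset by blast
  define p where "p = (\<lambda>b v. representation I v b)"
  have repr: "v = (\<Sum>b\<in>I. p b v *\<^sub>R b)" for v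
    unfolding p_def using sum_representation_eq[OF I(2) _ fin] I(3) by (metis UNIV_I order_refl)
  have lin: "linear (p b)" for b
    unfolding p_def using I(2,3) representation_add[OF I(2)] representation_scale[OF I(2)]
    by (intro linearI) auto
  \<comment> \<open>The map from coordinates to vectors attains a positive minimum on the compact unit sphere
    of the maximum norm.\<close>
  define K where "K = (\<Pi>\<^sub>E b\<in>UNIV. (if b \<in> I then {-1..1} else {0::real}))"
  define Z where "Z = K \<inter> (\<Union>b\<in>I. {a. \<bar>a b\<bar> = 1})"
  have K: "compact K"
    unfolding K_def
    using compactin_PiE[of "\<lambda>_. euclidean" UNIV "\<lambda>b. if b \<in> I then {-1..1} else {0::real}"]
    by (simp add: euclidean_product_topology)
  have Zc: "compact Z"
    unfolding Z_def
    by (intro compact_Int_closed K closed_UN fin ballI closed_Collect_eq continuous_intros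
        continuous_on_product_coordinates)
  define f where "f = (\<lambda>a :: 'b \<Rightarrow> real. \<Sum>b\<in>I. a b *\<^sub>R b)"
  have contf: "continuous_on T f" for T
    unfolding f_def
    by (intro continuous_on_sum continuous_on_scaleR continuous_on_const
        continuous_on_subset[OF continuous_on_product_coordinates subset_UNIV])
  have nz: "f a \<noteq> 0" if a: "a \<in> Z" for a
  proof
    assume 0: "f a = 0"
    obtain b where b: "b \<in> I" "\<bar>a b\<bar> = 1" using a by (auto simp: Z_def)
    have "a b = 0"
      using independentD[OF I(2) fin order_refl _ b(1)] 0 by (simp add: f_def)
    then show False using b(2) by simp
  qed
  obtain m where m: "m > 0" "\<And>a. a \<in> Z \<Longrightarrow> m \<le> norm (f a)"
  \<comment> \<open>\<open>Z\<close> is empty exactly if \<open>I\<close> is, that is in dimension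
    0, where any positive \<open>m\<close> will do.\<close>
  proof (cases "Z = {}")
    case True
    then show ?thesis using that[of 1] by simp
  next
    case False
    obtain a where "a \<in> Z" "\<forall>a'\<in>Z. norm (f a) \<le> norm (f a')"
      using continuous_attains_inf[OF Zc False] contf continuous_on_norm by blast
    then show ?thesis using that[of "norm (f a)"] nz by simp
  qed
  have "\<bar>p b v\<bar> \<le> norm v * (1 / m)" if b: "b \<in> I" for b v
  proof -
    define \<mu> where "\<mu> = Max ((\<lambda>b. \<bar>p b v\<bar>) ` I)"
    have le: "\<bar>p b' v\<bar> \<le> \<mu>" if "b' \<in> I" for b'
      using that fin by (simp add: \<mu>_def)
    have "\<mu> \<in> (\<lambda>b. \<bar>p b v\<bar>) ` I"
      unfolding \<mu>_def by (rule Max_in) (use fin b in auto)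
    then obtain b0 where b0: "b0 \<in> I" "\<mu> = \<bar>p b0 v\<bar>" by blast
    show ?thesis
    proof (cases "\<mu> = 0")
      case True
      then show ?thesis using le[OF b] m(1) by simp
    next
      case False
      then have pos: "\<mu> > 0" using b0 by simp
      \<comment> \<open>Dividing by the largest coordinate puts the coordinate vector of
        \<open>v\<close> into \<open>Z\<close>: the index \<open>b0\<close> of the maximum now has a
        coordinate of absolute value 1.\<close>
      define a where "a = (\<lambda>b. if b \<in> I then p b v / \<mu> else 0)"
      have "a b' \<in> {-1..1}" if "b' \<in> I" for b'
        using le[OF that] pos that by (auto simp: a_def divide_le_eq le_divide_eq abs_le_iff)
      moreover have "a b' = 0" if "b' \<notin> I" for b'
        using that by (simp add: a_def)
      ultimately have "a \<in> K" unfolding K_def by (intro PiE_I) auto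
      moreover have "\<bar>a b0\<bar> = 1" using b0 pos by (simp add: a_def)
      ultimately have "m \<le> norm (f a)" using b0 by (intro m(2)) (auto simp: Z_def)
      also have "f a = (1 / \<mu>) *\<^sub>R v"
        using arg_cong[OF repr[of v], of "\<lambda>w. (1 / \<mu>) *\<^sub>R w"]
        by (simp add: f_def a_def scaleR_sum_right)
      finally have "m * \<mu> \<le> norm v" using pos by (simp add: field_simps)
      then have "\<mu> \<le> norm v * (1 / m)" using m(1) by (simp add: field_simps)
      then show ?thesis using le[OF b] by linarith
    qed
  qed
  then have "bounded_linear (p b)" if "b \<in> I" for b
    using lin[of b] that by (intro bounded_linear_intro[of _ "1 / m"]) (auto simp: linear_add linear_scale)
  then show thesis using that fin repr by blast
qed

text \<open>The derivative of \<open>g \<circ> h\<close> along \<open>e\<close> is the sum over a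
  basis of a coordinate of the derivative of \<open>h\<close> along \<open>e\<close> times a partial
  derivative of \<open>g\<close> composed with \<open>h\<close>. The induction keeps
  \<open>h\<close> and replaces \<open>g\<close> by its partial derivatives; the coordinates are
  bounded linear in the derivative of \<open>h\<close>.\<close>

lemma Ck_on_compose:
  fixes g :: "'b::real_normed_vector \<Rightarrow> real" and h :: "'c::real_normed_vector \<Rightarrow> 'b"
  assumes fd: "finite B" "span B = (UNIV :: 'b set)"
    and "open S" "open T" "h ` S \<subseteq> T" "Ck_on k g T" "Ck_on k h S"
  shows "Ck_on k (g \<circ> h) S"
  using assms(6,7)
proof (induction k arbitrary: g)
  case 0
  then show ?case using assms(5) by (auto intro: continuous_on_compose2 simp: comp_def)
next
  case (Suc k)
  obtain I :: "'b set" and p where I: "finite I" "\<And>b. b \<in> I \<Longrightarrow> bounded_linear (p b)"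
      "\<And>v. v = (\<Sum>b\<in>I. p b v *\<^sub>R b)"
    using finite_dim_coordinates[OF fd] by metis
  have g': "(g has_derivative frechet_derivative g (at (h x))) (at (h x))" if "x \<in> S" for x
    using Suc.prems(1) assms(5) that by (auto simp: frechet_derivative_works[symmetric])
  have D: "(g \<circ> h has_derivative frechet_derivative g (at (h x)) \<circ> frechet_derivative h (at x)) (at x)"
    if "x \<in> S" for x
    using Suc.prems(2) that
    by (intro diff_chain_at g') (auto simp: frechet_derivative_works[symmetric])
  have "Ck_on k (\<lambda>x. frechet_derivative (g \<circ> h) (at x) e) S" for e
  proof (rule Ck_on_cong[OF assms(3)])
    show "Ck_on k (\<lambda>x. \<Sum>b\<in>I. p b (frechet_derivative h (at x) e)
        * ((\<lambda>y. frechet_derivative g (at y) b) \<circ> h) x) S"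
    proof (intro Ck_on_sum[OF assms(3) I(1)] Ck_on_mult[OF assms(3)])
      fix b assume b: "b \<in> I"
      show "Ck_on k (\<lambda>x. p b (frechet_derivative h (at x) e)) S"
        using Suc.prems(2) by (intro Ck_on_bounded_linear[OF assms(3) I(2)[OF b]]) simp
      show "Ck_on k ((\<lambda>y. frechet_derivative g (at y) b) \<circ> h) S"
        using Suc.prems Ck_on_SucD[OF Suc.prems(2)] by (intro Suc.IH) simp_all
    qed
    show "(\<Sum>b\<in>I. p b (frechet_derivative h (at x) e) * ((\<lambda>y. frechet_derivative g (at y) b) \<circ> h) x) =
        frechet_derivative (g \<circ> h) (at x) e" if x: "x \<in> S" for x
    proof -
      have lin: "linear (frechet_derivative g (at (h x)))"
        using g'[OF x] has_derivative_linear by blast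
      have "frechet_derivative (g \<circ> h) (at x) e =
          frechet_derivative g (at (h x)) (\<Sum>b\<in>I. p b (frechet_derivative h (at x) e) *\<^sub>R b)"
        using frechet_derivative_at[OF D[OF x]] I(3) by (metis comp_apply)
      then show ?thesis using lin by (simp add: linear_sum linear_scale)
    qed
  qed
  moreover have "g \<circ> h differentiable (at x)" if "x \<in> S" for x
    using D[OF that] unfolding differentiable_def by blast
  ultimately show ?case unfolding Ck_on.simps by blast
qed

section \<open>Smooth functions on a manifold\<close>

locale smooth_mfd =
  fixes A :: "('x::{t2_space,second_countable_topology}, 'b::real_normed_vector) atlas"
  assumes smooth_mfd: "smooth_manifold A"
begin

lemma chart_open: "(V, c) \<in> A \<Longrightarrow> open V"
  using smooth_mfd unfolding smooth_manifold_def by blast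

lemma chart_homeomorphism:
  "(V, c) \<in> A \<Longrightarrow> open (c ` V) \<and> homeomorphism V (c ` V) c (inv_into V c)"
  using smooth_mfd unfolding smooth_manifold_def by blast

lemma chart_inv:
  assumes "(V, c) \<in> A" "x \<in> V"
  shows "inv_into V c (c x) = x"
  using chart_homeomorphism[OF assms(1)] assms(2) unfolding homeomorphism_def by auto

text \<open>A homeomorphism gives openness relative to the image of the chart only; that image is
  itself open in the model space.\<close>

lemma chart_image_open:
  assumes "(V, c) \<in> A" "open U"
  shows "open (c ` (U \<inter> V))"
proof -
  have "openin (top_of_set (c ` V)) (c ` (U \<inter> V))"
    using chart_homeomorphism[OF assms(1)] homeomorphism_imp_open_map[of V "c ` V" c "inv_into V c" "U \<inter> V"]
      assms by (auto simp: openin_open)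
  then show ?thesis
    using chart_homeomorphism[OF assms(1)] openin_open_trans by blast
qed

lemma chart_transition:
  "(U, c) \<in> A \<Longrightarrow> (V, d) \<in> A \<Longrightarrow> smooth_on (c ` (U \<inter> V)) (d \<circ> inv_into U c)"
  using smooth_mfd unfolding smooth_manifold_def by blast

lemma smooth_funI:
  assumes "\<And>x. x \<notin> U \<Longrightarrow> f x = 0"
    and "\<And>V c k. (V, c) \<in> A \<Longrightarrow> Ck_on k (f \<circ> inv_into V c) (c ` (U \<inter> V))"
  shows "f \<in> smooth_fun A U"
  using assms unfolding smooth_fun_def smooth_on_def by auto

lemma smooth_funD:
  assumes "f \<in> smooth_fun A U"
  shows "x \<notin> U \<Longrightarrow> f x = 0"
    and "(V, c) \<in> A \<Longrightarrow> Ck_on k (f \<circ> inv_into V c) (c ` (U \<inter> V))"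
  using assms unfolding smooth_fun_def smooth_on_def by auto

lemma smooth_fun_cut:
  assumes "f \<in> smooth_fun A U" "open V" "V \<subseteq> U"
  shows "cut V f \<in> smooth_fun A V"
proof (rule smooth_funI)
  fix W c k assume W: "(W, c) \<in> A"
  show "Ck_on k (cut V f \<circ> inv_into W c) (c ` (V \<inter> W))"
  proof (rule Ck_on_cong[OF chart_image_open[OF W assms(2)]])
    show "Ck_on k (f \<circ> inv_into W c) (c ` (V \<inter> W))"
      by (rule Ck_on_subset[OF smooth_funD(2)[OF assms(1) W]]) (use assms(3) in auto)
    show "(f \<circ> inv_into W c) y = (cut V f \<circ> inv_into W c) y" if "y \<in> c ` (V \<inter> W)" for y
      using that chart_inv[OF W] by (auto simp: cut_def)
  qed
qed (simp add: cut_def)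

lemma smooth_fun_const:
  assumes "open U" shows "cut U (\<lambda>x. r) \<in> smooth_fun A U"
proof (rule smooth_funI)
  fix W c k assume W: "(W, c) \<in> A"
  show "Ck_on k (cut U (\<lambda>x. r) \<circ> inv_into W c) (c ` (U \<inter> W))"
    by (rule Ck_on_cong[OF chart_image_open[OF W assms] _ Ck_on_const[of k r]])
      (auto simp: cut_def chart_inv[OF W])
qed (simp add: cut_def)

lemma smooth_fun_add:
  assumes "open U" "f \<in> smooth_fun A U" "g \<in> smooth_fun A U"
  shows "(\<lambda>x. f x + g x) \<in> smooth_fun A U"
  using Ck_on_add[OF chart_image_open[OF _ assms(1)] smooth_funD(2)[OF assms(2)] smooth_funD(2)[OF assms(3)]]
    smooth_funD(1)[OF assms(2)] smooth_funD(1)[OF assms(3)]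
  by (intro smooth_funI) (auto simp: comp_def)

lemma smooth_fun_mult:
  assumes "open U" "f \<in> smooth_fun A U" "g \<in> smooth_fun A U"
  shows "(\<lambda>x. f x * g x) \<in> smooth_fun A U"
  using Ck_on_mult[OF chart_image_open[OF _ assms(1)] smooth_funD(2)[OF assms(2)] smooth_funD(2)[OF assms(3)]]
    smooth_funD(1)[OF assms(2)]
  by (intro smooth_funI) (auto simp: comp_def)

lemma smooth_fun_scale:
  assumes "open U" "f \<in> smooth_fun A U"
  shows "(\<lambda>x. r * f x) \<in> smooth_fun A U"
proof -
  have "(\<lambda>x. cut U (\<lambda>x. r) x * f x) = (\<lambda>x. r * f x)"
    using smooth_funD(1)[OF assms(2)] by (auto simp: cut_def)
  then show ?thesis
    using smooth_fun_mult[OF assms(1) smooth_fun_const[OF assms(1)] assms(2)] by metis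
qed

lemma smooth_fun_zero:
  assumes "open U" shows "(\<lambda>x. 0) \<in> smooth_fun A U"
  using smooth_fun_const[OF assms, of 0] by (simp add: cut_def)

lemma cring_Cinf:
  assumes U: "open U"
  shows "cring (Cinf A U)"
proof (rule cringI)
  show "abelian_group (Cinf A U)"
  proof (rule abelian_groupI)
    fix f assume "f \<in> carrier (Cinf A U)"
    then show "\<exists>g\<in>carrier (Cinf A U). g \<oplus>\<^bsub>Cinf A U\<^esub> f = \<zero>\<^bsub>Cinf A U\<^esub>"
      using smooth_fun_scale[OF U, of f "-1"] by (intro bexI[of _ "\<lambda>x. -1 * f x"]) (auto simp: Cinf_def)
  qed (auto simp: Cinf_def smooth_fun_zero smooth_fun_add U add.assoc add.commute)
  show "comm_monoid (Cinf A U)"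
    using smooth_fun_const[OF U] smooth_fun_mult[OF U]
    by (intro comm_monoidI) (auto simp: Cinf_def cut_def fun_eq_iff smooth_funD(1))
qed (auto simp: Cinf_def algebra_simps)

text \<open>Smoothness is demanded in every chart, not only in \<open>(V, c)\<close>. Seen in
  another chart \<open>(W, d)\<close>, the function is the partial derivative precomposed with the
  transition map from \<open>d\<close> to \<open>c\<close>. This is the use of the chain
  rule.\<close>

lemma smooth_fun_partial_derivative:
  assumes U: "open U" and f: "f \<in> smooth_fun A U" and V: "(V, c) \<in> A"
  shows "cut (U \<inter> V) (\<lambda>x. frechet_derivative (f \<circ> inv_into V c) (at (c x)) e) \<in> smooth_fun A (U \<inter> V)"
proof (rule smooth_funI)
  fix W d k assume W: "(W, d) \<in> A"
  obtain B :: "'b set" where B: "finite B" "span B = UNIV"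
    using smooth_mfd unfolding smooth_manifold_def by (elim conjE exE)
  define g where "g = (\<lambda>y. frechet_derivative (f \<circ> inv_into V c) (at y) e)"
  have op: "open (d ` ((U \<inter> V) \<inter> W))"
    using chart_image_open[OF W] U chart_open[OF V] by blast
  show "Ck_on k (cut (U \<inter> V) (\<lambda>x. frechet_derivative (f \<circ> inv_into V c) (at (c x)) e) \<circ> inv_into W d)
      (d ` ((U \<inter> V) \<inter> W))"
  proof (rule Ck_on_cong[OF op])
    have "Ck_on k (c \<circ> inv_into W d) (d ` ((U \<inter> V) \<inter> W))"
      by (rule Ck_on_subset[of k _ "d ` (W \<inter> V)"])
        (use chart_transition[OF W V] in \<open>auto simp: smooth_on_def simp del: comp_apply\<close>)
    moreover have "Ck_on k g (c ` (U \<inter> V))"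
      using smooth_funD(2)[OF f V, of "Suc k"] by (simp add: g_def)
    moreover have "(c \<circ> inv_into W d) ` (d ` ((U \<inter> V) \<inter> W)) \<subseteq> c ` (U \<inter> V)"
      by (auto simp: chart_inv[OF W])
    ultimately show "Ck_on k (g \<circ> (c \<circ> inv_into W d)) (d ` ((U \<inter> V) \<inter> W))"
      using Ck_on_compose[OF B op chart_image_open[OF V U]] by simp
  qed (auto simp: g_def cut_def chart_inv[OF W])
qed (auto simp: cut_def)

end

section \<open>Presheaves and sheaves of modules\<close>

lemma cut_cut: "V \<subseteq> U \<Longrightarrow> cut V (cut U f) = cut V f"
  by (auto simp: cut_def fun_eq_iff)

lemma module_sheaf_presheaf: "module_sheaf A F \<Longrightarrow> module_presheaf A F"
  by (simp add: module_sheaf_def)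

lemma presheaf_module: "module_presheaf A F \<Longrightarrow> open U \<Longrightarrow> module (Cinf A U) (Sec F U)"
  by (simp add: module_presheaf_def)

lemma
  assumes "module_presheaf A F" "open U"
  shows presheaf_add_closed: "s \<in> sections F U \<Longrightarrow> t \<in> sections F U \<Longrightarrow> s \<oplus>\<^bsub>Sec F U\<^esub> t \<in> sections F U"
    and presheaf_zero_closed: "\<zero>\<^bsub>Sec F U\<^esub> \<in> sections F U"
    and presheaf_smult_closed:
      "f \<in> smooth_fun A U \<Longrightarrow> s \<in> sections F U \<Longrightarrow> f \<odot>\<^bsub>Sec F U\<^esub> s \<in> sections F U"
    and presheaf_add_assoc: "s \<in> sections F U \<Longrightarrow> t \<in> sections F U \<Longrightarrow> r \<in> sections F U \<Longrightarrow>
      (s \<oplus>\<^bsub>Sec F U\<^esub> t) \<oplus>\<^bsub>Sec F U\<^esub> r = s \<oplus>\<^bsub>Sec F U\<^esub> (t \<oplus>\<^bsub>Sec F U\<^esub> r)"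
    and presheaf_add_comm: "s \<in> sections F U \<Longrightarrow> t \<in> sections F U \<Longrightarrow>
      s \<oplus>\<^bsub>Sec F U\<^esub> t = t \<oplus>\<^bsub>Sec F U\<^esub> s"
    and presheaf_add_lcomm: "s \<in> sections F U \<Longrightarrow> t \<in> sections F U \<Longrightarrow> r \<in> sections F U \<Longrightarrow>
      s \<oplus>\<^bsub>Sec F U\<^esub> (t \<oplus>\<^bsub>Sec F U\<^esub> r) = t \<oplus>\<^bsub>Sec F U\<^esub> (s \<oplus>\<^bsub>Sec F U\<^esub> r)"
    and presheaf_zero_add: "s \<in> sections F U \<Longrightarrow> \<zero>\<^bsub>Sec F U\<^esub> \<oplus>\<^bsub>Sec F U\<^esub> s = s"
    and presheaf_add_zero: "s \<in> sections F U \<Longrightarrow> s \<oplus>\<^bsub>Sec F U\<^esub> \<zero>\<^bsub>Sec F U\<^esub> = s"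
    and presheaf_add_eq_selfD: "s \<in> sections F U \<Longrightarrow> t \<in> sections F U \<Longrightarrow>
      s \<oplus>\<^bsub>Sec F U\<^esub> t = s \<Longrightarrow> t = \<zero>\<^bsub>Sec F U\<^esub>"

    and presheaf_smult_add: "f \<in> smooth_fun A U \<Longrightarrow> s \<in> sections F U \<Longrightarrow> t \<in> sections F U \<Longrightarrow>
      f \<odot>\<^bsub>Sec F U\<^esub> (s \<oplus>\<^bsub>Sec F U\<^esub> t) = (f \<odot>\<^bsub>Sec F U\<^esub> s) \<oplus>\<^bsub>Sec F U\<^esub> (f \<odot>\<^bsub>Sec F U\<^esub> t)"
    and presheaf_add_smult: "f \<in> smooth_fun A U \<Longrightarrow> g \<in> smooth_fun A U \<Longrightarrow> s \<in> sections F U \<Longrightarrow>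
      (\<lambda>x. f x + g x) \<odot>\<^bsub>Sec F U\<^esub> s = (f \<odot>\<^bsub>Sec F U\<^esub> s) \<oplus>\<^bsub>Sec F U\<^esub> (g \<odot>\<^bsub>Sec F U\<^esub> s)"
    and presheaf_mult_smult: "f \<in> smooth_fun A U \<Longrightarrow> g \<in> smooth_fun A U \<Longrightarrow> s \<in> sections F U \<Longrightarrow>
      (\<lambda>x. f x * g x) \<odot>\<^bsub>Sec F U\<^esub> s = f \<odot>\<^bsub>Sec F U\<^esub> (g \<odot>\<^bsub>Sec F U\<^esub> s)"
    and presheaf_one_smult: "s \<in> sections F U \<Longrightarrow> cut U (\<lambda>x. 1) \<odot>\<^bsub>Sec F U\<^esub> s = s"
    and presheaf_zero_smult: "s \<in> sections F U \<Longrightarrow> (\<lambda>x. 0) \<odot>\<^bsub>Sec F U\<^esub> s = \<zero>\<^bsub>Sec F U\<^esub>"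
    and presheaf_smult_zero: "f \<in> smooth_fun A U \<Longrightarrow> f \<odot>\<^bsub>Sec F U\<^esub> \<zero>\<^bsub>Sec F U\<^esub> = \<zero>\<^bsub>Sec F U\<^esub>"
proof -
  interpret module "Cinf A U" "Sec F U" using assms by (rule presheaf_module)
  have C: "carrier (Cinf A U) = smooth_fun A U" by (simp add: Cinf_def)
  show "s \<in> sections F U \<Longrightarrow> t \<in> sections F U \<Longrightarrow> s \<oplus>\<^bsub>Sec F U\<^esub> t \<in> sections F U"
    "\<zero>\<^bsub>Sec F U\<^esub> \<in> sections F U"
    "s \<in> sections F U \<Longrightarrow> t \<in> sections F U \<Longrightarrow> r \<in> sections F U \<Longrightarrow>
      (s \<oplus>\<^bsub>Sec F U\<^esub> t) \<oplus>\<^bsub>Sec F U\<^esub> r = s \<oplus>\<^bsub>Sec F U\<^esub> (t \<oplus>\<^bsub>Sec F U\<^esub> r)"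
    "s \<in> sections F U \<Longrightarrow> t \<in> sections F U \<Longrightarrow> s \<oplus>\<^bsub>Sec F U\<^esub> t = t \<oplus>\<^bsub>Sec F U\<^esub> s"
    "s \<in> sections F U \<Longrightarrow> t \<in> sections F U \<Longrightarrow> r \<in> sections F U \<Longrightarrow>
      s \<oplus>\<^bsub>Sec F U\<^esub> (t \<oplus>\<^bsub>Sec F U\<^esub> r) = t \<oplus>\<^bsub>Sec F U\<^esub> (s \<oplus>\<^bsub>Sec F U\<^esub> r)"
    "s \<in> sections F U \<Longrightarrow> \<zero>\<^bsub>Sec F U\<^esub> \<oplus>\<^bsub>Sec F U\<^esub> s = s"
    "s \<in> sections F U \<Longrightarrow> s \<oplus>\<^bsub>Sec F U\<^esub> \<zero>\<^bsub>Sec F U\<^esub> = s"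
    "s \<in> sections F U \<Longrightarrow> t \<in> sections F U \<Longrightarrow> s \<oplus>\<^bsub>Sec F U\<^esub> t = s \<Longrightarrow> t = \<zero>\<^bsub>Sec F U\<^esub>"

    by (simp_all add: M.a_ac)
  show "f \<in> smooth_fun A U \<Longrightarrow> s \<in> sections F U \<Longrightarrow> f \<odot>\<^bsub>Sec F U\<^esub> s \<in> sections F U"
    "f \<in> smooth_fun A U \<Longrightarrow> s \<in> sections F U \<Longrightarrow> t \<in> sections F U \<Longrightarrow>
      f \<odot>\<^bsub>Sec F U\<^esub> (s \<oplus>\<^bsub>Sec F U\<^esub> t) = (f \<odot>\<^bsub>Sec F U\<^esub> s) \<oplus>\<^bsub>Sec F U\<^esub> (f \<odot>\<^bsub>Sec F U\<^esub> t)"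
    "f \<in> smooth_fun A U \<Longrightarrow> f \<odot>\<^bsub>Sec F U\<^esub> \<zero>\<^bsub>Sec F U\<^esub> = \<zero>\<^bsub>Sec F U\<^esub>"
    by (simp_all add: C smult_r_distr)
  show "f \<in> smooth_fun A U \<Longrightarrow> g \<in> smooth_fun A U \<Longrightarrow> s \<in> sections F U \<Longrightarrow>
      (\<lambda>x. f x + g x) \<odot>\<^bsub>Sec F U\<^esub> s = (f \<odot>\<^bsub>Sec F U\<^esub> s) \<oplus>\<^bsub>Sec F U\<^esub> (g \<odot>\<^bsub>Sec F U\<^esub> s)"
    using smult_l_distr[of f g s] by (simp add: Cinf_def)
  show "f \<in> smooth_fun A U \<Longrightarrow> g \<in> smooth_fun A U \<Longrightarrow> s \<in> sections F U \<Longrightarrow>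
      (\<lambda>x. f x * g x) \<odot>\<^bsub>Sec F U\<^esub> s = f \<odot>\<^bsub>Sec F U\<^esub> (g \<odot>\<^bsub>Sec F U\<^esub> s)"
    using smult_assoc1[of f g s] by (simp add: Cinf_def)
  show "s \<in> sections F U \<Longrightarrow> cut U (\<lambda>x. 1) \<odot>\<^bsub>Sec F U\<^esub> s = s"
    using smult_one[of s] by (simp add: Cinf_def)
  show "s \<in> sections F U \<Longrightarrow> (\<lambda>x. 0) \<odot>\<^bsub>Sec F U\<^esub> s = \<zero>\<^bsub>Sec F U\<^esub>"
    using smult_l_null[of s] by (simp add: Cinf_def)
qed

lemma
  assumes "module_presheaf A F" "open U" "open V" "V \<subseteq> U"
  shows presheaf_Res_closed: "s \<in> sections F U \<Longrightarrow> Res F U V s \<in> sections F V"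
    and presheaf_Res_add: "s \<in> sections F U \<Longrightarrow> t \<in> sections F U \<Longrightarrow>
      Res F U V (s \<oplus>\<^bsub>Sec F U\<^esub> t) = Res F U V s \<oplus>\<^bsub>Sec F V\<^esub> Res F U V t"
    and presheaf_Res_smult: "f \<in> smooth_fun A U \<Longrightarrow> s \<in> sections F U \<Longrightarrow>
      Res F U V (f \<odot>\<^bsub>Sec F U\<^esub> s) = cut V f \<odot>\<^bsub>Sec F V\<^esub> Res F U V s"
    and presheaf_Res_zero: "Res F U V \<zero>\<^bsub>Sec F U\<^esub> = \<zero>\<^bsub>Sec F V\<^esub>"
proof -
  show 1: "s \<in> sections F U \<Longrightarrow> Res F U V s \<in> sections F V" for s
    using assms by (simp add: module_presheaf_def)
  show 2: "s \<in> sections F U \<Longrightarrow> t \<in> sections F U \<Longrightarrow>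
      Res F U V (s \<oplus>\<^bsub>Sec F U\<^esub> t) = Res F U V s \<oplus>\<^bsub>Sec F V\<^esub> Res F U V t" for s t
    using assms by (simp add: module_presheaf_def)
  show "f \<in> smooth_fun A U \<Longrightarrow> s \<in> sections F U \<Longrightarrow>
      Res F U V (f \<odot>\<^bsub>Sec F U\<^esub> s) = cut V f \<odot>\<^bsub>Sec F V\<^esub> Res F U V s"
    using assms by (simp add: module_presheaf_def)
  note z = presheaf_zero_closed[OF assms(1,2)]
  show "Res F U V \<zero>\<^bsub>Sec F U\<^esub> = \<zero>\<^bsub>Sec F V\<^esub>"
    using presheaf_add_eq_selfD[OF assms(1,3) 1[OF z] 1[OF z]] 2[OF z z]
      presheaf_zero_add[OF assms(1,2) z] by simp
qed

lemma presheaf_Res_id: "module_presheaf A F \<Longrightarrow> open U \<Longrightarrow> s \<in> sections F U \<Longrightarrow> Res F U U s = s"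
  by (simp add: module_presheaf_def)

lemma presheaf_Res_Res:
  "module_presheaf A F \<Longrightarrow> open U \<Longrightarrow> open V \<Longrightarrow> open W \<Longrightarrow> V \<subseteq> U \<Longrightarrow> W \<subseteq> V \<Longrightarrow> s \<in> sections F U \<Longrightarrow>
    Res F V W (Res F U V s) = Res F U W s"
  by (simp add: module_presheaf_def)

lemmas presheaf_closed = presheaf_add_closed presheaf_zero_closed presheaf_smult_closed presheaf_Res_closed

text \<open>The separation axiom is applied to the family of all open subsets over which the
  restrictions agree; by \<open>loc\<close> it covers \<open>U\<close>. Equality can thus be tested
  near each point.\<close>

lemma sheaf_eqI:
  assumes F: "module_sheaf A F" and U: "open U" and s: "s \<in> sections F U" and t: "t \<in> sections F U"
    and loc: "\<And>x. x \<in> U \<Longrightarrow> \<exists>V. open V \<and> x \<in> V \<and> V \<subseteq> U \<and> Res F U V s = Res F U V t"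
  shows "s = t"
proof -
  define \<U> where "\<U> = {V. open V \<and> V \<subseteq> U \<and> Res F U V s = Res F U V t}"
  have un: "\<Union>\<U> = U" using loc unfolding \<U>_def by blast
  have op: "\<forall>V\<in>\<U>. open V" by (simp add: \<U>_def)
  have "\<forall>s\<in>sections F (\<Union>\<U>). \<forall>t\<in>sections F (\<Union>\<U>).
      (\<forall>V\<in>\<U>. Res F (\<Union>\<U>) V s = Res F (\<Union>\<U>) V t) \<longrightarrow> s = t"
    using F op unfolding module_sheaf_def by blast
  then show ?thesis using s t by (simp add: un) (simp add: \<U>_def)
qed

text \<open>Gluing for a relation between open sets and local sections, since local solutions arise
  from existence statements at points. Compatibility with \<open>W = V\<close> shows that
  \<open>V\<close> is related to one section at most, so the arbitrary choice \<open>p\<close> loses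
  nothing.\<close>

lemma sheaf_glue:
  assumes F: "module_sheaf A F" and U: "open U"
    and P: "\<And>V s. P V s \<Longrightarrow> open V \<and> V \<subseteq> U \<and> s \<in> sections F V"
    and compat: "\<And>V W s t. P V s \<Longrightarrow> P W t \<Longrightarrow> Res F V (V \<inter> W) s = Res F W (V \<inter> W) t"
    and cover: "\<And>x. x \<in> U \<Longrightarrow> \<exists>V s. x \<in> V \<and> P V s"
  shows "\<exists>s\<in>sections F U. \<forall>V t. P V t \<longrightarrow> Res F U V s = t"
proof -
  define \<U> where "\<U> = {V. \<exists>s. P V s}"
  define p where "p = (\<lambda>V. SOME s. P V s)"
  have p: "P V (p V)" if "V \<in> \<U>" for V
    using that unfolding \<U>_def p_def by (auto intro: someI)
  have un: "\<Union>\<U> = U" using cover P unfolding \<U>_def by blast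
  have op: "\<forall>V\<in>\<U>. open V" using P p by blast
  have "\<forall>p. (\<forall>V\<in>\<U>. p V \<in> sections F V) \<and>
      (\<forall>V\<in>\<U>. \<forall>W\<in>\<U>. Res F V (V \<inter> W) (p V) = Res F W (V \<inter> W) (p W)) \<longrightarrow>
      (\<exists>s\<in>sections F (\<Union>\<U>). \<forall>V\<in>\<U>. Res F (\<Union>\<U>) V s = p V)"
    using F op unfolding module_sheaf_def by blast
  moreover have "\<forall>V\<in>\<U>. p V \<in> sections F V" using p P by blast
  moreover have "\<forall>V\<in>\<U>. \<forall>W\<in>\<U>. Res F V (V \<inter> W) (p V) = Res F W (V \<inter> W) (p W)"
    using p compat by blast
  ultimately obtain s where s: "s \<in> sections F U" "\<forall>V\<in>\<U>. Res F U V s = p V"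
    unfolding un by blast
  have "p V = t" if "P V t" for V t
  proof -
    have V: "V \<in> \<U>" using that by (auto simp: \<U>_def)
    show ?thesis
      using compat[OF p[OF V] that] P[OF that] P[OF p[OF V]]
        presheaf_Res_id[OF module_sheaf_presheaf[OF F]] by simp
  qed
  then show ?thesis using s by (intro bexI[of _ s]) (auto simp: \<U>_def)
qed

lemma
  assumes "additive_map_on U0 F G h" "open U" "U \<subseteq> U0"
  shows additive_map_closed: "s \<in> sections F U \<Longrightarrow> h U s \<in> sections G U"
    and additive_map_add: "s \<in> sections F U \<Longrightarrow> t \<in> sections F U \<Longrightarrow>
      h U (s \<oplus>\<^bsub>Sec F U\<^esub> t) = h U s \<oplus>\<^bsub>Sec G U\<^esub> h U t"
    and additive_map_Res: "open V \<Longrightarrow> V \<subseteq> U \<Longrightarrow> s \<in> sections F U \<Longrightarrow>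
      h V (Res F U V s) = Res G U V (h U s)"
  using assms unfolding additive_map_on_def by blast+

lemma additive_mapI:
  assumes "\<And>U s. open U \<Longrightarrow> U \<subseteq> U0 \<Longrightarrow> s \<in> sections F U \<Longrightarrow> h U s \<in> sections G U"
    and "\<And>U s t. open U \<Longrightarrow> U \<subseteq> U0 \<Longrightarrow> s \<in> sections F U \<Longrightarrow> t \<in> sections F U \<Longrightarrow>
      h U (s \<oplus>\<^bsub>Sec F U\<^esub> t) = h U s \<oplus>\<^bsub>Sec G U\<^esub> h U t"
    and "\<And>U V s. open U \<Longrightarrow> open V \<Longrightarrow> V \<subseteq> U \<Longrightarrow> U \<subseteq> U0 \<Longrightarrow> s \<in> sections F U \<Longrightarrow>
      h V (Res F U V s) = Res G U V (h U s)"
  shows "additive_map_on U0 F G h"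
  using assms unfolding additive_map_on_def by auto

lemma additive_map_mono: "additive_map_on U0 F G h \<Longrightarrow> U1 \<subseteq> U0 \<Longrightarrow> additive_map_on U1 F G h"
  unfolding additive_map_on_def by (meson order_trans)

lemma additive_map_zero:
  assumes "module_presheaf A F" "module_presheaf A G" "additive_map_on U0 F G h" "open U" "U \<subseteq> U0"
  shows "h U \<zero>\<^bsub>Sec F U\<^esub> = \<zero>\<^bsub>Sec G U\<^esub>"
proof -
  note z = presheaf_zero_closed[OF assms(1,4)]
  note h = additive_map_closed[OF assms(3-5) z]
  show ?thesis
    using presheaf_add_eq_selfD[OF assms(2,4) h h] additive_map_add[OF assms(3-5) z z]
      presheaf_zero_add[OF assms(1,4) z] by simp
qed

lemma additive_map_comp:
  assumes "additive_map_on U0 F G h" "additive_map_on U0 G H k"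
  shows "additive_map_on U0 F H (\<lambda>U s. k U (h U s))"
  by (rule additive_mapI)
    (auto simp: additive_map_closed[OF assms(1)] additive_map_closed[OF assms(2)]
      additive_map_add[OF assms(1)] additive_map_add[OF assms(2)]
      additive_map_Res[OF assms(1)] additive_map_Res[OF assms(2)] dest: subset_trans)

lemma sheaf_hom_additive: "sheaf_hom_on A U0 F G h \<Longrightarrow> additive_map_on U0 F G h"
  by (simp add: sheaf_hom_on_def)

lemma sheaf_hom_smult: "sheaf_hom_on A U0 F G h \<Longrightarrow> open U \<Longrightarrow> U \<subseteq> U0 \<Longrightarrow> f \<in> smooth_fun A U \<Longrightarrow>
    s \<in> sections F U \<Longrightarrow> h U (f \<odot>\<^bsub>Sec F U\<^esub> s) = f \<odot>\<^bsub>Sec G U\<^esub> h U s"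
  by (simp add: sheaf_hom_on_def)

lemma sheaf_hom_comp:
  assumes "sheaf_hom A F G h" "sheaf_hom A G H k"
  shows "sheaf_hom A F H (\<lambda>U s. k U (h U s))"
  using additive_map_comp[OF sheaf_hom_additive[OF assms(1)] sheaf_hom_additive[OF assms(2)]]
    additive_map_closed[OF sheaf_hom_additive[OF assms(1)]]
    sheaf_hom_smult[OF assms(1)] sheaf_hom_smult[OF assms(2)]
  by (simp add: sheaf_hom_on_def[of _ _ F H])

lemma sheaf_hom_id: "sheaf_hom A F F (\<lambda>U s. s)"
  by (auto simp: sheaf_hom_on_def additive_map_on_def)

section \<open>Germs and sheafification\<close>

lemma germ_mem_self: "module_presheaf A P \<Longrightarrow> open U \<Longrightarrow> x \<in> U \<Longrightarrow> s \<in> sections P U \<Longrightarrow> (U, s) \<in> germ P x U s"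
  unfolding germ_def by auto

text \<open>A germ is the set of all its representatives, so a single witness of agreement yields
  equality because agreement near \<open>x\<close> is transitive: two witnessing neighbourhoods are
  intersected and all restrictions are pushed down to the intersection.\<close>

lemma germ_eq_iff:
  assumes P: "module_presheaf A P" and U: "open U" "x \<in> U" "s \<in> sections P U"
    and V: "open V" "x \<in> V" "t \<in> sections P V"
  shows "germ P x U s = germ P x V t \<longleftrightarrow>
    (\<exists>W. open W \<and> x \<in> W \<and> W \<subseteq> U \<inter> V \<and> Res P U W s = Res P V W t)"
proof
  assume "germ P x U s = germ P x V t"
  then have "(V, t) \<in> germ P x U s" using germ_mem_self[OF P V] by simp
  then show "\<exists>W. open W \<and> x \<in> W \<and> W \<subseteq> U \<inter> V \<and> Res P U W s = Res P V W t"
    unfolding germ_def by auto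
next
  have sub: "germ P x U s \<subseteq> germ P x V t"
    if U: "open U" "x \<in> U" "s \<in> sections P U" and V: "open V" "x \<in> V" "t \<in> sections P V"
      and W: "open W" "x \<in> W" "W \<subseteq> U \<inter> V" "Res P U W s = Res P V W t" for U V W s t
  proof
    fix q assume "q \<in> germ P x U s"
    then obtain V' t' W' where q: "q = (V', t')" "open V'" "x \<in> V'" "t' \<in> sections P V'"
      and W': "open W'" "x \<in> W'" "W' \<subseteq> U \<inter> V'" "Res P U W' s = Res P V' W' t'"
      unfolding germ_def by auto
    have o: "open (W \<inter> W')" using W(1) W'(1) by (rule open_Int)
    have "Res P V (W \<inter> W') t = Res P W (W \<inter> W') (Res P V W t)"
      by (rule presheaf_Res_Res[OF P V(1) W(1) o _ _ V(3), symmetric]) (use W(3) in auto)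
    also have "\<dots> = Res P U (W \<inter> W') s"
      unfolding W(4)[symmetric] by (rule presheaf_Res_Res[OF P U(1) W(1) o _ _ U(3)]) (use W(3) in auto)
    also have "\<dots> = Res P W' (W \<inter> W') (Res P U W' s)"
      by (rule presheaf_Res_Res[OF P U(1) W'(1) o _ _ U(3), symmetric]) (use W'(3) in auto)
    also have "\<dots> = Res P V' (W \<inter> W') t'"
      unfolding W'(4) by (rule presheaf_Res_Res[OF P q(2) W'(1) o _ _ q(4)]) (use W'(3) in auto)
    finally show "q \<in> germ P x V t"
      unfolding germ_def q(1) using q(2-4) o W(2,3) W'(2,3)
      by (auto intro!: exI[of _ "W \<inter> W'"])
  qed
  assume "\<exists>W. open W \<and> x \<in> W \<and> W \<subseteq> U \<inter> V \<and> Res P U W s = Res P V W t"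
  then obtain W where W: "open W" "x \<in> W" "W \<subseteq> U \<inter> V" "Res P U W s = Res P V W t" by blast
  show "germ P x U s = germ P x V t"
    using sub[OF U V W] sub[OF V U W(1,2) _ W(4)[symmetric]] W(3) by blast
qed

lemma germ_Res:
  assumes P: "module_presheaf A P" and "open U" "open V" "V \<subseteq> U" "x \<in> V" "s \<in> sections P U"
  shows "germ P x V (Res P U V s) = germ P x U s"
  using assms presheaf_Res_closed[OF assms(1-4,6)]
  by (subst germ_eq_iff[OF P]) (auto intro!: exI[of _ V] simp: presheaf_Res_id[OF P])

lemma germ_mem_iff:
  "q \<in> germ P x U s \<longleftrightarrow> (\<exists>V t W. q = (V, t) \<and> open V \<and> x \<in> V \<and> t \<in> sections P V \<and>
     open W \<and> x \<in> W \<and> W \<subseteq> U \<and> W \<subseteq> V \<and> Res P U W s = Res P V W t)"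
  unfolding germ_def by auto

context smooth_mfd
begin

text \<open>Addition in the sheafification is a union over all pairs of representatives. All members
  of this union are the same germ and there is at least one, so it may be computed from two
  representatives over a common neighbourhood.\<close>

lemma germ_add_sections:
  assumes P: "module_presheaf A P" and V: "open V" "x \<in> V" "s \<in> sections P V" "t \<in> sections P V"
  shows "(\<Union>(V1, s1)\<in>germ P x V s. \<Union>(V2, s2)\<in>germ P x V t.
      germ P x (V1 \<inter> V2) (Res P V1 (V1 \<inter> V2) s1 \<oplus>\<^bsub>Sec P (V1 \<inter> V2)\<^esub> Res P V2 (V1 \<inter> V2) s2))
    = germ P x V (s \<oplus>\<^bsub>Sec P V\<^esub> t)"
proof -
  have "germ P x (V1 \<inter> V2) (Res P V1 (V1 \<inter> V2) s1 \<oplus>\<^bsub>Sec P (V1 \<inter> V2)\<^esub> Res P V2 (V1 \<inter> V2) s2)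
      = germ P x V (s \<oplus>\<^bsub>Sec P V\<^esub> t)"
    if q: "(V1, s1) \<in> germ P x V s" "(V2, s2) \<in> germ P x V t" for V1 V2 s1 s2
  proof -
    obtain W1 where 1: "open V1" "x \<in> V1" "s1 \<in> sections P V1" "open W1" "x \<in> W1" "W1 \<subseteq> V" "W1 \<subseteq> V1"
        "Res P V W1 s = Res P V1 W1 s1"
      using q(1) unfolding germ_mem_iff by auto
    obtain W2 where 2: "open V2" "x \<in> V2" "s2 \<in> sections P V2" "open W2" "x \<in> W2" "W2 \<subseteq> V" "W2 \<subseteq> V2"
        "Res P V W2 t = Res P V2 W2 s2"
      using q(2) unfolding germ_mem_iff by auto
    define W where "W = W1 \<inter> W2"
    have W: "open W" "x \<in> W" "W \<subseteq> W1" "W \<subseteq> W2" "W \<subseteq> V" "W \<subseteq> V1" "W \<subseteq> V2"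
      using 1 2 by (auto simp: W_def)
    have o: "open (V1 \<inter> V2)" using 1 2 by auto
    have e1: "Res P V W s = Res P V1 W s1"
      using 1 W presheaf_Res_Res[OF P V(1) 1(4) W(1) 1(6) W(3) V(3)]
        presheaf_Res_Res[OF P 1(1) 1(4) W(1) 1(7) W(3) 1(3)] by simp
    have e2: "Res P V W t = Res P V2 W s2"
      using 2 W presheaf_Res_Res[OF P V(1) 2(4) W(1) 2(6) W(4) V(4)]
        presheaf_Res_Res[OF P 2(1) 2(4) W(1) 2(7) W(4) 2(3)] by simp
    have r: "Res P V1 (V1 \<inter> V2) s1 \<in> sections P (V1 \<inter> V2)" "Res P V2 (V1 \<inter> V2) s2 \<in> sections P (V1 \<inter> V2)"
      using presheaf_Res_closed[OF P _ o] 1 2 by auto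
    have "Res P (V1 \<inter> V2) W (Res P V1 (V1 \<inter> V2) s1 \<oplus>\<^bsub>Sec P (V1 \<inter> V2)\<^esub> Res P V2 (V1 \<inter> V2) s2)
        = Res P V W (s \<oplus>\<^bsub>Sec P V\<^esub> t)"
      using W 1 2 o V r e1 e2 by (simp add: presheaf_Res_add[OF P] presheaf_Res_Res[OF P])
    then show ?thesis
      using W V o 1 2 presheaf_add_closed[OF P] r
      by (subst germ_eq_iff[OF P]) (auto intro!: exI[of _ W])
  qed
  moreover have "germ P x V s \<noteq> {}" "germ P x V t \<noteq> {}"
    using germ_mem_self[OF P V(1,2)] V(3,4) by blast+
  ultimately show ?thesis by (auto split: prod.splits) blast+
qed

lemma germ_smult_section:
  assumes P: "module_presheaf A P" and V: "open V" "x \<in> V" "s \<in> sections P V"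
    and U: "open U" "V \<subseteq> U" and f: "f \<in> smooth_fun A U"
  shows "(\<Union>(V1, s1)\<in>germ P x V s.
      germ P x (U \<inter> V1) (cut (U \<inter> V1) f \<odot>\<^bsub>Sec P (U \<inter> V1)\<^esub> Res P V1 (U \<inter> V1) s1))
    = germ P x V (cut V f \<odot>\<^bsub>Sec P V\<^esub> s)"
proof -
  have "germ P x (U \<inter> V1) (cut (U \<inter> V1) f \<odot>\<^bsub>Sec P (U \<inter> V1)\<^esub> Res P V1 (U \<inter> V1) s1)
      = germ P x V (cut V f \<odot>\<^bsub>Sec P V\<^esub> s)"
    if q: "(V1, s1) \<in> germ P x V s" for V1 s1
  proof -
    obtain W where 1: "open V1" "x \<in> V1" "s1 \<in> sections P V1" "open W" "x \<in> W" "W \<subseteq> V" "W \<subseteq> V1"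
        "Res P V W s = Res P V1 W s1"
      using q(1) unfolding germ_mem_iff by auto
    have o: "open (U \<inter> V1)" "W \<subseteq> U \<inter> V1" using 1 U by auto
    have r: "Res P V1 (U \<inter> V1) s1 \<in> sections P (U \<inter> V1)"
      using presheaf_Res_closed[OF P _ o(1)] 1 by auto
    have c: "cut (U \<inter> V1) f \<in> smooth_fun A (U \<inter> V1)" "cut V f \<in> smooth_fun A V"
      using smooth_fun_cut[OF f] o V U by auto
    have "Res P (U \<inter> V1) W (cut (U \<inter> V1) f \<odot>\<^bsub>Sec P (U \<inter> V1)\<^esub> Res P V1 (U \<inter> V1) s1)
        = Res P V W (cut V f \<odot>\<^bsub>Sec P V\<^esub> s)"
      using 1 o V r c by (simp add: presheaf_Res_smult[OF P] presheaf_Res_Res[OF P] cut_cut)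
    then show ?thesis
      using 1 V o U presheaf_smult_closed[OF P] r c
      by (subst germ_eq_iff[OF P]) (auto intro!: exI[of _ W])
  qed
  moreover have "germ P x V s \<noteq> {}"
    using germ_mem_self[OF P V] by blast
  ultimately show ?thesis by (auto split: prod.splits)
qed

end

text \<open>The canonical map from a presheaf to its sheafification. \<open>pure\<close> is its
  value at an elementary tensor, see \<open>pure_germs\<close>.\<close>

definition germs :: "('x::topological_space, 's) mod_sheaf \<Rightarrow> 'x set \<Rightarrow> 's \<Rightarrow> 'x \<Rightarrow> ('x set \<times> 's) set" where
  "germs P U s = (\<lambda>x. if x \<in> U then germ P x U s else {})"

lemma sheafify_section_iff:
  "\<sigma> \<in> sections (sheafify P) U \<longleftrightarrow> (\<forall>x. x \<notin> U \<longrightarrow> \<sigma> x = {}) \<and>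
     (\<forall>x\<in>U. \<exists>V s. open V \<and> x \<in> V \<and> V \<subseteq> U \<and> s \<in> sections P V \<and> (\<forall>y\<in>V. \<sigma> y = germ P y V s))"
  by (simp add: sheafify_def)

lemma sheafify_Res: "Res (sheafify P) U V \<sigma> = (\<lambda>x. if x \<in> V then \<sigma> x else {})"
  by (simp add: sheafify_def)

lemma sheafify_section_outside: "\<sigma> \<in> sections (sheafify P) U \<Longrightarrow> x \<notin> U \<Longrightarrow> \<sigma> x = {}"
  by (simp add: sheafify_section_iff)

lemma sheafify_section_local:
  assumes "\<sigma> \<in> sections (sheafify P) U" "x \<in> U"
  obtains V s where "open V" "x \<in> V" "V \<subseteq> U" "s \<in> sections P V" "Res (sheafify P) U V \<sigma> = germs P V s"
proof -
  obtain V s where V: "open V" "x \<in> V" "V \<subseteq> U" "s \<in> sections P V" "\<forall>y\<in>V. \<sigma> y = germ P y V s"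
    using assms unfolding sheafify_section_iff by blast
  then have "Res (sheafify P) U V \<sigma> = germs P V s"
    by (auto simp: sheafify_Res germs_def fun_eq_iff)
  then show thesis using that V by blast
qed

lemma Res_germs:
  assumes "module_presheaf A P" "open U" "open V" "V \<subseteq> U" "s \<in> sections P U"
  shows "Res (sheafify P) U V (germs P U s) = germs P V (Res P U V s)"
  using germ_Res[OF assms(1-4) _ assms(5)] assms(4) by (auto simp: sheafify_Res germs_def fun_eq_iff)

lemma germs_section: "open U \<Longrightarrow> s \<in> sections P U \<Longrightarrow> germs P U s \<in> sections (sheafify P) U"
  by (auto simp: sheafify_section_iff germs_def)

context smooth_mfd
begin

lemma sheafify_add_at:
  assumes "module_presheaf A P" "\<sigma> y = germ P y V s" "\<tau> y = germ P y V t"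
    "open V" "y \<in> V" "s \<in> sections P V" "t \<in> sections P V"
  shows "(\<sigma> \<oplus>\<^bsub>Sec (sheafify P) U\<^esub> \<tau>) y = germ P y V (s \<oplus>\<^bsub>Sec P V\<^esub> t)"
  using germ_add_sections[OF assms(1,4-7)] assms(2,3) by (simp add: sheafify_def)

lemma sheafify_smult_at:
  assumes "module_presheaf A P" "\<sigma> y = germ P y V s"
    "open V" "y \<in> V" "s \<in> sections P V" "open U" "V \<subseteq> U" "f \<in> smooth_fun A U"
  shows "(f \<odot>\<^bsub>Sec (sheafify P) U\<^esub> \<sigma>) y = germ P y V (cut V f \<odot>\<^bsub>Sec P V\<^esub> s)"
  using germ_smult_section[OF assms(1,3-8)] assms(2) by (simp add: sheafify_def)

lemma sheafify_zero_at:
  assumes "module_presheaf A P" "open V" "y \<in> V" "open U" "V \<subseteq> U"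
  shows "\<zero>\<^bsub>Sec (sheafify P) U\<^esub> y = germ P y V \<zero>\<^bsub>Sec P V\<^esub>"
  using germ_Res[OF assms(1,4,2,5,3) presheaf_zero_closed[OF assms(1,4)]]
    presheaf_Res_zero[OF assms(1,4,2,5)] assms by (auto simp: sheafify_def)

lemma sheafify_add_outside: "\<sigma> y = {} \<Longrightarrow> (\<sigma> \<oplus>\<^bsub>Sec (sheafify P) U\<^esub> \<tau>) y = {}"
  by (simp add: sheafify_def)

lemma sheafify_smult_outside: "\<sigma> y = {} \<Longrightarrow> (f \<odot>\<^bsub>Sec (sheafify P) U\<^esub> \<sigma>) y = {}"
  by (simp add: sheafify_def)

lemma sheafify_zero_outside: "y \<notin> U \<Longrightarrow> \<zero>\<^bsub>Sec (sheafify P) U\<^esub> y = {}"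
  by (simp add: sheafify_def)

text \<open>The module laws involve at most three sections. Common representatives near a point turn
  each law into the same law in the presheaf; sections are repeated in the use of this lemma where
  fewer occur.\<close>

lemma sheafify_local3:
  assumes P: "module_presheaf A P" and U: "open U"
    and "\<sigma> \<in> sections (sheafify P) U" "\<tau> \<in> sections (sheafify P) U" "\<rho> \<in> sections (sheafify P) U" "x \<in> U"
  obtains V s t r where "open V" "x \<in> V" "V \<subseteq> U" "s \<in> sections P V" "t \<in> sections P V" "r \<in> sections P V"
    "\<And>y. y \<in> V \<Longrightarrow> \<sigma> y = germ P y V s" "\<And>y. y \<in> V \<Longrightarrow> \<tau> y = germ P y V t" "\<And>y. y \<in> V \<Longrightarrow> \<rho> y = germ P y V r"
proof -
  obtain V1 s where 1: "open V1" "x \<in> V1" "V1 \<subseteq> U" "s \<in> sections P V1" "\<forall>y\<in>V1. \<sigma> y = germ P y V1 s"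
    using assms(3,6) unfolding sheafify_section_iff by metis
  obtain V2 t where 2: "open V2" "x \<in> V2" "V2 \<subseteq> U" "t \<in> sections P V2" "\<forall>y\<in>V2. \<tau> y = germ P y V2 t"
    using assms(4,6) unfolding sheafify_section_iff by metis
  obtain V3 r where 3: "open V3" "x \<in> V3" "V3 \<subseteq> U" "r \<in> sections P V3" "\<forall>y\<in>V3. \<rho> y = germ P y V3 r"
    using assms(5,6) unfolding sheafify_section_iff by metis
  define V where "V = V1 \<inter> V2 \<inter> V3"
  have V: "open V" "x \<in> V" "V \<subseteq> U" "V \<subseteq> V1" "V \<subseteq> V2" "V \<subseteq> V3" using 1 2 3 by (auto simp: V_def)
  show thesis
    by (rule that[of V "Res P V1 V s" "Res P V2 V t" "Res P V3 V r"])
      (use V 1 2 3 in \<open>auto simp: presheaf_Res_closed[OF P] germ_Res[OF P] subset_iff\<close>)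
qed

lemma sheafify_add_closed:
  assumes P: "module_presheaf A P" and U: "open U"
    and "\<sigma> \<in> sections (sheafify P) U" "\<tau> \<in> sections (sheafify P) U"
  shows "\<sigma> \<oplus>\<^bsub>Sec (sheafify P) U\<^esub> \<tau> \<in> sections (sheafify P) U"
  unfolding sheafify_section_iff
proof (intro conjI ballI allI impI)
  show "(\<sigma> \<oplus>\<^bsub>Sec (sheafify P) U\<^esub> \<tau>) x = {}" if "x \<notin> U" for x
    using sheafify_section_outside[OF assms(3) that] by (rule sheafify_add_outside)
  fix x assume "x \<in> U"
  from sheafify_local3[OF P U assms(3,4,4) this] obtain V s t where V: "open V" "x \<in> V" "V \<subseteq> U"
    "s \<in> sections P V" "t \<in> sections P V" "\<And>y. y \<in> V \<Longrightarrow> \<sigma> y = germ P y V s"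
    "\<And>y. y \<in> V \<Longrightarrow> \<tau> y = germ P y V t" by metis
  then show "\<exists>V s. open V \<and> x \<in> V \<and> V \<subseteq> U \<and> s \<in> sections P V \<and>
      (\<forall>y\<in>V. (\<sigma> \<oplus>\<^bsub>Sec (sheafify P) U\<^esub> \<tau>) y = germ P y V s)"
    by (intro exI[of _ V] exI[of _ "s \<oplus>\<^bsub>Sec P V\<^esub> t"])
      (auto simp: presheaf_add_closed[OF P] sheafify_add_at[OF P])
qed

lemma sheafify_smult_closed:
  assumes P: "module_presheaf A P" and U: "open U" and f: "f \<in> smooth_fun A U"
    and "\<sigma> \<in> sections (sheafify P) U"
  shows "f \<odot>\<^bsub>Sec (sheafify P) U\<^esub> \<sigma> \<in> sections (sheafify P) U"
  unfolding sheafify_section_iff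
proof (intro conjI ballI allI impI)
  show "(f \<odot>\<^bsub>Sec (sheafify P) U\<^esub> \<sigma>) x = {}" if "x \<notin> U" for x
    using sheafify_section_outside[OF assms(4) that] by (rule sheafify_smult_outside)
  fix x assume "x \<in> U"
  from sheafify_local3[OF P U assms(4,4,4) this] obtain V s where V: "open V" "x \<in> V" "V \<subseteq> U"
    "s \<in> sections P V" "\<And>y. y \<in> V \<Longrightarrow> \<sigma> y = germ P y V s" by metis
  then show "\<exists>V s. open V \<and> x \<in> V \<and> V \<subseteq> U \<and> s \<in> sections P V \<and>
      (\<forall>y\<in>V. (f \<odot>\<^bsub>Sec (sheafify P) U\<^esub> \<sigma>) y = germ P y V s)"
    by (intro exI[of _ V] exI[of _ "cut V f \<odot>\<^bsub>Sec P V\<^esub> s"])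
      (auto simp: presheaf_smult_closed[OF P] sheafify_smult_at[OF P _ _ _ _ U _ f] smooth_fun_cut[OF f])
qed

lemma sheafify_zero_section:
  "module_presheaf A P \<Longrightarrow> open U \<Longrightarrow> \<zero>\<^bsub>Sec (sheafify P) U\<^esub> \<in> sections (sheafify P) U"
  using germs_section[OF _ presheaf_zero_closed, of U A P] by (simp add: sheafify_def germs_def)

text \<open>Every law is an equality of functions on the manifold and is checked at one point.
  Inside \<open>U\<close> the stalk inherits it from the sections of \<open>P\<close> over a small
  neighbourhood; outside \<open>U\<close> both sides are the empty set.\<close>

lemma sheafify_module:
  assumes P: "module_presheaf A P" and U: "open U"
  shows "module (Cinf A U) (Sec (sheafify P) U)"
proof (rule moduleI[OF cring_Cinf[OF U]])
  let ?S = "Sec (sheafify P) U"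
  note rules = presheaf_closed[OF P] sheafify_section_outside sheafify_add_outside
    sheafify_smult_outside sheafify_zero_outside smooth_fun_cut
  note at_rules = sheafify_add_at[OF P] sheafify_smult_at[OF P]
    sheafify_zero_at[OF P]
  have C: "carrier (Cinf A U) = smooth_fun A U" "a \<oplus>\<^bsub>Cinf A U\<^esub> b = (\<lambda>x. a x + b x)"
    "a \<otimes>\<^bsub>Cinf A U\<^esub> b = (\<lambda>x. a x * b x)" "\<one>\<^bsub>Cinf A U\<^esub> = cut U (\<lambda>x. 1)" for a b
    by (simp_all add: Cinf_def)
  have cut_ops: "cut V (\<lambda>x. f x + g x) = (\<lambda>x. cut V f x + cut V g x)"
    "cut V (\<lambda>x. f x * g x) = (\<lambda>x. cut V f x * cut V g x)" for V f g by (auto simp: cut_def)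
  show "f \<odot>\<^bsub>?S\<^esub> \<sigma> \<in> carrier ?S" if "f \<in> carrier (Cinf A U)" "\<sigma> \<in> carrier ?S" for f \<sigma>
    using that by (simp add: C sheafify_smult_closed[OF P U])
  show "(f \<oplus>\<^bsub>Cinf A U\<^esub> g) \<odot>\<^bsub>?S\<^esub> \<sigma> = (f \<odot>\<^bsub>?S\<^esub> \<sigma>) \<oplus>\<^bsub>?S\<^esub> (g \<odot>\<^bsub>?S\<^esub> \<sigma>)"
    if "f \<in> carrier (Cinf A U)" "g \<in> carrier (Cinf A U)" "\<sigma> \<in> carrier ?S" for f g \<sigma>
  proof
    fix x
    have fg: "f \<in> smooth_fun A U" "g \<in> smooth_fun A U" "(\<lambda>x. f x + g x) \<in> smooth_fun A U"
      using that smooth_fun_add[OF U] by (auto simp: C)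
    show "((f \<oplus>\<^bsub>Cinf A U\<^esub> g) \<odot>\<^bsub>?S\<^esub> \<sigma>) x = ((f \<odot>\<^bsub>?S\<^esub> \<sigma>) \<oplus>\<^bsub>?S\<^esub> (g \<odot>\<^bsub>?S\<^esub> \<sigma>)) x"
    proof (cases "x \<in> U")
      case True
      from sheafify_local3[OF P U that(3,3,3) True] obtain V s where V: "open V" "x \<in> V" "V \<subseteq> U"
        "s \<in> sections P V" "\<sigma> x = germ P x V s" by metis
      then show ?thesis
        using fg by (simp add: C rules at_rules(1)[where V=V] at_rules(2)[where V=V] at_rules(3)[where V=V] U cut_ops presheaf_add_smult[OF P])
    qed (use that in \<open>simp add: rules\<close>)
  qed
  show "f \<odot>\<^bsub>?S\<^esub> (\<sigma> \<oplus>\<^bsub>?S\<^esub> \<tau>) = (f \<odot>\<^bsub>?S\<^esub> \<sigma>) \<oplus>\<^bsub>?S\<^esub> (f \<odot>\<^bsub>?S\<^esub> \<tau>)"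
    if "f \<in> carrier (Cinf A U)" "\<sigma> \<in> carrier ?S" "\<tau> \<in> carrier ?S" for f \<sigma> \<tau>
  proof
    fix x
    have fg: "f \<in> smooth_fun A U" using that by (auto simp: C)
    show "(f \<odot>\<^bsub>?S\<^esub> (\<sigma> \<oplus>\<^bsub>?S\<^esub> \<tau>)) x = ((f \<odot>\<^bsub>?S\<^esub> \<sigma>) \<oplus>\<^bsub>?S\<^esub> (f \<odot>\<^bsub>?S\<^esub> \<tau>)) x"
    proof (cases "x \<in> U")
      case True
      from sheafify_local3[OF P U that(2,3,3) True] obtain V s t where V: "open V" "x \<in> V" "V \<subseteq> U"
        "s \<in> sections P V" "t \<in> sections P V" "\<sigma> x = germ P x V s" "\<tau> x = germ P x V t" by metis
      then show ?thesis
        using fg by (simp add: rules at_rules(1)[where V=V] at_rules(2)[where V=V] at_rules(3)[where V=V] U presheaf_smult_add[OF P])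
    qed (use that in \<open>simp add: rules\<close>)
  qed
  show "(f \<otimes>\<^bsub>Cinf A U\<^esub> g) \<odot>\<^bsub>?S\<^esub> \<sigma> = f \<odot>\<^bsub>?S\<^esub> (g \<odot>\<^bsub>?S\<^esub> \<sigma>)"
    if "f \<in> carrier (Cinf A U)" "g \<in> carrier (Cinf A U)" "\<sigma> \<in> carrier ?S" for f g \<sigma>
  proof
    fix x
    have fg: "f \<in> smooth_fun A U" "g \<in> smooth_fun A U" "(\<lambda>x. f x * g x) \<in> smooth_fun A U"
      using that smooth_fun_mult[OF U] by (auto simp: C)
    show "((f \<otimes>\<^bsub>Cinf A U\<^esub> g) \<odot>\<^bsub>?S\<^esub> \<sigma>) x = (f \<odot>\<^bsub>?S\<^esub> (g \<odot>\<^bsub>?S\<^esub> \<sigma>)) x"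
    proof (cases "x \<in> U")
      case True
      from sheafify_local3[OF P U that(3,3,3) True] obtain V s where V: "open V" "x \<in> V" "V \<subseteq> U"
        "s \<in> sections P V" "\<sigma> x = germ P x V s" by metis
      then show ?thesis
        using fg by (simp add: C rules at_rules(1)[where V=V] at_rules(2)[where V=V] at_rules(3)[where V=V] U cut_ops presheaf_mult_smult[OF P])
    qed (use that in \<open>simp add: rules\<close>)
  qed
  show "\<one>\<^bsub>Cinf A U\<^esub> \<odot>\<^bsub>?S\<^esub> \<sigma> = \<sigma>" if "\<sigma> \<in> carrier ?S" for \<sigma>
  proof
    fix x
    show "(\<one>\<^bsub>Cinf A U\<^esub> \<odot>\<^bsub>?S\<^esub> \<sigma>) x = \<sigma> x"
    proof (cases "x \<in> U")
      case True
      from sheafify_local3[OF P U that that that True] obtain V s where V: "open V" "x \<in> V" "V \<subseteq> U"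
        "s \<in> sections P V" "\<sigma> x = germ P x V s" by metis
      then show ?thesis
        by (simp add: C rules at_rules(1)[where V=V] at_rules(2)[where V=V] at_rules(3)[where V=V] U smooth_fun_const[OF U] cut_cut presheaf_one_smult[OF P])
    qed (use that in \<open>simp add: rules\<close>)
  qed
  show "abelian_group ?S"
  proof (rule abelian_groupI)
    show "\<sigma> \<oplus>\<^bsub>?S\<^esub> \<tau> \<in> carrier ?S" if "\<sigma> \<in> carrier ?S" "\<tau> \<in> carrier ?S" for \<sigma> \<tau>
      using that by (rule sheafify_add_closed[OF P U])
    show "\<zero>\<^bsub>?S\<^esub> \<in> carrier ?S" by (rule sheafify_zero_section[OF P U])
    show "(\<sigma> \<oplus>\<^bsub>?S\<^esub> \<tau>) \<oplus>\<^bsub>?S\<^esub> \<rho> = \<sigma> \<oplus>\<^bsub>?S\<^esub> (\<tau> \<oplus>\<^bsub>?S\<^esub> \<rho>)"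
      if "\<sigma> \<in> carrier ?S" "\<tau> \<in> carrier ?S" "\<rho> \<in> carrier ?S" for \<sigma> \<tau> \<rho>
    proof
      fix x
      show "((\<sigma> \<oplus>\<^bsub>?S\<^esub> \<tau>) \<oplus>\<^bsub>?S\<^esub> \<rho>) x = (\<sigma> \<oplus>\<^bsub>?S\<^esub> (\<tau> \<oplus>\<^bsub>?S\<^esub> \<rho>)) x"
      proof (cases "x \<in> U")
        case True
        from sheafify_local3[OF P U that True] obtain V s t r where V: "open V" "x \<in> V" "V \<subseteq> U"
          "s \<in> sections P V" "t \<in> sections P V" "r \<in> sections P V"
          "\<sigma> x = germ P x V s" "\<tau> x = germ P x V t" "\<rho> x = germ P x V r" by metis
        then show ?thesis by (simp add: rules at_rules(1)[where V=V] at_rules(2)[where V=V] at_rules(3)[where V=V] U presheaf_add_assoc[OF P])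
      qed (use that in \<open>simp add: rules\<close>)
    qed
    show "\<sigma> \<oplus>\<^bsub>?S\<^esub> \<tau> = \<tau> \<oplus>\<^bsub>?S\<^esub> \<sigma>" if "\<sigma> \<in> carrier ?S" "\<tau> \<in> carrier ?S" for \<sigma> \<tau>
    proof
      fix x
      show "(\<sigma> \<oplus>\<^bsub>?S\<^esub> \<tau>) x = (\<tau> \<oplus>\<^bsub>?S\<^esub> \<sigma>) x"
      proof (cases "x \<in> U")
        case True
        from sheafify_local3[OF P U that(1,2,2) True] obtain V s t where V: "open V" "x \<in> V" "V \<subseteq> U"
          "s \<in> sections P V" "t \<in> sections P V" "\<sigma> x = germ P x V s" "\<tau> x = germ P x V t" by metis
        then show ?thesis using presheaf_add_comm[OF P V(1,4,5)] by (simp add: rules at_rules(1)[where V=V] at_rules(2)[where V=V] at_rules(3)[where V=V] U)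
      qed (use that in \<open>simp add: rules\<close>)
    qed
    show "\<zero>\<^bsub>?S\<^esub> \<oplus>\<^bsub>?S\<^esub> \<sigma> = \<sigma>" if "\<sigma> \<in> carrier ?S" for \<sigma>
    proof
      fix x
      show "(\<zero>\<^bsub>?S\<^esub> \<oplus>\<^bsub>?S\<^esub> \<sigma>) x = \<sigma> x"
      proof (cases "x \<in> U")
        case True
        from sheafify_local3[OF P U that that that True] obtain V s where V: "open V" "x \<in> V" "V \<subseteq> U"
          "s \<in> sections P V" "\<sigma> x = germ P x V s" by metis
        then show ?thesis by (simp add: rules at_rules(1)[where V=V] at_rules(2)[where V=V] at_rules(3)[where V=V] U presheaf_zero_add[OF P])
      qed (use that in \<open>simp add: rules\<close>)
    qed
    show "\<exists>\<tau>\<in>carrier ?S. \<tau> \<oplus>\<^bsub>?S\<^esub> \<sigma> = \<zero>\<^bsub>?S\<^esub>" if "\<sigma> \<in> carrier ?S" for \<sigma>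
    proof (rule bexI)
      note m = smooth_fun_const[OF U, of "-1"]
      \<comment> \<open>The additive inverse is the multiple by the constant -1, which is already
        known to be a section.\<close>
      show "cut U (\<lambda>x. -1) \<odot>\<^bsub>?S\<^esub> \<sigma> \<in> carrier ?S" using that by (rule sheafify_smult_closed[OF P U m])
      show "(cut U (\<lambda>x. -1) \<odot>\<^bsub>?S\<^esub> \<sigma>) \<oplus>\<^bsub>?S\<^esub> \<sigma> = \<zero>\<^bsub>?S\<^esub>"
      proof
        fix x
        show "((cut U (\<lambda>x. -1) \<odot>\<^bsub>?S\<^esub> \<sigma>) \<oplus>\<^bsub>?S\<^esub> \<sigma>) x = \<zero>\<^bsub>?S\<^esub> x"
        proof (cases "x \<in> U")
          case True
          from sheafify_local3[OF P U that that that True] obtain V s where V: "open V" "x \<in> V" "V \<subseteq> U"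
            "s \<in> sections P V" "\<sigma> x = germ P x V s" by metis
          have "(\<lambda>x. cut V (\<lambda>x. -1) x + cut V (\<lambda>x. 1) x) = (\<lambda>x. 0)" by (auto simp: cut_def)
          then have "(cut V (\<lambda>x. -1) \<odot>\<^bsub>Sec P V\<^esub> s) \<oplus>\<^bsub>Sec P V\<^esub> s = \<zero>\<^bsub>Sec P V\<^esub>"
            using presheaf_add_smult[OF P V(1) smooth_fun_const smooth_fun_const V(4), of "-1" 1] V
            by (simp add: presheaf_zero_smult[OF P] presheaf_one_smult[OF P])
          moreover have "(cut U (\<lambda>x. -1) \<odot>\<^bsub>?S\<^esub> \<sigma>) x = germ P x V (cut V (\<lambda>x. -1) \<odot>\<^bsub>Sec P V\<^esub> s)"
            using at_rules(2)[where \<sigma>=\<sigma> and y=x, OF V(5,1,2,4) U V(3) m] V by (simp add: cut_cut)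
          ultimately show ?thesis
            using at_rules(1)[where \<tau>=\<sigma> and y=x and \<sigma>="cut U (\<lambda>x. -1) \<odot>\<^bsub>?S\<^esub> \<sigma>", OF _ V(5,1,2) _ V(4)]
              presheaf_smult_closed[OF P V(1) smooth_fun_const[OF V(1)] V(4), of "-1"]
              at_rules(3)[OF V(1,2) U V(3)] by metis
        qed (use that in \<open>simp add: rules\<close>)
      qed
    qed
  qed
qed

lemma sheafify_Res_closed:
  assumes "module_presheaf A P" "open V" "V \<subseteq> U" "\<sigma> \<in> sections (sheafify P) U"
  shows "Res (sheafify P) U V \<sigma> \<in> sections (sheafify P) V"
  unfolding sheafify_section_iff
proof (intro conjI ballI allI impI)
  fix x assume x: "x \<in> V"
  then obtain W s where W: "open W" "x \<in> W" "W \<subseteq> U" "s \<in> sections P W" "\<forall>y\<in>W. \<sigma> y = germ P y W s"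
    using assms unfolding sheafify_section_iff by (metis subset_iff)
  then show "\<exists>W s. open W \<and> x \<in> W \<and> W \<subseteq> V \<and> s \<in> sections P W \<and>
      (\<forall>y\<in>W. Res (sheafify P) U V \<sigma> y = germ P y W s)"
  proof (intro exI[of _ "V \<inter> W"] exI[of _ "Res P W (V \<inter> W) s"] conjI ballI)
    have o: "open (V \<inter> W)" "V \<inter> W \<subseteq> W" using W assms by auto
    show "Res P W (V \<inter> W) s \<in> sections P (V \<inter> W)"
      by (rule presheaf_Res_closed[OF assms(1) W(1) o W(4)])
    show "Res (sheafify P) U V \<sigma> y = germ P y (V \<inter> W) (Res P W (V \<inter> W) s)" if "y \<in> V \<inter> W" for y
      using germ_Res[OF assms(1) W(1) o that W(4)] W(5) that by (simp add: sheafify_Res)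
  qed (use W x assms in auto)
qed (simp add: sheafify_Res)

lemma sheafify_presheaf:
  assumes P: "module_presheaf A P"
  shows "module_presheaf A (sheafify P)"
  unfolding module_presheaf_def
proof (intro conjI allI impI ballI)
  fix U V :: "'x set" assume "open U \<and> open V \<and> V \<subseteq> U"
  then have U: "open U" "open V" "V \<subseteq> U" by auto
  show "Res (sheafify P) U V \<sigma> \<in> sections (sheafify P) V" if "\<sigma> \<in> sections (sheafify P) U" for \<sigma>
    using sheafify_Res_closed[OF P U(2,3) that] .
  show "Res (sheafify P) U V (\<sigma> \<oplus>\<^bsub>Sec (sheafify P) U\<^esub> \<tau>)
      = Res (sheafify P) U V \<sigma> \<oplus>\<^bsub>Sec (sheafify P) V\<^esub> Res (sheafify P) U V \<tau>" for \<sigma> \<tau>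
    by (rule ext) (simp add: sheafify_def)
  show "Res (sheafify P) U V (f \<odot>\<^bsub>Sec (sheafify P) U\<^esub> \<sigma>)
      = cut V f \<odot>\<^bsub>Sec (sheafify P) V\<^esub> Res (sheafify P) U V \<sigma>"
    if f: "f \<in> smooth_fun A U" and s: "\<sigma> \<in> sections (sheafify P) U" for f \<sigma>
  proof
    fix x
    show "Res (sheafify P) U V (f \<odot>\<^bsub>Sec (sheafify P) U\<^esub> \<sigma>) x
      = (cut V f \<odot>\<^bsub>Sec (sheafify P) V\<^esub> Res (sheafify P) U V \<sigma>) x"
    proof (cases "x \<in> V")
      case True
      note c = sheafify_Res_closed[OF P U(2,3) s]
      from sheafify_local3[OF P U(2) c c c True] obtain W s where W: "open W" "x \<in> W" "W \<subseteq> V"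
        "s \<in> sections P W" "Res (sheafify P) U V \<sigma> x = germ P x W s" by metis
      moreover have "\<sigma> x = germ P x W s" using W(5) True by (simp add: sheafify_Res)
      ultimately show ?thesis
        using True U f smooth_fun_cut[OF f U(2,3)] W(3)
        by (simp add: sheafify_smult_at[OF P, of _ _ W s] cut_cut)
          (simp add: sheafify_Res sheafify_smult_at[OF P, of _ _ W s])
    qed (simp add: sheafify_Res sheafify_smult_outside)
  qed
next
  show "Res (sheafify P) U U \<sigma> = \<sigma>" if "\<sigma> \<in> sections (sheafify P) U" for U \<sigma>
    using sheafify_section_outside[OF that] by (auto simp: sheafify_Res fun_eq_iff)
  show "Res (sheafify P) V W (Res (sheafify P) U V \<sigma>) = Res (sheafify P) U W \<sigma>"
    if "open U \<and> open V \<and> open W \<and> V \<subseteq> U \<and> W \<subseteq> V" for U V W \<sigma>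
    using that by (auto simp: sheafify_Res fun_eq_iff)
qed (rule sheafify_module[OF P])

lemma sheafify_sheaf:
  assumes P: "module_presheaf A P"
  shows "module_sheaf A (sheafify P)"
  unfolding module_sheaf_def
proof (intro conjI allI impI ballI sheafify_presheaf[OF P])
  fix \<U> :: "'x set set" assume op: "\<forall>U\<in>\<U>. open U"
  {
    fix \<sigma> \<tau> assume st: "\<sigma> \<in> sections (sheafify P) (\<Union>\<U>)" "\<tau> \<in> sections (sheafify P) (\<Union>\<U>)"
      and eq: "\<forall>U\<in>\<U>. Res (sheafify P) (\<Union>\<U>) U \<sigma> = Res (sheafify P) (\<Union>\<U>) U \<tau>"
    show "\<sigma> = \<tau>"
    proof
      fix x
      show "\<sigma> x = \<tau> x"
      proof (cases "x \<in> \<Union>\<U>")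
        case True
        then obtain U where U: "U \<in> \<U>" "x \<in> U" by blast
        then show ?thesis using fun_cong[OF eq[rule_format, OF U(1)], of x] by (simp add: sheafify_Res)
      qed (use sheafify_section_outside[OF st(1)] sheafify_section_outside[OF st(2)] in metis)
    qed
  }
  fix p assume "(\<forall>U\<in>\<U>. p U \<in> sections (sheafify P) U) \<and>
    (\<forall>U\<in>\<U>. \<forall>V\<in>\<U>. Res (sheafify P) U (U \<inter> V) (p U) = Res (sheafify P) V (U \<inter> V) (p V))"
  then have p: "\<And>U. U \<in> \<U> \<Longrightarrow> p U \<in> sections (sheafify P) U"
    and "\<And>U V. U \<in> \<U> \<Longrightarrow> V \<in> \<U> \<Longrightarrow> Res (sheafify P) U (U \<inter> V) (p U) = Res (sheafify P) V (U \<inter> V) (p V)"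
    by blast+
  then have eq: "p U x = p V x" if "U \<in> \<U>" "V \<in> \<U>" "x \<in> U" "x \<in> V" for U V x
    using that unfolding sheafify_Res by (metis IntI)
  \<comment> \<open>At \<open>x\<close> any member of the cover that contains \<open>x\<close> may
    be used: by \<open>eq\<close> the given sections have equal values on overlaps.\<close>
  define \<sigma> where "\<sigma> = (\<lambda>x. if x \<in> \<Union>\<U> then p (SOME U. U \<in> \<U> \<and> x \<in> U) x else {})"
  have \<sigma>: "\<sigma> x = p U x" if "U \<in> \<U>" "x \<in> U" for U x
  proof -
    have "(SOME U. U \<in> \<U> \<and> x \<in> U) \<in> \<U> \<and> x \<in> (SOME U. U \<in> \<U> \<and> x \<in> U)"
      using that by (intro someI[of "\<lambda>U. U \<in> \<U> \<and> x \<in> U" U]) auto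
    then have "p (SOME U. U \<in> \<U> \<and> x \<in> U) x = p U x" by (intro eq that) auto
    moreover have "x \<in> \<Union>\<U>" using that by blast
    ultimately show ?thesis by (simp only: \<sigma>_def if_True)
  qed
  show "\<exists>\<sigma>\<in>sections (sheafify P) (\<Union>\<U>). \<forall>U\<in>\<U>. Res (sheafify P) (\<Union>\<U>) U \<sigma> = p U"
  proof (rule bexI[of _ \<sigma>])
    show "\<forall>U\<in>\<U>. Res (sheafify P) (\<Union>\<U>) U \<sigma> = p U"
      using \<sigma> sheafify_section_outside[OF p] by (auto simp: sheafify_Res fun_eq_iff)
    show "\<sigma> \<in> sections (sheafify P) (\<Union>\<U>)"
      unfolding sheafify_section_iff
    proof (intro conjI ballI allI impI)
      fix x assume "x \<in> \<Union>\<U>"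
      then obtain U where U: "U \<in> \<U>" "x \<in> U" by blast
      from p[OF U(1)] U(2) obtain V s where "open V" "x \<in> V" "V \<subseteq> U" "s \<in> sections P V"
        "\<forall>y\<in>V. p U y = germ P y V s" unfolding sheafify_section_iff by metis
      then show "\<exists>V s. open V \<and> x \<in> V \<and> V \<subseteq> \<Union>\<U> \<and> s \<in> sections P V \<and> (\<forall>y\<in>V. \<sigma> y = germ P y V s)"
        using \<sigma>[OF U(1)] U(1) by (intro exI[of _ V] exI[of _ s]) (auto simp: subset_iff)
    qed (simp add: \<sigma>_def)
  qed
qed

lemma germs_add:
  assumes "module_presheaf A P" "open U" "s \<in> sections P U" "t \<in> sections P U"
  shows "germs P U s \<oplus>\<^bsub>Sec (sheafify P) U\<^esub> germs P U t = germs P U (s \<oplus>\<^bsub>Sec P U\<^esub> t)"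
proof
  fix x
  show "(germs P U s \<oplus>\<^bsub>Sec (sheafify P) U\<^esub> germs P U t) x = germs P U (s \<oplus>\<^bsub>Sec P U\<^esub> t) x"
    using sheafify_add_at[OF assms(1) _ _ assms(2) _ assms(3,4), of "germs P U s" x "germs P U t" U]
    by (cases "x \<in> U") (simp_all add: germs_def sheafify_add_outside)
qed

lemma germs_smult:
  assumes "module_presheaf A P" "open U" "s \<in> sections P U" "f \<in> smooth_fun A U"
  shows "f \<odot>\<^bsub>Sec (sheafify P) U\<^esub> germs P U s = germs P U (f \<odot>\<^bsub>Sec P U\<^esub> s)"
proof
  fix x
  have "cut U f = f" using smooth_funD(1)[OF assms(4)] by (auto simp: cut_def)
  then show "(f \<odot>\<^bsub>Sec (sheafify P) U\<^esub> germs P U s) x = germs P U (f \<odot>\<^bsub>Sec P U\<^esub> s) x"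
    using sheafify_smult_at[OF assms(1) _ assms(2) _ assms(3) assms(2) order_refl assms(4), of "germs P U s" x]
    by (cases "x \<in> U") (simp_all add: germs_def sheafify_smult_outside)
qed

lemma germs_eq_local:
  assumes P: "module_presheaf A P" and U: "open U" and s: "s \<in> sections P U" "t \<in> sections P U"
    and eq: "germs P U s = germs P U t" and x: "x \<in> U"
  obtains W where "open W" "x \<in> W" "W \<subseteq> U" "Res P U W s = Res P U W t"
  using fun_cong[OF eq, of x] x unfolding germs_def
  by (simp add: germ_eq_iff[OF P U x s(1) U x s(2)]) blast

text \<open>The universal property is relative to an open subspace \<open>U0\<close>: this allows maps that depend on
  a section over \<open>U0\<close>.\<close>

lemma sheafify_lift:
  assumes P: "module_presheaf A P" and H: "module_sheaf A H" and h0: "additive_map_on U0 P H h0"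
  shows "\<exists>h. additive_map_on U0 (sheafify P) H h \<and>
    (\<forall>U. open U \<and> U \<subseteq> U0 \<longrightarrow> (\<forall>s\<in>sections P U. h U (germs P U s) = h0 U s))"
proof -
  note Hp = module_sheaf_presheaf[OF H]
  \<comment> \<open>A local value \<open>t\<close> of the lift is prescribed wherever \<sigma> comes
    from a presheaf section \<open>p\<close>. Since \<open>p\<close> is not unique, this is a
    relation, and \<open>sheaf_glue\<close> assembles the values.\<close>
  define rel where "rel = (\<lambda>U \<sigma> V t. open V \<and> V \<subseteq> U \<and>
    (\<exists>p\<in>sections P V. Res (sheafify P) U V \<sigma> = germs P V p \<and> t = h0 V p))"
  define h where "h = (\<lambda>U \<sigma>. SOME s. s \<in> sections H U \<and> (\<forall>V t. rel U \<sigma> V t \<longrightarrow> Res H U V s = t))"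
  have h: "h U \<sigma> \<in> sections H U \<and> (\<forall>V t. rel U \<sigma> V t \<longrightarrow> Res H U V (h U \<sigma>) = t)"
    if U: "open U" "U \<subseteq> U0" and s: "\<sigma> \<in> sections (sheafify P) U" for U \<sigma>
  proof -
    have "\<exists>s\<in>sections H U. \<forall>V t. rel U \<sigma> V t \<longrightarrow> Res H U V s = t"
    proof (rule sheaf_glue[OF H U(1)])
      show "open V \<and> V \<subseteq> U \<and> t \<in> sections H V" if "rel U \<sigma> V t" for V t
        using that U additive_map_closed[OF h0] unfolding rel_def by blast
      show "\<exists>V s. x \<in> V \<and> rel U \<sigma> V s" if "x \<in> U" for x
        using sheafify_section_local[OF s that] unfolding rel_def by metis
      fix V W t r assume "rel U \<sigma> V t" "rel U \<sigma> W r"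
      then obtain p q where V: "open V" "V \<subseteq> U" "p \<in> sections P V" "Res (sheafify P) U V \<sigma> = germs P V p" "t = h0 V p"
        and W: "open W" "W \<subseteq> U" "q \<in> sections P W" "Res (sheafify P) U W \<sigma> = germs P W q" "r = h0 W q"
        unfolding rel_def by blast
      define N where "N = V \<inter> W"
      have N: "open N" "N \<subseteq> V" "N \<subseteq> W" "N \<subseteq> U" "N \<subseteq> U0" using V W U by (auto simp: N_def)
      define p' q' where "p' = Res P V N p" and "q' = Res P W N q"
      have pq: "p' \<in> sections P N" "q' \<in> sections P N"
        using V W N presheaf_Res_closed[OF P] by (auto simp: p'_def q'_def)
      have "germs P N p' = Res (sheafify P) U N \<sigma>"
        unfolding p'_def Res_germs[OF P V(1) N(1,2) V(3), symmetric] V(4)[symmetric]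
        using presheaf_Res_Res[OF sheafify_presheaf[OF P] U(1) V(1) N(1) V(2) N(2) s] .
      moreover have "germs P N q' = Res (sheafify P) U N \<sigma>"
        unfolding q'_def Res_germs[OF P W(1) N(1,3) W(3), symmetric] W(4)[symmetric]
        using presheaf_Res_Res[OF sheafify_presheaf[OF P] U(1) W(1) N(1) W(2) N(3) s] .
      ultimately have g: "germs P N p' = germs P N q'" by simp
      \<comment> \<open>Equal germs make \<open>p'\<close> and \<open>q'\<close> agree near each
        point only, not over \<open>N\<close>. Their images do agree over \<open>N\<close>, because
        the target is separated.\<close>
      have "h0 N p' = h0 N q'"
      proof (rule sheaf_eqI[OF H N(1)])
        show "h0 N p' \<in> sections H N" "h0 N q' \<in> sections H N"
          using additive_map_closed[OF h0 N(1,5)] pq by auto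
        fix x assume "x \<in> N"
        from germs_eq_local[OF P N(1) pq g this] obtain W' where W': "open W'" "x \<in> W'" "W' \<subseteq> N"
          "Res P N W' p' = Res P N W' q'" by metis
        have "Res H N W' (h0 N p') = Res H N W' (h0 N q')"
          unfolding additive_map_Res[OF h0 N(1,5) W'(1,3) pq(1), symmetric]
            additive_map_Res[OF h0 N(1,5) W'(1,3) pq(2), symmetric] W'(4) ..
        then show "\<exists>V. open V \<and> x \<in> V \<and> V \<subseteq> N \<and> Res H N V (h0 N p') = Res H N V (h0 N q')"
          using W' by blast
      qed
      moreover have "h0 N p' = Res H V N (h0 V p)"
        unfolding p'_def by (rule additive_map_Res[OF h0 V(1) _ N(1,2) V(3)]) (use V U in auto)
      moreover have "h0 N q' = Res H W N (h0 W q)"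
        unfolding q'_def by (rule additive_map_Res[OF h0 W(1) _ N(1,3) W(3)]) (use W U in auto)
      ultimately show "Res H V (V \<inter> W) t = Res H W (V \<inter> W) r" by (simp add: V(5) W(5) N_def)
    qed
    then show ?thesis unfolding h_def by (rule bexE) (rule someI, blast)
  qed
  have hl: "Res H U V (h U \<sigma>) = h0 V p" if "open U" "U \<subseteq> U0" "\<sigma> \<in> sections (sheafify P) U"
    "open V" "V \<subseteq> U" "p \<in> sections P V" "\<And>y. y \<in> V \<Longrightarrow> \<sigma> y = germ P y V p" for U V \<sigma> p
  proof -
    have "Res (sheafify P) U V \<sigma> = germs P V p"
      using that(7) by (auto simp: sheafify_Res germs_def fun_eq_iff)
    then show ?thesis using h[OF that(1-3)] that(4-6) unfolding rel_def by blast
  qed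
  have "additive_map_on U0 (sheafify P) H h"
  proof (rule additive_mapI)
    fix U \<sigma> assume U: "open U" "U \<subseteq> U0" and s: "\<sigma> \<in> sections (sheafify P) U"
    show "h U \<sigma> \<in> sections H U" using h[OF U s] ..
    {
      fix \<tau> assume t: "\<tau> \<in> sections (sheafify P) U"
      note st = sheafify_add_closed[OF P U(1) s t]
      show "h U (\<sigma> \<oplus>\<^bsub>Sec (sheafify P) U\<^esub> \<tau>) = h U \<sigma> \<oplus>\<^bsub>Sec H U\<^esub> h U \<tau>"
      proof (rule sheaf_eqI[OF H U(1)])
        show "h U (\<sigma> \<oplus>\<^bsub>Sec (sheafify P) U\<^esub> \<tau>) \<in> sections H U" using h[OF U st] ..
        show "h U \<sigma> \<oplus>\<^bsub>Sec H U\<^esub> h U \<tau> \<in> sections H U"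
          using h[OF U s] h[OF U t] presheaf_add_closed[OF Hp U(1)] by simp
        fix x assume "x \<in> U"
        from sheafify_local3[OF P U(1) s t t this] obtain V p q where V: "open V" "x \<in> V" "V \<subseteq> U"
          "p \<in> sections P V" "q \<in> sections P V" "\<And>y. y \<in> V \<Longrightarrow> \<sigma> y = germ P y V p"
          "\<And>y. y \<in> V \<Longrightarrow> \<tau> y = germ P y V q" by metis
        have "Res H U V (h U (\<sigma> \<oplus>\<^bsub>Sec (sheafify P) U\<^esub> \<tau>)) = h0 V (p \<oplus>\<^bsub>Sec P V\<^esub> q)"
          using V by (intro hl[OF U st]) (auto simp: sheafify_add_at[OF P] presheaf_add_closed[OF P])
        also have "\<dots> = Res H U V (h U \<sigma>) \<oplus>\<^bsub>Sec H V\<^esub> Res H U V (h U \<tau>)"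
          using hl[OF U s V(1,3,4,6)] hl[OF U t V(1,3,5,7)] additive_map_add[OF h0 V(1) _ V(4,5)] V U by auto
        also have "\<dots> = Res H U V (h U \<sigma> \<oplus>\<^bsub>Sec H U\<^esub> h U \<tau>)"
          using h[OF U s] h[OF U t] presheaf_Res_add[OF Hp U(1) V(1,3)] by simp
        finally show "\<exists>V. open V \<and> x \<in> V \<and> V \<subseteq> U \<and>
            Res H U V (h U (\<sigma> \<oplus>\<^bsub>Sec (sheafify P) U\<^esub> \<tau>)) = Res H U V (h U \<sigma> \<oplus>\<^bsub>Sec H U\<^esub> h U \<tau>)"
          using V by blast
      qed
    }
    fix V assume V: "open V" "V \<subseteq> U"
    note r = sheafify_Res_closed[OF P V s]
    have V0: "V \<subseteq> U0" using V U by auto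
    show "h V (Res (sheafify P) U V \<sigma>) = Res H U V (h U \<sigma>)"
    proof (rule sheaf_eqI[OF H V(1)])
      show "h V (Res (sheafify P) U V \<sigma>) \<in> sections H V" using h[OF V(1) V0 r] ..
      show "Res H U V (h U \<sigma>) \<in> sections H V"
        using h[OF U s] presheaf_Res_closed[OF Hp U(1) V] by simp
      fix x assume "x \<in> V"
      from sheafify_local3[OF P V(1) r r r this] obtain W p where W: "open W" "x \<in> W" "W \<subseteq> V"
        "p \<in> sections P W" "\<And>y. y \<in> W \<Longrightarrow> Res (sheafify P) U V \<sigma> y = germ P y W p" by metis
      have "\<sigma> y = germ P y W p" if "y \<in> W" for y
        using W(5)[OF that] W(3) that by (auto simp: sheafify_Res split: if_splits)
      then have "Res H U W (h U \<sigma>) = h0 W p" using W V by (intro hl[OF U s]) auto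
      moreover have "Res H V W (Res H U V (h U \<sigma>)) = Res H U W (h U \<sigma>)"
        using h[OF U s] presheaf_Res_Res[OF Hp U(1) V(1) W(1) V(2) W(3)] by simp
      ultimately show "\<exists>W. open W \<and> x \<in> W \<and> W \<subseteq> V \<and>
          Res H V W (h V (Res (sheafify P) U V \<sigma>)) = Res H V W (Res H U V (h U \<sigma>))"
        using hl[OF V(1) V0 r W(1,3,4,5)] W by auto
    qed
  qed
  moreover have "h U (germs P U s) = h0 U s" if "open U" "U \<subseteq> U0" "s \<in> sections P U" for U s
  proof -
    note g = germs_section[OF that(1,3)]
    have "Res H U U (h U (germs P U s)) = h0 U s"
      by (rule hl[OF that(1,2) g that(1) order_refl that(3)]) (simp add: germs_def)
    then show ?thesis using h[OF that(1,2) g] presheaf_Res_id[OF Hp that(1)] by simp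
  qed
  ultimately show ?thesis by blast
qed

end

section \<open>Tensor products of modules\<close>

lemma mult_tensor_free [simp]: "c \<otimes>\<^bsub>tensor_free M N\<^esub> d = c + d"
  by (simp add: tensor_free_def)

lemma tensor_coset_conv: "tensor_coset R M N c = (\<lambda>h. h + c) ` tensor_relations R M N"
  by (auto simp: tensor_coset_def r_coset_def)

locale module_pair = M: Module.module R M + N: Module.module R N
  for R :: "'r ring" and M :: "('r, 's) module" and N :: "('r, 't) module"
begin

abbreviation "rel \<equiv> tensor_relations R M N"
abbreviation "coset \<equiv> tensor_coset R M N"
abbreviation "T \<equiv> tensor_module R M N"
abbreviation "S \<equiv> carrier M \<times> carrier N"

definition gens :: "(('s \<times> 't) \<Rightarrow>\<^sub>0 int) set" where
  "gens = {frag_of (x \<oplus>\<^bsub>M\<^esub> x', y) - frag_of (x, y) - frag_of (x', y) | x x' y.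
         x \<in> carrier M \<and> x' \<in> carrier M \<and> y \<in> carrier N} \<union>
      {frag_of (x, y \<oplus>\<^bsub>N\<^esub> y') - frag_of (x, y) - frag_of (x, y') | x y y'.
         x \<in> carrier M \<and> y \<in> carrier N \<and> y' \<in> carrier N} \<union>
      {frag_of (r \<odot>\<^bsub>M\<^esub> x, y) - frag_of (x, r \<odot>\<^bsub>N\<^esub> y) | r x y.
         r \<in> carrier R \<and> x \<in> carrier M \<and> y \<in> carrier N}"

lemma rel_generate: "rel = generate (tensor_free M N) gens"
  by (simp add: tensor_relations_def gens_def)

lemma keys_diff_frag_of:
  "Poly_Mapping.keys c \<subseteq> Z \<Longrightarrow> b \<in> Z \<Longrightarrow> Poly_Mapping.keys (c - frag_of b) \<subseteq> Z"
  using keys_diff[of c "frag_of b"] by (auto simp: keys_frag_of)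

lemma gens_cases [consumes 1, case_names left right balanced]:
  assumes "g \<in> gens"
  obtains (left) x x' y where "x \<in> carrier M" "x' \<in> carrier M" "y \<in> carrier N"
      "g = frag_of (x \<oplus>\<^bsub>M\<^esub> x', y) - frag_of (x, y) - frag_of (x', y)"
    | (right) x y y' where "x \<in> carrier M" "y \<in> carrier N" "y' \<in> carrier N"
      "g = frag_of (x, y \<oplus>\<^bsub>N\<^esub> y') - frag_of (x, y) - frag_of (x, y')"
    | (balanced) r x y where "r \<in> carrier R" "x \<in> carrier M" "y \<in> carrier N"
      "g = frag_of (r \<odot>\<^bsub>M\<^esub> x, y) - frag_of (x, r \<odot>\<^bsub>N\<^esub> y)"
  using assms unfolding gens_def
  by (elim UnE CollectE exE conjE)
    (rule that(1), assumption+ | rule that(2), assumption+ | rule that(3), assumption+)+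

lemma gens_keys: "g \<in> gens \<Longrightarrow> Poly_Mapping.keys g \<subseteq> S"
  by (induction rule: gens_cases) (simp_all only:, (intro keys_diff_frag_of; simp add: keys_frag_of)+)

text \<open>The inverse in the free abelian group is the negative for elements supported on
  \<open>carrier M \<times> carrier N\<close>. The supports of the generators are therefore needed
  to read the inverse case as a negative.\<close>

lemma rel_induct [consumes 1, case_names zero gen add minus]:
  assumes "c \<in> rel" "P 0" "\<And>g. g \<in> gens \<Longrightarrow> P g" "\<And>a b. P a \<Longrightarrow> P b \<Longrightarrow> P (a + b)" "\<And>a. P a \<Longrightarrow> P (- a)"
  shows "P c"
  using assms(1) unfolding rel_generate
proof (induction rule: generate.induct)
  case (inv h)
  then show ?case using gens_keys assms(3,5) by (simp add: tensor_free_def)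
qed (use assms in \<open>auto simp: tensor_free_def\<close>)

lemma rel_gen: "g \<in> gens \<Longrightarrow> g \<in> rel"
  unfolding rel_generate by (rule generate.incl)

lemma rel_zero: "0 \<in> rel"
  using generate.one[of "tensor_free M N" gens] by (simp add: rel_generate tensor_free_def)

lemma rel_add: "a \<in> rel \<Longrightarrow> b \<in> rel \<Longrightarrow> a + b \<in> rel"
  using generate.eng[of a "tensor_free M N" gens b] by (simp add: rel_generate)

lemma rel_minus:
  assumes "a \<in> rel" shows "- a \<in> rel"
proof -
  \<comment> \<open>\<open>generate\<close> contains inverses of generators only. The claim is made
    symmetric under negation so that it passes through all cases of the induction.\<close>
  have "a \<in> rel \<and> - a \<in> rel" using assms
  proof (induction rule: rel_induct)
    case (gen g)
    then show ?case
      using generate.inv[of g gens "tensor_free M N"] gens_keys[OF gen] rel_gen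
      by (simp add: rel_generate tensor_free_def)
  next
    case (add a b)
    then show ?case using rel_add[of "-a" "-b"] rel_add by (simp add: add.commute)
  qed (simp_all add: rel_zero)
  then show ?thesis ..
qed

lemma rel_diff: "a \<in> rel \<Longrightarrow> b \<in> rel \<Longrightarrow> a - b \<in> rel"
  using rel_add[OF _ rel_minus] by fastforce

lemma coset_eq_iff: "coset c = coset d \<longleftrightarrow> c - d \<in> rel"
proof
  assume "coset c = coset d"
  then have "0 + c \<in> coset d" using rel_zero unfolding tensor_coset_conv by blast
  then show "c - d \<in> rel" by (auto simp: tensor_coset_conv)
next
  have "coset c \<subseteq> coset d" if "c - d \<in> rel" for c d
  proof
    fix z assume "z \<in> coset c"
    then obtain h where "h \<in> rel" "z = (h + (c - d)) + d" by (auto simp: tensor_coset_conv)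
    then show "z \<in> coset d" using rel_add[OF _ that] unfolding tensor_coset_conv by blast
  qed
  moreover assume "c - d \<in> rel"
  moreover from this have "d - c \<in> rel" using rel_minus by fastforce
  ultimately show "coset c = coset d" by blast
qed

lemma coset_gens:
  "x \<in> carrier M \<Longrightarrow> x' \<in> carrier M \<Longrightarrow> y \<in> carrier N \<Longrightarrow>
    frag_of (x \<oplus>\<^bsub>M\<^esub> x', y) - frag_of (x, y) - frag_of (x', y) \<in> gens"
  "x \<in> carrier M \<Longrightarrow> y \<in> carrier N \<Longrightarrow> y' \<in> carrier N \<Longrightarrow>
    frag_of (x, y \<oplus>\<^bsub>N\<^esub> y') - frag_of (x, y) - frag_of (x, y') \<in> gens"
  "r \<in> carrier R \<Longrightarrow> x \<in> carrier M \<Longrightarrow> y \<in> carrier N \<Longrightarrow>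
    frag_of (r \<odot>\<^bsub>M\<^esub> x, y) - frag_of (x, r \<odot>\<^bsub>N\<^esub> y) \<in> gens"
  unfolding gens_def by blast+

text \<open>A map of formal sums descends to the quotients as soon as it sends generating relations
  to relations. Scalar multiplication and restriction of tensors are both obtained in this
  way.\<close>

lemma frag_extend_rel:
  assumes "\<And>g. g \<in> gens \<Longrightarrow> frag_extend \<phi> g \<in> tensor_relations R' M' N'"
    and "module_pair R' M' N'" and "c \<in> rel"
  shows "frag_extend \<phi> c \<in> tensor_relations R' M' N'"
  using assms(3)
  by (induction rule: rel_induct)
    (auto simp: assms(1) frag_extend_add frag_extend_minus module_pair.rel_zero[OF assms(2)]
      module_pair.rel_add[OF assms(2)] module_pair.rel_minus[OF assms(2)])

lemma coset_carrier_iff: "C \<in> carrier T \<longleftrightarrow> (\<exists>c. Poly_Mapping.keys c \<subseteq> S \<and> C = coset c)"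
proof -
  have "carrier T = (\<Union>c\<in>{c. Poly_Mapping.keys c \<subseteq> S}. {coset c})"
    unfolding tensor_module_def Let_def FactGroup_def RCOSETS_def tensor_coset_def tensor_free_def
      free_Abelian_group_def by simp
  then show ?thesis by simp
qed

lemma coset_closed: "Poly_Mapping.keys c \<subseteq> S \<Longrightarrow> coset c \<in> carrier T"
  by (auto simp: coset_carrier_iff)

lemma coset_add: "coset c \<oplus>\<^bsub>T\<^esub> coset d = coset (c + d)"
proof -
  have "coset c \<oplus>\<^bsub>T\<^esub> coset d = {h + k | h k. h \<in> coset c \<and> k \<in> coset d}"
    by (auto simp: tensor_module_def Let_def FactGroup_def set_mult_def)
  also have "\<dots> = coset (c + d)"
  proof (intro Set.set_eqI iffI)
    fix z assume "z \<in> {h + k | h k. h \<in> coset c \<and> k \<in> coset d}"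
    then obtain a b where "a \<in> rel" "b \<in> rel" "z = (a + c) + (b + d)"
      by (auto simp: tensor_coset_conv)
    then show "z \<in> coset (c + d)"
      using rel_add[of a b] by (auto simp: tensor_coset_conv image_iff add_ac intro!: bexI[of _ "a + b"])
  next
    fix z assume "z \<in> coset (c + d)"
    then obtain a where "a \<in> rel" "z = a + (c + d)" by (auto simp: tensor_coset_conv)
    then have "z = (a + c) + (0 + d)" "a + c \<in> coset c" "0 + d \<in> coset d"
      using rel_zero by (auto simp: tensor_coset_conv add_ac)
    then show "z \<in> {h + k | h k. h \<in> coset c \<and> k \<in> coset d}" by blast
  qed
  finally show ?thesis .
qed

lemma coset_zero: "\<zero>\<^bsub>T\<^esub> = coset 0"
  by (simp add: tensor_module_def Let_def FactGroup_def tensor_coset_conv)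

text \<open>Operations on tensors are defined as unions over the representatives of a coset; the
  union collapses once its members are equal.\<close>

lemma UN_coset:
  assumes "\<And>c'. c' \<in> coset c \<Longrightarrow> F c' = F c"
  shows "(\<Union>c'\<in>coset c. F c') = F c"
proof -
  have "c \<in> coset c" using rel_zero by (auto simp: tensor_coset_conv image_iff intro!: bexI[of _ 0])
  then show ?thesis using assms by blast
qed

lemma coset_mem_iff: "c' \<in> coset c \<longleftrightarrow> c' - c \<in> rel"
  by (auto simp: tensor_coset_conv image_iff) (metis diff_add_cancel)

definition scal :: "'r \<Rightarrow> ('s \<times> 't \<Rightarrow>\<^sub>0 int) \<Rightarrow> ('s \<times> 't \<Rightarrow>\<^sub>0 int)" where
  "scal r = frag_extend (\<lambda>(x, y). frag_of (r \<odot>\<^bsub>M\<^esub> x, y))"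

lemma scal_simps: "scal r 0 = 0" "scal r (c + d) = scal r c + scal r d" "scal r (c - d) = scal r c - scal r d"
  "scal r (frag_of (x, y)) = frag_of (r \<odot>\<^bsub>M\<^esub> x, y)"
  by (simp_all add: scal_def frag_extend_add frag_extend_diff)

lemma scal_gens:
  assumes r: "r \<in> carrier R" and "g \<in> gens"
  shows "scal r g \<in> rel"
  using assms(2)
proof (cases rule: gens_cases)
  case (left x x' y)
  then show ?thesis
    using rel_gen[OF coset_gens(1)[of "r \<odot>\<^bsub>M\<^esub> x" "r \<odot>\<^bsub>M\<^esub> x'" y]] r
    by (simp add: scal_simps M.smult_r_distr)
next
  case (right x y y')
  then show ?thesis
    using rel_gen[OF coset_gens(2)[of "r \<odot>\<^bsub>M\<^esub> x" y y']] r by (simp add: scal_simps)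
next
  case (balanced s x y)
  \<comment> \<open>Commutativity of the ring enters here: scaling by \<open>r\<close> must respect
    the relation that moves \<open>s\<close> across the tensor sign.\<close>
  have "r \<odot>\<^bsub>M\<^esub> (s \<odot>\<^bsub>M\<^esub> x) = s \<odot>\<^bsub>M\<^esub> (r \<odot>\<^bsub>M\<^esub> x)"
    using r balanced(1,2) M.smult_assoc1 M.m_comm by metis
  then show ?thesis
    using rel_gen[OF coset_gens(3)[of s "r \<odot>\<^bsub>M\<^esub> x" y]] r balanced by (simp add: scal_simps)
qed

lemma coset_smult:
  assumes r: "r \<in> carrier R"
  shows "r \<odot>\<^bsub>T\<^esub> coset c = coset (scal r c)"
proof -
  have pair: "module_pair R M N" by unfold_locales
  have "r \<odot>\<^bsub>T\<^esub> coset c = (\<Union>c'\<in>coset c. coset (scal r c'))"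
    by (simp add: tensor_module_def Let_def scal_def)
  also have "\<dots> = coset (scal r c)"
  proof (rule UN_coset)
    fix c' assume "c' \<in> coset c"
    then have "scal r (c' - c) \<in> rel"
      using frag_extend_rel[OF _ pair, of "\<lambda>(x, y). frag_of (r \<odot>\<^bsub>M\<^esub> x, y)"] scal_gens[OF r]
      by (simp add: coset_mem_iff scal_def)
    then show "coset (scal r c') = coset (scal r c)" by (simp add: coset_eq_iff scal_simps)
  qed
  finally show ?thesis .
qed

lemma scal_keys: "r \<in> carrier R \<Longrightarrow> Poly_Mapping.keys c \<subseteq> S \<Longrightarrow> Poly_Mapping.keys (scal r c) \<subseteq> S"
  unfolding scal_def using keys_frag_extend[of "\<lambda>(x, y). frag_of (r \<odot>\<^bsub>M\<^esub> x, y)" c]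
  by (fastforce simp: keys_frag_of split: prod.splits)

lemma coset_frag_add_left: "x \<in> carrier M \<Longrightarrow> x' \<in> carrier M \<Longrightarrow> y \<in> carrier N \<Longrightarrow>
    coset (frag_of (x \<oplus>\<^bsub>M\<^esub> x', y)) = coset (frag_of (x, y)) \<oplus>\<^bsub>T\<^esub> coset (frag_of (x', y))"
  using rel_gen[OF coset_gens(1)] by (simp add: coset_add coset_eq_iff diff_diff_add)

lemma coset_frag_add_right: "x \<in> carrier M \<Longrightarrow> y \<in> carrier N \<Longrightarrow> y' \<in> carrier N \<Longrightarrow>
    coset (frag_of (x, y \<oplus>\<^bsub>N\<^esub> y')) = coset (frag_of (x, y)) \<oplus>\<^bsub>T\<^esub> coset (frag_of (x, y'))"
  using rel_gen[OF coset_gens(2)] by (simp add: coset_add coset_eq_iff diff_diff_add)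

lemma coset_frag_balanced: "r \<in> carrier R \<Longrightarrow> x \<in> carrier M \<Longrightarrow> y \<in> carrier N \<Longrightarrow>
    coset (frag_of (r \<odot>\<^bsub>M\<^esub> x, y)) = coset (frag_of (x, r \<odot>\<^bsub>N\<^esub> y))"
  using rel_gen[OF coset_gens(3)] by (simp add: coset_eq_iff)

lemma coset_frag_smult: "r \<in> carrier R \<Longrightarrow>
    r \<odot>\<^bsub>T\<^esub> coset (frag_of (x, y)) = coset (frag_of (r \<odot>\<^bsub>M\<^esub> x, y))"
  by (simp add: coset_smult scal_simps)

lemma tensor_module_module: "Module.module R T"
proof (rule moduleI)
  show "cring R" by (rule M.is_cring)
  show "abelian_group T"
  proof (rule abelian_groupI)
    fix C D E assume "C \<in> carrier T" "D \<in> carrier T"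
    then obtain c d where c: "Poly_Mapping.keys c \<subseteq> S" "C = coset c"
      and d: "Poly_Mapping.keys d \<subseteq> S" "D = coset d" unfolding coset_carrier_iff by blast
    show "C \<oplus>\<^bsub>T\<^esub> D \<in> carrier T"
      unfolding c d coset_add by (rule coset_closed) (use c d keys_add[of c d] in blast)
    show "C \<oplus>\<^bsub>T\<^esub> D = D \<oplus>\<^bsub>T\<^esub> C" unfolding c d coset_add by (simp add: add.commute)
    assume "E \<in> carrier T"
    then obtain e where e: "E = coset e" unfolding coset_carrier_iff by blast
    show "(C \<oplus>\<^bsub>T\<^esub> D) \<oplus>\<^bsub>T\<^esub> E = C \<oplus>\<^bsub>T\<^esub> (D \<oplus>\<^bsub>T\<^esub> E)"
      unfolding c d e coset_add by (simp add: add.assoc)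
  next
    fix C assume "C \<in> carrier T"
    then obtain c where c: "Poly_Mapping.keys c \<subseteq> S" "C = coset c" unfolding coset_carrier_iff by blast
    show "\<zero>\<^bsub>T\<^esub> \<oplus>\<^bsub>T\<^esub> C = C" unfolding c coset_zero coset_add by simp
    show "\<exists>D\<in>carrier T. D \<oplus>\<^bsub>T\<^esub> C = \<zero>\<^bsub>T\<^esub>"
      unfolding c coset_zero by (rule bexI[of _ "coset (- c)"]) (use c in \<open>simp_all add: coset_add coset_closed\<close>)
  qed (simp add: coset_zero coset_closed)
next
  fix r C assume r: "r \<in> carrier R" and "C \<in> carrier T"
  then obtain c where c: "Poly_Mapping.keys c \<subseteq> S" "C = coset c" unfolding coset_carrier_iff by blast
  show "r \<odot>\<^bsub>T\<^esub> C \<in> carrier T" unfolding c coset_smult[OF r] by (rule coset_closed[OF scal_keys[OF r c(1)]])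
  {
    fix D assume "D \<in> carrier T"
    then obtain d where d: "D = coset d" unfolding coset_carrier_iff by blast
    show "r \<odot>\<^bsub>T\<^esub> (C \<oplus>\<^bsub>T\<^esub> D) = (r \<odot>\<^bsub>T\<^esub> C) \<oplus>\<^bsub>T\<^esub> (r \<odot>\<^bsub>T\<^esub> D)"
      unfolding c d by (simp add: coset_smult[OF r] coset_add scal_simps)
  }
  fix s assume s: "s \<in> carrier R"
  \<comment> \<open>Additivity in the scalar holds only modulo the relations, as it uses
    biadditivity of the tensor sign. The law for products below holds for the formal sums
    themselves.\<close>
  have "scal (r \<oplus>\<^bsub>R\<^esub> s) c - (scal r c + scal s c) \<in> rel" using c(1)
  proof (induction c rule: frag_induction)
    case (one p)
    then obtain x y where "p = (x, y)" "x \<in> carrier M" "y \<in> carrier N" by blast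
    then show ?case
      using rel_gen[OF coset_gens(1)[of "r \<odot>\<^bsub>M\<^esub> x" "s \<odot>\<^bsub>M\<^esub> x" y]] r s
      by (simp add: scal_simps M.smult_l_distr diff_diff_add)
  next
    case (diff a b)
    have "scal (r \<oplus>\<^bsub>R\<^esub> s) (a - b) - (scal r (a - b) + scal s (a - b)) =
      (scal (r \<oplus>\<^bsub>R\<^esub> s) a - (scal r a + scal s a)) - (scal (r \<oplus>\<^bsub>R\<^esub> s) b - (scal r b + scal s b))"
      by (simp add: scal_simps algebra_simps)
    then show ?case using rel_diff[OF diff] by simp
  qed (simp add: scal_simps rel_zero)
  then show "(r \<oplus>\<^bsub>R\<^esub> s) \<odot>\<^bsub>T\<^esub> C = (r \<odot>\<^bsub>T\<^esub> C) \<oplus>\<^bsub>T\<^esub> (s \<odot>\<^bsub>T\<^esub> C)"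
    unfolding c using r s by (simp add: coset_smult coset_add coset_eq_iff)
  have "scal (r \<otimes>\<^bsub>R\<^esub> s) c = scal r (scal s c)" using c(1)
  proof (induction c rule: frag_induction)
    case (one p)
    then show ?case using r s by (auto simp: scal_simps M.smult_assoc1)
  qed (simp_all add: scal_simps)
  then show "(r \<otimes>\<^bsub>R\<^esub> s) \<odot>\<^bsub>T\<^esub> C = r \<odot>\<^bsub>T\<^esub> (s \<odot>\<^bsub>T\<^esub> C)"
    unfolding c using r s by (simp add: coset_smult)
next
  fix C assume "C \<in> carrier T"
  then obtain c where c: "Poly_Mapping.keys c \<subseteq> S" "C = coset c" unfolding coset_carrier_iff by blast
  have "scal \<one>\<^bsub>R\<^esub> c = c" using c(1)
  proof (induction c rule: frag_induction)
    case (one p)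
    then show ?case by (auto simp: scal_simps)
  qed (simp_all add: scal_simps)
  then show "\<one>\<^bsub>R\<^esub> \<odot>\<^bsub>T\<^esub> C = C" unfolding c by (simp add: coset_smult)
qed

text \<open>No case for negatives is required: the negative of x \<otimes> y is (-x) \<otimes> y,
  and the zero element is 0 \<otimes> 0. Hence every element is a sum of pure tensors.\<close>

lemma tensor_module_induct [consumes 1, case_names pure add]:
  assumes "C \<in> carrier T"
    and pure: "\<And>x y. x \<in> carrier M \<Longrightarrow> y \<in> carrier N \<Longrightarrow> P (coset (frag_of (x, y)))"
    and add: "\<And>C D. C \<in> carrier T \<Longrightarrow> D \<in> carrier T \<Longrightarrow> P C \<Longrightarrow> P D \<Longrightarrow> P (C \<oplus>\<^bsub>T\<^esub> D)"
  shows "P C"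
proof -
  obtain c where c: "Poly_Mapping.keys c \<subseteq> S" "C = coset c"
    using assms(1) unfolding coset_carrier_iff by blast
  have coset_zero': "coset (frag_of (\<zero>\<^bsub>M\<^esub>, y)) = coset 0" if y: "y \<in> carrier N" for y
    using rel_minus[OF rel_gen[OF coset_gens(1)[of "\<zero>\<^bsub>M\<^esub>" "\<zero>\<^bsub>M\<^esub>" y]]] y by (simp add: coset_eq_iff)
  \<comment> \<open>\<open>frag_induction\<close> builds formal sums by differences. Carrying the
    negative of each element along makes the class of a difference a sum of classes that are already
    covered; the supports are carried for \<open>coset_closed\<close>.\<close>
  have "P (coset c) \<and> P (coset (- c)) \<and> Poly_Mapping.keys c \<subseteq> S" using c(1)
  proof (induction c rule: frag_induction)
    case zero
    show ?case using pure[of "\<zero>\<^bsub>M\<^esub>" "\<zero>\<^bsub>N\<^esub>"] coset_zero'[of "\<zero>\<^bsub>N\<^esub>"] by simp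
  next
    case (one p)
    then obtain x y where p: "p = (x, y)" "x \<in> carrier M" "y \<in> carrier N" by blast
    define x' where "x' = \<ominus>\<^bsub>M\<^esub> x"
    have x': "x' \<in> carrier M" using p(2) by (simp add: x'_def)
    have "coset (frag_of (x, y) + frag_of (x', y)) = coset 0"
      unfolding coset_add[symmetric] coset_frag_add_left[OF p(2) x' p(3), symmetric]
      using p coset_zero' by (simp add: x'_def M.M.r_neg)
    then have "- (frag_of (x, y) + frag_of (x', y)) \<in> rel"
      by (intro rel_minus) (simp add: coset_eq_iff)
    then have "coset (- frag_of p) = coset (frag_of (x', y))"
    proof -
      have "- frag_of p - frag_of (x', y) = - (frag_of (x, y) + frag_of (x', y))"
        by (simp add: p(1) algebra_simps)
      then show ?thesis using \<open>- (frag_of (x, y) + frag_of (x', y)) \<in> rel\<close> by (simp only: coset_eq_iff)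
    qed
    then show ?case using pure p x' one by (simp add: keys_frag_of)
  next
    case (diff a b)
    have eq: "coset (a - b) = coset a \<oplus>\<^bsub>T\<^esub> coset (- b)" "coset (- (a - b)) = coset (- a) \<oplus>\<^bsub>T\<^esub> coset b"
      by (simp_all add: coset_add)
    have k: "Poly_Mapping.keys (a - b) \<subseteq> S" using keys_diff[of a b] diff by blast
    have "P (coset a \<oplus>\<^bsub>T\<^esub> coset (- b))" "P (coset (- a) \<oplus>\<^bsub>T\<^esub> coset b)"
      using diff by (auto intro!: add coset_closed)
    then show ?case using k unfolding eq by blast
  qed
  then show ?thesis by (simp add: c(2))
qed

text \<open>The target is a mere abelian group and \<open>b\<close> is balanced but not linear. This
  generality is forced by connections, whose tensor product is to be lifted and is not linear over
  the ring.\<close>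

lemma tensor_module_lift:
  fixes H :: "('h, 'k) ring_scheme"
  assumes H: "abelian_group H"
    and closed: "\<And>x y. x \<in> carrier M \<Longrightarrow> y \<in> carrier N \<Longrightarrow> b x y \<in> carrier H"
    and add_left: "\<And>x x' y. x \<in> carrier M \<Longrightarrow> x' \<in> carrier M \<Longrightarrow> y \<in> carrier N \<Longrightarrow>
      b (x \<oplus>\<^bsub>M\<^esub> x') y = b x y \<oplus>\<^bsub>H\<^esub> b x' y"
    and add_right: "\<And>x y y'. x \<in> carrier M \<Longrightarrow> y \<in> carrier N \<Longrightarrow> y' \<in> carrier N \<Longrightarrow>
      b x (y \<oplus>\<^bsub>N\<^esub> y') = b x y \<oplus>\<^bsub>H\<^esub> b x y'"
    and balanced: "\<And>r x y. r \<in> carrier R \<Longrightarrow> x \<in> carrier M \<Longrightarrow> y \<in> carrier N \<Longrightarrow>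
      b (r \<odot>\<^bsub>M\<^esub> x) y = b x (r \<odot>\<^bsub>N\<^esub> y)"
  shows "\<exists>k. (\<forall>C\<in>carrier T. k C \<in> carrier H) \<and>
    (\<forall>C\<in>carrier T. \<forall>D\<in>carrier T. k (C \<oplus>\<^bsub>T\<^esub> D) = k C \<oplus>\<^bsub>H\<^esub> k D) \<and>
    (\<forall>x\<in>carrier M. \<forall>y\<in>carrier N. k (coset (frag_of (x, y))) = b x y)"
proof -
  interpret H: abelian_group H by (rule H)
  have "(\<lambda>(x, y). b x y) ` S \<subseteq> carrier (add_monoid H)" using closed by auto
  from comm_group.free_Abelian_group_universal[OF H.a_comm_group this]
  obtain h where h: "h \<in> hom (free_Abelian_group S) (add_monoid H)"
    and hb': "\<And>p. p \<in> S \<Longrightarrow> h (frag_of p) = (\<lambda>(x, y). b x y) p" by metis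
  have hb: "h (frag_of (x, y)) = b x y" if "x \<in> carrier M" "y \<in> carrier N" for x y
    using hb'[of "(x, y)"] that by simp
  have hc: "h c \<in> carrier H" if "Poly_Mapping.keys c \<subseteq> S" for c
    using hom_in_carrier[OF h, of c] that by simp
  have ha: "h (c + d) = h c \<oplus>\<^bsub>H\<^esub> h d" if "Poly_Mapping.keys c \<subseteq> S" "Poly_Mapping.keys d \<subseteq> S" for c d
    using hom_mult[OF h, of c d] that by simp
  have h0: "h 0 = \<zero>\<^bsub>H\<^esub>" using ha[of 0 0] hc[of 0] by simp
  have hd: "h (c - d) \<oplus>\<^bsub>H\<^esub> h d = h c" if "Poly_Mapping.keys c \<subseteq> S" "Poly_Mapping.keys d \<subseteq> S" for c d
  proof -
    have "Poly_Mapping.keys (c - d) \<subseteq> S" using keys_diff[of c d] that by blast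
    then show ?thesis using ha[of "c - d" d] that(2) by simp
  qed
  have hz: "h c = \<zero>\<^bsub>H\<^esub>" if "c \<in> rel" for c
  proof -
    have "Poly_Mapping.keys c \<subseteq> S \<and> h c = \<zero>\<^bsub>H\<^esub>" using that
    proof (induction rule: rel_induct)
      case (gen g)
      have k: "Poly_Mapping.keys g \<subseteq> S" by (rule gens_keys[OF gen])
      \<comment> \<open>Both kinds of additivity relations have the shape c - p - q. As
        \<open>h\<close> is additive only on supported elements, the two terms are added back by
        \<open>hd\<close> and cancelled.\<close>
      have d2: "h (c - frag_of p - frag_of q) = \<zero>\<^bsub>H\<^esub>"
        if "Poly_Mapping.keys c \<subseteq> S" "p \<in> S" "q \<in> S" "h c = h (frag_of p) \<oplus>\<^bsub>H\<^esub> h (frag_of q)" for c p q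
      proof -
        have "Poly_Mapping.keys (c - frag_of p) \<subseteq> S" by (intro keys_diff_frag_of that)
        moreover have "Poly_Mapping.keys (c - frag_of p - frag_of q) \<subseteq> S"
          by (intro keys_diff_frag_of that)
        moreover have fr: "Poly_Mapping.keys (frag_of p) \<subseteq> S" "Poly_Mapping.keys (frag_of q) \<subseteq> S"
          using that by (auto simp: keys_frag_of)
        ultimately have "(h (c - frag_of p - frag_of q) \<oplus>\<^bsub>H\<^esub> h (frag_of q)) \<oplus>\<^bsub>H\<^esub> h (frag_of p) =
            h (frag_of p) \<oplus>\<^bsub>H\<^esub> h (frag_of q)"
          using hd that by metis
        then show ?thesis
          using hc[OF fr(1)] hc[OF fr(2)] hc[OF \<open>Poly_Mapping.keys (c - frag_of p - frag_of q) \<subseteq> S\<close>]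
          by (metis H.a_assoc H.a_comm H.add.l_cancel_one' H.a_closed)
      qed
      show ?case
      proof (intro conjI k)
        show "h g = \<zero>\<^bsub>H\<^esub>" using gen
        proof (cases rule: gens_cases)
          case (left x x' y)
          then show ?thesis using add_left by (simp only: left(4)) (rule d2; simp add: keys_frag_of hb)
        next
          case (right x y y')
          then show ?thesis using add_right by (simp only: right(4)) (rule d2; simp add: keys_frag_of hb)
        next
          case b: (balanced s x y)
          have "h g \<oplus>\<^bsub>H\<^esub> h (frag_of (x, s \<odot>\<^bsub>N\<^esub> y)) = h (frag_of (s \<odot>\<^bsub>M\<^esub> x, y))"
            unfolding b(4) by (rule hd) (use b in \<open>simp_all add: keys_frag_of\<close>)
          then show ?thesis using balanced[OF b(1-3)] hb b(1-3) hc[OF k] closed by simp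
        qed
      qed
    next
      case (add a b)
      then show ?case using ha[of a b] keys_add[of a b] by auto
    next
      case (minus a)
      then show ?case using hd[of 0 a] hc[of "-a"] h0 by simp
    qed (simp add: h0)
    then show ?thesis ..
  qed
  \<comment> \<open>The representative is arbitrary: two of them differ by a relation, and
    \<open>h\<close> vanishes on relations by \<open>hz\<close>.\<close>
  define k where "k = (\<lambda>C. h (SOME c. Poly_Mapping.keys c \<subseteq> S \<and> C = coset c))"
  have k: "k (coset c) = h c" if c: "Poly_Mapping.keys c \<subseteq> S" for c
  proof -
    define c' where "c' = (SOME c'. Poly_Mapping.keys c' \<subseteq> S \<and> coset c = coset c')"
    have c': "Poly_Mapping.keys c' \<subseteq> S \<and> coset c = coset c'"
      unfolding c'_def by (rule someI[of _ c]) (use c in simp)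
    then have "c - c' \<in> rel" by (simp add: coset_eq_iff)
    then have "h c' = h c" using hz hd[of c c'] hc[of c'] c c' by simp
    then show ?thesis by (simp add: k_def c'_def)
  qed
  show ?thesis
  proof (intro exI[of _ k] conjI ballI)
    fix C D assume "C \<in> carrier T" "D \<in> carrier T"
    then obtain c d where c: "Poly_Mapping.keys c \<subseteq> S" "C = coset c"
      and d: "Poly_Mapping.keys d \<subseteq> S" "D = coset d" unfolding coset_carrier_iff by blast
    show "k C \<in> carrier H" unfolding c k[OF c(1)] by (rule hc[OF c(1)])
    have "Poly_Mapping.keys (c + d) \<subseteq> S" using c d keys_add[of c d] by blast
    then show "k (C \<oplus>\<^bsub>T\<^esub> D) = k C \<oplus>\<^bsub>H\<^esub> k D"
      using c d by (simp add: coset_add k ha)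
  qed (use k hb in \<open>simp_all add: keys_frag_of\<close>)
qed

end

section \<open>The presheaf tensor product\<close>

lemma presheaf_module_pair:
  "module_presheaf A F \<Longrightarrow> module_presheaf A G \<Longrightarrow> open U \<Longrightarrow> module_pair (Cinf A U) (Sec F U) (Sec G U)"
  unfolding module_pair_def by (simp add: presheaf_module)

lemma Sec_tensor_presheaf:
  "Sec (tensor_presheaf A F G) U = tensor_module (Cinf A U) (Sec F U) (Sec G U)"
  by (simp add: tensor_presheaf_def)

text \<open>The elementary tensor before sheafification; \<open>pure\<close> is the family of its
  germs.\<close>

definition tensor_elem ::
  "('x::{t2_space,second_countable_topology}, 'b::real_normed_vector) atlas
     \<Rightarrow> ('x, 's) mod_sheaf \<Rightarrow> ('x, 't) mod_sheaf \<Rightarrow> 'x set \<Rightarrow> 's \<Rightarrow> 't \<Rightarrow> (('s \<times> 't) \<Rightarrow>\<^sub>0 int) set" where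
  "tensor_elem A F G U s t = tensor_coset (Cinf A U) (Sec F U) (Sec G U) (frag_of (s, t))"

context smooth_mfd
begin

lemma carrier_Cinf: "carrier (Cinf A U) = smooth_fun A U"
  by (simp add: Cinf_def)

context
  fixes F :: "('x, 's) mod_sheaf" and G :: "('x, 't) mod_sheaf"
  assumes F: "module_presheaf A F" and G: "module_presheaf A G"
begin

definition frag_Res :: "'x set \<Rightarrow> 'x set \<Rightarrow> ('s \<times> 't \<Rightarrow>\<^sub>0 int) \<Rightarrow> ('s \<times> 't \<Rightarrow>\<^sub>0 int)" where
  "frag_Res U V = frag_extend (\<lambda>(s, t). frag_of (Res F U V s, Res G U V t))"

lemma frag_Res_simps: "frag_Res U V 0 = 0" "frag_Res U V (c + d) = frag_Res U V c + frag_Res U V d"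
  "frag_Res U V (c - d) = frag_Res U V c - frag_Res U V d" "frag_Res U V (frag_of (s, t)) = frag_of (Res F U V s, Res G U V t)"
  by (simp_all add: frag_Res_def frag_extend_add frag_extend_diff)

lemma frag_Res_keys:
  assumes "open U" "open V" "V \<subseteq> U" "Poly_Mapping.keys c \<subseteq> sections F U \<times> sections G U"
  shows "Poly_Mapping.keys (frag_Res U V c) \<subseteq> sections F V \<times> sections G V"
proof -
  have "Poly_Mapping.keys (frag_of (Res F U V s, Res G U V t)) \<subseteq> sections F V \<times> sections G V"
    if "(s, t) \<in> Poly_Mapping.keys c" for s t
    using that assms presheaf_Res_closed[OF F] presheaf_Res_closed[OF G] by (auto simp: keys_frag_of)
  then show ?thesis
    unfolding frag_Res_def using keys_frag_extend[of "\<lambda>(s, t). frag_of (Res F U V s, Res G U V t)" c] by fastforce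
qed

text \<open>Restriction carries each generating relation over \<open>U\<close> to the one of the
  same kind over \<open>V\<close>; for the balancing relation the scalar is cut down to
  \<open>V\<close>. Restriction of tensors is therefore well defined on cosets.\<close>

lemma tensor_presheaf_Res_coset:
  assumes U: "open U" "open V" "V \<subseteq> U"
  shows "Res (tensor_presheaf A F G) U V (tensor_coset (Cinf A U) (Sec F U) (Sec G U) c) =
    tensor_coset (Cinf A V) (Sec F V) (Sec G V) (frag_Res U V c)"
proof -
  interpret U: module_pair "Cinf A U" "Sec F U" "Sec G U" by (rule presheaf_module_pair[OF F G U(1)])
  interpret V: module_pair "Cinf A V" "Sec F V" "Sec G V" by (rule presheaf_module_pair[OF F G U(2)])
  note Rc = presheaf_Res_closed[OF F U] presheaf_Res_closed[OF G U]
  have gens: "frag_Res U V g \<in> V.rel" if "g \<in> U.gens" for g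
    using that
  proof (cases rule: U.gens_cases)
    case (left x x' y)
    then show ?thesis
      using V.rel_gen[OF V.coset_gens(1)] Rc by (simp add: frag_Res_simps presheaf_Res_add[OF F U])
  next
    case (right x y y')
    then show ?thesis
      using V.rel_gen[OF V.coset_gens(2)] Rc by (simp add: frag_Res_simps presheaf_Res_add[OF G U])
  next
    case (balanced f x y)
    then show ?thesis
      using V.rel_gen[OF V.coset_gens(3)] Rc smooth_fun_cut[OF _ U(2,3)]
      by (simp add: frag_Res_simps presheaf_Res_smult[OF F U] presheaf_Res_smult[OF G U] carrier_Cinf)
  qed
  have "Res (tensor_presheaf A F G) U V (U.coset c) = (\<Union>c'\<in>U.coset c. V.coset (frag_Res U V c'))"
    by (simp add: tensor_presheaf_def frag_Res_def)
  also have "\<dots> = V.coset (frag_Res U V c)"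
  proof (rule U.UN_coset)
    fix c' assume "c' \<in> U.coset c"
    then have "frag_Res U V (c' - c) \<in> V.rel"
      using U.frag_extend_rel[OF _ V.module_pair_axioms] gens unfolding frag_Res_def by (simp add: U.coset_mem_iff)
    then show "V.coset (frag_Res U V c') = V.coset (frag_Res U V c)" by (simp add: V.coset_eq_iff frag_Res_simps)
  qed
  finally show ?thesis .
qed

text \<open>Functoriality of restriction and its compatibility with scalars hold already for formal
  sums and are checked on generators by \<open>frag_induction\<close>; the passage to cosets comes
  last.\<close>

lemma tensor_presheaf_presheaf: "module_presheaf A (tensor_presheaf A F G)"
  unfolding module_presheaf_def
proof (intro conjI allI impI ballI)
  fix U :: "'x set" assume U: "open U"
  interpret U: module_pair "Cinf A U" "Sec F U" "Sec G U" by (rule presheaf_module_pair[OF F G U(1)])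
  show "Module.module (Cinf A U) (Sec (tensor_presheaf A F G) U)"
    unfolding Sec_tensor_presheaf by (rule U.tensor_module_module)
  fix C assume "C \<in> sections (tensor_presheaf A F G) U"
  then obtain c where c: "Poly_Mapping.keys c \<subseteq> U.S" "C = U.coset c"
    unfolding Sec_tensor_presheaf U.coset_carrier_iff by blast
  have "frag_Res U U c = c" using c(1)
  proof (induction c rule: frag_induction)
    case (one p)
    then show ?case by (auto simp: frag_Res_simps presheaf_Res_id[OF F U] presheaf_Res_id[OF G U])
  qed (simp_all add: frag_Res_simps)
  then show "Res (tensor_presheaf A F G) U U C = C"
    by (simp add: c(2) tensor_presheaf_Res_coset[OF U U])
next
  fix U V W :: "'x set" and C assume "open U \<and> open V \<and> open W \<and> V \<subseteq> U \<and> W \<subseteq> V"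
  then have U: "open U" "open V" "open W" "V \<subseteq> U" "W \<subseteq> V" "W \<subseteq> U" by auto
  interpret U: module_pair "Cinf A U" "Sec F U" "Sec G U" by (rule presheaf_module_pair[OF F G U(1)])
  assume "C \<in> sections (tensor_presheaf A F G) U"
  then obtain c where c: "Poly_Mapping.keys c \<subseteq> U.S" "C = U.coset c"
    unfolding Sec_tensor_presheaf U.coset_carrier_iff by blast
  have "frag_Res V W (frag_Res U V c) = frag_Res U W c" using c(1)
  proof (induction c rule: frag_induction)
    case (one p)
    then show ?case by (auto simp: frag_Res_simps presheaf_Res_Res[OF F U(1-5)] presheaf_Res_Res[OF G U(1-5)])
  qed (simp_all add: frag_Res_simps)
  then show "Res (tensor_presheaf A F G) V W (Res (tensor_presheaf A F G) U V C) =
      Res (tensor_presheaf A F G) U W C"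
    by (simp add: c(2) tensor_presheaf_Res_coset U)
next
  fix U V :: "'x set" and C assume "open U \<and> open V \<and> V \<subseteq> U"
  then have U: "open U" "open V" "V \<subseteq> U" by auto
  interpret U: module_pair "Cinf A U" "Sec F U" "Sec G U" by (rule presheaf_module_pair[OF F G U(1)])
  interpret V: module_pair "Cinf A V" "Sec F V" "Sec G V" by (rule presheaf_module_pair[OF F G U(2)])
  assume "C \<in> sections (tensor_presheaf A F G) U"
  then obtain c where c: "Poly_Mapping.keys c \<subseteq> U.S" "C = U.coset c"
    unfolding Sec_tensor_presheaf U.coset_carrier_iff by blast
  show "Res (tensor_presheaf A F G) U V C \<in> sections (tensor_presheaf A F G) V"
    unfolding c tensor_presheaf_Res_coset[OF U] Sec_tensor_presheaf
    by (rule V.coset_closed[OF frag_Res_keys[OF U c(1)]])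
  {
    fix D assume "D \<in> sections (tensor_presheaf A F G) U"
    then obtain d where d: "D = U.coset d" unfolding Sec_tensor_presheaf U.coset_carrier_iff by blast
    show "Res (tensor_presheaf A F G) U V (C \<oplus>\<^bsub>Sec (tensor_presheaf A F G) U\<^esub> D) =
        Res (tensor_presheaf A F G) U V C \<oplus>\<^bsub>Sec (tensor_presheaf A F G) V\<^esub> Res (tensor_presheaf A F G) U V D"
      unfolding c d Sec_tensor_presheaf
      by (simp add: tensor_presheaf_Res_coset[OF U] U.coset_add V.coset_add frag_Res_simps)
  }
  fix f assume f: "f \<in> smooth_fun A U"
  have fc: "f \<in> carrier (Cinf A U)" "cut V f \<in> carrier (Cinf A V)"
    using f smooth_fun_cut[OF f U(2,3)] by (auto simp: carrier_Cinf)
  have "frag_Res U V (U.scal f c) = V.scal (cut V f) (frag_Res U V c)" using c(1)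
  proof (induction c rule: frag_induction)
    case (one p)
    then show ?case by (auto simp: frag_Res_simps U.scal_simps V.scal_simps presheaf_Res_smult[OF F U f])
  qed (simp_all add: frag_Res_simps U.scal_simps V.scal_simps)
  then show "Res (tensor_presheaf A F G) U V (f \<odot>\<^bsub>Sec (tensor_presheaf A F G) U\<^esub> C) =
      cut V f \<odot>\<^bsub>Sec (tensor_presheaf A F G) V\<^esub> Res (tensor_presheaf A F G) U V C"
    unfolding c Sec_tensor_presheaf
    by (simp add: tensor_presheaf_Res_coset[OF U] U.coset_smult[OF fc(1)] V.coset_smult[OF fc(2)])
qed

lemma tensor_elem_facts:
  assumes U: "open U"
  shows tensor_elem_closed: "s \<in> sections F U \<Longrightarrow> t \<in> sections G U \<Longrightarrow> tensor_elem A F G U s t \<in> sections (tensor_presheaf A F G) U"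
    and tensor_elem_add_left: "s \<in> sections F U \<Longrightarrow> s' \<in> sections F U \<Longrightarrow> t \<in> sections G U \<Longrightarrow>
      tensor_elem A F G U (s \<oplus>\<^bsub>Sec F U\<^esub> s') t = tensor_elem A F G U s t \<oplus>\<^bsub>Sec (tensor_presheaf A F G) U\<^esub> tensor_elem A F G U s' t"
    and tensor_elem_add_right: "s \<in> sections F U \<Longrightarrow> t \<in> sections G U \<Longrightarrow> t' \<in> sections G U \<Longrightarrow>
      tensor_elem A F G U s (t \<oplus>\<^bsub>Sec G U\<^esub> t') = tensor_elem A F G U s t \<oplus>\<^bsub>Sec (tensor_presheaf A F G) U\<^esub> tensor_elem A F G U s t'"
    and tensor_elem_balanced: "f \<in> smooth_fun A U \<Longrightarrow> s \<in> sections F U \<Longrightarrow> t \<in> sections G U \<Longrightarrow>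
      tensor_elem A F G U (f \<odot>\<^bsub>Sec F U\<^esub> s) t = tensor_elem A F G U s (f \<odot>\<^bsub>Sec G U\<^esub> t)"
    and tensor_elem_smult: "f \<in> smooth_fun A U \<Longrightarrow> s \<in> sections F U \<Longrightarrow> t \<in> sections G U \<Longrightarrow>
      f \<odot>\<^bsub>Sec (tensor_presheaf A F G) U\<^esub> tensor_elem A F G U s t = tensor_elem A F G U (f \<odot>\<^bsub>Sec F U\<^esub> s) t"
    and tensor_elem_Res: "open V \<Longrightarrow> V \<subseteq> U \<Longrightarrow>
      Res (tensor_presheaf A F G) U V (tensor_elem A F G U s t) = tensor_elem A F G V (Res F U V s) (Res G U V t)"
proof -
  interpret U: module_pair "Cinf A U" "Sec F U" "Sec G U" by (rule presheaf_module_pair[OF F G U(1)])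
  show "s \<in> sections F U \<Longrightarrow> t \<in> sections G U \<Longrightarrow> tensor_elem A F G U s t \<in> sections (tensor_presheaf A F G) U"
    unfolding tensor_elem_def Sec_tensor_presheaf by (rule U.coset_closed) (simp add: keys_frag_of)
  show "s \<in> sections F U \<Longrightarrow> s' \<in> sections F U \<Longrightarrow> t \<in> sections G U \<Longrightarrow>
      tensor_elem A F G U (s \<oplus>\<^bsub>Sec F U\<^esub> s') t = tensor_elem A F G U s t \<oplus>\<^bsub>Sec (tensor_presheaf A F G) U\<^esub> tensor_elem A F G U s' t"
    unfolding tensor_elem_def Sec_tensor_presheaf by (rule U.coset_frag_add_left)
  show "s \<in> sections F U \<Longrightarrow> t \<in> sections G U \<Longrightarrow> t' \<in> sections G U \<Longrightarrow>
      tensor_elem A F G U s (t \<oplus>\<^bsub>Sec G U\<^esub> t') = tensor_elem A F G U s t \<oplus>\<^bsub>Sec (tensor_presheaf A F G) U\<^esub> tensor_elem A F G U s t'"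
    unfolding tensor_elem_def Sec_tensor_presheaf by (rule U.coset_frag_add_right)
  show "f \<in> smooth_fun A U \<Longrightarrow> s \<in> sections F U \<Longrightarrow> t \<in> sections G U \<Longrightarrow>
      tensor_elem A F G U (f \<odot>\<^bsub>Sec F U\<^esub> s) t = tensor_elem A F G U s (f \<odot>\<^bsub>Sec G U\<^esub> t)"
    unfolding tensor_elem_def Sec_tensor_presheaf by (rule U.coset_frag_balanced) (simp_all add: carrier_Cinf)
  show "f \<in> smooth_fun A U \<Longrightarrow> s \<in> sections F U \<Longrightarrow> t \<in> sections G U \<Longrightarrow>
      f \<odot>\<^bsub>Sec (tensor_presheaf A F G) U\<^esub> tensor_elem A F G U s t = tensor_elem A F G U (f \<odot>\<^bsub>Sec F U\<^esub> s) t"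
    unfolding tensor_elem_def Sec_tensor_presheaf by (rule U.coset_frag_smult) (simp_all add: carrier_Cinf)
  show "open V \<Longrightarrow> V \<subseteq> U \<Longrightarrow>
      Res (tensor_presheaf A F G) U V (tensor_elem A F G U s t) = tensor_elem A F G V (Res F U V s) (Res G U V t)"
    unfolding tensor_elem_def by (simp add: tensor_presheaf_Res_coset[OF U] frag_Res_simps)
qed

lemma tensor_presheaf_induct [consumes 2, case_names pure add]:
  assumes U: "open U" and "C \<in> sections (tensor_presheaf A F G) U"
    and "\<And>s t. s \<in> sections F U \<Longrightarrow> t \<in> sections G U \<Longrightarrow> P (tensor_elem A F G U s t)"
    and "\<And>C D. C \<in> sections (tensor_presheaf A F G) U \<Longrightarrow> D \<in> sections (tensor_presheaf A F G) U \<Longrightarrow>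
      P C \<Longrightarrow> P D \<Longrightarrow> P (C \<oplus>\<^bsub>Sec (tensor_presheaf A F G) U\<^esub> D)"
  shows "P C"
  using assms(2-4) unfolding Sec_tensor_presheaf tensor_elem_def
  by (rule module_pair.tensor_module_induct[OF presheaf_module_pair[OF F G U]])

text \<open>The universal property for modules gives one map for each open set, chosen without
  regard to restriction. The maps fit together because additive maps that agree on elementary
  tensors are equal, and there both sides are values of \<open>b\<close>.\<close>

lemma tensor_presheaf_lift:
  assumes H: "module_presheaf A H"
    and closed: "\<And>U s t. open U \<Longrightarrow> U \<subseteq> U0 \<Longrightarrow> s \<in> sections F U \<Longrightarrow> t \<in> sections G U \<Longrightarrow> b U s t \<in> sections H U"
    and add_left: "\<And>U s s' t. open U \<Longrightarrow> U \<subseteq> U0 \<Longrightarrow> s \<in> sections F U \<Longrightarrow> s' \<in> sections F U \<Longrightarrow> t \<in> sections G U \<Longrightarrow>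
      b U (s \<oplus>\<^bsub>Sec F U\<^esub> s') t = b U s t \<oplus>\<^bsub>Sec H U\<^esub> b U s' t"
    and add_right: "\<And>U s t t'. open U \<Longrightarrow> U \<subseteq> U0 \<Longrightarrow> s \<in> sections F U \<Longrightarrow> t \<in> sections G U \<Longrightarrow> t' \<in> sections G U \<Longrightarrow>
      b U s (t \<oplus>\<^bsub>Sec G U\<^esub> t') = b U s t \<oplus>\<^bsub>Sec H U\<^esub> b U s t'"
    and balanced: "\<And>U f s t. open U \<Longrightarrow> U \<subseteq> U0 \<Longrightarrow> f \<in> smooth_fun A U \<Longrightarrow> s \<in> sections F U \<Longrightarrow> t \<in> sections G U \<Longrightarrow>
      b U (f \<odot>\<^bsub>Sec F U\<^esub> s) t = b U s (f \<odot>\<^bsub>Sec G U\<^esub> t)"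
    and Res: "\<And>U V s t. open U \<Longrightarrow> U \<subseteq> U0 \<Longrightarrow> open V \<Longrightarrow> V \<subseteq> U \<Longrightarrow> s \<in> sections F U \<Longrightarrow> t \<in> sections G U \<Longrightarrow>
      b V (Res F U V s) (Res G U V t) = Res H U V (b U s t)"
  shows "\<exists>h. additive_map_on U0 (tensor_presheaf A F G) H h \<and>
    (\<forall>U. open U \<and> U \<subseteq> U0 \<longrightarrow> (\<forall>s\<in>sections F U. \<forall>t\<in>sections G U. h U (tensor_elem A F G U s t) = b U s t))"
proof -
  let ?P = "tensor_presheaf A F G"
  define lift where "lift = (\<lambda>U k. (\<forall>C\<in>sections ?P U. k C \<in> sections H U) \<and>
      (\<forall>C\<in>sections ?P U. \<forall>D\<in>sections ?P U. k (C \<oplus>\<^bsub>Sec ?P U\<^esub> D) = k C \<oplus>\<^bsub>Sec H U\<^esub> k D) \<and>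
      (\<forall>s\<in>sections F U. \<forall>t\<in>sections G U. k (tensor_elem A F G U s t) = b U s t))"
  have "\<exists>k. lift U k" if U: "open U" "U \<subseteq> U0" for U
  proof -
    interpret U: module_pair "Cinf A U" "Sec F U" "Sec G U" by (rule presheaf_module_pair[OF F G U(1)])
    have "abelian_group (Sec H U)"
      using presheaf_module[OF H U(1)] by (simp add: Module.module_def)
    from U.tensor_module_lift[OF this, of "b U"] show ?thesis
      unfolding lift_def Sec_tensor_presheaf tensor_elem_def
      using closed[OF U] add_left[OF U] add_right[OF U] balanced[OF U] by (simp add: carrier_Cinf)
  qed
  then obtain h where "\<And>U. open U \<Longrightarrow> U \<subseteq> U0 \<Longrightarrow> lift U (h U)" by metis
  then have h: "\<And>U C. open U \<Longrightarrow> U \<subseteq> U0 \<Longrightarrow> C \<in> sections ?P U \<Longrightarrow> h U C \<in> sections H U"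
    "\<And>U C D. open U \<Longrightarrow> U \<subseteq> U0 \<Longrightarrow> C \<in> sections ?P U \<Longrightarrow> D \<in> sections ?P U \<Longrightarrow>
      h U (C \<oplus>\<^bsub>Sec ?P U\<^esub> D) = h U C \<oplus>\<^bsub>Sec H U\<^esub> h U D"
    "\<And>U s t. open U \<Longrightarrow> U \<subseteq> U0 \<Longrightarrow> s \<in> sections F U \<Longrightarrow> t \<in> sections G U \<Longrightarrow> h U (tensor_elem A F G U s t) = b U s t"
    unfolding lift_def by blast+
  have "additive_map_on U0 ?P H h"
  proof (rule additive_mapI)
    fix U V C assume U: "open U" "open V" "V \<subseteq> U" "U \<subseteq> U0" and C: "C \<in> sections ?P U"
    have V0: "V \<subseteq> U0" using U by auto
    note P = tensor_presheaf_presheaf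
    show "h V (Res ?P U V C) = Res H U V (h U C)"
      using U(1) C
    proof (induction rule: tensor_presheaf_induct)
      case (pure s t)
      then show ?case
        using U V0 by (simp add: tensor_elem_Res h(3) Res presheaf_Res_closed[OF F] presheaf_Res_closed[OF G])
    next
      case (add C D)
      then show ?case
        using U V0 by (simp add: presheaf_Res_add[OF P] presheaf_Res_add[OF H] presheaf_Res_closed[OF P] h)
    qed
  qed (simp_all add: h)
  then show ?thesis using h(3) by blast
qed

end

end

section \<open>The tensor product of sheaves\<close>

text \<open>Biadditive, balanced and compatible with restriction, but linearity over smooth
  functions is left out: the tensor product of two connections is an instance. The open subspace
  \<open>U0\<close> serves maps that involve a fixed section over \<open>U0\<close>.\<close>

definition balanced_map_on ::
  "('x::{t2_space,second_countable_topology}, 'b::real_normed_vector) atlas \<Rightarrow> 'x set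
     \<Rightarrow> ('x, 's) mod_sheaf \<Rightarrow> ('x, 't) mod_sheaf \<Rightarrow> ('x, 'u) mod_sheaf \<Rightarrow> ('x set \<Rightarrow> 's \<Rightarrow> 't \<Rightarrow> 'u) \<Rightarrow> bool" where
  "balanced_map_on A U0 F G H b \<longleftrightarrow>
    (\<forall>U. open U \<and> U \<subseteq> U0 \<longrightarrow> (\<forall>s\<in>sections F U. \<forall>t\<in>sections G U.
       b U s t \<in> sections H U \<and>
       (\<forall>s'\<in>sections F U. b U (s \<oplus>\<^bsub>Sec F U\<^esub> s') t = b U s t \<oplus>\<^bsub>Sec H U\<^esub> b U s' t) \<and>
       (\<forall>t'\<in>sections G U. b U s (t \<oplus>\<^bsub>Sec G U\<^esub> t') = b U s t \<oplus>\<^bsub>Sec H U\<^esub> b U s t') \<and>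
       (\<forall>f\<in>smooth_fun A U. b U (f \<odot>\<^bsub>Sec F U\<^esub> s) t = b U s (f \<odot>\<^bsub>Sec G U\<^esub> t)) \<and>
       (\<forall>V. open V \<and> V \<subseteq> U \<longrightarrow> b V (Res F U V s) (Res G U V t) = Res H U V (b U s t))))"

abbreviation "balanced_map A \<equiv> balanced_map_on A UNIV"

lemma
  assumes "balanced_map_on A U0 F G H b" "open U" "U \<subseteq> U0" "s \<in> sections F U" "t \<in> sections G U"
  shows balanced_map_closed: "b U s t \<in> sections H U"
    and balanced_map_add_left: "s' \<in> sections F U \<Longrightarrow> b U (s \<oplus>\<^bsub>Sec F U\<^esub> s') t = b U s t \<oplus>\<^bsub>Sec H U\<^esub> b U s' t"
    and balanced_map_add_right: "t' \<in> sections G U \<Longrightarrow> b U s (t \<oplus>\<^bsub>Sec G U\<^esub> t') = b U s t \<oplus>\<^bsub>Sec H U\<^esub> b U s t'"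
    and balanced_map_balanced: "f \<in> smooth_fun A U \<Longrightarrow> b U (f \<odot>\<^bsub>Sec F U\<^esub> s) t = b U s (f \<odot>\<^bsub>Sec G U\<^esub> t)"
    and balanced_map_Res: "open V \<Longrightarrow> V \<subseteq> U \<Longrightarrow> b V (Res F U V s) (Res G U V t) = Res H U V (b U s t)"
proof -
  note D = assms(1)[unfolded balanced_map_on_def, THEN spec, THEN mp, OF conjI[OF assms(2,3)],
      THEN bspec, OF assms(4), THEN bspec, OF assms(5)]
  show "b U s t \<in> sections H U"
    by (rule D[THEN conjunct1])
  show "s' \<in> sections F U \<Longrightarrow> b U (s \<oplus>\<^bsub>Sec F U\<^esub> s') t = b U s t \<oplus>\<^bsub>Sec H U\<^esub> b U s' t"
    by (rule D[THEN conjunct2, THEN conjunct1, THEN bspec])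
  show "t' \<in> sections G U \<Longrightarrow> b U s (t \<oplus>\<^bsub>Sec G U\<^esub> t') = b U s t \<oplus>\<^bsub>Sec H U\<^esub> b U s t'"
    by (rule D[THEN conjunct2, THEN conjunct2, THEN conjunct1, THEN bspec])
  show "f \<in> smooth_fun A U \<Longrightarrow> b U (f \<odot>\<^bsub>Sec F U\<^esub> s) t = b U s (f \<odot>\<^bsub>Sec G U\<^esub> t)"
    by (rule D[THEN conjunct2, THEN conjunct2, THEN conjunct2, THEN conjunct1, THEN bspec])
  show "open V \<Longrightarrow> V \<subseteq> U \<Longrightarrow> b V (Res F U V s) (Res G U V t) = Res H U V (b U s t)"
    by (rule D[THEN conjunct2, THEN conjunct2, THEN conjunct2, THEN conjunct2, THEN spec, THEN mp, OF conjI])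
qed

lemma balanced_mapI:
  assumes "\<And>U s t. open U \<Longrightarrow> U \<subseteq> U0 \<Longrightarrow> s \<in> sections F U \<Longrightarrow> t \<in> sections G U \<Longrightarrow> b U s t \<in> sections H U"
    and "\<And>U s s' t. open U \<Longrightarrow> U \<subseteq> U0 \<Longrightarrow> s \<in> sections F U \<Longrightarrow> s' \<in> sections F U \<Longrightarrow> t \<in> sections G U \<Longrightarrow>
      b U (s \<oplus>\<^bsub>Sec F U\<^esub> s') t = b U s t \<oplus>\<^bsub>Sec H U\<^esub> b U s' t"
    and "\<And>U s t t'. open U \<Longrightarrow> U \<subseteq> U0 \<Longrightarrow> s \<in> sections F U \<Longrightarrow> t \<in> sections G U \<Longrightarrow> t' \<in> sections G U \<Longrightarrow>
      b U s (t \<oplus>\<^bsub>Sec G U\<^esub> t') = b U s t \<oplus>\<^bsub>Sec H U\<^esub> b U s t'"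
    and "\<And>U f s t. open U \<Longrightarrow> U \<subseteq> U0 \<Longrightarrow> f \<in> smooth_fun A U \<Longrightarrow> s \<in> sections F U \<Longrightarrow> t \<in> sections G U \<Longrightarrow>
      b U (f \<odot>\<^bsub>Sec F U\<^esub> s) t = b U s (f \<odot>\<^bsub>Sec G U\<^esub> t)"
    and "\<And>U V s t. open U \<Longrightarrow> U \<subseteq> U0 \<Longrightarrow> open V \<Longrightarrow> V \<subseteq> U \<Longrightarrow> s \<in> sections F U \<Longrightarrow> t \<in> sections G U \<Longrightarrow>
      b V (Res F U V s) (Res G U V t) = Res H U V (b U s t)"
  shows "balanced_map_on A U0 F G H b"
  using assms unfolding balanced_map_on_def by simp

context smooth_mfd
begin

lemma smooth_fun_cut_self: "f \<in> smooth_fun A U \<Longrightarrow> cut U f = f"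
  using smooth_funD(1) by (fastforce simp: cut_def)

text \<open>Multiplication by one function over \<open>U\<close>, seen as a map of sheaves on the
  open subspace \<open>U\<close>. With it, linearity becomes an equality of two additive maps and
  follows from uniqueness of lifts.\<close>

lemma additive_map_smult:
  assumes F: "module_presheaf A F" and U: "open U" and f: "f \<in> smooth_fun A U"
  shows "additive_map_on U F F (\<lambda>V s. cut V f \<odot>\<^bsub>Sec F V\<^esub> s)"
proof (rule additive_mapI)
  fix V W s assume V: "open V" "open W" "W \<subseteq> V" "V \<subseteq> U" and s: "s \<in> sections F V"
  show "cut W f \<odot>\<^bsub>Sec F W\<^esub> Res F V W s = Res F V W (cut V f \<odot>\<^bsub>Sec F V\<^esub> s)"
    using presheaf_Res_smult[OF F V(1-3) smooth_fun_cut[OF f V(1,4)] s] V by (simp add: cut_cut)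
qed (simp_all add: presheaf_smult_closed[OF F] presheaf_smult_add[OF F] smooth_fun_cut[OF f])

lemma additive_map_sum:
  assumes G: "module_presheaf A G" and h: "additive_map_on U F G h" and k: "additive_map_on U F G k"
  shows "additive_map_on U F G (\<lambda>V s. h V s \<oplus>\<^bsub>Sec G V\<^esub> k V s)"
proof (rule additive_mapI)
  fix V s t assume V: "open V" "V \<subseteq> U" and s: "s \<in> sections F V" "t \<in> sections F V"
  note c = additive_map_closed[OF h V] additive_map_closed[OF k V]
  show "h V (s \<oplus>\<^bsub>Sec F V\<^esub> t) \<oplus>\<^bsub>Sec G V\<^esub> k V (s \<oplus>\<^bsub>Sec F V\<^esub> t) =
      h V s \<oplus>\<^bsub>Sec G V\<^esub> k V s \<oplus>\<^bsub>Sec G V\<^esub> (h V t \<oplus>\<^bsub>Sec G V\<^esub> k V t)"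
    using s c presheaf_add_closed[OF G V(1)]
    by (simp add: additive_map_add[OF h V] additive_map_add[OF k V] presheaf_add_assoc[OF G V(1)]
        presheaf_add_lcomm[OF G V(1)])
next
  fix V W s assume V: "open V" "open W" "W \<subseteq> V" "V \<subseteq> U" and s: "s \<in> sections F V"
  show "h W (Res F V W s) \<oplus>\<^bsub>Sec G W\<^esub> k W (Res F V W s) = Res G V W (h V s \<oplus>\<^bsub>Sec G V\<^esub> k V s)"
    using s V by (simp add: presheaf_Res_add[OF G V(1-3)] additive_map_Res[OF h V(1,4,2,3)]
        additive_map_Res[OF k V(1,4,2,3)] additive_map_closed[OF h] additive_map_closed[OF k])
qed (simp add: presheaf_add_closed[OF G] additive_map_closed[OF h] additive_map_closed[OF k])

lemma pure_germs: "pure A F G U s t = germs (tensor_presheaf A F G) U (tensor_elem A F G U s t)"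
  by (simp add: pure_def germs_def tensor_elem_def)

context
  fixes F :: "('x, 's) mod_sheaf" and G :: "('x, 't) mod_sheaf"
  assumes F: "module_presheaf A F" and G: "module_presheaf A G"
begin

lemma tensor_sheaf: "module_sheaf A (tensor A F G)"
  unfolding tensor_def by (rule sheafify_sheaf[OF tensor_presheaf_presheaf[OF F G]])

lemma tensor_module_presheaf: "module_presheaf A (tensor A F G)"
  by (rule module_sheaf_presheaf[OF tensor_sheaf])

lemma
  assumes U: "open U"
  shows pure_closed: "s \<in> sections F U \<Longrightarrow> t \<in> sections G U \<Longrightarrow> pure A F G U s t \<in> sections (tensor A F G) U"
    and pure_add_left: "s \<in> sections F U \<Longrightarrow> s' \<in> sections F U \<Longrightarrow> t \<in> sections G U \<Longrightarrow>
      pure A F G U (s \<oplus>\<^bsub>Sec F U\<^esub> s') t = pure A F G U s t \<oplus>\<^bsub>Sec (tensor A F G) U\<^esub> pure A F G U s' t"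
    and pure_add_right: "s \<in> sections F U \<Longrightarrow> t \<in> sections G U \<Longrightarrow> t' \<in> sections G U \<Longrightarrow>
      pure A F G U s (t \<oplus>\<^bsub>Sec G U\<^esub> t') = pure A F G U s t \<oplus>\<^bsub>Sec (tensor A F G) U\<^esub> pure A F G U s t'"
    and pure_smult_left: "f \<in> smooth_fun A U \<Longrightarrow> s \<in> sections F U \<Longrightarrow> t \<in> sections G U \<Longrightarrow>
      pure A F G U (f \<odot>\<^bsub>Sec F U\<^esub> s) t = f \<odot>\<^bsub>Sec (tensor A F G) U\<^esub> pure A F G U s t"
    and pure_smult_right: "f \<in> smooth_fun A U \<Longrightarrow> s \<in> sections F U \<Longrightarrow> t \<in> sections G U \<Longrightarrow>
      pure A F G U s (f \<odot>\<^bsub>Sec G U\<^esub> t) = f \<odot>\<^bsub>Sec (tensor A F G) U\<^esub> pure A F G U s t"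
    and pure_Res: "open V \<Longrightarrow> V \<subseteq> U \<Longrightarrow> s \<in> sections F U \<Longrightarrow> t \<in> sections G U \<Longrightarrow>
      Res (tensor A F G) U V (pure A F G U s t) = pure A F G V (Res F U V s) (Res G U V t)"
proof -
  note P = tensor_presheaf_presheaf[OF F G]
  note E = tensor_elem_closed[OF F G U]
  note pure_germs[simp] tensor_def[simp]
  show "s \<in> sections F U \<Longrightarrow> t \<in> sections G U \<Longrightarrow> pure A F G U s t \<in> sections (tensor A F G) U"
    by (simp add: germs_section[OF U E])
  show "s \<in> sections F U \<Longrightarrow> s' \<in> sections F U \<Longrightarrow> t \<in> sections G U \<Longrightarrow>
      pure A F G U (s \<oplus>\<^bsub>Sec F U\<^esub> s') t = pure A F G U s t \<oplus>\<^bsub>Sec (tensor A F G) U\<^esub> pure A F G U s' t"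
    by (simp add: tensor_elem_add_left[OF F G U] germs_add[OF P U E E])
  show "s \<in> sections F U \<Longrightarrow> t \<in> sections G U \<Longrightarrow> t' \<in> sections G U \<Longrightarrow>
      pure A F G U s (t \<oplus>\<^bsub>Sec G U\<^esub> t') = pure A F G U s t \<oplus>\<^bsub>Sec (tensor A F G) U\<^esub> pure A F G U s t'"
    by (simp add: tensor_elem_add_right[OF F G U] germs_add[OF P U E E])
  show "f \<in> smooth_fun A U \<Longrightarrow> s \<in> sections F U \<Longrightarrow> t \<in> sections G U \<Longrightarrow>
      pure A F G U (f \<odot>\<^bsub>Sec F U\<^esub> s) t = f \<odot>\<^bsub>Sec (tensor A F G) U\<^esub> pure A F G U s t"
    by (simp add: tensor_elem_smult[OF F G U] germs_smult[OF P U E])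
  show "f \<in> smooth_fun A U \<Longrightarrow> s \<in> sections F U \<Longrightarrow> t \<in> sections G U \<Longrightarrow>
      pure A F G U s (f \<odot>\<^bsub>Sec G U\<^esub> t) = f \<odot>\<^bsub>Sec (tensor A F G) U\<^esub> pure A F G U s t"
    by (simp add: tensor_elem_smult[OF F G U] germs_smult[OF P U E] flip: tensor_elem_balanced[OF F G U])
  show "open V \<Longrightarrow> V \<subseteq> U \<Longrightarrow> s \<in> sections F U \<Longrightarrow> t \<in> sections G U \<Longrightarrow>
      Res (tensor A F G) U V (pure A F G U s t) = pure A F G V (Res F U V s) (Res G U V t)"
    by (simp add: tensor_elem_Res[OF F G U] Res_germs[OF P U _ _ E])
qed

text \<open>Near each point a section of the sheafification comes from the presheaf, where it is a
  finite sum of pure tensors. The case \<open>local\<close> is the passage back from neighbourhoods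
  to \<open>U\<close>; it holds for properties that are local in nature.\<close>

lemma tensor_induct [consumes 2, case_names pure add local]:
  assumes U: "open U" and z: "z \<in> sections (tensor A F G) U"
    and pure: "\<And>V s t. open V \<Longrightarrow> V \<subseteq> U \<Longrightarrow> s \<in> sections F V \<Longrightarrow> t \<in> sections G V \<Longrightarrow> P V (pure A F G V s t)"
    and add: "\<And>V z w. open V \<Longrightarrow> V \<subseteq> U \<Longrightarrow> z \<in> sections (tensor A F G) V \<Longrightarrow> w \<in> sections (tensor A F G) V \<Longrightarrow>
      P V z \<Longrightarrow> P V w \<Longrightarrow> P V (z \<oplus>\<^bsub>Sec (tensor A F G) V\<^esub> w)"
    and local: "(\<And>x. x \<in> U \<Longrightarrow> \<exists>V. open V \<and> x \<in> V \<and> V \<subseteq> U \<and> P V (Res (tensor A F G) U V z)) \<Longrightarrow> P U z"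
  shows "P U z"
proof (rule local)
  fix x assume "x \<in> U"
  from sheafify_section_local[OF z[unfolded tensor_def] this] obtain V C where
    V: "open V" "x \<in> V" "V \<subseteq> U" "C \<in> sections (tensor_presheaf A F G) V"
      "Res (tensor A F G) U V z = germs (tensor_presheaf A F G) V C" unfolding tensor_def by metis
  note Pp = tensor_presheaf_presheaf[OF F G]
  have "P V (germs (tensor_presheaf A F G) V C)" using V(1,4)
  proof (induction rule: tensor_presheaf_induct[OF F G, consumes 2, case_names pure add])
    case (pure s t)
    then show ?case using assms(3)[OF V(1,3)] by (simp add: pure_germs)
  next
    case (add C D)
    then show ?case
      using assms(4)[OF V(1,3) germs_section[OF V(1) add(1), folded tensor_def] germs_section[OF V(1) add(2), folded tensor_def]]
      by (simp add: tensor_def germs_add[OF Pp V(1)])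
  qed
  then show "\<exists>V. open V \<and> x \<in> V \<and> V \<subseteq> U \<and> P V (Res (tensor A F G) U V z)"
    using V by auto
qed

text \<open>Additivity of both maps handles sums, and the separation axiom of the target handles the
  step from neighbourhoods to \<open>U\<close>. All later identities between maps out of a tensor
  product are reduced to pure tensors by this uniqueness.\<close>

lemma tensor_additive_eqI:
  assumes H: "module_sheaf A H" and h: "additive_map_on U (tensor A F G) H h"
    and k: "additive_map_on U (tensor A F G) H k"
    and eq: "\<And>V s t. open V \<Longrightarrow> V \<subseteq> U \<Longrightarrow> s \<in> sections F V \<Longrightarrow> t \<in> sections G V \<Longrightarrow>
      h V (pure A F G V s t) = k V (pure A F G V s t)"
    and U: "open U" "z \<in> sections (tensor A F G) U"
  shows "h U z = k U z"
  using U
proof (induction rule: tensor_induct)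
  case (add V z w)
  then show ?case by (simp add: additive_map_add[OF h] additive_map_add[OF k])
next
  case local
  show ?case
  proof (rule sheaf_eqI[OF H U(1)])
    show "h U z \<in> sections H U" "k U z \<in> sections H U"
      using additive_map_closed[OF h U(1)] additive_map_closed[OF k U(1)] U(2) by auto
    fix x assume "x \<in> U"
    from local[OF this] show "\<exists>V. open V \<and> x \<in> V \<and> V \<subseteq> U \<and> Res H U V (h U z) = Res H U V (k U z)"
      using additive_map_Res[OF h U(1)] additive_map_Res[OF k U(1)] U(2) by fastforce
  qed
qed (rule eq)

text \<open>For fixed \<open>f\<close> over \<open>U\<close>, multiplying before or after applying
  \<open>h\<close> gives two additive maps on \<open>U\<close>. They agree on pure tensors by
  \<open>lin\<close>, where \<open>f\<close> can be absorbed into the left factor.\<close>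

lemma tensor_sheaf_homI:
  assumes H: "module_sheaf A H" and h: "additive_map (tensor A F G) H h"
    and lin: "\<And>V f s t. open V \<Longrightarrow> f \<in> smooth_fun A V \<Longrightarrow> s \<in> sections F V \<Longrightarrow> t \<in> sections G V \<Longrightarrow>
      h V (pure A F G V (f \<odot>\<^bsub>Sec F V\<^esub> s) t) = f \<odot>\<^bsub>Sec H V\<^esub> h V (pure A F G V s t)"
  shows "sheaf_hom A (tensor A F G) H h"
  unfolding sheaf_hom_on_def
proof (intro conjI h allI impI ballI)
  fix U f z assume "open U \<and> U \<subseteq> UNIV" and f: "f \<in> smooth_fun A U" and z: "z \<in> sections (tensor A F G) U"
  then have U: "open U" by simp
  note hU = additive_map_mono[OF h subset_UNIV[of U]]
  have "h U (cut U f \<odot>\<^bsub>Sec (tensor A F G) U\<^esub> z) = cut U f \<odot>\<^bsub>Sec H U\<^esub> h U z"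
  proof (rule tensor_additive_eqI[OF H _ _ _ U z])
    show "additive_map_on U (tensor A F G) H (\<lambda>V z. h V (cut V f \<odot>\<^bsub>Sec (tensor A F G) V\<^esub> z))"
      by (rule additive_map_comp[OF additive_map_smult[OF tensor_module_presheaf U f] hU])
    show "additive_map_on U (tensor A F G) H (\<lambda>V z. cut V f \<odot>\<^bsub>Sec H V\<^esub> h V z)"
      by (rule additive_map_comp[OF hU additive_map_smult[OF module_sheaf_presheaf[OF H] U f]])
    fix V s t assume "open V" "V \<subseteq> U" "s \<in> sections F V" "t \<in> sections G V"
    then show "h V (cut V f \<odot>\<^bsub>Sec (tensor A F G) V\<^esub> pure A F G V s t) = cut V f \<odot>\<^bsub>Sec H V\<^esub> h V (pure A F G V s t)"
      using lin smooth_fun_cut[OF f] by (simp flip: pure_smult_left)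
  qed
  then show "h U (f \<odot>\<^bsub>Sec (tensor A F G) U\<^esub> z) = f \<odot>\<^bsub>Sec H U\<^esub> h U z"
    by (simp add: smooth_fun_cut_self[OF f])
qed

lemma tensor_lift_exists:
  assumes H: "module_sheaf A H" and b: "balanced_map_on A U0 F G H b"
  shows "\<exists>h. additive_map_on U0 (tensor A F G) H h \<and>
    (\<forall>U. open U \<and> U \<subseteq> U0 \<longrightarrow> (\<forall>s\<in>sections F U. \<forall>t\<in>sections G U. h U (pure A F G U s t) = b U s t))"
proof -
  have "\<exists>h. additive_map_on U0 (tensor_presheaf A F G) H h \<and>
    (\<forall>U. open U \<and> U \<subseteq> U0 \<longrightarrow> (\<forall>s\<in>sections F U. \<forall>t\<in>sections G U. h U (tensor_elem A F G U s t) = b U s t))"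
    by (rule tensor_presheaf_lift[OF F G module_sheaf_presheaf[OF H]],
        (rule balanced_map_closed[OF b], assumption+), (rule balanced_map_add_left[OF b], assumption+),
        (rule balanced_map_add_right[OF b], assumption+), (rule balanced_map_balanced[OF b], assumption+),
        (rule balanced_map_Res[OF b], assumption+))
  then obtain h0 where h0': "additive_map_on U0 (tensor_presheaf A F G) H h0 \<and>
    (\<forall>U. open U \<and> U \<subseteq> U0 \<longrightarrow> (\<forall>s\<in>sections F U. \<forall>t\<in>sections G U. h0 U (tensor_elem A F G U s t) = b U s t))"
    by (rule exE)
  note h0 = conjunct1[OF h0'] conjunct2[OF h0', rule_format, OF conjI]
  from sheafify_lift[OF tensor_presheaf_presheaf[OF F G] H h0(1)] obtain h where
    h: "additive_map_on U0 (tensor A F G) H h"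
    "\<And>U C. open U \<Longrightarrow> U \<subseteq> U0 \<Longrightarrow> C \<in> sections (tensor_presheaf A F G) U \<Longrightarrow>
      h U (germs (tensor_presheaf A F G) U C) = h0 U C" unfolding tensor_def by blast
  have "h U (pure A F G U s t) = b U s t"
    if "open U" "U \<subseteq> U0" "s \<in> sections F U" "t \<in> sections G U" for U s t
    using h(2)[OF that(1,2) tensor_elem_closed[OF F G that(1,3,4)]] h0(2)[OF that] by (simp add: pure_germs)
  then show ?thesis using h(1) by blast
qed

text \<open>The choice in \<open>tensor_lift\<close> is meaningful once some lift exists; from here
  on its defining properties are available for every balanced map into a sheaf.\<close>

lemma
  assumes H: "module_sheaf A H" and b: "balanced_map A F G H b"
  shows tensor_lift_additive: "additive_map (tensor A F G) H (tensor_lift A F G H b)"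
    and tensor_lift_pure: "open U \<Longrightarrow> s \<in> sections F U \<Longrightarrow> t \<in> sections G U \<Longrightarrow>
      tensor_lift A F G H b U (pure A F G U s t) = b U s t"
proof -
  define spec where "spec = (\<lambda>h. additive_map (tensor A F G) H h \<and>
    (\<forall>U. open U \<longrightarrow> (\<forall>s\<in>sections F U. \<forall>t\<in>sections G U. h U (pure A F G U s t) = b U s t)))"
  obtain h where h: "spec h" using tensor_lift_exists[OF H b] by (auto simp: spec_def)
  have "tensor_lift A F G H b = (SOME h. spec h)" by (simp add: tensor_lift_def spec_def)
  then have "spec (tensor_lift A F G H b)" using someI[of spec, OF h] by simp
  then have "additive_map (tensor A F G) H (tensor_lift A F G H b) \<and>
    (\<forall>U. open U \<longrightarrow> (\<forall>s\<in>sections F U. \<forall>t\<in>sections G U. tensor_lift A F G H b U (pure A F G U s t) = b U s t))"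
    unfolding spec_def .
  then show "additive_map (tensor A F G) H (tensor_lift A F G H b)"
    "open U \<Longrightarrow> s \<in> sections F U \<Longrightarrow> t \<in> sections G U \<Longrightarrow> tensor_lift A F G H b U (pure A F G U s t) = b U s t"
    by blast+
qed

lemma tensor_lift_hom:
  assumes H: "module_sheaf A H" and b: "balanced_map A F G H b"
    and lin: "\<And>V f s t. open V \<Longrightarrow> f \<in> smooth_fun A V \<Longrightarrow> s \<in> sections F V \<Longrightarrow> t \<in> sections G V \<Longrightarrow>
      b V (f \<odot>\<^bsub>Sec F V\<^esub> s) t = f \<odot>\<^bsub>Sec H V\<^esub> b V s t"
  shows "sheaf_hom A (tensor A F G) H (tensor_lift A F G H b)"
  by (rule tensor_sheaf_homI[OF H tensor_lift_additive[OF H b]])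
    (simp add: tensor_lift_pure[OF H b] presheaf_smult_closed[OF F] lin)

end

section \<open>Functoriality, associativity and exchange of tensor factors\<close>

lemma tensor_map_balanced:
  assumes F: "module_presheaf A F" and G: "module_presheaf A G"
    and F': "module_presheaf A F'" and G': "module_presheaf A G'"
    and f: "sheaf_hom A F F' f" and g: "sheaf_hom A G G' g"
  shows "balanced_map A F G (tensor A F' G') (\<lambda>U s t. pure A F' G' U (f U s) (g U t))"
proof -
  note fa = sheaf_hom_additive[OF f] and ga = sheaf_hom_additive[OF g]
  note c = additive_map_closed[OF fa] additive_map_closed[OF ga]
  show ?thesis
    by (rule balanced_mapI)
      (simp_all add: c pure_closed[OF F' G'] pure_add_left[OF F' G'] pure_add_right[OF F' G']
        additive_map_add[OF fa] additive_map_add[OF ga] sheaf_hom_smult[OF f] sheaf_hom_smult[OF g]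
        pure_smult_left[OF F' G'] pure_smult_right[OF F' G'] pure_Res[OF F' G']
        additive_map_Res[OF fa] additive_map_Res[OF ga])
qed

lemma
  assumes F: "module_presheaf A F" and G: "module_presheaf A G"
    and F': "module_presheaf A F'" and G': "module_presheaf A G'"
    and f: "sheaf_hom A F F' f" and g: "sheaf_hom A G G' g"
  shows tensor_map_hom: "sheaf_hom A (tensor A F G) (tensor A F' G') (tensor_map A F G F' G' f g)"
    and tensor_map_pure: "open U \<Longrightarrow> s \<in> sections F U \<Longrightarrow> t \<in> sections G U \<Longrightarrow>
      tensor_map A F G F' G' f g U (pure A F G U s t) = pure A F' G' U (f U s) (g U t)"
proof -
  note b = tensor_map_balanced[OF assms] and H = tensor_sheaf[OF F' G']
  show "sheaf_hom A (tensor A F G) (tensor A F' G') (tensor_map A F G F' G' f g)"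
    unfolding tensor_map_def
    by (rule tensor_lift_hom[OF F G H b])
      (simp add: sheaf_hom_smult[OF f] pure_smult_left[OF F' G']
        additive_map_closed[OF sheaf_hom_additive[OF f]] additive_map_closed[OF sheaf_hom_additive[OF g]])
  show "open U \<Longrightarrow> s \<in> sections F U \<Longrightarrow> t \<in> sections G U \<Longrightarrow>
      tensor_map A F G F' G' f g U (pure A F G U s t) = pure A F' G' U (f U s) (g U t)"
    unfolding tensor_map_def by (rule tensor_lift_pure[OF F G H b])
qed

text \<open>Linear over smooth functions in each argument. The first argument is the one to be held
  fixed while the other two are turned into a tensor product, whatever its place in the intended
  triple product.\<close>

definition trilinear_map ::
  "('x, 'p) mod_sheaf \<Rightarrow> ('x, 's) mod_sheaf \<Rightarrow> ('x, 't) mod_sheaf \<Rightarrow> ('x, 'u) mod_sheaf \<Rightarrow>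
    ('x set \<Rightarrow> 'p \<Rightarrow> 's \<Rightarrow> 't \<Rightarrow> 'u) \<Rightarrow> bool" where
  "trilinear_map P F G H c \<longleftrightarrow>
    (\<forall>U. open U \<longrightarrow> (\<forall>p\<in>sections P U. \<forall>s\<in>sections F U. \<forall>t\<in>sections G U.
       c U p s t \<in> sections H U \<and>
       (\<forall>p'\<in>sections P U. c U (p \<oplus>\<^bsub>Sec P U\<^esub> p') s t = c U p s t \<oplus>\<^bsub>Sec H U\<^esub> c U p' s t) \<and>
       (\<forall>s'\<in>sections F U. c U p (s \<oplus>\<^bsub>Sec F U\<^esub> s') t = c U p s t \<oplus>\<^bsub>Sec H U\<^esub> c U p s' t) \<and>
       (\<forall>t'\<in>sections G U. c U p s (t \<oplus>\<^bsub>Sec G U\<^esub> t') = c U p s t \<oplus>\<^bsub>Sec H U\<^esub> c U p s t') \<and>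
       (\<forall>f\<in>smooth_fun A U. c U (f \<odot>\<^bsub>Sec P U\<^esub> p) s t = f \<odot>\<^bsub>Sec H U\<^esub> c U p s t \<and>
          c U p (f \<odot>\<^bsub>Sec F U\<^esub> s) t = f \<odot>\<^bsub>Sec H U\<^esub> c U p s t \<and>
          c U p s (f \<odot>\<^bsub>Sec G U\<^esub> t) = f \<odot>\<^bsub>Sec H U\<^esub> c U p s t) \<and>
       (\<forall>V. open V \<and> V \<subseteq> U \<longrightarrow>
          c V (Res P U V p) (Res F U V s) (Res G U V t) = Res H U V (c U p s t))))"

text \<open>A trilinear map induces a map \<open>b\<close> on \<open>P \<times> (F \<otimes> G)\<close>: for a section \<open>p\<close> of \<open>P\<close> over \<open>U\<close>, lift the
  balanced map obtained by fixing \<open>p\<close> on the open subspace \<open>U\<close>. The properties of \<open>b\<close> in \<open>p\<close>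
  follow from the uniqueness of lifts.\<close>

lemma trilinear_lift:
  fixes P :: "('x, 'p) mod_sheaf" and F :: "('x, 's) mod_sheaf" and G :: "('x, 't) mod_sheaf"
  assumes P: "module_presheaf A P" and F: "module_presheaf A F" and G: "module_presheaf A G"
    and H: "module_sheaf A H" and c: "trilinear_map P F G H c"
  obtains b where "balanced_map A P (tensor A F G) H b"
    "\<And>U f p z. open U \<Longrightarrow> f \<in> smooth_fun A U \<Longrightarrow> p \<in> sections P U \<Longrightarrow> z \<in> sections (tensor A F G) U \<Longrightarrow>
      b U (f \<odot>\<^bsub>Sec P U\<^esub> p) z = f \<odot>\<^bsub>Sec H U\<^esub> b U p z"
    "\<And>U p s t. open U \<Longrightarrow> p \<in> sections P U \<Longrightarrow> s \<in> sections F U \<Longrightarrow> t \<in> sections G U \<Longrightarrow>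
      b U p (pure A F G U s t) = c U p s t"
proof -
  note Hp = module_sheaf_presheaf[OF H]
  let ?T = "tensor A F G"
  have c': "c U p s t \<in> sections H U"
    "p' \<in> sections P U \<Longrightarrow> c U (p \<oplus>\<^bsub>Sec P U\<^esub> p') s t = c U p s t \<oplus>\<^bsub>Sec H U\<^esub> c U p' s t"
    "s' \<in> sections F U \<Longrightarrow> c U p (s \<oplus>\<^bsub>Sec F U\<^esub> s') t = c U p s t \<oplus>\<^bsub>Sec H U\<^esub> c U p s' t"
    "t' \<in> sections G U \<Longrightarrow> c U p s (t \<oplus>\<^bsub>Sec G U\<^esub> t') = c U p s t \<oplus>\<^bsub>Sec H U\<^esub> c U p s t'"
    "f \<in> smooth_fun A U \<Longrightarrow> c U (f \<odot>\<^bsub>Sec P U\<^esub> p) s t = f \<odot>\<^bsub>Sec H U\<^esub> c U p s t"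
    "f \<in> smooth_fun A U \<Longrightarrow> c U p (f \<odot>\<^bsub>Sec F U\<^esub> s) t = f \<odot>\<^bsub>Sec H U\<^esub> c U p s t"
    "f \<in> smooth_fun A U \<Longrightarrow> c U p s (f \<odot>\<^bsub>Sec G U\<^esub> t) = f \<odot>\<^bsub>Sec H U\<^esub> c U p s t"
    "open V \<Longrightarrow> V \<subseteq> U \<Longrightarrow> c V (Res P U V p) (Res F U V s) (Res G U V t) = Res H U V (c U p s t)"
    if "open U" "p \<in> sections P U" "s \<in> sections F U" "t \<in> sections G U" for U p p' s s' t t' f V
    using c[unfolded trilinear_map_def, rule_format, OF that] by auto
  define lift where "lift = (\<lambda>U p h. additive_map_on U ?T H h \<and>
    (\<forall>V. open V \<and> V \<subseteq> U \<longrightarrow> (\<forall>s\<in>sections F V. \<forall>t\<in>sections G V.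
      h V (pure A F G V s t) = c V (Res P U V p) s t)))"
  have "\<exists>h. lift U p h" if U: "open U" and p: "p \<in> sections P U" for U p
  proof -
    have pc: "Res P U V p \<in> sections P V" if "open V" "V \<subseteq> U" for V
      using presheaf_Res_closed[OF P U that p] .
    have "balanced_map_on A U F G H (\<lambda>V s t. c V (Res P U V p) s t)"
    proof (rule balanced_mapI)
      fix V W s t assume V: "open V" "V \<subseteq> U" "open W" "W \<subseteq> V" and st: "s \<in> sections F V" "t \<in> sections G V"
      have "Res P U W p = Res P V W (Res P U V p)"
        using presheaf_Res_Res[OF P U V(1,3,2,4) p] by simp
      then show "c W (Res P U W p) (Res F V W s) (Res G V W t) = Res H V W (c V (Res P U V p) s t)"
        using c'(8)[OF V(1) pc[OF V(1,2)] st V(3,4)] by simp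
    qed (simp_all add: c' pc)
    from tensor_lift_exists[OF F G H this] show ?thesis unfolding lift_def by blast
  qed
  then obtain h where h: "\<And>U p. open U \<Longrightarrow> p \<in> sections P U \<Longrightarrow> lift U p (h U p)" by metis
  have ha: "additive_map_on U ?T H (h U p)" if "open U" "p \<in> sections P U" for U p
    using h[OF that] unfolding lift_def by blast
  have hp: "h U p V (pure A F G V s t) = c V (Res P U V p) s t"
    if "open U" "p \<in> sections P U" "open V" "V \<subseteq> U" "s \<in> sections F V" "t \<in> sections G V" for U p V s t
    using h[OF that(1,2)] that(3-6) unfolding lift_def by blast
  define b where "b = (\<lambda>U p z. h U p U z)"
  have lin: "b U (f \<odot>\<^bsub>Sec P U\<^esub> p) z = f \<odot>\<^bsub>Sec H U\<^esub> b U p z"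
    if U: "open U" and f: "f \<in> smooth_fun A U" and p: "p \<in> sections P U" and z: "z \<in> sections ?T U" for U f p z
  proof -
    note fp = presheaf_smult_closed[OF P U f p]
    have "h U (f \<odot>\<^bsub>Sec P U\<^esub> p) U z = cut U f \<odot>\<^bsub>Sec H U\<^esub> h U p U z"
    proof (rule tensor_additive_eqI[where k="\<lambda>V z. cut V f \<odot>\<^bsub>Sec H V\<^esub> h U p V z", OF F G H ha[OF U fp] _ _ U z])
      show "additive_map_on U ?T H (\<lambda>V z. cut V f \<odot>\<^bsub>Sec H V\<^esub> h U p V z)"
        by (rule additive_map_comp[OF ha[OF U p] additive_map_smult[OF Hp U f]])
      fix V s t assume V: "open V" "V \<subseteq> U" and st: "s \<in> sections F V" "t \<in> sections G V"
      show "h U (f \<odot>\<^bsub>Sec P U\<^esub> p) V (pure A F G V s t) = cut V f \<odot>\<^bsub>Sec H V\<^esub> h U p V (pure A F G V s t)"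
        using c'(5)[OF V(1) presheaf_Res_closed[OF P U V p] st smooth_fun_cut[OF f V]]
        by (simp add: hp[OF U fp V st] hp[OF U p V st] presheaf_Res_smult[OF P U V f p])
    qed
    then show ?thesis by (simp add: b_def smooth_fun_cut_self[OF f])
  qed
  have pu: "b U p (pure A F G U s t) = c U p s t"
    if "open U" "p \<in> sections P U" "s \<in> sections F U" "t \<in> sections G U" for U p s t
    using hp[OF that(1,2,1) order_refl that(3,4)] by (simp add: b_def presheaf_Res_id[OF P that(1,2)])
  have bal: "balanced_map A P ?T H b"
  proof (rule balanced_mapI)
    fix U p z assume U: "open U" and p: "p \<in> sections P U" and z: "z \<in> sections ?T U"
    show "b U p z \<in> sections H U"
      unfolding b_def by (rule additive_map_closed[OF ha[OF U p] U order_refl z])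
    {
      fix z' assume z': "z' \<in> sections ?T U"
      show "b U p (z \<oplus>\<^bsub>Sec ?T U\<^esub> z') = b U p z \<oplus>\<^bsub>Sec H U\<^esub> b U p z'"
        unfolding b_def by (rule additive_map_add[OF ha[OF U p] U order_refl z z'])
    }
    {
      fix p' assume p': "p' \<in> sections P U"
      note pp = presheaf_add_closed[OF P U p p']
      show "b U (p \<oplus>\<^bsub>Sec P U\<^esub> p') z = b U p z \<oplus>\<^bsub>Sec H U\<^esub> b U p' z"
        unfolding b_def
      proof (rule tensor_additive_eqI[OF F G H ha[OF U pp] additive_map_sum[OF Hp ha[OF U p] ha[OF U p']] _ U z])
        fix V s t assume V: "open V" "V \<subseteq> U" and st: "s \<in> sections F V" "t \<in> sections G V"
        show "h U (p \<oplus>\<^bsub>Sec P U\<^esub> p') V (pure A F G V s t) =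
            h U p V (pure A F G V s t) \<oplus>\<^bsub>Sec H V\<^esub> h U p' V (pure A F G V s t)"
          using c'(2)[OF V(1) presheaf_Res_closed[OF P U V p] st presheaf_Res_closed[OF P U V p']]
          by (simp add: hp[OF U pp V st] hp[OF U p V st] hp[OF U p' V st] presheaf_Res_add[OF P U V p p'])
      qed
    }
    {
      fix f assume f: "f \<in> smooth_fun A U"
      \<comment> \<open>Balancing is obtained by pulling \<open>f\<close> out of either argument:
        this is linearity in \<open>z\<close>, while \<open>lin\<close> is linearity in
        \<open>p\<close>.\<close>
      have "h U p U (cut U f \<odot>\<^bsub>Sec ?T U\<^esub> z) = cut U f \<odot>\<^bsub>Sec H U\<^esub> h U p U z"
      proof (rule tensor_additive_eqI[where h="\<lambda>V z. h U p V (cut V f \<odot>\<^bsub>Sec ?T V\<^esub> z)"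
            and k="\<lambda>V z. cut V f \<odot>\<^bsub>Sec H V\<^esub> h U p V z", OF F G H _ _ _ U z])
        show "additive_map_on U ?T H (\<lambda>V z. cut V f \<odot>\<^bsub>Sec H V\<^esub> h U p V z)"
          by (rule additive_map_comp[OF ha[OF U p] additive_map_smult[OF Hp U f]])
        show "additive_map_on U ?T H (\<lambda>V z. h U p V (cut V f \<odot>\<^bsub>Sec ?T V\<^esub> z))"
          by (rule additive_map_comp[OF additive_map_smult[OF tensor_module_presheaf[OF F G] U f] ha[OF U p]])
        fix V s t assume V: "open V" "V \<subseteq> U" and st: "s \<in> sections F V" "t \<in> sections G V"
        note fV = smooth_fun_cut[OF f V]
        show "h U p V (cut V f \<odot>\<^bsub>Sec ?T V\<^esub> pure A F G V s t) = cut V f \<odot>\<^bsub>Sec H V\<^esub> h U p V (pure A F G V s t)"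
          using hp[OF U p V presheaf_smult_closed[OF F V(1) fV st(1)] st(2)]
            c'(6)[OF V(1) presheaf_Res_closed[OF P U V p] st fV]
          by (simp add: hp[OF U p V st] pure_smult_left[OF F G V(1) fV st])
      qed
      then show "b U (f \<odot>\<^bsub>Sec P U\<^esub> p) z = b U p (f \<odot>\<^bsub>Sec ?T U\<^esub> z)"
        using lin[OF U f p z] by (simp add: b_def smooth_fun_cut_self[OF f])
    }
    fix V assume V: "open V" "V \<subseteq> U"
    note pV = presheaf_Res_closed[OF P U V p]
    note zV = presheaf_Res_closed[OF tensor_module_presheaf[OF F G] U V z]
    \<comment> \<open>The lift made for the restriction of \<open>p\<close> and the lift made for
      \<open>p\<close> were chosen independently. They agree on \<open>V\<close> by uniqueness,
      since both have the same values on pure tensors there.\<close>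
    have "h V (Res P U V p) V (Res ?T U V z) = h U p V (Res ?T U V z)"
    proof (rule tensor_additive_eqI[OF F G H ha[OF V(1) pV] additive_map_mono[OF ha[OF U p] V(2)] _ V(1) zV])
      fix W s t assume W: "open W" "W \<subseteq> V" and st: "s \<in> sections F W" "t \<in> sections G W"
      have "W \<subseteq> U" using W V by auto
      then show "h V (Res P U V p) W (pure A F G W s t) = h U p W (pure A F G W s t)"
        by (simp add: hp[OF V(1) pV W st] hp[OF U p W(1) _ st] presheaf_Res_Res[OF P U V(1) W(1) V(2) W(2) p])
    qed
    also have "\<dots> = Res H U V (h U p U z)"
      by (rule additive_map_Res[OF ha[OF U p] U order_refl V z])
    finally show "b V (Res P U V p) (Res ?T U V z) = Res H U V (b U p z)" by (simp add: b_def)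
  qed
  show thesis
    by (rule that, rule bal, rule lin, assumption+, rule pu, assumption+)
qed

text \<open>The factor \<open>H\<close> is held fixed first, so the trilinear map is stated with the
  section of \<open>H\<close> in front. The description of \<open>tensor_assoc\<close> prescribes
  values on triple pure tensors only; its linearity is regained from the bilinear map
  \<open>b\<close>.\<close>

lemma
  fixes F :: "('x, 's) mod_sheaf" and G :: "('x, 't) mod_sheaf" and H :: "('x, 'u) mod_sheaf"
  assumes F: "module_presheaf A F" and G: "module_presheaf A G" and H: "module_presheaf A H"
  shows tensor_assoc_hom:
      "sheaf_hom A (tensor A (tensor A F G) H) (tensor A F (tensor A G H)) (tensor_assoc A F G H)"
    and tensor_assoc_pure: "open U \<Longrightarrow> s \<in> sections F U \<Longrightarrow> t \<in> sections G U \<Longrightarrow> u \<in> sections H U \<Longrightarrow>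
      tensor_assoc A F G H U (pure A (tensor A F G) H U (pure A F G U s t) u) =
        pure A F (tensor A G H) U s (pure A G H U t u)"
proof -
  note FG = tensor_module_presheaf[OF F G] and GH = tensor_module_presheaf[OF G H]
  let ?K = "tensor A F (tensor A G H)" and ?D = "tensor A (tensor A F G) H"
  have K: "module_sheaf A ?K" by (rule tensor_sheaf[OF F GH])
  have "trilinear_map H F G ?K (\<lambda>U u s t. pure A F (tensor A G H) U s (pure A G H U t u))"
    unfolding trilinear_map_def
    by (simp add: pure_closed[OF F GH] pure_closed[OF G H] pure_add_left[OF G H] pure_add_right[OF G H]
        pure_add_left[OF F GH] pure_add_right[OF F GH] pure_smult_left[OF G H] pure_smult_right[OF G H]
        pure_smult_left[OF F GH] pure_smult_right[OF F GH] pure_Res[OF F GH] pure_Res[OF G H])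
  from trilinear_lift[OF H F G K this] obtain b where b: "balanced_map A H (tensor A F G) ?K b"
    "\<And>U f p z. open U \<Longrightarrow> f \<in> smooth_fun A U \<Longrightarrow> p \<in> sections H U \<Longrightarrow> z \<in> sections (tensor A F G) U \<Longrightarrow>
      b U (f \<odot>\<^bsub>Sec H U\<^esub> p) z = f \<odot>\<^bsub>Sec ?K U\<^esub> b U p z"
    "\<And>U p s t. open U \<Longrightarrow> p \<in> sections H U \<Longrightarrow> s \<in> sections F U \<Longrightarrow> t \<in> sections G U \<Longrightarrow>
      b U p (pure A F G U s t) = pure A F (tensor A G H) U s (pure A G H U t p)" by metis
  \<comment> \<open>Exchange of the two arguments restores the order (F \<otimes> G) \<otimes>
    H.\<close>
  have b': "balanced_map A (tensor A F G) H ?K (\<lambda>U z u. b U u z)"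
    by (rule balanced_mapI)
      (simp_all add: balanced_map_closed[OF b(1)] balanced_map_add_left[OF b(1)]
        balanced_map_add_right[OF b(1)] balanced_map_balanced[OF b(1)] balanced_map_Res[OF b(1)])
  from tensor_lift_exists[OF FG H K this] obtain h where h: "additive_map ?D ?K h"
    "\<And>U z u. open U \<Longrightarrow> z \<in> sections (tensor A F G) U \<Longrightarrow> u \<in> sections H U \<Longrightarrow>
      h U (pure A (tensor A F G) H U z u) = b U u z" by auto
  define spec where "spec = (\<lambda>h. additive_map ?D ?K h \<and>
     (\<forall>U. open U \<longrightarrow> (\<forall>s\<in>sections F U. \<forall>t\<in>sections G U. \<forall>u\<in>sections H U.
        h U (pure A (tensor A F G) H U (pure A F G U s t) u) = pure A F (tensor A G H) U s (pure A G H U t u))))"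
  have "spec h" using h b(3) pure_closed[OF F G] by (simp add: spec_def)
  moreover have "tensor_assoc A F G H = (SOME h. spec h)" by (simp add: tensor_assoc_def spec_def)
  ultimately have "spec (tensor_assoc A F G H)" using someI[of spec h] by simp
  then have a: "additive_map ?D ?K (tensor_assoc A F G H)"
    and ap: "\<And>U s t u. open U \<Longrightarrow> s \<in> sections F U \<Longrightarrow> t \<in> sections G U \<Longrightarrow> u \<in> sections H U \<Longrightarrow>
      tensor_assoc A F G H U (pure A (tensor A F G) H U (pure A F G U s t) u) =
        pure A F (tensor A G H) U s (pure A G H U t u)"
    unfolding spec_def by blast+
  then show "open U \<Longrightarrow> s \<in> sections F U \<Longrightarrow> t \<in> sections G U \<Longrightarrow> u \<in> sections H U \<Longrightarrow>
      tensor_assoc A F G H U (pure A (tensor A F G) H U (pure A F G U s t) u) =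
        pure A F (tensor A G H) U s (pure A G H U t u)" by blast
  \<comment> \<open>The chosen map is known where the left factor is itself pure. With
    \<open>u\<close> fixed, both sides are additive in \<open>z\<close> on \<open>U\<close>, so
    uniqueness extends the formula to every \<open>z\<close>.\<close>
  have az: "tensor_assoc A F G H U (pure A (tensor A F G) H U z u) = b U u z"
    if U: "open U" and z: "z \<in> sections (tensor A F G) U" and u: "u \<in> sections H U" for U z u
  proof -
    define k where "k = (\<lambda>V z. pure A (tensor A F G) H V z (Res H U V u))"
    have uV: "Res H U V u \<in> sections H V" if "open V" "V \<subseteq> U" for V
      using presheaf_Res_closed[OF H U that u] .
    have k: "additive_map_on U (tensor A F G) ?D k"
      by (rule additive_mapI) (simp_all add: k_def uV pure_closed[OF FG H] pure_add_left[OF FG H]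
          pure_Res[OF FG H] presheaf_Res_Res[OF H U _ _ _ _ u])
    have bu: "additive_map_on U (tensor A F G) ?K (\<lambda>V. b V (Res H U V u))"
      by (rule additive_mapI) (simp_all add: uV balanced_map_closed[OF b(1)] balanced_map_add_right[OF b(1)]
          balanced_map_Res[OF b(1), symmetric] presheaf_Res_Res[OF H U _ _ _ _ u])
    have "tensor_assoc A F G H U (k U z) = b U (Res H U U u) z"
    proof (rule tensor_additive_eqI[OF F G K additive_map_comp[OF k additive_map_mono[OF a subset_UNIV]] bu _ U z])
      fix V s t assume V: "open V" "V \<subseteq> U" and st: "s \<in> sections F V" "t \<in> sections G V"
      show "tensor_assoc A F G H V (k V (pure A F G V s t)) = b V (Res H U V u) (pure A F G V s t)"
        by (simp add: k_def ap[OF V(1) st uV[OF V]] b(3)[OF V(1) uV[OF V] st])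
    qed
    then show ?thesis by (simp add: k_def presheaf_Res_id[OF H U u])
  qed
  show "sheaf_hom A ?D ?K (tensor_assoc A F G H)"
  proof (rule tensor_sheaf_homI[OF FG H K a])
    fix V f z u assume V: "open V" and f: "f \<in> smooth_fun A V" and z: "z \<in> sections (tensor A F G) V"
      and u: "u \<in> sections H V"
    show "tensor_assoc A F G H V (pure A (tensor A F G) H V (f \<odot>\<^bsub>Sec (tensor A F G) V\<^esub> z) u) =
        f \<odot>\<^bsub>Sec ?K V\<^esub> tensor_assoc A F G H V (pure A (tensor A F G) H V z u)"
      using b(2)[OF V f u z] balanced_map_balanced[OF b(1) V subset_UNIV u z f]
      by (simp add: az[OF V _ u] z presheaf_smult_closed[OF FG V f])
  qed
qed

text \<open>The same argument as for associativity, with \<open>F\<close> as the factor held fixed.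
  Here the arguments of the bilinear map are already in the right order.\<close>

lemma
  fixes F :: "('x, 's) mod_sheaf" and G :: "('x, 't) mod_sheaf" and H :: "('x, 'u) mod_sheaf"
  assumes F: "module_presheaf A F" and G: "module_presheaf A G" and H: "module_presheaf A H"
  shows tensor_swap_hom:
      "sheaf_hom A (tensor A F (tensor A G H)) (tensor A G (tensor A F H)) (tensor_swap A F G H)"
    and tensor_swap_pure: "open U \<Longrightarrow> s \<in> sections F U \<Longrightarrow> t \<in> sections G U \<Longrightarrow> u \<in> sections H U \<Longrightarrow>
      tensor_swap A F G H U (pure A F (tensor A G H) U s (pure A G H U t u)) =
        pure A G (tensor A F H) U t (pure A F H U s u)"
proof -
  note FH = tensor_module_presheaf[OF F H] and GH = tensor_module_presheaf[OF G H]
  let ?K = "tensor A G (tensor A F H)" and ?D = "tensor A F (tensor A G H)"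
  have K: "module_sheaf A ?K" by (rule tensor_sheaf[OF G FH])
  have "trilinear_map F G H ?K (\<lambda>U s t u. pure A G (tensor A F H) U t (pure A F H U s u))"
    unfolding trilinear_map_def
    by (simp add: pure_closed[OF G FH] pure_closed[OF F H] pure_add_left[OF F H] pure_add_right[OF F H]
        pure_add_left[OF G FH] pure_add_right[OF G FH] pure_smult_left[OF F H] pure_smult_right[OF F H]
        pure_smult_left[OF G FH] pure_smult_right[OF G FH] pure_Res[OF G FH] pure_Res[OF F H])
  from trilinear_lift[OF F G H K this] obtain b where b: "balanced_map A F (tensor A G H) ?K b"
    "\<And>U f p z. open U \<Longrightarrow> f \<in> smooth_fun A U \<Longrightarrow> p \<in> sections F U \<Longrightarrow> z \<in> sections (tensor A G H) U \<Longrightarrow>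
      b U (f \<odot>\<^bsub>Sec F U\<^esub> p) z = f \<odot>\<^bsub>Sec ?K U\<^esub> b U p z"
    "\<And>U p s t. open U \<Longrightarrow> p \<in> sections F U \<Longrightarrow> s \<in> sections G U \<Longrightarrow> t \<in> sections H U \<Longrightarrow>
      b U p (pure A G H U s t) = pure A G (tensor A F H) U s (pure A F H U p t)" by metis
  from tensor_lift_exists[OF F GH K b(1)] obtain h where h: "additive_map ?D ?K h"
    "\<And>U s z. open U \<Longrightarrow> s \<in> sections F U \<Longrightarrow> z \<in> sections (tensor A G H) U \<Longrightarrow>
      h U (pure A F (tensor A G H) U s z) = b U s z" by auto
  define spec where "spec = (\<lambda>h. additive_map ?D ?K h \<and>
     (\<forall>U. open U \<longrightarrow> (\<forall>s\<in>sections F U. \<forall>t\<in>sections G U. \<forall>u\<in>sections H U.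
        h U (pure A F (tensor A G H) U s (pure A G H U t u)) = pure A G (tensor A F H) U t (pure A F H U s u))))"
  have "spec h" using h b(3) pure_closed[OF G H] by (simp add: spec_def)
  moreover have "tensor_swap A F G H = (SOME h. spec h)" by (simp add: tensor_swap_def spec_def)
  ultimately have "spec (tensor_swap A F G H)" using someI[of spec h] by simp
  then have a: "additive_map ?D ?K (tensor_swap A F G H)"
    and ap: "\<And>U s t u. open U \<Longrightarrow> s \<in> sections F U \<Longrightarrow> t \<in> sections G U \<Longrightarrow> u \<in> sections H U \<Longrightarrow>
      tensor_swap A F G H U (pure A F (tensor A G H) U s (pure A G H U t u)) =
        pure A G (tensor A F H) U t (pure A F H U s u)"
    unfolding spec_def by blast+
  then show "open U \<Longrightarrow> s \<in> sections F U \<Longrightarrow> t \<in> sections G U \<Longrightarrow> u \<in> sections H U \<Longrightarrow>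
      tensor_swap A F G H U (pure A F (tensor A G H) U s (pure A G H U t u)) =
        pure A G (tensor A F H) U t (pure A F H U s u)" by blast
  have az: "tensor_swap A F G H U (pure A F (tensor A G H) U s z) = b U s z"
    if U: "open U" and s: "s \<in> sections F U" and z: "z \<in> sections (tensor A G H) U" for U s z
  proof -
    define k where "k = (\<lambda>V z. pure A F (tensor A G H) V (Res F U V s) z)"
    have sV: "Res F U V s \<in> sections F V" if "open V" "V \<subseteq> U" for V
      using presheaf_Res_closed[OF F U that s] .
    have k: "additive_map_on U (tensor A G H) ?D k"
      by (rule additive_mapI) (simp_all add: k_def sV pure_closed[OF F GH] pure_add_right[OF F GH]
          pure_Res[OF F GH] presheaf_Res_Res[OF F U _ _ _ _ s])
    have bu: "additive_map_on U (tensor A G H) ?K (\<lambda>V. b V (Res F U V s))"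
      by (rule additive_mapI) (simp_all add: sV balanced_map_closed[OF b(1)] balanced_map_add_right[OF b(1)]
          balanced_map_Res[OF b(1), symmetric] presheaf_Res_Res[OF F U _ _ _ _ s])
    have "tensor_swap A F G H U (k U z) = b U (Res F U U s) z"
    proof (rule tensor_additive_eqI[OF G H K additive_map_comp[OF k additive_map_mono[OF a subset_UNIV]] bu _ U z])
      fix V t u assume V: "open V" "V \<subseteq> U" and tu: "t \<in> sections G V" "u \<in> sections H V"
      show "tensor_swap A F G H V (k V (pure A G H V t u)) = b V (Res F U V s) (pure A G H V t u)"
        by (simp add: k_def ap[OF V(1) sV[OF V] tu] b(3)[OF V(1) sV[OF V] tu])
    qed
    then show ?thesis by (simp add: k_def presheaf_Res_id[OF F U s])
  qed
  show "sheaf_hom A ?D ?K (tensor_swap A F G H)"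
  proof (rule tensor_sheaf_homI[OF F GH K a])
    fix V f s z assume V: "open V" and f: "f \<in> smooth_fun A V" and s: "s \<in> sections F V"
      and z: "z \<in> sections (tensor A G H) V"
    show "tensor_swap A F G H V (pure A F (tensor A G H) V (f \<odot>\<^bsub>Sec F V\<^esub> s) z) =
        f \<odot>\<^bsub>Sec ?K V\<^esub> tensor_swap A F G H V (pure A F (tensor A G H) V s z)"
      using b(2)[OF V f s z] by (simp add: az[OF V _ z] s presheaf_smult_closed[OF F V f])
  qed
qed

end

section \<open>The cotangent sheaf\<close>

context smooth_mfd
begin

section \<open>Smooth germs and tangent vectors\<close>

lemma smooth_fun_smooth_at: "open U \<Longrightarrow> x \<in> U \<Longrightarrow> f \<in> smooth_fun A U \<Longrightarrow> f \<in> smooth_at A x"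
  unfolding smooth_at_def using smooth_fun_cut_self by fastforce

lemma smooth_at2:
  assumes "f \<in> smooth_at A x" "g \<in> smooth_at A x"
  obtains W where "open W" "x \<in> W" "cut W f \<in> smooth_fun A W" "cut W g \<in> smooth_fun A W"
proof -
  obtain U V where U: "open U" "x \<in> U" "cut U f \<in> smooth_fun A U"
    and V: "open V" "x \<in> V" "cut V g \<in> smooth_fun A V"
    using assms unfolding smooth_at_def by blast
  show thesis
    using that[of "U \<inter> V"] smooth_fun_cut[OF U(3), of "U \<inter> V"] smooth_fun_cut[OF V(3), of "U \<inter> V"] U V
    by (auto simp: cut_cut)
qed

lemma
  assumes "f \<in> smooth_at A x" "g \<in> smooth_at A x"
  shows smooth_at_add: "(\<lambda>y. f y + g y) \<in> smooth_at A x"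
    and smooth_at_mult: "(\<lambda>y. f y * g y) \<in> smooth_at A x"
proof -
  from smooth_at2[OF assms] obtain W where W: "open W" "x \<in> W" "cut W f \<in> smooth_fun A W" "cut W g \<in> smooth_fun A W"
    by blast
  have "cut W (\<lambda>y. f y + g y) = (\<lambda>y. cut W f y + cut W g y)"
    "cut W (\<lambda>y. f y * g y) = (\<lambda>y. cut W f y * cut W g y)" by (auto simp: cut_def)
  then show "(\<lambda>y. f y + g y) \<in> smooth_at A x" "(\<lambda>y. f y * g y) \<in> smooth_at A x"
    unfolding smooth_at_def using W smooth_fun_add[OF W(1,3,4)] smooth_fun_mult[OF W(1,3,4)] by auto
qed

lemma smooth_at_scale:
  assumes "f \<in> smooth_at A x"
  shows "(\<lambda>y. r * f y) \<in> smooth_at A x"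
proof -
  obtain U where U: "open U" "x \<in> U" "cut U f \<in> smooth_fun A U"
    using assms unfolding smooth_at_def by blast
  have "cut U (\<lambda>y. r * f y) = (\<lambda>y. r * cut U f y)" by (auto simp: cut_def)
  then show ?thesis unfolding smooth_at_def using U smooth_fun_scale[OF U(1,3)] by auto
qed

text \<open>Only a cut-off of \<open>f\<close> is known to be smooth. It agrees with
  \<open>f\<close> near \<open>x\<close>, which is enough for differentiability of the chart
  expression at \<open>c x\<close>.\<close>

lemma smooth_at_has_derivative:
  assumes V: "(V, c) \<in> A" "x \<in> V" and f: "f \<in> smooth_at A x"
  shows "((f \<circ> inv_into V c) has_derivative frechet_derivative (f \<circ> inv_into V c) (at (c x))) (at (c x))"
proof -
  obtain U where U: "open U" "x \<in> U" "cut U f \<in> smooth_fun A U"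
    using f unfolding smooth_at_def by blast
  have "Ck_on (Suc 0) (cut U f \<circ> inv_into V c) (c ` (U \<inter> V))"
    by (rule smooth_funD(2)[OF U(3) V(1)])
  then have "Ck_on (Suc 0) (f \<circ> inv_into V c) (c ` (U \<inter> V))"
    by (rule Ck_on_cong[OF chart_image_open[OF V(1) U(1)], rotated])
      (auto simp: cut_def chart_inv[OF V(1)])
  then have "(f \<circ> inv_into V c) differentiable (at (c x))"
    unfolding Ck_on.simps using U V by blast
  then show ?thesis by (simp only: frechet_derivative_works)
qed

text \<open>\<open>ext_deriv\<close> returns 0 off the tangent space, so the coordinate vectors must
  be known to be derivations before df can be evaluated on them. The sum, product and scaling rules
  are those of the Frechet derivative.\<close>

lemma coord_vector_tangent:
  assumes V: "(V, c) \<in> A" "x \<in> V"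
  shows "coord_vector A V c e x \<in> tangent_space A x"
proof -
  let ?D = "\<lambda>f. frechet_derivative (f \<circ> inv_into V c) (at (c x))"
  have add: "?D (\<lambda>y. f y + g y) e = ?D f e + ?D g e"
    and mult: "?D (\<lambda>y. f y * g y) e = f x * ?D g e + g x * ?D f e"
    if fg: "f \<in> smooth_at A x" "g \<in> smooth_at A x" for f g
  proof -
    note D = smooth_at_has_derivative[OF V fg(1)] smooth_at_has_derivative[OF V fg(2)]
    have "(\<lambda>y. f y + g y) \<circ> inv_into V c = (\<lambda>z. (f \<circ> inv_into V c) z + (g \<circ> inv_into V c) z)"
      "(\<lambda>y. f y * g y) \<circ> inv_into V c = (\<lambda>z. (f \<circ> inv_into V c) z * (g \<circ> inv_into V c) z)" by auto
    then show "?D (\<lambda>y. f y + g y) e = ?D f e + ?D g e"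
      "?D (\<lambda>y. f y * g y) e = f x * ?D g e + g x * ?D f e"
      using fun_cong[OF frechet_derivative_at[OF has_derivative_add[OF D]], of e]
        fun_cong[OF frechet_derivative_at[OF has_derivative_mult[OF D]], of e]
      by (simp_all add: chart_inv[OF V] mult.commute)
  qed
  have scale: "?D (\<lambda>y. r * f y) e = r * ?D f e" if f: "f \<in> smooth_at A x" for r f
  proof -
    have "(\<lambda>y. r * f y) \<circ> inv_into V c = (\<lambda>z. r * (f \<circ> inv_into V c) z)" by auto
    then show ?thesis
      using fun_cong[OF frechet_derivative_at[OF has_derivative_mult_right[OF smooth_at_has_derivative[OF V f], of r]], of e]
      by simp
  qed
  have local: "?D f e = ?D g e" if "open U" "x \<in> U" "\<forall>y\<in>U. f y = g y" for f g U
  proof -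
    have "?D f = ?D g"
      by (rule frechet_derivative_cong_open[OF chart_image_open[OF V(1) that(1)]])
        (use that V in \<open>auto simp: chart_inv[OF V(1)]\<close>)
    then show ?thesis by simp
  qed
  show ?thesis
    unfolding tangent_space_def coord_vector_def
    using add mult scale local by (auto simp: smooth_at_add smooth_at_mult smooth_at_scale)
qed

lemma tangentD:
  assumes "v \<in> tangent_space A x" "f \<in> smooth_at A x"
  shows tangent_add: "g \<in> smooth_at A x \<Longrightarrow> v (\<lambda>y. f y + g y) = v f + v g"
    and tangent_mult: "g \<in> smooth_at A x \<Longrightarrow> v (\<lambda>y. f y * g y) = f x * v g + g x * v f"
    and tangent_local: "g \<in> smooth_at A x \<Longrightarrow> open U \<Longrightarrow> x \<in> U \<Longrightarrow> (\<And>y. y \<in> U \<Longrightarrow> f y = g y) \<Longrightarrow> v f = v g"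
    and tangent_scale: "v (\<lambda>y. r * f y) = r * v f"
  using assms unfolding tangent_space_def by blast+

lemma tangent_space_add:
  assumes "v \<in> tangent_space A x" "w \<in> tangent_space A x"
  shows "(\<lambda>f. v f + w f) \<in> tangent_space A x"
  using assms unfolding tangent_space_def by (simp add: algebra_simps)

lemma tangent_space_scale:
  assumes "v \<in> tangent_space A x"
  shows "(\<lambda>f. r * v f) \<in> tangent_space A x"
  using assms unfolding tangent_space_def by (simp add: algebra_simps)

section \<open>The cotangent sheaf as a presheaf of modules, and the exterior derivative\<close>

lemma cotangent_section_iff:
  "\<omega> \<in> sections (cotangent A) U \<longleftrightarrow> (\<forall>x. x \<notin> U \<longrightarrow> \<omega> x = (\<lambda>v. 0)) \<and>
    (\<forall>x\<in>U. \<omega> x \<in> cotangent_space A x) \<and>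
    (\<forall>(V, c)\<in>A. \<forall>e. cut (U \<inter> V) (\<lambda>x. \<omega> x (coord_vector A V c e x)) \<in> smooth_fun A (U \<inter> V))"
  by (simp add: cotangent_def)

lemma cotangent_section_chart:
  "\<omega> \<in> sections (cotangent A) U \<Longrightarrow> (V, c) \<in> A \<Longrightarrow>
    cut (U \<inter> V) (\<lambda>x. \<omega> x (coord_vector A V c e x)) \<in> smooth_fun A (U \<inter> V)"
  unfolding cotangent_section_iff by blast

lemma cotangent_ops:
  "\<omega> \<oplus>\<^bsub>Sec (cotangent A) U\<^esub> \<eta> = (\<lambda>x v. \<omega> x v + \<eta> x v)"
  "f \<odot>\<^bsub>Sec (cotangent A) U\<^esub> \<omega> = (\<lambda>x v. f x * \<omega> x v)"
  "\<zero>\<^bsub>Sec (cotangent A) U\<^esub> = (\<lambda>x v. 0)"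
  "Res (cotangent A) U V \<omega> = (\<lambda>x. if x \<in> V then \<omega> x else (\<lambda>v. 0))"
  by (simp_all add: cotangent_def)

lemma cotangent_space_zero: "(\<lambda>v. 0) \<in> cotangent_space A x"
  by (simp add: cotangent_space_def)

lemma cotangent_space_add:
  "l \<in> cotangent_space A x \<Longrightarrow> m \<in> cotangent_space A x \<Longrightarrow> (\<lambda>v. l v + m v) \<in> cotangent_space A x"
  by (simp add: cotangent_space_def algebra_simps)

lemma cotangent_space_scale: "l \<in> cotangent_space A x \<Longrightarrow> (\<lambda>v. r * l v) \<in> cotangent_space A x"
  by (simp add: cotangent_space_def algebra_simps)

lemma cotangent_add_closed:
  assumes U: "open U" and w: "\<omega> \<in> sections (cotangent A) U" "\<eta> \<in> sections (cotangent A) U"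
  shows "(\<lambda>x v. \<omega> x v + \<eta> x v) \<in> sections (cotangent A) U"
  unfolding cotangent_section_iff
proof (intro conjI allI impI ballI, goal_cases)
  case (3 p)
  obtain V c where p: "p = (V, c)" by fastforce
  have V: "(V, c) \<in> A" "open (U \<inter> V)" using 3 p U chart_open by auto
  have "cut (U \<inter> V) (\<lambda>x. \<omega> x (coord_vector A V c e x) + \<eta> x (coord_vector A V c e x)) \<in> smooth_fun A (U \<inter> V)" for e
  proof -
    have "cut (U \<inter> V) (\<lambda>x. \<omega> x (coord_vector A V c e x) + \<eta> x (coord_vector A V c e x)) =
      (\<lambda>y. cut (U \<inter> V) (\<lambda>x. \<omega> x (coord_vector A V c e x)) y + cut (U \<inter> V) (\<lambda>x. \<eta> x (coord_vector A V c e x)) y)"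
      by (auto simp: cut_def)
    then show ?thesis
      using smooth_fun_add[OF V(2) w[THEN cotangent_section_chart, OF V(1)]] by simp
  qed
  then show ?case by (simp add: p)
qed (use w in \<open>auto simp: cotangent_section_iff cotangent_space_add\<close>)

lemma cotangent_smult_closed:
  assumes U: "open U" and f: "f \<in> smooth_fun A U" and w: "\<omega> \<in> sections (cotangent A) U"
  shows "(\<lambda>x v. f x * \<omega> x v) \<in> sections (cotangent A) U"
  unfolding cotangent_section_iff
proof (intro conjI allI impI ballI, goal_cases)
  case (3 p)
  obtain V c where p: "p = (V, c)" by fastforce
  have V: "(V, c) \<in> A" "open (U \<inter> V)" using 3 p U chart_open by auto
  have "cut (U \<inter> V) (\<lambda>x. f x * \<omega> x (coord_vector A V c e x)) \<in> smooth_fun A (U \<inter> V)" for e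
  proof -
    have "cut (U \<inter> V) (\<lambda>x. f x * \<omega> x (coord_vector A V c e x)) =
      (\<lambda>y. cut (U \<inter> V) f y * cut (U \<inter> V) (\<lambda>x. \<omega> x (coord_vector A V c e x)) y)"
      by (auto simp: cut_def)
    then show ?thesis
      using smooth_fun_mult[OF V(2) smooth_fun_cut[OF f V(2)] cotangent_section_chart[OF w V(1)]] by simp
  qed
  then show ?case by (simp add: p)
qed (use w in \<open>auto simp: cotangent_section_iff cotangent_space_scale\<close>)

lemma cotangent_zero_closed:
  assumes "open U" shows "(\<lambda>x v. 0) \<in> sections (cotangent A) U"
proof -
  have "cut (U \<inter> V) (\<lambda>x. 0) \<in> smooth_fun A (U \<inter> V)" if "(V, c) \<in> A" for V c
    using smooth_fun_const[of "U \<inter> V" 0] assms chart_open[OF that] by blast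
  then show ?thesis by (auto simp: cotangent_section_iff cotangent_space_zero)
qed

lemma cotangent_Res_closed:
  assumes U: "open U" "open V" "V \<subseteq> U" and w: "\<omega> \<in> sections (cotangent A) U"
  shows "Res (cotangent A) U V \<omega> \<in> sections (cotangent A) V"
  unfolding cotangent_section_iff cotangent_ops
proof (intro conjI allI impI ballI, goal_cases)
  case (3 p)
  obtain W c where p: "p = (W, c)" by fastforce
  have W: "(W, c) \<in> A" "open (V \<inter> W)" "V \<inter> W \<subseteq> U \<inter> W" using 3 p U chart_open by auto
  have "cut (V \<inter> W) (\<lambda>x. (if x \<in> V then \<omega> x else (\<lambda>v. 0)) (coord_vector A W c e x)) \<in> smooth_fun A (V \<inter> W)" for e
  proof -
    have "cut (V \<inter> W) (\<lambda>x. (if x \<in> V then \<omega> x else (\<lambda>v. 0)) (coord_vector A W c e x)) =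
      cut (V \<inter> W) (cut (U \<inter> W) (\<lambda>x. \<omega> x (coord_vector A W c e x)))"
      using U by (auto simp: cut_def fun_eq_iff)
    then show ?thesis
      using smooth_fun_cut[OF cotangent_section_chart[OF w W(1)] W(2,3)] by simp
  qed
  then show ?case by (simp add: p)
qed (use w U in \<open>auto simp: cotangent_section_iff\<close>)

text \<open>The presheaf axioms are what the tensor products with \<open>cotangent A\<close> rest
  on, as these are sheafified afterwards.\<close>

lemma cotangent_presheaf: "module_presheaf A (cotangent A)"
  unfolding module_presheaf_def
proof (intro conjI allI impI ballI, goal_cases)
  case U: (1 U)
  show ?case
  proof (rule moduleI[OF cring_Cinf[OF U]])
    show "abelian_group (Sec (cotangent A) U)"
    proof (rule abelian_groupI)
      fix \<omega> assume w: "\<omega> \<in> sections (cotangent A) U"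
      then have z: "\<omega> x = (\<lambda>v. 0)" if "x \<notin> U" for x using that by (simp add: cotangent_section_iff)
      show "\<exists>\<eta>\<in>sections (cotangent A) U. \<eta> \<oplus>\<^bsub>Sec (cotangent A) U\<^esub> \<omega> = \<zero>\<^bsub>Sec (cotangent A) U\<^esub>"
        using z by (intro bexI[OF _ cotangent_smult_closed[OF U smooth_fun_const[OF U, of "-1"] w]])
          (auto simp: cotangent_ops cut_def fun_eq_iff)
    qed (auto simp: cotangent_ops cotangent_add_closed[OF U] cotangent_zero_closed[OF U] algebra_simps)
  next
    fix \<omega> assume w: "\<omega> \<in> sections (cotangent A) U"
    then have z: "\<omega> x = (\<lambda>v. 0)" if "x \<notin> U" for x using that by (simp add: cotangent_section_iff)
    show "\<one>\<^bsub>Cinf A U\<^esub> \<odot>\<^bsub>Sec (cotangent A) U\<^esub> \<omega> = \<omega>"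
      using z by (auto simp: cotangent_ops Cinf_def cut_def fun_eq_iff)
  qed (auto simp: cotangent_ops Cinf_def cotangent_smult_closed[OF U] algebra_simps)
next
  case (2 U \<omega>)
  then have "\<omega> x = (\<lambda>v. 0)" if "x \<notin> U" for x using that by (simp add: cotangent_section_iff)
  then show ?case by (auto simp: cotangent_ops fun_eq_iff)
next
  case (4 U V \<omega>)
  then show ?case by (intro cotangent_Res_closed) auto
qed (auto simp: cotangent_ops cut_def fun_eq_iff)

text \<open>On a coordinate vector field of a chart, df is the partial derivative of the chart
  expression of \<open>f\<close>; its smoothness in all charts is
  \<open>smooth_fun_partial_derivative\<close>.\<close>

lemma ext_deriv_closed:
  assumes U: "open U" and f: "f \<in> smooth_fun A U"
  shows "ext_deriv A U f \<in> sections (cotangent A) U"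
  unfolding cotangent_section_iff
proof (intro conjI allI impI ballI, goal_cases)
  case (2 x)
  then show ?case
    by (auto simp: cotangent_space_def ext_deriv_def tangent_space_add tangent_space_scale)
next
  case (3 p)
  obtain V c where p: "p = (V, c)" by fastforce
  have V: "(V, c) \<in> A" "open (U \<inter> V)" using 3 p U chart_open by auto
  have "cut (U \<inter> V) (\<lambda>x. ext_deriv A U f x (coord_vector A V c e x)) \<in> smooth_fun A (U \<inter> V)" for e
  proof -
    have "cut (U \<inter> V) (\<lambda>x. ext_deriv A U f x (coord_vector A V c e x)) =
      cut (U \<inter> V) (\<lambda>x. frechet_derivative (f \<circ> inv_into V c) (at (c x)) e)"
      using coord_vector_tangent[OF V(1)] smooth_fun_smooth_at[OF U _ f]
      by (auto simp: cut_def ext_deriv_def coord_vector_def fun_eq_iff)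
    then show ?thesis using smooth_fun_partial_derivative[OF U f V(1)] by simp
  qed
  then show ?case by (simp add: p)
qed (simp add: ext_deriv_def)

lemma ext_deriv_add:
  assumes "open U" "f \<in> smooth_fun A U" "g \<in> smooth_fun A U"
  shows "ext_deriv A U (\<lambda>x. f x + g x) = ext_deriv A U f \<oplus>\<^bsub>Sec (cotangent A) U\<^esub> ext_deriv A U g"
  using smooth_fun_smooth_at[OF assms(1)] assms tangent_add
  by (auto simp: cotangent_ops ext_deriv_def fun_eq_iff)

lemma ext_deriv_mult:
  assumes "open U" "f \<in> smooth_fun A U" "g \<in> smooth_fun A U"
  shows "ext_deriv A U (\<lambda>x. f x * g x) =
    (f \<odot>\<^bsub>Sec (cotangent A) U\<^esub> ext_deriv A U g) \<oplus>\<^bsub>Sec (cotangent A) U\<^esub> (g \<odot>\<^bsub>Sec (cotangent A) U\<^esub> ext_deriv A U f)"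
  using smooth_fun_smooth_at[OF assms(1)] assms tangent_mult
  by (auto simp: cotangent_ops ext_deriv_def fun_eq_iff)

text \<open>The constant 1 cut off outside \<open>U\<close> is idempotent, so the Leibniz rule makes
  the value of a tangent vector at a point of \<open>U\<close> equal to its double. The unit law of
  the jet module depends on this.\<close>

lemma ext_deriv_one:
  assumes U: "open U"
  shows "ext_deriv A U (cut U (\<lambda>x. 1)) = \<zero>\<^bsub>Sec (cotangent A) U\<^esub>"
proof -
  have "v (cut U (\<lambda>x. 1)) = 0" if x: "x \<in> U" and v: "v \<in> tangent_space A x" for x v
  proof -
    let ?h = "cut U (\<lambda>x. 1)"
    have h: "?h \<in> smooth_at A x" by (rule smooth_fun_smooth_at[OF U x smooth_fun_const[OF U]])
    have "(\<lambda>y. ?h y * ?h y) = ?h" by (auto simp: cut_def)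
    then have "v ?h = ?h x * v ?h + ?h x * v ?h" using tangent_mult[OF v h h] by simp
    then show ?thesis using x by (simp add: cut_def)
  qed
  then show ?thesis by (auto simp: ext_deriv_def cotangent_ops fun_eq_iff)
qed

text \<open>Restriction replaces \<open>f\<close> by \<open>cut V f\<close>, which is another
  function on the manifold. Tangent vectors at points of \<open>V\<close> do not notice, because
  derivations of germs are local.\<close>

lemma ext_deriv_Res:
  assumes U: "open U" "open V" "V \<subseteq> U" and f: "f \<in> smooth_fun A U"
  shows "Res (cotangent A) U V (ext_deriv A U f) = ext_deriv A V (cut V f)"
proof -
  have "v (cut V f) = v f" if x: "x \<in> V" and v: "v \<in> tangent_space A x" for x v
  proof (rule tangent_local[OF v _ _ U(2) x])
    show "cut V f \<in> smooth_at A x" by (rule smooth_fun_smooth_at[OF U(2) x smooth_fun_cut[OF f U(2,3)]])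
    show "f \<in> smooth_at A x" by (rule smooth_fun_smooth_at[OF U(1) _ f]) (use x U in auto)
  qed (simp add: cut_def)
  from this[symmetric] show ?thesis using U(3) by (auto simp: ext_deriv_def cotangent_ops fun_eq_iff)
qed

lemma pure_zero_left:
  assumes "module_presheaf A F" "module_presheaf A G" "open U" "t \<in> sections G U"
  shows "pure A F G U \<zero>\<^bsub>Sec F U\<^esub> t = \<zero>\<^bsub>Sec (tensor A F G) U\<^esub>"
  using pure_add_left[OF assms(1-3), of "\<zero>\<^bsub>Sec F U\<^esub>" "\<zero>\<^bsub>Sec F U\<^esub>" t, symmetric] assms
    pure_closed[OF assms(1-3)] presheaf_zero_closed[OF assms(1,3)]
  by (intro presheaf_add_eq_selfD[OF tensor_module_presheaf[OF assms(1,2)] assms(3)])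
    (simp_all add: presheaf_zero_add[OF assms(1)])

lemma pure_zero_right:
  assumes "module_presheaf A F" "module_presheaf A G" "open U" "s \<in> sections F U"
  shows "pure A F G U s \<zero>\<^bsub>Sec G U\<^esub> = \<zero>\<^bsub>Sec (tensor A F G) U\<^esub>"
  using pure_add_right[OF assms(1-3), of s "\<zero>\<^bsub>Sec G U\<^esub>" "\<zero>\<^bsub>Sec G U\<^esub>", symmetric] assms
    pure_closed[OF assms(1-3)] presheaf_zero_closed[OF assms(2,3)]
  by (intro presheaf_add_eq_selfD[OF tensor_module_presheaf[OF assms(1,2)] assms(3)])
    (simp_all add: presheaf_zero_add[OF assms(2)])

section \<open>Sheaves of pairs and the jet sheaf\<close>

text \<open>The gluing and separation conditions mention sections and restrictions but no scalars.
  They hold for every module structure on pairs, so the lemma covers the direct sum and the jet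
  sheaf with its twisted scalar action alike.\<close>

lemma pair_sheafI:
  assumes J: "module_presheaf A J" and F: "module_sheaf A F" and G: "module_sheaf A G"
    and sec: "\<And>U. sections J U = sections F U \<times> sections G U"
    and Res: "\<And>U V s t. Res J U V (s, t) = (Res F U V s, Res G U V t)"
  shows "module_sheaf A J"
  unfolding module_sheaf_def
proof (intro conjI allI impI ballI J)
  fix \<U> :: "'x set set" assume op: "\<forall>U\<in>\<U>. open U"
  have F1: "\<forall>s\<in>sections F (\<Union>\<U>). \<forall>t\<in>sections F (\<Union>\<U>).
      (\<forall>U\<in>\<U>. Res F (\<Union>\<U>) U s = Res F (\<Union>\<U>) U t) \<longrightarrow> s = t"
    using F op unfolding module_sheaf_def by blast
  have G1: "\<forall>s\<in>sections G (\<Union>\<U>). \<forall>t\<in>sections G (\<Union>\<U>).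
      (\<forall>U\<in>\<U>. Res G (\<Union>\<U>) U s = Res G (\<Union>\<U>) U t) \<longrightarrow> s = t"
    using G op unfolding module_sheaf_def by blast
  have F2: "\<forall>p. (\<forall>U\<in>\<U>. p U \<in> sections F U) \<and>
      (\<forall>U\<in>\<U>. \<forall>V\<in>\<U>. Res F U (U \<inter> V) (p U) = Res F V (U \<inter> V) (p V)) \<longrightarrow>
      (\<exists>s\<in>sections F (\<Union>\<U>). \<forall>U\<in>\<U>. Res F (\<Union>\<U>) U s = p U)"
    using F op unfolding module_sheaf_def by blast
  have G2: "\<forall>p. (\<forall>U\<in>\<U>. p U \<in> sections G U) \<and>
      (\<forall>U\<in>\<U>. \<forall>V\<in>\<U>. Res G U (U \<inter> V) (p U) = Res G V (U \<inter> V) (p V)) \<longrightarrow>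
      (\<exists>s\<in>sections G (\<Union>\<U>). \<forall>U\<in>\<U>. Res G (\<Union>\<U>) U s = p U)"
    using G op unfolding module_sheaf_def by blast
  {
    fix p q assume pq: "p \<in> sections J (\<Union>\<U>)" "q \<in> sections J (\<Union>\<U>)"
      and eq: "\<forall>U\<in>\<U>. Res J (\<Union>\<U>) U p = Res J (\<Union>\<U>) U q"
    obtain s t s' t' where st: "p = (s, t)" "q = (s', t')" by fastforce
    then show "p = q"
      using pq eq F1[rule_format, of s s'] G1[rule_format, of t t'] by (simp add: sec Res)
  }
  fix p assume p: "(\<forall>U\<in>\<U>. p U \<in> sections J U) \<and>
    (\<forall>U\<in>\<U>. \<forall>V\<in>\<U>. Res J U (U \<inter> V) (p U) = Res J V (U \<inter> V) (p V))"
  define s t where "s = (\<lambda>U. fst (p U))" and "t = (\<lambda>U. snd (p U))"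
  have ps: "p U = (s U, t U)" for U by (simp add: s_def t_def)
  have "\<exists>s'\<in>sections F (\<Union>\<U>). \<forall>U\<in>\<U>. Res F (\<Union>\<U>) U s' = s U"
    by (rule F2[rule_format]) (use p in \<open>auto simp: ps sec Res\<close>)
  moreover have "\<exists>t'\<in>sections G (\<Union>\<U>). \<forall>U\<in>\<U>. Res G (\<Union>\<U>) U t' = t U"
    by (rule G2[rule_format]) (use p in \<open>auto simp: ps sec Res\<close>)
  ultimately obtain s' t' where "s' \<in> sections F (\<Union>\<U>)" "\<forall>U\<in>\<U>. Res F (\<Union>\<U>) U s' = s U"
    "t' \<in> sections G (\<Union>\<U>)" "\<forall>U\<in>\<U>. Res G (\<Union>\<U>) U t' = t U" by blast
  then show "\<exists>q\<in>sections J (\<Union>\<U>). \<forall>U\<in>\<U>. Res J (\<Union>\<U>) U q = p U"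
    by (intro bexI[of _ "(s', t')"]) (simp_all add: ps sec Res)
qed

lemma jet_sheaf_simps:
  "sections (jet_sheaf A E) U = sections E U \<times> sections (tensor A (cotangent A) E) U"
  "(s, \<tau>) \<oplus>\<^bsub>Sec (jet_sheaf A E) U\<^esub> (s', \<tau>') = (s \<oplus>\<^bsub>Sec E U\<^esub> s', \<tau> \<oplus>\<^bsub>Sec (tensor A (cotangent A) E) U\<^esub> \<tau>')"
  "\<zero>\<^bsub>Sec (jet_sheaf A E) U\<^esub> = (\<zero>\<^bsub>Sec E U\<^esub>, \<zero>\<^bsub>Sec (tensor A (cotangent A) E) U\<^esub>)"
  "f \<odot>\<^bsub>Sec (jet_sheaf A E) U\<^esub> (s, \<tau>) = (f \<odot>\<^bsub>Sec E U\<^esub> s,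
     (f \<odot>\<^bsub>Sec (tensor A (cotangent A) E) U\<^esub> \<tau>) \<oplus>\<^bsub>Sec (tensor A (cotangent A) E) U\<^esub>
       pure A (cotangent A) E U (ext_deriv A U f) s)"
  "Res (jet_sheaf A E) U V (s, \<tau>) = (Res E U V s, Res (tensor A (cotangent A) E) U V \<tau>)"
  by (simp_all add: jet_sheaf_def Let_def)

text \<open>Each law of the twisted scalar action rests on a rule for d: distributivity over sums of
  functions on additivity, the unit law on d1 = 0, compatibility with restriction on locality.
  Associativity is the product rule: f dg \<otimes> s comes from \<open>f\<close> acting on dg
  \<otimes> s, and g df \<otimes> s from df \<otimes> (g s).\<close>

lemma jet_presheaf:
  assumes E: "module_presheaf A E"
  shows "module_presheaf A (jet_sheaf A E)"
proof -
  let ?T = "cotangent A" and ?N = "tensor A (cotangent A) E" and ?J = "jet_sheaf A E"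
  note T = cotangent_presheaf
  note N = tensor_module_presheaf[OF T E]
  note d = ext_deriv_closed pure_closed[OF T E]
  note cl = presheaf_closed[OF E] presheaf_closed[OF N] d
  show ?thesis
    unfolding module_presheaf_def
  proof (intro conjI allI impI ballI, goal_cases)
    case U: (1 U)
    show ?case
    proof (rule moduleI[OF cring_Cinf[OF U]])
      show "abelian_group (Sec ?J U)"
      proof (rule abelian_groupI)
        fix p assume "p \<in> sections ?J U"
        then obtain s \<tau> where p: "p = (s, \<tau>)" "s \<in> sections E U" "\<tau> \<in> sections ?N U"
          by (auto simp: jet_sheaf_simps)
        have ab: "abelian_group (Sec E U)" "abelian_group (Sec ?N U)"
          using presheaf_module[OF E U] presheaf_module[OF N U] by (simp_all add: Module.module_def)
        obtain s' where s': "s' \<in> sections E U" "s' \<oplus>\<^bsub>Sec E U\<^esub> s = \<zero>\<^bsub>Sec E U\<^esub>"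
          using p(2) abelian_group.a_inv_closed[OF ab(1)] abelian_group.l_neg[OF ab(1)] by blast
        obtain \<tau>' where t': "\<tau>' \<in> sections ?N U" "\<tau>' \<oplus>\<^bsub>Sec ?N U\<^esub> \<tau> = \<zero>\<^bsub>Sec ?N U\<^esub>"
          using p(3) abelian_group.a_inv_closed[OF ab(2)] abelian_group.l_neg[OF ab(2)] by blast
        show "\<exists>q\<in>sections ?J U. q \<oplus>\<^bsub>Sec ?J U\<^esub> p = \<zero>\<^bsub>Sec ?J U\<^esub>"
          using s' t' by (intro bexI[of _ "(s', \<tau>')"]) (simp_all add: p jet_sheaf_simps)
      qed (auto simp: jet_sheaf_simps cl[OF U] presheaf_zero_add[OF E U] presheaf_zero_add[OF N U]
          presheaf_add_assoc[OF E U] presheaf_add_assoc[OF N U] intro: presheaf_add_comm[OF E U] presheaf_add_comm[OF N U])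
    next
      fix f p assume f: "f \<in> carrier (Cinf A U)" and "p \<in> sections ?J U"
      then obtain s \<tau> where p: "p = (s, \<tau>)" "s \<in> sections E U" "\<tau> \<in> sections ?N U"
        by (auto simp: jet_sheaf_simps)
      note f = f[unfolded carrier_Cinf]
      show "f \<odot>\<^bsub>Sec ?J U\<^esub> p \<in> sections ?J U" using f p U by (simp add: jet_sheaf_simps cl)
      {
        fix q assume "q \<in> sections ?J U"
        then obtain s' \<tau>' where q: "q = (s', \<tau>')" "s' \<in> sections E U" "\<tau>' \<in> sections ?N U"
          by (auto simp: jet_sheaf_simps)
        show "f \<odot>\<^bsub>Sec ?J U\<^esub> (p \<oplus>\<^bsub>Sec ?J U\<^esub> q) = (f \<odot>\<^bsub>Sec ?J U\<^esub> p) \<oplus>\<^bsub>Sec ?J U\<^esub> (f \<odot>\<^bsub>Sec ?J U\<^esub> q)"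
          using f p q U by (simp add: jet_sheaf_simps cl presheaf_smult_add[OF E] presheaf_smult_add[OF N]
              pure_add_right[OF T E] presheaf_add_assoc[OF N] presheaf_add_lcomm[OF N])
      }
      fix g assume "g \<in> carrier (Cinf A U)"
      note g = this[unfolded carrier_Cinf]
      have C: "f \<oplus>\<^bsub>Cinf A U\<^esub> g = (\<lambda>x. f x + g x)" "f \<otimes>\<^bsub>Cinf A U\<^esub> g = (\<lambda>x. f x * g x)"
        by (simp_all add: Cinf_def)
      show "(f \<oplus>\<^bsub>Cinf A U\<^esub> g) \<odot>\<^bsub>Sec ?J U\<^esub> p = (f \<odot>\<^bsub>Sec ?J U\<^esub> p) \<oplus>\<^bsub>Sec ?J U\<^esub> (g \<odot>\<^bsub>Sec ?J U\<^esub> p)"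
        using f g p U by (simp add: C jet_sheaf_simps cl presheaf_add_smult[OF E] presheaf_add_smult[OF N]
            ext_deriv_add pure_add_left[OF T E] presheaf_add_assoc[OF N] presheaf_add_lcomm[OF N])
      show "(f \<otimes>\<^bsub>Cinf A U\<^esub> g) \<odot>\<^bsub>Sec ?J U\<^esub> p = f \<odot>\<^bsub>Sec ?J U\<^esub> (g \<odot>\<^bsub>Sec ?J U\<^esub> p)"
        using f g p U by (simp add: C jet_sheaf_simps cl presheaf_mult_smult[OF E] presheaf_mult_smult[OF N]
            ext_deriv_mult pure_add_left[OF T E] pure_smult_left[OF T E] pure_smult_right[OF T E]
            presheaf_closed[OF T] presheaf_smult_add[OF N] presheaf_add_assoc[OF N])
    next
      fix p assume "p \<in> sections ?J U"
      then obtain s \<tau> where p: "p = (s, \<tau>)" "s \<in> sections E U" "\<tau> \<in> sections ?N U"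
        by (auto simp: jet_sheaf_simps)
      have "\<one>\<^bsub>Cinf A U\<^esub> = cut U (\<lambda>x. 1)" by (simp add: Cinf_def)
      then show "\<one>\<^bsub>Cinf A U\<^esub> \<odot>\<^bsub>Sec ?J U\<^esub> p = p"
        using p U by (simp add: jet_sheaf_simps presheaf_one_smult[OF E] presheaf_one_smult[OF N]
            ext_deriv_one pure_zero_left[OF T E] presheaf_add_zero[OF N])
    qed
  next
    case (2 U p)
    then show ?case by (auto simp: jet_sheaf_simps presheaf_Res_id[OF E] presheaf_Res_id[OF N])
  next
    case (3 U V W p)
    then show ?case by (auto simp: jet_sheaf_simps presheaf_Res_Res[OF E] presheaf_Res_Res[OF N])
  next
    case (4 U V p)
    then show ?case by (auto simp: jet_sheaf_simps cl)
  next
    case (5 U V p q)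
    then show ?case by (auto simp: jet_sheaf_simps presheaf_Res_add[OF E] presheaf_Res_add[OF N])
  next
    case (6 U V f p)
    then show ?case
      by (auto simp: jet_sheaf_simps cl presheaf_Res_smult[OF E] presheaf_Res_smult[OF N]
          presheaf_Res_add[OF N] pure_Res[OF T E] ext_deriv_Res)
  qed
qed

lemma jet_sheaf_sheaf:
  assumes E: "module_sheaf A E"
  shows "module_sheaf A (jet_sheaf A E)"
  by (rule pair_sheafI[OF jet_presheaf[OF module_sheaf_presheaf[OF E]] E
        tensor_sheaf[OF cotangent_presheaf module_sheaf_presheaf[OF E]]])
    (simp_all add: jet_sheaf_simps)

end

section \<open>Connections and morphisms of twisted quiver sheaves\<close>

context smooth_mfd
begin

lemma
  assumes "connection A E D"
  shows connection_additive: "additive_map E (tensor A (cotangent A) E) D"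
    and connection_Leibniz: "open U \<Longrightarrow> f \<in> smooth_fun A U \<Longrightarrow> s \<in> sections E U \<Longrightarrow>
        D U (f \<odot>\<^bsub>Sec E U\<^esub> s) =
          (f \<odot>\<^bsub>Sec (tensor A (cotangent A) E) U\<^esub> D U s)
            \<oplus>\<^bsub>Sec (tensor A (cotangent A) E) U\<^esub> pure A (cotangent A) E U (ext_deriv A U f) s"
  using assms unfolding connection_def by blast+

text \<open>The value at \<open>(s, \<tau>) \<otimes> m\<close> of the second component of the structure map of the jet bundle,
  before \<open>id \<otimes> \<phi>\<^sub>a\<close> is applied; for \<open>\<tau> = \<nabla> s\<close> it is the tensor product connection.\<close>

definition twist ::
  "('x, 's) mod_sheaf \<Rightarrow> ('x, 'm) mod_sheaf \<Rightarrow> ('x set \<Rightarrow> 'm \<Rightarrow> ('x, 'x form, 'm) tensor_sec)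
     \<Rightarrow> 'x set \<Rightarrow> 's \<Rightarrow> ('x, 'x form, 's) tensor_sec \<Rightarrow> 'm \<Rightarrow> ('x, 'x form, ('x, 's, 'm) tensor_sec) tensor_sec" where
  "twist E M D U s \<tau> m =
    tensor_assoc A (cotangent A) E M U (pure A (tensor A (cotangent A) E) M U \<tau> m)
      \<oplus>\<^bsub>Sec (tensor A (cotangent A) (tensor A E M)) U\<^esub>
    tensor_swap A E (cotangent A) M U (pure A E (tensor A (cotangent A) M) U s (D U m))"

context
  fixes E :: "('x, 's) mod_sheaf" and M :: "('x, 'm) mod_sheaf" and D
  assumes E: "module_presheaf A E" and M: "module_presheaf A M" and D: "connection A M D"
begin

private abbreviation (input) "T \<equiv> cotangent A"
private abbreviation (input) "TE \<equiv> tensor A T E"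
private abbreviation (input) "TM \<equiv> tensor A T M"
private abbreviation (input) "EM \<equiv> tensor A E M"
private abbreviation (input) "H \<equiv> tensor A T EM"

private lemmas T = cotangent_presheaf
private lemmas TE = tensor_module_presheaf[OF T E]
private lemmas TM = tensor_module_presheaf[OF T M]
private lemmas EM = tensor_module_presheaf[OF E M]
private lemmas H = tensor_module_presheaf[OF T EM]
private lemmas assoc_hom = tensor_assoc_hom[OF T E M]
private lemmas swap_hom = tensor_swap_hom[OF E T M]
private lemmas assoc_add = additive_map_add[OF sheaf_hom_additive[OF assoc_hom] _ subset_UNIV]
private lemmas swap_add = additive_map_add[OF sheaf_hom_additive[OF swap_hom] _ subset_UNIV]
private lemmas assoc_closed = additive_map_closed[OF sheaf_hom_additive[OF assoc_hom] _ subset_UNIV]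
private lemmas swap_closed = additive_map_closed[OF sheaf_hom_additive[OF swap_hom] _ subset_UNIV]
private lemmas D_closed = additive_map_closed[OF connection_additive[OF D] _ subset_UNIV]
private lemmas D_add = additive_map_add[OF connection_additive[OF D] _ subset_UNIV]
private lemmas pures = pure_closed[OF TE M] pure_closed[OF E TM] pure_closed[OF T E] pure_closed[OF T M]
  pure_closed[OF E M] pure_closed[OF T EM]

lemma twist_parts:
  assumes U: "open U" and s: "s \<in> sections E U" and t: "\<tau> \<in> sections TE U" and m: "m \<in> sections M U"
  shows "tensor_assoc A T E M U (pure A TE M U \<tau> m) \<in> sections H U"
    and "tensor_swap A E T M U (pure A E TM U s (D U m)) \<in> sections H U"
  using assms by (simp_all add: assoc_closed swap_closed pures D_closed)

lemma twist_closed: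
  assumes "open U" "s \<in> sections E U" "\<tau> \<in> sections TE U" "m \<in> sections M U"
  shows "twist E M D U s \<tau> m \<in> sections H U"
  unfolding twist_def by (rule presheaf_add_closed[OF H assms(1) twist_parts[OF assms]])

text \<open>Additivity in the pair \<open>(s, \<tau>)\<close>, as addition in the jet sheaf
  requires; the two components vary together.\<close>

lemma twist_add_left:
  assumes U: "open U" and s: "s \<in> sections E U" "s' \<in> sections E U"
    and t: "\<tau> \<in> sections TE U" "\<tau>' \<in> sections TE U" and m: "m \<in> sections M U"
  shows "twist E M D U (s \<oplus>\<^bsub>Sec E U\<^esub> s') (\<tau> \<oplus>\<^bsub>Sec TE U\<^esub> \<tau>') m =
    twist E M D U s \<tau> m \<oplus>\<^bsub>Sec H U\<^esub> twist E M D U s' \<tau>' m"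
proof -
  have 1: "tensor_assoc A T E M U (pure A TE M U (\<tau> \<oplus>\<^bsub>Sec TE U\<^esub> \<tau>') m) =
      tensor_assoc A T E M U (pure A TE M U \<tau> m) \<oplus>\<^bsub>Sec H U\<^esub> tensor_assoc A T E M U (pure A TE M U \<tau>' m)"
    using assms by (simp add: pure_add_left[OF TE M] assoc_add pures)
  have 2: "tensor_swap A E T M U (pure A E TM U (s \<oplus>\<^bsub>Sec E U\<^esub> s') (D U m)) =
      tensor_swap A E T M U (pure A E TM U s (D U m)) \<oplus>\<^bsub>Sec H U\<^esub> tensor_swap A E T M U (pure A E TM U s' (D U m))"
    using assms by (simp add: pure_add_left[OF E TM] swap_add pures D_closed)
  show ?thesis
    unfolding twist_def 1 2
    using twist_parts[OF U s(1) t(1) m] twist_parts[OF U s(2) t(2) m] presheaf_closed[OF H U]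
    by (simp add: presheaf_add_assoc[OF H U] presheaf_add_lcomm[OF H U])
qed

lemma twist_add_right:
  assumes U: "open U" and s: "s \<in> sections E U" and t: "\<tau> \<in> sections TE U"
    and m: "m \<in> sections M U" "m' \<in> sections M U"
  shows "twist E M D U s \<tau> (m \<oplus>\<^bsub>Sec M U\<^esub> m') = twist E M D U s \<tau> m \<oplus>\<^bsub>Sec H U\<^esub> twist E M D U s \<tau> m'"
proof -
  have 1: "tensor_assoc A T E M U (pure A TE M U \<tau> (m \<oplus>\<^bsub>Sec M U\<^esub> m')) =
      tensor_assoc A T E M U (pure A TE M U \<tau> m) \<oplus>\<^bsub>Sec H U\<^esub> tensor_assoc A T E M U (pure A TE M U \<tau> m')"
    using assms by (simp add: pure_add_right[OF TE M] assoc_add pures)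
  have 2: "tensor_swap A E T M U (pure A E TM U s (D U (m \<oplus>\<^bsub>Sec M U\<^esub> m'))) =
      tensor_swap A E T M U (pure A E TM U s (D U m)) \<oplus>\<^bsub>Sec H U\<^esub> tensor_swap A E T M U (pure A E TM U s (D U m'))"
    using assms by (simp add: D_add pure_add_right[OF E TM] swap_add pures D_closed)
  show ?thesis
    unfolding twist_def 1 2
    using twist_parts[OF U s t m(1)] twist_parts[OF U s t m(2)] presheaf_closed[OF H U]
    by (simp add: presheaf_add_assoc[OF H U] presheaf_add_lcomm[OF H U])
qed

text \<open>The pair on the left is the jet action of \<open>f\<close> on
  \<open>(s, \<tau>)\<close>. The extra term df \<otimes> (s \<otimes> m) is the image of (df
  \<otimes> s) \<otimes> m under the associativity map.\<close>

lemma twist_smult_left: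
  assumes U: "open U" and f: "f \<in> smooth_fun A U" and s: "s \<in> sections E U" and t: "\<tau> \<in> sections TE U"
    and m: "m \<in> sections M U"
  shows "twist E M D U (f \<odot>\<^bsub>Sec E U\<^esub> s) ((f \<odot>\<^bsub>Sec TE U\<^esub> \<tau>) \<oplus>\<^bsub>Sec TE U\<^esub> pure A T E U (ext_deriv A U f) s) m =
    (f \<odot>\<^bsub>Sec H U\<^esub> twist E M D U s \<tau> m) \<oplus>\<^bsub>Sec H U\<^esub> pure A T EM U (ext_deriv A U f) (pure A E M U s m)"
proof -
  note df = ext_deriv_closed[OF U f]
  have 1: "tensor_assoc A T E M U (pure A TE M U ((f \<odot>\<^bsub>Sec TE U\<^esub> \<tau>) \<oplus>\<^bsub>Sec TE U\<^esub> pure A T E U (ext_deriv A U f) s) m) =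
      (f \<odot>\<^bsub>Sec H U\<^esub> tensor_assoc A T E M U (pure A TE M U \<tau> m)) \<oplus>\<^bsub>Sec H U\<^esub>
        pure A T EM U (ext_deriv A U f) (pure A E M U s m)"
    using assms df
    by (simp add: pure_add_left[OF TE M] pure_smult_left[OF TE M] assoc_add pures presheaf_closed[OF TE]
        presheaf_closed[OF tensor_module_presheaf[OF TE M]] tensor_assoc_pure[OF T E M]
        sheaf_hom_smult[OF assoc_hom])
  have 2: "tensor_swap A E T M U (pure A E TM U (f \<odot>\<^bsub>Sec E U\<^esub> s) (D U m)) =
      f \<odot>\<^bsub>Sec H U\<^esub> tensor_swap A E T M U (pure A E TM U s (D U m))"
    using assms by (simp add: pure_smult_left[OF E TM] pures D_closed sheaf_hom_smult[OF swap_hom])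
  have "pure A T EM U (ext_deriv A U f) (pure A E M U s m) \<in> sections H U"
    using assms df by (simp add: pures)
  then show ?thesis
    unfolding twist_def 1 2
    using twist_parts[OF U s t m] f presheaf_closed[OF H U]
    by (simp add: presheaf_smult_add[OF H U] presheaf_add_assoc[OF H U] presheaf_add_comm[OF H U]
        presheaf_add_lcomm[OF H U])
qed

text \<open>The same extra term as in \<open>twist_smult_left\<close>, now from the Leibniz rule for
  the connection on \<open>M\<close>: the exchange map brings df in s \<otimes> (df \<otimes> m) to
  the front. Agreement of the two formulas is what makes \<open>twist\<close> balanced on
  jets.\<close>

lemma twist_smult_right:
  assumes U: "open U" and f: "f \<in> smooth_fun A U" and s: "s \<in> sections E U" and t: "\<tau> \<in> sections TE U"
    and m: "m \<in> sections M U"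
  shows "twist E M D U s \<tau> (f \<odot>\<^bsub>Sec M U\<^esub> m) =
    (f \<odot>\<^bsub>Sec H U\<^esub> twist E M D U s \<tau> m) \<oplus>\<^bsub>Sec H U\<^esub> pure A T EM U (ext_deriv A U f) (pure A E M U s m)"
proof -
  note df = ext_deriv_closed[OF U f]
  have 1: "tensor_assoc A T E M U (pure A TE M U \<tau> (f \<odot>\<^bsub>Sec M U\<^esub> m)) =
      f \<odot>\<^bsub>Sec H U\<^esub> tensor_assoc A T E M U (pure A TE M U \<tau> m)"
    using assms by (simp add: pure_smult_right[OF TE M] pures sheaf_hom_smult[OF assoc_hom])
  have 2: "tensor_swap A E T M U (pure A E TM U s (D U (f \<odot>\<^bsub>Sec M U\<^esub> m))) =
      (f \<odot>\<^bsub>Sec H U\<^esub> tensor_swap A E T M U (pure A E TM U s (D U m))) \<oplus>\<^bsub>Sec H U\<^esub>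
        pure A T EM U (ext_deriv A U f) (pure A E M U s m)"
    using assms df
    by (simp add: connection_Leibniz[OF D] pure_add_right[OF E TM] pure_smult_right[OF E TM] swap_add pures
        D_closed presheaf_closed[OF TM] presheaf_closed[OF tensor_module_presheaf[OF E TM]]
        tensor_swap_pure[OF E T M] sheaf_hom_smult[OF swap_hom])
  have "pure A T EM U (ext_deriv A U f) (pure A E M U s m) \<in> sections H U"
    using assms df by (simp add: pures)
  then show ?thesis
    unfolding twist_def 1 2
    using twist_parts[OF U s t m] f presheaf_closed[OF H U]
    by (simp add: presheaf_smult_add[OF H U] presheaf_add_assoc[OF H U])
qed

lemma twist_Res:
  assumes U: "open U" "open V" "V \<subseteq> U" and s: "s \<in> sections E U" and t: "\<tau> \<in> sections TE U"
    and m: "m \<in> sections M U"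
  shows "twist E M D V (Res E U V s) (Res TE U V \<tau>) (Res M U V m) = Res H U V (twist E M D U s \<tau> m)"
  unfolding twist_def presheaf_Res_add[OF H U twist_parts[OF U(1) s t m]]
  using assms
  by (simp add: pure_Res[OF TE M, symmetric] pure_Res[OF E TM, symmetric] D_closed pures
      additive_map_Res[OF sheaf_hom_additive[OF assoc_hom], symmetric]
      additive_map_Res[OF sheaf_hom_additive[OF swap_hom], symmetric]
      additive_map_Res[OF connection_additive[OF D]])

text \<open>The connection term disappears on the image of \<alpha>, so there the structure map of
  the jet bundle reduces to that of the cotangent twist of the quiver bundle.\<close>

lemma twist_zero_left:
  assumes U: "open U" and t: "\<tau> \<in> sections TE U" and m: "m \<in> sections M U"
  shows "twist E M D U \<zero>\<^bsub>Sec E U\<^esub> \<tau> m = tensor_assoc A T E M U (pure A TE M U \<tau> m)"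
proof -
  have "tensor_swap A E T M U (pure A E TM U \<zero>\<^bsub>Sec E U\<^esub> (D U m)) = \<zero>\<^bsub>Sec H U\<^esub>"
    using additive_map_zero[OF tensor_module_presheaf[OF E TM] H sheaf_hom_additive[OF swap_hom] U subset_UNIV]
      pure_zero_left[OF E TM U D_closed[OF U m]] by simp
  then show ?thesis
    unfolding twist_def using assms by (simp add: presheaf_add_zero[OF H U] assoc_closed pures)
qed

text \<open>By the Leibniz rule, the pair formed by f s and its derivative is the jet action of
  \<open>f\<close> on \<open>(s, D0 U s)\<close>. The two scaling lemmas for \<open>twist\<close>
  therefore apply and give the balancing that neither summand of the tensor connection has by
  itself.\<close>

lemma tensor_connection_facts:
  assumes D0: "connection A E D0"
  shows tensor_connection_additive: "additive_map EM H (tensor_connection A E M D0 D)"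
    and tensor_connection_pure: "open U \<Longrightarrow> s \<in> sections E U \<Longrightarrow> m \<in> sections M U \<Longrightarrow>
      tensor_connection A E M D0 D U (pure A E M U s m) = twist E M D U s (D0 U s) m"
proof -
  note d = additive_map_closed[OF connection_additive[OF D0] _ subset_UNIV]
    additive_map_add[OF connection_additive[OF D0] _ subset_UNIV]
    additive_map_Res[OF connection_additive[OF D0] _ subset_UNIV]
  have b: "balanced_map A E M H (\<lambda>U s m. twist E M D U s (D0 U s) m)"
  proof (rule balanced_mapI)
    fix U f s m assume *: "open U" "f \<in> smooth_fun A U" "s \<in> sections E U" "m \<in> sections M U"
    show "twist E M D U (f \<odot>\<^bsub>Sec E U\<^esub> s) (D0 U (f \<odot>\<^bsub>Sec E U\<^esub> s)) m =
        twist E M D U s (D0 U s) (f \<odot>\<^bsub>Sec M U\<^esub> m)"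
      unfolding connection_Leibniz[OF D0 *(1-3)]
      using twist_smult_left[OF *(1-3) d(1)[OF *(1,3)] *(4)] twist_smult_right[OF *(1-3) d(1)[OF *(1,3)] *(4)]
      by simp
  qed (simp_all add: twist_closed twist_add_left twist_add_right twist_Res d)
  have eq: "tensor_connection A E M D0 D = tensor_lift A E M H (\<lambda>U s m. twist E M D U s (D0 U s) m)"
    by (simp add: tensor_connection_def Let_def twist_def)
  show "additive_map EM H (tensor_connection A E M D0 D)"
    unfolding eq by (rule tensor_lift_additive[OF E M tensor_sheaf[OF T EM] b])
  show "open U \<Longrightarrow> s \<in> sections E U \<Longrightarrow> m \<in> sections M U \<Longrightarrow>
      tensor_connection A E M D0 D U (pure A E M U s m) = twist E M D U s (D0 U s) m"
    unfolding eq by (rule tensor_lift_pure[OF E M tensor_sheaf[OF T EM] b])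
qed

end

end

locale twisted_quiver = smooth_mfd A
  for A :: "('x::{t2_space,second_countable_topology}, 'b::real_normed_vector) atlas" +
  fixes Q :: "('v, 'a) pre_digraph" and M :: "'a \<Rightarrow> ('x, 'm) mod_sheaf"
  assumes quiver: "wf_digraph Q" and M_sheaf: "a \<in> arcs Q \<Longrightarrow> module_sheaf A (M a)"
begin

lemma M_presheaf: "a \<in> arcs Q \<Longrightarrow> module_presheaf A (M a)"
  by (rule module_sheaf_presheaf[OF M_sheaf])

lemma arc_verts: "a \<in> arcs Q \<Longrightarrow> tail Q a \<in> verts Q" "a \<in> arcs Q \<Longrightarrow> head Q a \<in> verts Q"
  using quiver unfolding wf_digraph_def by auto

lemma
  assumes "twisted_qsheaf A Q M R"
  shows Ob_sheaf: "i \<in> verts Q \<Longrightarrow> module_sheaf A (Ob R i)"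
    and Ar_hom: "a \<in> arcs Q \<Longrightarrow> sheaf_hom A (tensor A (Ob R (tail Q a)) (M a)) (Ob R (head Q a)) (Ar R a)"
  using assms unfolding twisted_qsheaf_def by blast+

lemma Ob_presheaf: "twisted_qsheaf A Q M R \<Longrightarrow> i \<in> verts Q \<Longrightarrow> module_presheaf A (Ob R i)"
  by (rule module_sheaf_presheaf[OF Ob_sheaf])

lemma Ar_closed: "twisted_qsheaf A Q M R \<Longrightarrow> a \<in> arcs Q \<Longrightarrow> open U \<Longrightarrow>
    s \<in> sections (Ob R (tail Q a)) U \<Longrightarrow> m \<in> sections (M a) U \<Longrightarrow>
    Ar R a U (pure A (Ob R (tail Q a)) (M a) U s m) \<in> sections (Ob R (head Q a)) U"
  by (rule additive_map_closed[OF sheaf_hom_additive[OF Ar_hom] _ subset_UNIV])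
    (auto intro!: pure_closed Ob_presheaf M_presheaf arc_verts)

lemma qmorphism_hom: "qmorphism A Q M R R' f \<Longrightarrow> i \<in> verts Q \<Longrightarrow> sheaf_hom A (Ob R i) (Ob R' i) (f i)"
  unfolding qmorphism_def by blast

text \<open>Both composites around the square are additive maps from the tensor sheaf to a sheaf, so
  \<open>tensor_additive_eqI\<close> applies. The reduction also removes \<open>tensor_map\<close>
  from the condition.\<close>

lemma qmorphism_iff_pure:
  assumes R: "twisted_qsheaf A Q M R" and R': "twisted_qsheaf A Q M R'"
  shows "qmorphism A Q M R R' f \<longleftrightarrow>
     (\<forall>i\<in>verts Q. sheaf_hom A (Ob R i) (Ob R' i) (f i)) \<and>
     (\<forall>a\<in>arcs Q. \<forall>U. open U \<longrightarrow> (\<forall>s\<in>sections (Ob R (tail Q a)) U. \<forall>m\<in>sections (M a) U.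
        f (head Q a) U (Ar R a U (pure A (Ob R (tail Q a)) (M a) U s m)) =
        Ar R' a U (pure A (Ob R' (tail Q a)) (M a) U (f (tail Q a) U s) m)))"
proof (cases "\<forall>i\<in>verts Q. sheaf_hom A (Ob R i) (Ob R' i) (f i)")
  case True
  have "(\<forall>U. open U \<longrightarrow> (\<forall>z\<in>sections (tensor A (Ob R (tail Q a)) (M a)) U.
        f (head Q a) U (Ar R a U z) =
        Ar R' a U (tensor_map A (Ob R (tail Q a)) (M a) (Ob R' (tail Q a)) (M a)
                     (f (tail Q a)) (\<lambda>U m. m) U z))) \<longleftrightarrow>
      (\<forall>U. open U \<longrightarrow> (\<forall>s\<in>sections (Ob R (tail Q a)) U. \<forall>m\<in>sections (M a) U.
        f (head Q a) U (Ar R a U (pure A (Ob R (tail Q a)) (M a) U s m)) =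
        Ar R' a U (pure A (Ob R' (tail Q a)) (M a) U (f (tail Q a) U s) m)))" (is "?L \<longleftrightarrow> ?P")
    if a: "a \<in> arcs Q" for a :: 'a
  proof -
    note v = arc_verts[OF a]
    note E = Ob_presheaf[OF R v(1)] and E' = Ob_presheaf[OF R' v(1)] and Ma = M_presheaf[OF a]
    note fh = True[rule_format, OF v(1)] True[rule_format, OF v(2)]
    note tm = tensor_map_hom[OF E Ma E' Ma fh(1) sheaf_hom_id] tensor_map_pure[OF E Ma E' Ma fh(1) sheaf_hom_id]
    show ?thesis
    proof
      assume ?L
      then show ?P using pure_closed[OF E Ma] by (simp add: tm(2))
    next
      assume P: ?P
      show ?L
      proof (intro allI impI ballI)
        fix U z assume U: "open U" and z: "z \<in> sections (tensor A (Ob R (tail Q a)) (M a)) U"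
        show "f (head Q a) U (Ar R a U z) =
            Ar R' a U (tensor_map A (Ob R (tail Q a)) (M a) (Ob R' (tail Q a)) (M a) (f (tail Q a)) (\<lambda>U m. m) U z)"
          by (rule tensor_additive_eqI[OF E Ma Ob_sheaf[OF R' v(2)]
                additive_map_mono[OF additive_map_comp[OF sheaf_hom_additive[OF Ar_hom[OF R a]] sheaf_hom_additive[OF fh(2)]] subset_UNIV]
                additive_map_mono[OF additive_map_comp[OF sheaf_hom_additive[OF tm(1)] sheaf_hom_additive[OF Ar_hom[OF R' a]]] subset_UNIV] _ U z])
            (use P in \<open>simp add: tm(2)\<close>)
      qed
    qed
  qed
  then show ?thesis unfolding qmorphism_def by (intro conj_cong refl ball_cong)
qed (auto simp: qmorphism_def)

lemma qmorphism_pure: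
  assumes "qmorphism A Q M R R' f" "twisted_qsheaf A Q M R" "twisted_qsheaf A Q M R'"
    "a \<in> arcs Q" "open U" "s \<in> sections (Ob R (tail Q a)) U" "m \<in> sections (M a) U"
  shows "f (head Q a) U (Ar R a U (pure A (Ob R (tail Q a)) (M a) U s m)) =
    Ar R' a U (pure A (Ob R' (tail Q a)) (M a) U (f (tail Q a) U s) m)"
  using assms(1)[unfolded qmorphism_iff_pure[OF assms(2,3)]] assms(4-7) by blast

lemma qmorphismI:
  assumes "twisted_qsheaf A Q M R" "twisted_qsheaf A Q M R'"
    and "\<And>i. i \<in> verts Q \<Longrightarrow> sheaf_hom A (Ob R i) (Ob R' i) (f i)"
    and "\<And>a U s m. a \<in> arcs Q \<Longrightarrow> open U \<Longrightarrow> s \<in> sections (Ob R (tail Q a)) U \<Longrightarrow> m \<in> sections (M a) U \<Longrightarrow>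
      f (head Q a) U (Ar R a U (pure A (Ob R (tail Q a)) (M a) U s m)) =
        Ar R' a U (pure A (Ob R' (tail Q a)) (M a) U (f (tail Q a) U s) m)"
  shows "qmorphism A Q M R R' f"
  unfolding qmorphism_iff_pure[OF assms(1,2)] using assms(3,4) by blast

end

section \<open>The jet sequence\<close>

locale jet_sequence = twisted_quiver A Q M
  for A :: "('x::{t2_space,second_countable_topology}, 'b::real_normed_vector) atlas"
    and Q :: "('v, 'a) pre_digraph" and M :: "'a \<Rightarrow> ('x, 'm) mod_sheaf" +
  fixes R :: "('x, 's, 'm, 'v, 'a) qsheaf"
    and D1 :: "'a \<Rightarrow> 'x set \<Rightarrow> 'm \<Rightarrow> ('x, 'x form, 'm) tensor_sec"
  assumes R: "twisted_qsheaf A Q M R" and D1: "a \<in> arcs Q \<Longrightarrow> connection A (M a) (D1 a)"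
begin

abbreviation "src a \<equiv> Ob R (tail Q a)"
abbreviation "tgt a \<equiv> Ob R (head Q a)"
abbreviation "N \<equiv> cotangent_qsheaf A Q M R"
abbreviation "J \<equiv> jet_qsheaf A Q M R D1"

lemma src_presheaf: "a \<in> arcs Q \<Longrightarrow> module_presheaf A (src a)"
  by (rule Ob_presheaf[OF R arc_verts(1)])

lemma tgt_presheaf: "a \<in> arcs Q \<Longrightarrow> module_presheaf A (tgt a)"
  by (rule Ob_presheaf[OF R arc_verts(2)])

lemma
  assumes a: "a \<in> arcs Q"
  shows cotangent_arrow_hom: "sheaf_hom A (tensor A (cotangent A) (tensor A (src a) (M a)))
      (tensor A (cotangent A) (tgt a)) (cotangent_arrow A Q M R a)"
    and cotangent_arrow_pure: "open U \<Longrightarrow> \<omega> \<in> sections (cotangent A) U \<Longrightarrow>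
      z \<in> sections (tensor A (src a) (M a)) U \<Longrightarrow>
      cotangent_arrow A Q M R a U (pure A (cotangent A) (tensor A (src a) (M a)) U \<omega> z) =
        pure A (cotangent A) (tgt a) U \<omega> (Ar R a U z)"
proof -
  note p = cotangent_presheaf tensor_module_presheaf[OF src_presheaf[OF a] M_presheaf[OF a]]
    cotangent_presheaf tgt_presheaf[OF a] sheaf_hom_id Ar_hom[OF R a]
  show "sheaf_hom A (tensor A (cotangent A) (tensor A (src a) (M a)))
      (tensor A (cotangent A) (tgt a)) (cotangent_arrow A Q M R a)"
    unfolding cotangent_arrow_def by (rule tensor_map_hom[OF p])
  show "open U \<Longrightarrow> \<omega> \<in> sections (cotangent A) U \<Longrightarrow>
      z \<in> sections (tensor A (src a) (M a)) U \<Longrightarrow>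
      cotangent_arrow A Q M R a U (pure A (cotangent A) (tensor A (src a) (M a)) U \<omega> z) =
        pure A (cotangent A) (tgt a) U \<omega> (Ar R a U z)"
    unfolding cotangent_arrow_def by (rule tensor_map_pure[OF p])
qed

lemmas cotangent_arrow_closed =
  additive_map_closed[OF sheaf_hom_additive[OF cotangent_arrow_hom] _ subset_UNIV]

lemma Ob_N: "Ob N i = tensor A (cotangent A) (Ob R i)"
  by (simp add: cotangent_qsheaf_def)

lemma N_twisted: "twisted_qsheaf A Q M N"
  unfolding twisted_qsheaf_def
proof (intro conjI ballI)
  show "module_sheaf A (Ob N i)" if "i \<in> verts Q" for i
    unfolding Ob_N by (rule tensor_sheaf[OF cotangent_presheaf Ob_presheaf[OF R that]])
  show "sheaf_hom A (tensor A (Ob N (tail Q a)) (M a)) (Ob N (head Q a)) (Ar N a)" if "a \<in> arcs Q" for a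
    using sheaf_hom_comp[OF tensor_assoc_hom[OF cotangent_presheaf src_presheaf[OF that] M_presheaf[OF that]]
        cotangent_arrow_hom[OF that]]
    by (simp add: cotangent_qsheaf_def)
qed

lemma Ob_J: "Ob J i = jet_sheaf A (Ob R i)"
  by (simp add: jet_qsheaf_def)

text \<open>In the target the jet action contributes df \<otimes> \<phi>(s \<otimes> m). This is the
  image under id \<otimes> \<phi> of the extra term in the scaling lemmas for \<open>twist\<close>,
  so the pair of components is linear although the second component alone is not.\<close>

lemma jet_arrow:
  assumes a: "a \<in> arcs Q"
  shows jet_arrow_hom: "sheaf_hom A (tensor A (Ob J (tail Q a)) (M a)) (Ob J (head Q a)) (Ar J a)"
    and jet_arrow_pure: "open U \<Longrightarrow> s \<in> sections (src a) U \<Longrightarrow>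
      \<tau> \<in> sections (tensor A (cotangent A) (src a)) U \<Longrightarrow> m \<in> sections (M a) U \<Longrightarrow>
      Ar J a U (pure A (Ob J (tail Q a)) (M a) U (s, \<tau>) m) =
        (Ar R a U (pure A (src a) (M a) U s m),
         cotangent_arrow A Q M R a U (twist (src a) (M a) (D1 a) U s \<tau> m))"
proof -
  note E = src_presheaf[OF a] and E' = tgt_presheaf[OF a] and Ma = M_presheaf[OF a] and T = cotangent_presheaf
  note TE' = tensor_module_presheaf[OF T E']
  note EM = tensor_module_presheaf[OF E Ma] and H = tensor_module_presheaf[OF T tensor_module_presheaf[OF E Ma]]
  note TE = tensor_module_presheaf[OF T E]
  note JE = jet_presheaf[OF E] and JE' = jet_sheaf_sheaf[OF Ob_sheaf[OF R arc_verts(2)[OF a]]]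
  note \<kappa> = cotangent_arrow_closed[OF a]
    additive_map_add[OF sheaf_hom_additive[OF cotangent_arrow_hom[OF a]] _ subset_UNIV]
    sheaf_hom_smult[OF cotangent_arrow_hom[OF a] _ subset_UNIV] cotangent_arrow_pure[OF a]
    additive_map_Res[OF sheaf_hom_additive[OF cotangent_arrow_hom[OF a]] _ subset_UNIV, symmetric]
  note \<phi> = additive_map_closed[OF sheaf_hom_additive[OF Ar_hom[OF R a]] _ subset_UNIV]
    additive_map_add[OF sheaf_hom_additive[OF Ar_hom[OF R a]] _ subset_UNIV]
    sheaf_hom_smult[OF Ar_hom[OF R a] _ subset_UNIV]
    additive_map_Res[OF sheaf_hom_additive[OF Ar_hom[OF R a]] _ subset_UNIV, symmetric]
  note tw = twist_closed[OF E Ma D1[OF a]] twist_add_left[OF E Ma D1[OF a]] twist_add_right[OF E Ma D1[OF a]]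
    twist_smult_left[OF E Ma D1[OF a]] twist_smult_right[OF E Ma D1[OF a]] twist_Res[OF E Ma D1[OF a], symmetric]
  note pu = pure_closed[OF E Ma] pure_closed[OF T EM] pure_add_left[OF E Ma] pure_add_right[OF E Ma]
    pure_smult_left[OF E Ma] pure_smult_right[OF E Ma] pure_Res[OF E Ma]
  let ?b = "\<lambda>U (s, \<tau>) m. (Ar R a U (pure A (src a) (M a) U s m),
         cotangent_arrow A Q M R a U (twist (src a) (M a) (D1 a) U s \<tau> m))"
  \<comment> \<open>Pulling \<open>f\<close> out of either argument gives the same result. The two
    equations together are the balancing condition, and the first is also the linearity of the
    lift.\<close>
  have lin: "?b U (f \<odot>\<^bsub>Sec (jet_sheaf A (src a)) U\<^esub> p) m = f \<odot>\<^bsub>Sec (jet_sheaf A (tgt a)) U\<^esub> ?b U p m"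
    "?b U p (f \<odot>\<^bsub>Sec (M a) U\<^esub> m) = f \<odot>\<^bsub>Sec (jet_sheaf A (tgt a)) U\<^esub> ?b U p m"
    if "open U" "f \<in> smooth_fun A U" "p \<in> sections (jet_sheaf A (src a)) U" "m \<in> sections (M a) U" for U f p m
    using that by (auto simp: jet_sheaf_simps tw pu \<phi> \<kappa> presheaf_closed[OF H] ext_deriv_closed)
  have b: "balanced_map A (jet_sheaf A (src a)) (M a) (jet_sheaf A (tgt a)) ?b"
  proof (rule balanced_mapI, goal_cases)
    case (1 U p m)
    then show ?case by (auto simp: jet_sheaf_simps tw pu \<phi> \<kappa>)
  next
    case (2 U p p' m)
    then show ?case by (auto simp: jet_sheaf_simps tw pu \<phi> \<kappa>)
  next
    case (3 U p m m')
    then show ?case by (auto simp: jet_sheaf_simps tw pu \<phi> \<kappa>)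
  next
    case (4 U f p m)
    then show ?case by (simp only: lin)
  next
    case (5 U V p m)
    then show ?case by (auto simp: jet_sheaf_simps tw pu \<phi> \<kappa>)
  qed
  have eq: "Ar J a = tensor_lift A (jet_sheaf A (src a)) (M a) (jet_sheaf A (tgt a)) ?b"
    by (simp add: jet_qsheaf_def Let_def twist_def)
  show "sheaf_hom A (tensor A (Ob J (tail Q a)) (M a)) (Ob J (head Q a)) (Ar J a)"
    unfolding eq Ob_J by (rule tensor_lift_hom[OF JE Ma JE' b]) (rule lin(1))
  show "open U \<Longrightarrow> s \<in> sections (src a) U \<Longrightarrow>
      \<tau> \<in> sections (tensor A (cotangent A) (src a)) U \<Longrightarrow> m \<in> sections (M a) U \<Longrightarrow>
      Ar J a U (pure A (Ob J (tail Q a)) (M a) U (s, \<tau>) m) =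
        (Ar R a U (pure A (src a) (M a) U s m),
         cotangent_arrow A Q M R a U (twist (src a) (M a) (D1 a) U s \<tau> m))"
    unfolding eq Ob_J using tensor_lift_pure[OF JE Ma JE' b, of U "(s, \<tau>)" m] by (simp add: jet_sheaf_simps)
qed

lemma J_twisted: "twisted_qsheaf A Q M J"
  unfolding twisted_qsheaf_def
proof (intro conjI ballI)
  show "module_sheaf A (Ob J i)" if "i \<in> verts Q" for i
    unfolding Ob_J by (rule jet_sheaf_sheaf[OF Ob_sheaf[OF R that]])
qed (rule jet_arrow_hom)

text \<open>The jet action of \<open>f\<close> on \<open>(0, \<tau>)\<close> has the extra term df
  \<otimes> 0, which vanishes; hence the inclusion is linear. For the arrows,
  \<open>twist_zero_left\<close> applies.\<close>

lemma alpha_qmorphism: "qmorphism A Q M N J (jet_alpha R)"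
proof (rule qmorphismI[OF N_twisted J_twisted])
  fix i assume i: "i \<in> verts Q"
  note E = Ob_presheaf[OF R i] and T = cotangent_presheaf
  note TE = tensor_module_presheaf[OF T E]
  show "sheaf_hom A (Ob N i) (Ob J i) (jet_alpha R i)"
    unfolding sheaf_hom_on_def additive_map_on_def Ob_N Ob_J
    by (auto simp: jet_alpha_def jet_sheaf_simps presheaf_closed[OF E] presheaf_closed[OF TE]
        presheaf_zero_add[OF E] presheaf_Res_zero[OF E] presheaf_smult_zero[OF E]
        pure_zero_right[OF T E] ext_deriv_closed presheaf_add_zero[OF TE])
next
  fix a U n m assume a: "a \<in> arcs Q" and U: "open U" and n: "n \<in> sections (Ob N (tail Q a)) U"
    and m: "m \<in> sections (M a) U"
  note E = src_presheaf[OF a] and Ma = M_presheaf[OF a]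
  have "Ar R a U (pure A (src a) (M a) U \<zero>\<^bsub>Sec (src a) U\<^esub> m) = \<zero>\<^bsub>Sec (tgt a) U\<^esub>"
    using additive_map_zero[OF tensor_module_presheaf[OF E Ma] tgt_presheaf[OF a] sheaf_hom_additive[OF Ar_hom[OF R a]] U subset_UNIV]
      pure_zero_left[OF E Ma U m] by simp
  moreover have "Ar N a U (pure A (Ob N (tail Q a)) (M a) U n m) =
      cotangent_arrow A Q M R a U (tensor_assoc A (cotangent A) (src a) (M a) U
        (pure A (tensor A (cotangent A) (src a)) (M a) U n m))"
    by (simp add: cotangent_qsheaf_def)
  ultimately show "jet_alpha R (head Q a) U (Ar N a U (pure A (Ob N (tail Q a)) (M a) U n m)) =
      Ar J a U (pure A (Ob J (tail Q a)) (M a) U (jet_alpha R (tail Q a) U n) m)"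
    using jet_arrow_pure[OF a U presheaf_zero_closed[OF E U] n[unfolded Ob_N] m]
      twist_zero_left[OF E Ma D1[OF a] U n[unfolded Ob_N] m]
    by (simp add: jet_alpha_def)
qed

lemma beta_qmorphism: "qmorphism A Q M J R jet_beta"
proof (rule qmorphismI[OF J_twisted R])
  fix i assume "i \<in> verts Q"
  show "sheaf_hom A (Ob J i) (Ob R i) (jet_beta i)"
    unfolding sheaf_hom_on_def additive_map_on_def Ob_J
    by (auto simp: jet_beta_def jet_sheaf_simps)
next
  fix a U p m assume a: "a \<in> arcs Q" and U: "open U" and p: "p \<in> sections (Ob J (tail Q a)) U"
    and m: "m \<in> sections (M a) U"
  then show "jet_beta (head Q a) U (Ar J a U (pure A (Ob J (tail Q a)) (M a) U p m)) =
      Ar R a U (pure A (src a) (M a) U (jet_beta (tail Q a) U p) m)"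
    using jet_arrow_pure[OF a U _ _ m] by (auto simp: jet_beta_def Ob_J jet_sheaf_simps)
qed

lemma jet_short_exact: "short_exact A Q M N J R (jet_alpha R) jet_beta"
  unfolding short_exact_def
proof (intro conjI N_twisted J_twisted R alpha_qmorphism beta_qmorphism ballI allI impI)
  fix i and U :: "'x set" assume i: "i \<in> verts Q" and U: "open U"
  note E = Ob_presheaf[OF R i] and T = cotangent_presheaf
  note TE = tensor_module_presheaf[OF T E]
  show "inj_on (jet_alpha R i U) (sections (Ob N i) U)"
    by (auto simp: inj_on_def jet_alpha_def)
  show "jet_alpha R i U ` sections (Ob N i) U =
      {p \<in> sections (Ob J i) U. jet_beta i U p = \<zero>\<^bsub>Sec (Ob R i) U\<^esub>}"
    using presheaf_zero_closed[OF E U]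
    by (auto simp: jet_alpha_def jet_beta_def Ob_N Ob_J jet_sheaf_simps)
  fix s x assume s: "s \<in> sections (Ob R i) U" and x: "x \<in> U"
  \<comment> \<open>The pair of \<open>s\<close> and 0 lifts \<open>s\<close> over all of
    \<open>U\<close>. Sending \<open>s\<close> to this pair is additive but in general not linear
    for the jet action, so it is no splitting.\<close>
  show "\<exists>V p. open V \<and> x \<in> V \<and> V \<subseteq> U \<and> p \<in> sections (Ob J i) V \<and> jet_beta i V p = Res (Ob R i) U V s"
    using s x U presheaf_zero_closed[OF TE U] presheaf_Res_id[OF E U s]
    by (intro exI[of _ U] exI[of _ "(s, \<zero>\<^bsub>Sec (tensor A (cotangent A) (Ob R i)) U\<^esub>)"])
      (auto simp: jet_beta_def Ob_J jet_sheaf_simps)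
qed

text \<open>\<open>D1'\<close> is known to agree with \<open>D1\<close> on sections over open sets
  only. On pure tensors the tensor connection evaluates it at such a section, so \<open>D1\<close>
  may stand on the right, where the jet structure map has it.\<close>

lemma relative_connection_iff_pure:
  assumes D1': "\<forall>a\<in>arcs Q. \<forall>U. open U \<longrightarrow> (\<forall>m\<in>sections (M a) U. D1' a U m = D1 a U m)"
    and conn': "\<forall>a\<in>arcs Q. connection A (M a) (D1' a)"
    and conn: "\<forall>i\<in>verts Q. connection A (Ob R i) (D0 i)"
  shows "relative_connection A Q M R D0 D1' \<longleftrightarrow>
    (\<forall>a\<in>arcs Q. \<forall>U. open U \<longrightarrow> (\<forall>s\<in>sections (src a) U. \<forall>m\<in>sections (M a) U.
      D0 (head Q a) U (Ar R a U (pure A (src a) (M a) U s m)) =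
        cotangent_arrow A Q M R a U (twist (src a) (M a) (D1 a) U s (D0 (tail Q a) U s) m)))"
proof -
  have "(\<forall>U. open U \<longrightarrow> (\<forall>z\<in>sections (tensor A (src a) (M a)) U. D0 (head Q a) U (Ar R a U z) =
        cotangent_arrow A Q M R a U (tensor_connection A (src a) (M a) (D0 (tail Q a)) (D1' a) U z))) \<longleftrightarrow>
      (\<forall>U. open U \<longrightarrow> (\<forall>s\<in>sections (src a) U. \<forall>m\<in>sections (M a) U.
      D0 (head Q a) U (Ar R a U (pure A (src a) (M a) U s m)) =
        cotangent_arrow A Q M R a U (twist (src a) (M a) (D1 a) U s (D0 (tail Q a) U s) m)))" (is "?L \<longleftrightarrow> ?P")
    if a: "a \<in> arcs Q" for a
  proof -
    note v = arc_verts[OF a]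
    note E = src_presheaf[OF a] and Ma = M_presheaf[OF a] and c' = conn'[rule_format, OF a]
    note c = conn[rule_format, OF v(1)]
    have tw: "twist (src a) (M a) (D1' a) U s \<tau> m = twist (src a) (M a) (D1 a) U s \<tau> m"
      if "open U" "m \<in> sections (M a) U" for U s \<tau> m
      using D1' a that by (simp add: twist_def)
    have tp: "tensor_connection A (src a) (M a) (D0 (tail Q a)) (D1' a) U (pure A (src a) (M a) U s m) =
        twist (src a) (M a) (D1 a) U s (D0 (tail Q a) U s) m"
      if "open U" "s \<in> sections (src a) U" "m \<in> sections (M a) U" for U s m
      using tensor_connection_pure[OF E Ma c' c that] tw[OF that(1,3)] by simp
    show ?thesis
    proof
      assume ?L
      then show ?P using pure_closed[OF E Ma] by (simp flip: tp)
    next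
      assume P: ?P
      show ?L
      proof (intro allI impI ballI)
        fix U z assume U: "open U" and z: "z \<in> sections (tensor A (src a) (M a)) U"
        show "D0 (head Q a) U (Ar R a U z) =
            cotangent_arrow A Q M R a U (tensor_connection A (src a) (M a) (D0 (tail Q a)) (D1' a) U z)"
          by (rule tensor_additive_eqI[OF E Ma tensor_sheaf[OF cotangent_presheaf tgt_presheaf[OF a]]
                additive_map_mono[OF additive_map_comp[OF sheaf_hom_additive[OF Ar_hom[OF R a]]
                  connection_additive[OF conn[rule_format, OF v(2)]]] subset_UNIV]
                additive_map_mono[OF additive_map_comp[OF tensor_connection_additive[OF E Ma c' c]
                  sheaf_hom_additive[OF cotangent_arrow_hom[OF a]]] subset_UNIV] _ U z])
            (use P in \<open>simp add: tp\<close>)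
      qed
    qed
  qed
  then have "(\<forall>a\<in>arcs Q. \<forall>U. open U \<longrightarrow> (\<forall>z\<in>sections (tensor A (src a) (M a)) U. D0 (head Q a) U (Ar R a U z) =
        cotangent_arrow A Q M R a U (tensor_connection A (src a) (M a) (D0 (tail Q a)) (D1' a) U z))) \<longleftrightarrow>
      (\<forall>a\<in>arcs Q. \<forall>U. open U \<longrightarrow> (\<forall>s\<in>sections (src a) U. \<forall>m\<in>sections (M a) U.
      D0 (head Q a) U (Ar R a U (pure A (src a) (M a) U s m)) =
        cotangent_arrow A Q M R a U (twist (src a) (M a) (D1 a) U s (D0 (tail Q a) U s) m)))"
    by (intro ball_cong refl)
  moreover have "relative_connection A Q M R D0 D1' \<longleftrightarrow>
      (\<forall>a\<in>arcs Q. \<forall>U. open U \<longrightarrow> (\<forall>z\<in>sections (tensor A (src a) (M a)) U. D0 (head Q a) U (Ar R a U z) =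
        cotangent_arrow A Q M R a U (tensor_connection A (src a) (M a) (D0 (tail Q a)) (D1' a) U z)))"
    unfolding relative_connection_def
    by (rule iffI, elim conjE, assumption, intro conjI, rule conn, rule conn', assumption)
  ultimately show ?thesis by (rule trans[rotated])
qed

text \<open>Comparing second components turns each clause for \<sigma> into the corresponding clause
  for \<open>D\<close>; first components match trivially.\<close>

lemma jet_section_hom_iff:
  assumes i: "i \<in> verts Q"
    and \<sigma>: "\<And>U s. open U \<Longrightarrow> s \<in> sections (Ob R i) U \<Longrightarrow> \<sigma> U s = (s, D U s)"
  shows "sheaf_hom A (Ob R i) (Ob J i) \<sigma> \<longleftrightarrow> connection A (Ob R i) D"
proof -
  note E = Ob_presheaf[OF R i]
  show ?thesis
    unfolding sheaf_hom_on_def connection_def additive_map_on_def Ob_J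
    using \<sigma> presheaf_closed[OF E] by (auto simp: jet_sheaf_simps)
qed

text \<open>Splittings and families of connections correspond through \<sigma> = (id,
  \<open>D0\<close>). From a splitting one takes \<open>D1\<close> itself as \<open>D1'\<close>;
  conversely, \<open>D1'\<close> is compared with \<open>D1\<close> only through its values on
  sections over open sets.\<close>

lemma split_iff_relative_connection:
  "(\<exists>\<sigma>. qmorphism A Q M R J \<sigma> \<and>
        (\<forall>i\<in>verts Q. \<forall>U. open U \<longrightarrow> (\<forall>s\<in>sections (Ob R i) U. jet_beta i U (\<sigma> i U s) = s))) \<longleftrightarrow>
   (\<exists>D0 D1'. relative_connection A Q M R D0 D1' \<and>
         (\<forall>a\<in>arcs Q. \<forall>U. open U \<longrightarrow> (\<forall>m\<in>sections (M a) U. D1' a U m = D1 a U m)))"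
proof
  assume "\<exists>\<sigma>. qmorphism A Q M R J \<sigma> \<and>
    (\<forall>i\<in>verts Q. \<forall>U. open U \<longrightarrow> (\<forall>s\<in>sections (Ob R i) U. jet_beta i U (\<sigma> i U s) = s))"
  then obtain \<sigma> where \<sigma>0: "qmorphism A Q M R J \<sigma> \<and>
    (\<forall>i\<in>verts Q. \<forall>U. open U \<longrightarrow> (\<forall>s\<in>sections (Ob R i) U. jet_beta i U (\<sigma> i U s) = s))"
    by (rule exE)
  note \<sigma> = conjunct1[OF \<sigma>0] conjunct2[OF \<sigma>0, unfolded jet_beta_def, rule_format]
  define D0 where "D0 = (\<lambda>i U s. snd (\<sigma> i U s))"
  have \<sigma>': "\<sigma> i U s = (s, D0 i U s)" if "i \<in> verts Q" "open U" "s \<in> sections (Ob R i) U" for i U s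
    using \<sigma>(2)[OF that] by (simp add: D0_def prod_eq_iff)
  have conn: "connection A (Ob R i) (D0 i)" if i: "i \<in> verts Q" for i
    by (rule iffD1[OF jet_section_hom_iff[of i "\<sigma> i" "D0 i"] qmorphism_hom[OF \<sigma>(1) i]])
      (use i in \<open>simp_all add: \<sigma>'\<close>)
  have "relative_connection A Q M R D0 D1"
  proof (subst relative_connection_iff_pure)
    show "\<forall>a\<in>arcs Q. \<forall>U. open U \<longrightarrow> (\<forall>s\<in>sections (src a) U. \<forall>m\<in>sections (M a) U.
      D0 (head Q a) U (Ar R a U (pure A (src a) (M a) U s m)) =
        cotangent_arrow A Q M R a U (twist (src a) (M a) (D1 a) U s (D0 (tail Q a) U s) m))"
    proof (intro ballI allI impI)
      fix a U s m assume a: "a \<in> arcs Q" and U: "open U" and s: "s \<in> sections (src a) U" and m: "m \<in> sections (M a) U"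
      note v = arc_verts[OF a]
      have d: "D0 (tail Q a) U s \<in> sections (tensor A (cotangent A) (src a)) U"
        by (rule additive_map_closed[OF connection_additive[OF conn[OF v(1)]] U subset_UNIV s])
      show "D0 (head Q a) U (Ar R a U (pure A (src a) (M a) U s m)) =
        cotangent_arrow A Q M R a U (twist (src a) (M a) (D1 a) U s (D0 (tail Q a) U s) m)"
        using qmorphism_pure[OF \<sigma>(1) R J_twisted a U s m]
        by (simp add: \<sigma>'[OF v(1) U s] \<sigma>'[OF v(2) U Ar_closed[OF R a U s m]] jet_arrow_pure[OF a U s d m])
    qed
  qed (auto simp: conn D1)
  then show "\<exists>D0 D1'. relative_connection A Q M R D0 D1' \<and>
         (\<forall>a\<in>arcs Q. \<forall>U. open U \<longrightarrow> (\<forall>m\<in>sections (M a) U. D1' a U m = D1 a U m))"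
    by (intro exI[of _ D0] exI[of _ D1]) simp
next
  assume "\<exists>D0 D1'. relative_connection A Q M R D0 D1' \<and>
         (\<forall>a\<in>arcs Q. \<forall>U. open U \<longrightarrow> (\<forall>m\<in>sections (M a) U. D1' a U m = D1 a U m))"
  then obtain D0 D1' where rc: "relative_connection A Q M R D0 D1'"
    and D1': "\<forall>a\<in>arcs Q. \<forall>U. open U \<longrightarrow> (\<forall>m\<in>sections (M a) U. D1' a U m = D1 a U m)"
    by (elim exE conjE)
  note conn = rc[unfolded relative_connection_def, THEN conjunct1]
    rc[unfolded relative_connection_def, THEN conjunct2, THEN conjunct1]
  note pu = rc[unfolded relative_connection_iff_pure[OF D1' conn(2,1)], rule_format]
  define \<sigma> where "\<sigma> = (\<lambda>i U s. (s, D0 i U s))"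
  have "qmorphism A Q M R J \<sigma>"
  proof (rule qmorphismI[OF R J_twisted])
    show "sheaf_hom A (Ob R i) (Ob J i) (\<sigma> i)" if i: "i \<in> verts Q" for i
      using jet_section_hom_iff[OF i, of "\<sigma> i" "D0 i"] conn(1) i by (simp add: \<sigma>_def)
    fix a U s m assume a: "a \<in> arcs Q" and U: "open U" and s: "s \<in> sections (src a) U" and m: "m \<in> sections (M a) U"
    have d: "D0 (tail Q a) U s \<in> sections (tensor A (cotangent A) (src a)) U"
      by (rule additive_map_closed[OF connection_additive[OF conn(1)[rule_format, OF arc_verts(1)[OF a]]] U subset_UNIV s])
    show "\<sigma> (head Q a) U (Ar R a U (pure A (src a) (M a) U s m)) =
        Ar J a U (pure A (Ob J (tail Q a)) (M a) U (\<sigma> (tail Q a) U s) m)"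
      by (simp add: \<sigma>_def pu[OF a U s m] jet_arrow_pure[OF a U s d m])
  qed
  then show "\<exists>\<sigma>. qmorphism A Q M R J \<sigma> \<and>
        (\<forall>i\<in>verts Q. \<forall>U. open U \<longrightarrow> (\<forall>s\<in>sections (Ob R i) U. jet_beta i U (\<sigma> i U s) = s))"
    by (intro exI[of _ \<sigma>]) (simp add: \<sigma>_def jet_beta_def)
qed

end

section \<open>Extensions\<close>

text \<open>The conditions under which \<open>prod_sheaf F G C\<close> is a subsheaf of modules.\<close>

definition submodule_condition ::
  "('x::{t2_space,second_countable_topology}, 'b::real_normed_vector) atlas
     \<Rightarrow> ('x, 's) mod_sheaf \<Rightarrow> ('x, 't) mod_sheaf \<Rightarrow> ('x set \<Rightarrow> 's \<Rightarrow> 't \<Rightarrow> bool) \<Rightarrow> bool" where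
  "submodule_condition A F G C \<longleftrightarrow>
    (\<forall>U. open U \<longrightarrow> C U \<zero>\<^bsub>Sec F U\<^esub> \<zero>\<^bsub>Sec G U\<^esub>) \<and>
    (\<forall>U. open U \<longrightarrow> (\<forall>s\<in>sections F U. \<forall>t\<in>sections G U.
       (C U s t \<longrightarrow>
         (\<forall>s'\<in>sections F U. \<forall>t'\<in>sections G U. C U s' t' \<longrightarrow>
            C U (s \<oplus>\<^bsub>Sec F U\<^esub> s') (t \<oplus>\<^bsub>Sec G U\<^esub> t')) \<and>
         (\<forall>f\<in>smooth_fun A U. C U (f \<odot>\<^bsub>Sec F U\<^esub> s) (f \<odot>\<^bsub>Sec G U\<^esub> t)) \<and>
         (\<forall>V. open V \<and> V \<subseteq> U \<longrightarrow> C V (Res F U V s) (Res G U V t))) \<and>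
       ((\<forall>x\<in>U. \<exists>V. open V \<and> x \<in> V \<and> V \<subseteq> U \<and> C V (Res F U V s) (Res G U V t)) \<longrightarrow> C U s t)))"

lemma submodule_condition_True: "submodule_condition A F G (\<lambda>U s t. True)"
  by (simp add: submodule_condition_def)

lemma
  assumes "submodule_condition A F G C" "open U"
  shows submodule_condition_zero: "C U \<zero>\<^bsub>Sec F U\<^esub> \<zero>\<^bsub>Sec G U\<^esub>"
    and submodule_condition_add: "s \<in> sections F U \<Longrightarrow> t \<in> sections G U \<Longrightarrow> C U s t \<Longrightarrow>
      s' \<in> sections F U \<Longrightarrow> t' \<in> sections G U \<Longrightarrow> C U s' t' \<Longrightarrow> C U (s \<oplus>\<^bsub>Sec F U\<^esub> s') (t \<oplus>\<^bsub>Sec G U\<^esub> t')"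
    and submodule_condition_smult: "s \<in> sections F U \<Longrightarrow> t \<in> sections G U \<Longrightarrow> C U s t \<Longrightarrow>
      f \<in> smooth_fun A U \<Longrightarrow> C U (f \<odot>\<^bsub>Sec F U\<^esub> s) (f \<odot>\<^bsub>Sec G U\<^esub> t)"
    and submodule_condition_Res: "s \<in> sections F U \<Longrightarrow> t \<in> sections G U \<Longrightarrow> C U s t \<Longrightarrow>
      open V \<Longrightarrow> V \<subseteq> U \<Longrightarrow> C V (Res F U V s) (Res G U V t)"
    and submodule_condition_local: "s \<in> sections F U \<Longrightarrow> t \<in> sections G U \<Longrightarrow>
      (\<And>x. x \<in> U \<Longrightarrow> \<exists>V. open V \<and> x \<in> V \<and> V \<subseteq> U \<and> C V (Res F U V s) (Res G U V t)) \<Longrightarrow> C U s t"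
  using assms(1)[unfolded submodule_condition_def, THEN conjunct1, rule_format, OF assms(2)]
    assms(1)[unfolded submodule_condition_def, THEN conjunct2, rule_format, OF assms(2)] by simp_all

lemma prod_sheaf_simps:
  "sections (prod_sheaf F G C) U = {(s, t). s \<in> sections F U \<and> t \<in> sections G U \<and> C U s t}"
  "(s, t) \<oplus>\<^bsub>Sec (prod_sheaf F G C) U\<^esub> (s', t') = (s \<oplus>\<^bsub>Sec F U\<^esub> s', t \<oplus>\<^bsub>Sec G U\<^esub> t')"
  "\<zero>\<^bsub>Sec (prod_sheaf F G C) U\<^esub> = (\<zero>\<^bsub>Sec F U\<^esub>, \<zero>\<^bsub>Sec G U\<^esub>)"
  "f \<odot>\<^bsub>Sec (prod_sheaf F G C) U\<^esub> (s, t) = (f \<odot>\<^bsub>Sec F U\<^esub> s, f \<odot>\<^bsub>Sec G U\<^esub> t)"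
  "Res (prod_sheaf F G C) U V (s, t) = (Res F U V s, Res G U V t)"
  by (simp_all add: prod_sheaf_def)

section \<open>Subsheaves of direct sums, and sheaves with renamed sections\<close>

context smooth_mfd
begin

lemma prod_sheaf_presheaf:
  assumes F: "module_presheaf A F" and G: "module_presheaf A G" and C: "submodule_condition A F G C"
  shows "module_presheaf A (prod_sheaf F G C)"
  unfolding module_presheaf_def
proof (intro conjI allI impI ballI, goal_cases)
  case U: (1 U)
  let ?P = "prod_sheaf F G C"
  note cl = presheaf_closed[OF F U] presheaf_closed[OF G U] submodule_condition_zero[OF C U]
    submodule_condition_add[OF C U] submodule_condition_smult[OF C U]
  have CI: "carrier (Cinf A U) = smooth_fun A U" "a \<oplus>\<^bsub>Cinf A U\<^esub> b = (\<lambda>x. a x + b x)"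
    "a \<otimes>\<^bsub>Cinf A U\<^esub> b = (\<lambda>x. a x * b x)" "\<one>\<^bsub>Cinf A U\<^esub> = cut U (\<lambda>x. 1)" for a b
    by (simp_all add: Cinf_def)
  show ?case
  proof (rule moduleI[OF cring_Cinf[OF U]])
    show "abelian_group (Sec ?P U)"
    proof (rule abelian_groupI)
      fix p assume p: "p \<in> sections ?P U"
      then obtain s t where st: "p = (s, t)" "s \<in> sections F U" "t \<in> sections G U" "C U s t"
        by (auto simp: prod_sheaf_simps)
      \<comment> \<open>\<open>submodule_condition\<close> has no clause for negatives; closure
        under the constant scalar -1 supplies them.\<close>
      note m = smooth_fun_const[OF U, of "-1"] smooth_fun_const[OF U, of 1]
      have "(\<lambda>x. cut U (\<lambda>x. -1) x + cut U (\<lambda>x. 1) x) = (\<lambda>x. 0)" by (auto simp: cut_def)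
      then have "(cut U (\<lambda>x. -1) \<odot>\<^bsub>Sec F U\<^esub> s) \<oplus>\<^bsub>Sec F U\<^esub> s = \<zero>\<^bsub>Sec F U\<^esub>"
        "(cut U (\<lambda>x. -1) \<odot>\<^bsub>Sec G U\<^esub> t) \<oplus>\<^bsub>Sec G U\<^esub> t = \<zero>\<^bsub>Sec G U\<^esub>"
        using presheaf_add_smult[OF F U m st(2)] presheaf_add_smult[OF G U m st(3)]
          presheaf_one_smult[OF F U st(2)] presheaf_one_smult[OF G U st(3)]
          presheaf_zero_smult[OF F U st(2)] presheaf_zero_smult[OF G U st(3)] by simp_all
      then show "\<exists>q\<in>sections ?P U. q \<oplus>\<^bsub>Sec ?P U\<^esub> p = \<zero>\<^bsub>Sec ?P U\<^esub>"
        using st m by (intro bexI[of _ "cut U (\<lambda>x. -1) \<odot>\<^bsub>Sec ?P U\<^esub> p"]) (auto simp: prod_sheaf_simps cl)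
    qed (auto simp: prod_sheaf_simps cl presheaf_zero_add[OF F U] presheaf_zero_add[OF G U]
        presheaf_add_assoc[OF F U] presheaf_add_assoc[OF G U] intro: presheaf_add_comm[OF F U] presheaf_add_comm[OF G U])
  qed (auto simp: prod_sheaf_simps CI cl presheaf_add_smult[OF F U] presheaf_add_smult[OF G U]
      presheaf_smult_add[OF F U] presheaf_smult_add[OF G U] presheaf_mult_smult[OF F U] presheaf_mult_smult[OF G U]
      presheaf_one_smult[OF F U] presheaf_one_smult[OF G U])
next
  case (2 U p)
  then show ?case by (auto simp: prod_sheaf_simps presheaf_Res_id[OF F] presheaf_Res_id[OF G])
next
  case (3 U V W p)
  then show ?case by (auto simp: prod_sheaf_simps presheaf_Res_Res[OF F] presheaf_Res_Res[OF G])
next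
  case (4 U V p)
  then show ?case
    by (auto simp: prod_sheaf_simps presheaf_Res_closed[OF F] presheaf_Res_closed[OF G] submodule_condition_Res[OF C])
next
  case (5 U V p q)
  then show ?case by (auto simp: prod_sheaf_simps presheaf_Res_add[OF F] presheaf_Res_add[OF G])
next
  case (6 U V f p)
  then show ?case by (auto simp: prod_sheaf_simps presheaf_Res_smult[OF F] presheaf_Res_smult[OF G])
qed

text \<open>Sections are glued in the full direct sum, where nothing constrains the pairs. The
  locality clause of \<open>submodule_condition\<close> then puts the result back into the
  subsheaf.\<close>

lemma prod_sheaf_sheaf:
  assumes F: "module_sheaf A F" and G: "module_sheaf A G" and C: "submodule_condition A F G C"
  shows "module_sheaf A (prod_sheaf F G C)"
proof -
  note Fp = module_sheaf_presheaf[OF F] and Gp = module_sheaf_presheaf[OF G]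
  have D: "module_sheaf A (prod_sheaf F G (\<lambda>U s t. True))"
    by (rule pair_sheafI[OF prod_sheaf_presheaf[OF Fp Gp submodule_condition_True] F G])
      (auto simp: prod_sheaf_simps)
  let ?D = "prod_sheaf F G (\<lambda>U s t. True)" and ?P = "prod_sheaf F G C"
  have sec: "p \<in> sections ?P U \<longleftrightarrow> p \<in> sections ?D U \<and> C U (fst p) (snd p)" for p U
    by (auto simp: prod_sheaf_simps)
  have R: "Res ?P = Res ?D" by (simp add: prod_sheaf_def)
  show ?thesis
    unfolding module_sheaf_def
  proof (intro conjI allI impI ballI prod_sheaf_presheaf[OF Fp Gp C])
    fix \<U> :: "'x set set" assume op: "\<forall>U\<in>\<U>. open U"
    then have oU: "open (\<Union>\<U>)" by blast
    {
      fix p q assume pq: "p \<in> sections ?P (\<Union>\<U>)" "q \<in> sections ?P (\<Union>\<U>)"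
        and eq: "\<forall>U\<in>\<U>. Res ?P (\<Union>\<U>) U p = Res ?P (\<Union>\<U>) U q"
      show "p = q"
      proof (rule sheaf_eqI[OF D oU])
        fix x assume "x \<in> \<Union>\<U>"
        then show "\<exists>V. open V \<and> x \<in> V \<and> V \<subseteq> \<Union>\<U> \<and> Res ?D (\<Union>\<U>) V p = Res ?D (\<Union>\<U>) V q"
          using op eq unfolding R by blast
      qed (use pq sec in auto)
    }
    fix p assume p: "(\<forall>U\<in>\<U>. p U \<in> sections ?P U) \<and>
      (\<forall>U\<in>\<U>. \<forall>V\<in>\<U>. Res ?P U (U \<inter> V) (p U) = Res ?P V (U \<inter> V) (p V))"
    have "\<exists>q\<in>sections ?D (\<Union>\<U>). \<forall>U\<in>\<U>. Res ?D (\<Union>\<U>) U q = p U"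
    proof -
      have "\<forall>p. (\<forall>U\<in>\<U>. p U \<in> sections ?D U) \<and>
        (\<forall>U\<in>\<U>. \<forall>V\<in>\<U>. Res ?D U (U \<inter> V) (p U) = Res ?D V (U \<inter> V) (p V)) \<longrightarrow>
        (\<exists>q\<in>sections ?D (\<Union>\<U>). \<forall>U\<in>\<U>. Res ?D (\<Union>\<U>) U q = p U)"
        using D op unfolding module_sheaf_def by blast
      then show ?thesis using p sec unfolding R by blast
    qed
    then obtain q where q: "q \<in> sections ?D (\<Union>\<U>)" "\<forall>U\<in>\<U>. Res ?D (\<Union>\<U>) U q = p U" by blast
    obtain s t where st: "q = (s, t)" by fastforce
    have "C (\<Union>\<U>) s t"
    proof (rule submodule_condition_local[OF C oU])
      show "s \<in> sections F (\<Union>\<U>)" "t \<in> sections G (\<Union>\<U>)" using q(1) by (auto simp: st prod_sheaf_simps)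
      fix x assume "x \<in> \<Union>\<U>"
      then obtain U where U: "U \<in> \<U>" "x \<in> U" by blast
      have "p U = (Res F (\<Union>\<U>) U s, Res G (\<Union>\<U>) U t)"
        using q(2) U(1) by (simp add: st prod_sheaf_simps)
      then have "C U (Res F (\<Union>\<U>) U s) (Res G (\<Union>\<U>) U t)"
        using p U(1) sec by fastforce
      then show "\<exists>V. open V \<and> x \<in> V \<and> V \<subseteq> \<Union>\<U> \<and> C V (Res F (\<Union>\<U>) V s) (Res G (\<Union>\<U>) V t)"
        using U op by blast
    qed
    then show "\<exists>q\<in>sections ?P (\<Union>\<U>). \<forall>U\<in>\<U>. Res ?P (\<Union>\<U>) U q = p U"
      using q sec by (intro bexI[of _ q]) (simp_all add: R st)
  qed
qed

lemma prod_sheaf_fst: "sheaf_hom A (prod_sheaf F G C) F (\<lambda>U. fst)"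
  unfolding sheaf_hom_on_def additive_map_on_def by (auto simp: prod_sheaf_simps)

lemma prod_sheaf_snd: "sheaf_hom A (prod_sheaf F G C) G (\<lambda>U. snd)"
  unfolding sheaf_hom_on_def additive_map_on_def by (auto simp: prod_sheaf_simps)

text \<open>With \<beta> and the identity for \<open>h\<close> and \<open>k\<close>, this is the
  condition that cuts out the pullback in the connecting map. Its locality is the separation axiom
  of \<open>H\<close>.\<close>

lemma submodule_condition_equalizer:
  assumes F: "module_presheaf A F" and G: "module_presheaf A G" and H: "module_sheaf A H"
    and h: "sheaf_hom A F H h" and k: "sheaf_hom A G H k"
  shows "submodule_condition A F G (\<lambda>U s t. h U s = k U t)"
proof -
  note ha = sheaf_hom_additive[OF h] and ka = sheaf_hom_additive[OF k]
  note Hp = module_sheaf_presheaf[OF H]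
  have "h U s = k U t"
    if U: "open U" and s: "s \<in> sections F U" and t: "t \<in> sections G U"
      and loc: "\<forall>x\<in>U. \<exists>V. open V \<and> x \<in> V \<and> V \<subseteq> U \<and> h V (Res F U V s) = k V (Res G U V t)" for U s t
  proof (rule sheaf_eqI[OF H U])
    show "h U s \<in> sections H U" "k U t \<in> sections H U"
      using additive_map_closed[OF ha U subset_UNIV s] additive_map_closed[OF ka U subset_UNIV t] by auto
    fix x assume "x \<in> U"
    then show "\<exists>V. open V \<and> x \<in> V \<and> V \<subseteq> U \<and> Res H U V (h U s) = Res H U V (k U t)"
      using loc additive_map_Res[OF ha U subset_UNIV _ _ s] additive_map_Res[OF ka U subset_UNIV _ _ t] by metis
  qed
  moreover have "h U \<zero>\<^bsub>Sec F U\<^esub> = k U \<zero>\<^bsub>Sec G U\<^esub>" if "open U" for U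
    using additive_map_zero[OF F Hp ha that subset_UNIV] additive_map_zero[OF G Hp ka that subset_UNIV] by simp
  ultimately show ?thesis
    unfolding submodule_condition_def
    by (simp add: additive_map_add[OF ha] additive_map_add[OF ka] sheaf_hom_smult[OF h] sheaf_hom_smult[OF k]
        additive_map_Res[OF ha] additive_map_Res[OF ka])
qed

text \<open>The same sheaf with its sections renamed into another type along \<open>g\<close>;
  operations are read back through the inverse, so \<open>g\<close> should be injective. It serves
  to bring an extension into the one section type that \<open>Ext1\<close> allows.\<close>

definition transport_sheaf :: "('s \<Rightarrow> 't) \<Rightarrow> ('x, 's) mod_sheaf \<Rightarrow> ('x, 't) mod_sheaf" where
  "transport_sheaf g F =
     \<lparr>Sec = (\<lambda>U.
        \<lparr>carrier = g ` sections F U, mult = undefined, one = undefined,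
         ring.zero = g \<zero>\<^bsub>Sec F U\<^esub>, add = (\<lambda>a b. g (inv_into UNIV g a \<oplus>\<^bsub>Sec F U\<^esub> inv_into UNIV g b)),
         smult = (\<lambda>f a. g (f \<odot>\<^bsub>Sec F U\<^esub> inv_into UNIV g a))\<rparr>),
      Res = (\<lambda>U V a. g (Res F U V (inv_into UNIV g a)))\<rparr>"

lemma transport_sheaf_simps:
  "sections (transport_sheaf g F) U = g ` sections F U"
  "\<zero>\<^bsub>Sec (transport_sheaf g F) U\<^esub> = g \<zero>\<^bsub>Sec F U\<^esub>"
  "inj g \<Longrightarrow> g s \<oplus>\<^bsub>Sec (transport_sheaf g F) U\<^esub> g t = g (s \<oplus>\<^bsub>Sec F U\<^esub> t)"
  "inj g \<Longrightarrow> f \<odot>\<^bsub>Sec (transport_sheaf g F) U\<^esub> g s = g (f \<odot>\<^bsub>Sec F U\<^esub> s)"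
  "inj g \<Longrightarrow> Res (transport_sheaf g F) U V (g s) = g (Res F U V s)"
  by (simp_all add: transport_sheaf_def)

lemma transport_sheaf_sheaf:
  assumes F: "module_sheaf A F" and g: "inj g"
  shows "module_sheaf A (transport_sheaf g F)"
proof -
  let ?T = "transport_sheaf g F"
  note Fp = module_sheaf_presheaf[OF F]
  note ts = transport_sheaf_simps(1,2) transport_sheaf_simps(3-)[OF g]
  have P: "module_presheaf A ?T"
    unfolding module_presheaf_def
  proof (intro conjI allI impI ballI, goal_cases)
    case U: (1 U)
    note cl = presheaf_closed[OF Fp U]
    have CI: "carrier (Cinf A U) = smooth_fun A U" "a \<oplus>\<^bsub>Cinf A U\<^esub> b = (\<lambda>x. a x + b x)"
      "a \<otimes>\<^bsub>Cinf A U\<^esub> b = (\<lambda>x. a x * b x)" "\<one>\<^bsub>Cinf A U\<^esub> = cut U (\<lambda>x. 1)" for a b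
      by (simp_all add: Cinf_def)
    show ?case
    proof (rule moduleI[OF cring_Cinf[OF U]])
      show "abelian_group (Sec ?T U)"
      proof (rule abelian_groupI)
        fix p assume "p \<in> sections ?T U"
        then obtain s where s: "p = g s" "s \<in> sections F U" by (auto simp: ts)
        have ab: "abelian_group (Sec F U)"
          using presheaf_module[OF Fp U] by (simp add: Module.module_def)
        obtain s' where s': "s' \<in> sections F U" "s' \<oplus>\<^bsub>Sec F U\<^esub> s = \<zero>\<^bsub>Sec F U\<^esub>"
          using s(2) abelian_group.a_inv_closed[OF ab] abelian_group.l_neg[OF ab] by blast
        show "\<exists>q\<in>sections ?T U. q \<oplus>\<^bsub>Sec ?T U\<^esub> p = \<zero>\<^bsub>Sec ?T U\<^esub>"
          using s' by (intro bexI[of _ "g s'"]) (simp_all add: s ts)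
      qed (auto simp: ts cl presheaf_zero_add[OF Fp U] presheaf_add_assoc[OF Fp U]
          intro: arg_cong[of _ _ g, OF presheaf_add_comm[OF Fp U]])
    qed (auto simp: ts CI cl presheaf_add_smult[OF Fp U] presheaf_smult_add[OF Fp U]
        presheaf_mult_smult[OF Fp U] presheaf_one_smult[OF Fp U])
  next
    case (2 U p)
    then show ?case by (auto simp: ts presheaf_Res_id[OF Fp])
  next
    case (3 U V W p)
    then show ?case by (auto simp: ts presheaf_Res_Res[OF Fp])
  next
    case (4 U V p)
    then show ?case by (auto simp: ts presheaf_Res_closed[OF Fp])
  next
    case (5 U V p q)
    then show ?case by (auto simp: ts presheaf_Res_add[OF Fp])
  next
    case (6 U V f p)
    then show ?case by (auto simp: ts presheaf_Res_smult[OF Fp])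
  qed
  show ?thesis
    unfolding module_sheaf_def
  proof (intro conjI allI impI ballI P)
    fix \<U> :: "'x set set" assume op: "\<forall>U\<in>\<U>. open U"
    then have oU: "open (\<Union>\<U>)" by blast
    {
      fix p q assume "p \<in> sections ?T (\<Union>\<U>)" "q \<in> sections ?T (\<Union>\<U>)"
        and eq: "\<forall>U\<in>\<U>. Res ?T (\<Union>\<U>) U p = Res ?T (\<Union>\<U>) U q"
      then obtain s t where st: "p = g s" "s \<in> sections F (\<Union>\<U>)" "q = g t" "t \<in> sections F (\<Union>\<U>)"
        by (auto simp: ts)
      have "s = t"
      proof (rule sheaf_eqI[OF F oU st(2,4)])
        fix x assume "x \<in> \<Union>\<U>"
        then obtain U where U: "U \<in> \<U>" "x \<in> U" by blast
        have "Res F (\<Union>\<U>) U s = Res F (\<Union>\<U>) U t"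
          using eq U(1) g by (simp add: st ts inj_eq)
        then show "\<exists>V. open V \<and> x \<in> V \<and> V \<subseteq> \<Union>\<U> \<and> Res F (\<Union>\<U>) V s = Res F (\<Union>\<U>) V t"
          using U op by blast
      qed
      then show "p = q" by (simp add: st)
    }
    fix p assume p: "(\<forall>U\<in>\<U>. p U \<in> sections ?T U) \<and>
      (\<forall>U\<in>\<U>. \<forall>V\<in>\<U>. Res ?T U (U \<inter> V) (p U) = Res ?T V (U \<inter> V) (p V))"
    define q where "q = (\<lambda>U. inv_into UNIV g (p U))"
    have q: "q U \<in> sections F U" "p U = g (q U)" if "U \<in> \<U>" for U
      using p that g by (auto simp: ts q_def)
    have "Res F U (U \<inter> V) (q U) = Res F V (U \<inter> V) (q V)" if "U \<in> \<U>" "V \<in> \<U>" for U V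
      using p that g by (auto simp: q(2) ts inj_eq)
    moreover have "\<forall>p. (\<forall>U\<in>\<U>. p U \<in> sections F U) \<and>
        (\<forall>U\<in>\<U>. \<forall>V\<in>\<U>. Res F U (U \<inter> V) (p U) = Res F V (U \<inter> V) (p V)) \<longrightarrow>
        (\<exists>q\<in>sections F (\<Union>\<U>). \<forall>U\<in>\<U>. Res F (\<Union>\<U>) U q = p U)"
      using F op unfolding module_sheaf_def by blast
    ultimately obtain s where "s \<in> sections F (\<Union>\<U>)" "\<forall>U\<in>\<U>. Res F (\<Union>\<U>) U s = q U"
      using q(1) by blast
    then show "\<exists>r\<in>sections ?T (\<Union>\<U>). \<forall>U\<in>\<U>. Res ?T (\<Union>\<U>) U r = p U"
      by (intro bexI[of _ "g s"]) (simp_all add: ts q(2))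
  qed
qed

lemma transport_sheaf_hom: "inj g \<Longrightarrow> sheaf_hom A F (transport_sheaf g F) (\<lambda>U. g)"
  unfolding sheaf_hom_on_def additive_map_on_def by (simp add: transport_sheaf_simps)

lemma transport_sheaf_inv_hom: "inj g \<Longrightarrow> sheaf_hom A (transport_sheaf g F) F (\<lambda>U. inv_into UNIV g)"
  unfolding sheaf_hom_on_def additive_map_on_def by (auto simp: transport_sheaf_simps)

end

section \<open>Subobjects of direct sums of twisted quiver sheaves\<close>

context twisted_quiver
begin

text \<open>The structure map is given by the two projections, so it evidently lands in the direct
  sum. That it respects the condition \<open>C\<close> is assumed on pure tensors and has to be
  extended to all sections of the tensor product.\<close>

lemma prod_qsheaf:
  assumes P: "twisted_qsheaf A Q M P" and S: "twisted_qsheaf A Q M S"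
    and C: "\<And>i. i \<in> verts Q \<Longrightarrow> submodule_condition A (Ob P i) (Ob S i) (C i)"
    and Ar: "\<And>a U p s m. a \<in> arcs Q \<Longrightarrow> open U \<Longrightarrow> p \<in> sections (Ob P (tail Q a)) U \<Longrightarrow>
      s \<in> sections (Ob S (tail Q a)) U \<Longrightarrow> C (tail Q a) U p s \<Longrightarrow> m \<in> sections (M a) U \<Longrightarrow>
      C (head Q a) U (Ar P a U (pure A (Ob P (tail Q a)) (M a) U p m))
        (Ar S a U (pure A (Ob S (tail Q a)) (M a) U s m))"
  defines "D \<equiv> prod_qsheaf A Q M P S C"
  shows Ob_prod: "Ob D i = prod_sheaf (Ob P i) (Ob S i) (C i)"
    and Ar_prod_pure: "a \<in> arcs Q \<Longrightarrow> open U \<Longrightarrow> p \<in> sections (Ob P (tail Q a)) U \<Longrightarrow>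
      s \<in> sections (Ob S (tail Q a)) U \<Longrightarrow> C (tail Q a) U p s \<Longrightarrow> m \<in> sections (M a) U \<Longrightarrow>
      Ar D a U (pure A (Ob D (tail Q a)) (M a) U (p, s) m) =
        (Ar P a U (pure A (Ob P (tail Q a)) (M a) U p m), Ar S a U (pure A (Ob S (tail Q a)) (M a) U s m))"
    and prod_twisted: "twisted_qsheaf A Q M D"
    and prod_fst: "qmorphism A Q M D P (\<lambda>i U. fst)"
    and prod_snd: "qmorphism A Q M D S (\<lambda>i U. snd)"
proof -
  show ObD: "Ob D i = prod_sheaf (Ob P i) (Ob S i) (C i)" for i
    by (simp add: D_def prod_qsheaf_def Let_def)
  have Dsheaf: "module_sheaf A (Ob D i)" if "i \<in> verts Q" for i
    unfolding ObD by (rule prod_sheaf_sheaf[OF Ob_sheaf[OF P that] Ob_sheaf[OF S that] C[OF that]])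
  note fst_hom = prod_sheaf_fst[of "Ob P i" "Ob S i" "C i" for i, folded ObD]
  note snd_hom = prod_sheaf_snd[of "Ob P i" "Ob S i" "C i" for i, folded ObD]
  have arc: "sheaf_hom A (tensor A (Ob D (tail Q a)) (M a)) (Ob D (head Q a)) (Ar D a)"
    "open U \<Longrightarrow> p \<in> sections (Ob P (tail Q a)) U \<Longrightarrow>
      s \<in> sections (Ob S (tail Q a)) U \<Longrightarrow> C (tail Q a) U p s \<Longrightarrow> m \<in> sections (M a) U \<Longrightarrow>
      Ar D a U (pure A (Ob D (tail Q a)) (M a) U (p, s) m) =
        (Ar P a U (pure A (Ob P (tail Q a)) (M a) U p m), Ar S a U (pure A (Ob S (tail Q a)) (M a) U s m))"
    if a: "a \<in> arcs Q" for a U p s m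
  proof -
    note v = arc_verts[OF a]
    note Ps = Ob_presheaf[OF P v(1)] and Ss = Ob_presheaf[OF S v(1)]
      and Ds = module_sheaf_presheaf[OF Dsheaf[OF v(1)]] and Ma = M_presheaf[OF a]
    define h where "h = (\<lambda>U z. Ar P a U (tensor_map A (Ob D (tail Q a)) (M a) (Ob P (tail Q a)) (M a) (\<lambda>U. fst) (\<lambda>U m. m) U z))"
    define k where "k = (\<lambda>U z. Ar S a U (tensor_map A (Ob D (tail Q a)) (M a) (Ob S (tail Q a)) (M a) (\<lambda>U. snd) (\<lambda>U m. m) U z))"
    have hh: "sheaf_hom A (tensor A (Ob D (tail Q a)) (M a)) (Ob P (head Q a)) h"
      unfolding h_def by (rule sheaf_hom_comp[OF tensor_map_hom[OF Ds Ma Ps Ma fst_hom sheaf_hom_id] Ar_hom[OF P a]])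
    have kh: "sheaf_hom A (tensor A (Ob D (tail Q a)) (M a)) (Ob S (head Q a)) k"
      unfolding k_def by (rule sheaf_hom_comp[OF tensor_map_hom[OF Ds Ma Ss Ma snd_hom sheaf_hom_id] Ar_hom[OF S a]])
    have ArD: "Ar D a U z = (h U z, k U z)" for U z
      unfolding h_def k_def ObD by (simp add: D_def prod_qsheaf_def Let_def)
    have pu: "h U (pure A (Ob D (tail Q a)) (M a) U p m) = Ar P a U (pure A (Ob P (tail Q a)) (M a) U (fst p) m)"
      "k U (pure A (Ob D (tail Q a)) (M a) U p m) = Ar S a U (pure A (Ob S (tail Q a)) (M a) U (snd p) m)"
      if "open U" "p \<in> sections (Ob D (tail Q a)) U" "m \<in> sections (M a) U" for U p m
      unfolding h_def k_def using that
      by (simp_all add: tensor_map_pure[OF Ds Ma Ps Ma fst_hom sheaf_hom_id] tensor_map_pure[OF Ds Ma Ss Ma snd_hom sheaf_hom_id])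
    \<comment> \<open>\<open>tensor_induct\<close> applies to the condition itself: pure tensors are
      the hypothesis \<open>Ar\<close>, sums use closure under addition, and the local case is the
      locality clause of \<open>submodule_condition\<close>.\<close>
    have cond: "C (head Q a) U (h U z) (k U z)"
      if U: "open U" and z: "z \<in> sections (tensor A (Ob D (tail Q a)) (M a)) U" for U z
    proof -
      note hc = additive_map_closed[OF sheaf_hom_additive[OF hh] _ subset_UNIV]
      note kc = additive_map_closed[OF sheaf_hom_additive[OF kh] _ subset_UNIV]
      show ?thesis
        using U z
      proof (induction rule: tensor_induct[OF Ds Ma, consumes 2, case_names pure add local])
        case (pure V p m)
        then show ?case using pu[OF pure(1,3,4)] Ar[OF a pure(1) _ _ _ pure(4), of "fst p" "snd p"]
          by (auto simp: ObD prod_sheaf_simps)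
      next
        case (add V z w)
        then show ?case
          using additive_map_add[OF sheaf_hom_additive[OF hh] add(1) subset_UNIV add(3,4)]
            additive_map_add[OF sheaf_hom_additive[OF kh] add(1) subset_UNIV add(3,4)]
            submodule_condition_add[OF C[OF v(2)] add(1) hc[OF add(1,3)] kc[OF add(1,3)] _ hc[OF add(1,4)] kc[OF add(1,4)]]
          by simp
      next
        case local
        show ?case
        proof (rule submodule_condition_local[OF C[OF v(2)] U hc[OF U z] kc[OF U z]])
          fix x assume "x \<in> U"
          from local[OF this] show "\<exists>V. open V \<and> x \<in> V \<and> V \<subseteq> U \<and>
              C (head Q a) V (Res (Ob P (head Q a)) U V (h U z)) (Res (Ob S (head Q a)) U V (k U z))"
            using additive_map_Res[OF sheaf_hom_additive[OF hh] U subset_UNIV _ _ z]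
              additive_map_Res[OF sheaf_hom_additive[OF kh] U subset_UNIV _ _ z] by metis
        qed
      qed
    qed
    show "sheaf_hom A (tensor A (Ob D (tail Q a)) (M a)) (Ob D (head Q a)) (Ar D a)"
      unfolding sheaf_hom_on_def
    proof (intro conjI additive_mapI allI ballI impI)
      fix U z assume U: "open U" and z: "z \<in> sections (tensor A (Ob D (tail Q a)) (M a)) U"
      show "Ar D a U z \<in> sections (Ob D (head Q a)) U"
        using cond[OF U z] additive_map_closed[OF sheaf_hom_additive[OF hh] U subset_UNIV z]
          additive_map_closed[OF sheaf_hom_additive[OF kh] U subset_UNIV z]
        by (simp add: ArD ObD prod_sheaf_simps)
    qed (simp_all add: ArD ObD prod_sheaf_simps sheaf_hom_smult[OF hh[unfolded ObD]] sheaf_hom_smult[OF kh[unfolded ObD]]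
        additive_map_add[OF sheaf_hom_additive[OF hh[unfolded ObD]]] additive_map_add[OF sheaf_hom_additive[OF kh[unfolded ObD]]]
        additive_map_Res[OF sheaf_hom_additive[OF hh[unfolded ObD]]] additive_map_Res[OF sheaf_hom_additive[OF kh[unfolded ObD]]])
    show "open U \<Longrightarrow> p \<in> sections (Ob P (tail Q a)) U \<Longrightarrow>
      s \<in> sections (Ob S (tail Q a)) U \<Longrightarrow> C (tail Q a) U p s \<Longrightarrow> m \<in> sections (M a) U \<Longrightarrow>
      Ar D a U (pure A (Ob D (tail Q a)) (M a) U (p, s) m) =
        (Ar P a U (pure A (Ob P (tail Q a)) (M a) U p m), Ar S a U (pure A (Ob S (tail Q a)) (M a) U s m))"
      using pu[of U "(p, s)" m] by (simp add: ArD ObD prod_sheaf_simps)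
  qed
  show tw: "twisted_qsheaf A Q M D" unfolding twisted_qsheaf_def using Dsheaf arc(1) by blast
  show "a \<in> arcs Q \<Longrightarrow> open U \<Longrightarrow> p \<in> sections (Ob P (tail Q a)) U \<Longrightarrow>
      s \<in> sections (Ob S (tail Q a)) U \<Longrightarrow> C (tail Q a) U p s \<Longrightarrow> m \<in> sections (M a) U \<Longrightarrow>
      Ar D a U (pure A (Ob D (tail Q a)) (M a) U (p, s) m) =
        (Ar P a U (pure A (Ob P (tail Q a)) (M a) U p m), Ar S a U (pure A (Ob S (tail Q a)) (M a) U s m))"
    by (rule arc(2))
  show "qmorphism A Q M D P (\<lambda>i U. fst)"
  proof (rule qmorphismI[OF tw P fst_hom])
    fix a U p m assume *: "a \<in> arcs Q" "open U" "p \<in> sections (Ob D (tail Q a)) U" "m \<in> sections (M a) U"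
    then show "fst (Ar D a U (pure A (Ob D (tail Q a)) (M a) U p m)) =
        Ar P a U (pure A (Ob P (tail Q a)) (M a) U (fst p) m)"
      using arc(2)[OF *(1,2), of "fst p" "snd p" m] by (auto simp: ObD prod_sheaf_simps)
  qed
  show "qmorphism A Q M D S (\<lambda>i U. snd)"
  proof (rule qmorphismI[OF tw S snd_hom])
    fix a U p m assume *: "a \<in> arcs Q" "open U" "p \<in> sections (Ob D (tail Q a)) U" "m \<in> sections (M a) U"
    then show "snd (Ar D a U (pure A (Ob D (tail Q a)) (M a) U p m)) =
        Ar S a U (pure A (Ob S (tail Q a)) (M a) U (snd p) m)"
      using arc(2)[OF *(1,2), of "fst p" "snd p" m] by (auto simp: ObD prod_sheaf_simps)
  qed
qed

section \<open>Composition and inversion of morphisms, equivalence of extensions\<close>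

lemma qmorphism_closed: "qmorphism A Q M P P' f \<Longrightarrow> i \<in> verts Q \<Longrightarrow> open U \<Longrightarrow>
    s \<in> sections (Ob P i) U \<Longrightarrow> f i U s \<in> sections (Ob P' i) U"
  by (rule additive_map_closed[OF sheaf_hom_additive[OF qmorphism_hom] _ subset_UNIV])

lemma qmorphism_add: "qmorphism A Q M P P' f \<Longrightarrow> i \<in> verts Q \<Longrightarrow> open U \<Longrightarrow>
    s \<in> sections (Ob P i) U \<Longrightarrow> t \<in> sections (Ob P i) U \<Longrightarrow>
    f i U (s \<oplus>\<^bsub>Sec (Ob P i) U\<^esub> t) = f i U s \<oplus>\<^bsub>Sec (Ob P' i) U\<^esub> f i U t"
  by (rule additive_map_add[OF sheaf_hom_additive[OF qmorphism_hom] _ subset_UNIV])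

lemma qmorphism_comp:
  assumes P: "twisted_qsheaf A Q M P" and P': "twisted_qsheaf A Q M P'" and P'': "twisted_qsheaf A Q M P''"
    and f: "qmorphism A Q M P P' f" and g: "qmorphism A Q M P' P'' g"
  shows "qmorphism A Q M P P'' (\<lambda>i U s. g i U (f i U s))"
proof (rule qmorphismI[OF P P''])
  show "sheaf_hom A (Ob P i) (Ob P'' i) (\<lambda>U s. g i U (f i U s))" if "i \<in> verts Q" for i
    by (rule sheaf_hom_comp[OF qmorphism_hom[OF f that] qmorphism_hom[OF g that]])
  fix a U s m assume *: "a \<in> arcs Q" "open U" "s \<in> sections (Ob P (tail Q a)) U" "m \<in> sections (M a) U"
  show "g (head Q a) U (f (head Q a) U (Ar P a U (pure A (Ob P (tail Q a)) (M a) U s m))) =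
      Ar P'' a U (pure A (Ob P'' (tail Q a)) (M a) U (g (tail Q a) U (f (tail Q a) U s)) m)"
    unfolding qmorphism_pure[OF f P P' *]
    by (rule qmorphism_pure[OF g P' P'' *(1,2) qmorphism_closed[OF f arc_verts(1)[OF *(1)] *(2,3)] *(4)])
qed

text \<open>Each identity for the inverse is verified after applying \<open>f\<close>, where it
  becomes the identity for \<open>f\<close>; injectivity on sections, in the form \<open>gI\<close>,
  brings it back.\<close>

lemma qmorphism_inverse:
  assumes P: "twisted_qsheaf A Q M P" and P': "twisted_qsheaf A Q M P'" and f: "qmorphism A Q M P P' f"
    and bij: "\<And>i U. i \<in> verts Q \<Longrightarrow> open U \<Longrightarrow> bij_betw (f i U) (sections (Ob P i) U) (sections (Ob P' i) U)"
  defines "g \<equiv> \<lambda>i U. inv_into (sections (Ob P i) U) (f i U)"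
  shows "qmorphism A Q M P' P g"
proof (rule qmorphismI[OF P' P])
  have g: "g i U t \<in> sections (Ob P i) U" "f i U (g i U t) = t"
    if "i \<in> verts Q" "open U" "t \<in> sections (Ob P' i) U" for i U t
    using bij_betw_imp_surj_on[OF bij[OF that(1,2)]] that(3) unfolding g_def
    by (auto simp: inv_into_into f_inv_into_f)
  have gI: "g i U t = s" if "i \<in> verts Q" "open U" "s \<in> sections (Ob P i) U" "f i U s = t" for i U s t
    using bij_betw_imp_inj_on[OF bij[OF that(1,2)]] that(3,4) unfolding g_def by (auto simp: inv_into_f_f)
  show "sheaf_hom A (Ob P' i) (Ob P i) (g i)" if i: "i \<in> verts Q" for i
  proof -
    note Pp = Ob_presheaf[OF P i] and fh = qmorphism_hom[OF f i]
    note fa = sheaf_hom_additive[OF fh]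
    show ?thesis
      unfolding sheaf_hom_on_def
    proof (intro conjI additive_mapI allI impI ballI)
      fix U V s assume *: "open U" "open V" "V \<subseteq> U" "s \<in> sections (Ob P' i) U"
      show "g i V (Res (Ob P' i) U V s) = Res (Ob P i) U V (g i U s)"
        using * g[OF i *(1,4)] additive_map_Res[OF fa *(1) subset_UNIV *(2,3) g(1)[OF i *(1,4)]]
        by (intro gI[OF i *(2)] presheaf_Res_closed[OF Pp]) simp_all
    next
      fix U s t assume *: "open U" "s \<in> sections (Ob P' i) U" "t \<in> sections (Ob P' i) U"
      show "g i U (s \<oplus>\<^bsub>Sec (Ob P' i) U\<^esub> t) = g i U s \<oplus>\<^bsub>Sec (Ob P i) U\<^esub> g i U t"
        using * g[OF i *(1,2)] g[OF i *(1,3)] additive_map_add[OF fa *(1) subset_UNIV g(1)[OF i *(1,2)] g(1)[OF i *(1,3)]]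
        by (intro gI[OF i *(1)] presheaf_add_closed[OF Pp]) simp_all
    next
      fix U k s assume *: "open U \<and> U \<subseteq> UNIV" "k \<in> smooth_fun A U" "s \<in> sections (Ob P' i) U"
      then show "g i U (k \<odot>\<^bsub>Sec (Ob P' i) U\<^esub> s) = k \<odot>\<^bsub>Sec (Ob P i) U\<^esub> g i U s"
        using g[OF i _ *(3)] sheaf_hom_smult[OF fh _ subset_UNIV *(2) g(1)[OF i _ *(3)]]
        by (intro gI[OF i] presheaf_smult_closed[OF Pp]) simp_all
    qed (rule g(1)[OF i])
  qed
  fix a U t m assume *: "a \<in> arcs Q" "open U" "t \<in> sections (Ob P' (tail Q a)) U" "m \<in> sections (M a) U"
  note v = arc_verts[OF *(1)]
  note gt = g[OF v(1) *(2,3)]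
  show "g (head Q a) U (Ar P' a U (pure A (Ob P' (tail Q a)) (M a) U t m)) =
      Ar P a U (pure A (Ob P (tail Q a)) (M a) U (g (tail Q a) U t) m)"
    using qmorphism_pure[OF f P P' *(1,2) gt(1) *(4)] gt(2)
    by (intro gI[OF v(2) *(2)] Ar_closed[OF P *(1,2) gt(1) *(4)]) simp
qed

lemma ext_equiv_trans:
  assumes tw: "twisted_qsheaf A Q M P" "twisted_qsheaf A Q M P'" "twisted_qsheaf A Q M P''"
    and 1: "ext_equiv A Q M R N (P, \<alpha>, \<beta>) (P', \<alpha>', \<beta>')" and 2: "ext_equiv A Q M R N (P', \<alpha>', \<beta>') (P'', \<alpha>'', \<beta>'')"
  shows "ext_equiv A Q M R N (P, \<alpha>, \<beta>) (P'', \<alpha>'', \<beta>'')"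
proof -
  obtain f where f: "qmorphism A Q M P P' f"
    "\<And>i U. i \<in> verts Q \<Longrightarrow> open U \<Longrightarrow> bij_betw (f i U) (sections (Ob P i) U) (sections (Ob P' i) U)"
    "\<And>i U n. i \<in> verts Q \<Longrightarrow> open U \<Longrightarrow> n \<in> sections (Ob N i) U \<Longrightarrow> f i U (\<alpha> i U n) = \<alpha>' i U n"
    "\<And>i U p. i \<in> verts Q \<Longrightarrow> open U \<Longrightarrow> p \<in> sections (Ob P i) U \<Longrightarrow> \<beta>' i U (f i U p) = \<beta> i U p"
    using 1 unfolding ext_equiv_def by auto
  obtain g where g: "qmorphism A Q M P' P'' g"
    "\<And>i U. i \<in> verts Q \<Longrightarrow> open U \<Longrightarrow> bij_betw (g i U) (sections (Ob P' i) U) (sections (Ob P'' i) U)"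
    "\<And>i U n. i \<in> verts Q \<Longrightarrow> open U \<Longrightarrow> n \<in> sections (Ob N i) U \<Longrightarrow> g i U (\<alpha>' i U n) = \<alpha>'' i U n"
    "\<And>i U p. i \<in> verts Q \<Longrightarrow> open U \<Longrightarrow> p \<in> sections (Ob P' i) U \<Longrightarrow> \<beta>'' i U (g i U p) = \<beta>' i U p"
    using 2 unfolding ext_equiv_def by auto
  have "bij_betw (\<lambda>s. g i U (f i U s)) (sections (Ob P i) U) (sections (Ob P'' i) U)"
    if "i \<in> verts Q" "open U" for i U
    using bij_betw_trans[OF f(2)[OF that] g(2)[OF that]] by (simp add: comp_def)
  then show ?thesis
    unfolding ext_equiv_def prod.case
    using qmorphism_comp[OF tw f(1) g(1)] f(3,4) g(3,4) qmorphism_closed[OF f(1)]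
    by (intro exI[of _ "\<lambda>i U s. g i U (f i U s)"]) simp
qed

text \<open>The hypothesis on \<alpha> places \<open>\<alpha> i U n\<close> among the sections of
  \<open>P\<close>, on which the inverse undoes the given equivalence.\<close>

lemma ext_equiv_sym:
  assumes tw: "twisted_qsheaf A Q M P" "twisted_qsheaf A Q M P'"
    and \<alpha>: "\<And>i U n. i \<in> verts Q \<Longrightarrow> open U \<Longrightarrow> n \<in> sections (Ob N i) U \<Longrightarrow> \<alpha> i U n \<in> sections (Ob P i) U"
    and 1: "ext_equiv A Q M R N (P, \<alpha>, \<beta>) (P', \<alpha>', \<beta>')"
  shows "ext_equiv A Q M R N (P', \<alpha>', \<beta>') (P, \<alpha>, \<beta>)"
proof -
  obtain f where f: "qmorphism A Q M P P' f"
    "\<And>i U. i \<in> verts Q \<Longrightarrow> open U \<Longrightarrow> bij_betw (f i U) (sections (Ob P i) U) (sections (Ob P' i) U)"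
    "\<And>i U n. i \<in> verts Q \<Longrightarrow> open U \<Longrightarrow> n \<in> sections (Ob N i) U \<Longrightarrow> f i U (\<alpha> i U n) = \<alpha>' i U n"
    "\<And>i U p. i \<in> verts Q \<Longrightarrow> open U \<Longrightarrow> p \<in> sections (Ob P i) U \<Longrightarrow> \<beta>' i U (f i U p) = \<beta> i U p"
    using 1 unfolding ext_equiv_def by auto
  define g where "g = (\<lambda>i U. inv_into (sections (Ob P i) U) (f i U))"
  have q: "qmorphism A Q M P' P g"
    unfolding g_def by (rule qmorphism_inverse[OF tw f(1,2)])
  have b: "bij_betw (g i U) (sections (Ob P' i) U) (sections (Ob P i) U)" if "i \<in> verts Q" "open U" for i U
    unfolding g_def by (rule bij_betw_inv_into[OF f(2)[OF that]])
  have fg: "f i U (g i U p) = p" if "i \<in> verts Q" "open U" "p \<in> sections (Ob P' i) U" for i U p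
    unfolding g_def using bij_betw_inv_into_right[OF f(2)[OF that(1,2)] that(3)] .
  have gf: "g i U (f i U p) = p" if "i \<in> verts Q" "open U" "p \<in> sections (Ob P i) U" for i U p
    unfolding g_def using bij_betw_inv_into_left[OF f(2)[OF that(1,2)] that(3)] .
  have "g i U (\<alpha>' i U n) = \<alpha> i U n" if "i \<in> verts Q" "open U" "n \<in> sections (Ob N i) U" for i U n
    using gf[OF that(1,2) \<alpha>[OF that]] f(3)[OF that] by simp
  moreover have "\<beta> i U (g i U p) = \<beta>' i U p" if "i \<in> verts Q" "open U" "p \<in> sections (Ob P' i) U" for i U p
    using f(4)[OF that(1,2) qmorphism_closed[OF q that]] fg[OF that] by simp
  ultimately show ?thesis
    unfolding ext_equiv_def prod.case using q b by (intro exI[of _ g]) simp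
qed

text \<open>By symmetry and transitivity, equivalent extensions have the same equivalents. The two
  middle terms may have different section types, as long as the members of both classes are taken in
  the section type of \<open>Ext1\<close>.\<close>

lemma ext_class_cong:
  assumes tw: "twisted_qsheaf A Q M P" "twisted_qsheaf A Q M P'"
    and \<alpha>: "\<And>i U n. i \<in> verts Q \<Longrightarrow> open U \<Longrightarrow> n \<in> sections (Ob N i) U \<Longrightarrow> \<alpha> i U n \<in> sections (Ob P i) U"
    and eq: "ext_equiv A Q M R N (P, \<alpha>, \<beta>) (P', \<alpha>', \<beta>')"
  shows "ext_class A Q M R N (P, \<alpha>, \<beta>) = ext_class A Q M R N (P', \<alpha>', \<beta>')"
proof -
  have "ext_equiv A Q M R N (P, \<alpha>, \<beta>) Y \<longleftrightarrow> ext_equiv A Q M R N (P', \<alpha>', \<beta>') Y"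
    if "is_extension A Q M R N Y" for Y
  proof -
    obtain P'' \<alpha>'' \<beta>'' where Y: "Y = (P'', \<alpha>'', \<beta>'')" using prod_cases3 by blast
    have tw'': "twisted_qsheaf A Q M P''"
      using that unfolding is_extension_def Y short_exact_def by simp
    show ?thesis
      unfolding Y using ext_equiv_trans[OF tw tw'' eq]
        ext_equiv_trans[OF tw(2,1) tw'' ext_equiv_sym[OF tw \<alpha> eq]] by blast
  qed
  then show ?thesis unfolding ext_class_def by blast
qed

text \<open>Structure maps are conjugated by the renaming: names are removed inside the tensor
  product, the original map is applied, and the result is named again.\<close>

definition transport_qsheaf :: "('s \<Rightarrow> 't) \<Rightarrow> ('x, 's, 'm, 'v, 'a) qsheaf \<Rightarrow> ('x, 't, 'm, 'v, 'a) qsheaf" where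
  "transport_qsheaf g P =
    \<lparr>Ob = (\<lambda>i. transport_sheaf g (Ob P i)),
     Ar = (\<lambda>a U z. g (Ar P a U (tensor_map A (transport_sheaf g (Ob P (tail Q a))) (M a) (Ob P (tail Q a)) (M a)
       (\<lambda>U. inv_into UNIV g) (\<lambda>U m. m) U z)))\<rparr>"

lemma Ob_transport: "Ob (transport_qsheaf g P) i = transport_sheaf g (Ob P i)"
  by (simp add: transport_qsheaf_def)

lemma
  assumes P: "twisted_qsheaf A Q M P" and g: "inj g"
  shows transport_twisted: "twisted_qsheaf A Q M (transport_qsheaf g P)"
    and transport_qmorphism: "qmorphism A Q M P (transport_qsheaf g P) (\<lambda>i U. g)"
    and transport_inv_qmorphism: "qmorphism A Q M (transport_qsheaf g P) P (\<lambda>i U. inv_into UNIV g)"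
proof -
  let ?T = "transport_qsheaf g P"
  have arc: "sheaf_hom A (tensor A (Ob ?T (tail Q a)) (M a)) (Ob ?T (head Q a)) (Ar ?T a)"
    "open U \<Longrightarrow> s \<in> sections (Ob P (tail Q a)) U \<Longrightarrow> m \<in> sections (M a) U \<Longrightarrow>
      Ar ?T a U (pure A (Ob ?T (tail Q a)) (M a) U (g s) m) = g (Ar P a U (pure A (Ob P (tail Q a)) (M a) U s m))"
    if a: "a \<in> arcs Q" for a U s m
  proof -
    note v = arc_verts[OF a]
    note E = Ob_presheaf[OF P v(1)] and Ma = M_presheaf[OF a]
    note TE = module_sheaf_presheaf[OF transport_sheaf_sheaf[OF Ob_sheaf[OF P v(1)] g]]
    note tm = tensor_map_hom[OF TE Ma E Ma transport_sheaf_inv_hom[OF g] sheaf_hom_id]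
      tensor_map_pure[OF TE Ma E Ma transport_sheaf_inv_hom[OF g] sheaf_hom_id]
    show "sheaf_hom A (tensor A (Ob ?T (tail Q a)) (M a)) (Ob ?T (head Q a)) (Ar ?T a)"
      using sheaf_hom_comp[OF sheaf_hom_comp[OF tm(1) Ar_hom[OF P a]] transport_sheaf_hom[OF g]]
      by (simp add: transport_qsheaf_def)
    show "open U \<Longrightarrow> s \<in> sections (Ob P (tail Q a)) U \<Longrightarrow> m \<in> sections (M a) U \<Longrightarrow>
      Ar ?T a U (pure A (Ob ?T (tail Q a)) (M a) U (g s) m) = g (Ar P a U (pure A (Ob P (tail Q a)) (M a) U s m))"
      using g by (simp add: transport_qsheaf_def tm(2) transport_sheaf_simps)
  qed
  show tw: "twisted_qsheaf A Q M ?T"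
    unfolding twisted_qsheaf_def
  proof (intro conjI ballI)
    show "module_sheaf A (Ob ?T i)" if "i \<in> verts Q" for i
      unfolding Ob_transport by (rule transport_sheaf_sheaf[OF Ob_sheaf[OF P that] g])
  qed (rule arc(1))
  show "qmorphism A Q M P ?T (\<lambda>i U. g)"
    by (rule qmorphismI[OF P tw]) (simp_all add: Ob_transport transport_sheaf_hom[OF g] arc(2)[unfolded Ob_transport])
  show "qmorphism A Q M ?T P (\<lambda>i U. inv_into UNIV g)"
  proof (rule qmorphismI[OF tw P])
    show "sheaf_hom A (Ob ?T i) (Ob P i) (\<lambda>U. inv_into UNIV g)" for i
      unfolding Ob_transport by (rule transport_sheaf_inv_hom[OF g])
    fix a U t m assume *: "a \<in> arcs Q" "open U" "t \<in> sections (Ob ?T (tail Q a)) U" "m \<in> sections (M a) U"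
    then obtain s where s: "t = g s" "s \<in> sections (Ob P (tail Q a)) U"
      by (auto simp: Ob_transport transport_sheaf_simps)
    show "inv_into UNIV g (Ar ?T a U (pure A (Ob ?T (tail Q a)) (M a) U t m)) =
        Ar P a U (pure A (Ob P (tail Q a)) (M a) U (inv_into UNIV g t) m)"
      using arc(2)[OF *(1,2) s(2) *(4)] g by (simp add: s(1))
  qed
qed

text \<open>Renaming along an injection is bijective on sections and linear both ways, so exactness
  carries over and \<open>g\<close> itself is the equivalence. This produces members of
  \<open>ext_class\<close> from extensions with arbitrary section types.\<close>

lemma transport_extension:
  assumes ex: "short_exact A Q M N P R \<alpha> \<beta>" and g: "inj g"
  defines "Y \<equiv> (transport_qsheaf g P, \<lambda>i U n. g (\<alpha> i U n), \<lambda>i U p. \<beta> i U (inv_into UNIV g p))"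
  shows "is_extension A Q M R N Y" and "ext_equiv A Q M R N (P, \<alpha>, \<beta>) Y"
proof -
  let ?T = "transport_qsheaf g P"
  have tw: "twisted_qsheaf A Q M N" "twisted_qsheaf A Q M P" "twisted_qsheaf A Q M R"
    and q: "qmorphism A Q M N P \<alpha>" "qmorphism A Q M P R \<beta>"
    and exact: "\<And>i U. i \<in> verts Q \<Longrightarrow> open U \<Longrightarrow>
        inj_on (\<alpha> i U) (sections (Ob N i) U) \<and>
        \<alpha> i U ` sections (Ob N i) U = {p \<in> sections (Ob P i) U. \<beta> i U p = \<zero>\<^bsub>Sec (Ob R i) U\<^esub>} \<and>
        (\<forall>s\<in>sections (Ob R i) U. \<forall>x\<in>U. \<exists>V p. open V \<and> x \<in> V \<and> V \<subseteq> U \<and>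
           p \<in> sections (Ob P i) V \<and> \<beta> i V p = Res (Ob R i) U V s)"
    using ex unfolding short_exact_def by auto
  note twT = transport_twisted[OF tw(2) g]
  have inv: "inv_into UNIV g (g p) = p" for p using g by simp
  have "short_exact A Q M N ?T R (\<lambda>i U n. g (\<alpha> i U n)) (\<lambda>i U p. \<beta> i U (inv_into UNIV g p))"
    unfolding short_exact_def
  proof (intro conjI ballI allI impI tw twT
      qmorphism_comp[OF tw(1,2) twT q(1) transport_qmorphism[OF tw(2) g]]
      qmorphism_comp[OF twT tw(2,3) transport_inv_qmorphism[OF tw(2) g] q(2)])
    fix i and U :: "'x set" assume i: "i \<in> verts Q" and U: "open U"
    note e = exact[OF i U]
    show "inj_on (\<lambda>n. g (\<alpha> i U n)) (sections (Ob N i) U)"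
      using comp_inj_on[OF conjunct1[OF e] inj_on_subset[OF g subset_UNIV]] by (simp add: comp_def)
    have "(\<lambda>n. g (\<alpha> i U n)) ` sections (Ob N i) U = g ` (\<alpha> i U ` sections (Ob N i) U)"
      by (simp add: image_image)
    also have "\<dots> = {p \<in> sections (Ob ?T i) U. \<beta> i U (inv_into UNIV g p) = \<zero>\<^bsub>Sec (Ob R i) U\<^esub>}"
      using e by (auto simp: Ob_transport transport_sheaf_simps inv)
    finally show "(\<lambda>n. g (\<alpha> i U n)) ` sections (Ob N i) U =
        {p \<in> sections (Ob ?T i) U. \<beta> i U (inv_into UNIV g p) = \<zero>\<^bsub>Sec (Ob R i) U\<^esub>}" .
    fix s x assume "s \<in> sections (Ob R i) U" "x \<in> U"
    then obtain V p where "open V" "x \<in> V" "V \<subseteq> U" "p \<in> sections (Ob P i) V" "\<beta> i V p = Res (Ob R i) U V s"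
      using conjunct2[OF conjunct2[OF e]] by blast
    then show "\<exists>V p. open V \<and> x \<in> V \<and> V \<subseteq> U \<and> p \<in> sections (Ob ?T i) V \<and> \<beta> i V (inv_into UNIV g p) = Res (Ob R i) U V s"
      by (intro exI[of _ V] exI[of _ "g p"]) (auto simp: Ob_transport transport_sheaf_simps inv)
  qed
  then show "is_extension A Q M R N Y" by (simp add: is_extension_def Y_def)
  have "bij_betw g (sections (Ob P i) U) (sections (Ob ?T i) U)" for i U
    using inj_on_subset[OF g subset_UNIV]
    by (simp add: bij_betw_def Ob_transport transport_sheaf_simps(1))
  then show "ext_equiv A Q M R N (P, \<alpha>, \<beta>) Y"
    unfolding ext_equiv_def Y_def prod.case using transport_qmorphism[OF tw(2) g]
    by (intro exI[of _ "\<lambda>i U. g"]) (simp add: inv)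
qed

section \<open>Splittings of an extension and its pullback along the identity\<close>

context
  fixes N :: "('x, 'n, 'm, 'v, 'a) qsheaf" and P :: "('x, 'e, 'm, 'v, 'a) qsheaf"
    and R :: "('x, 's, 'm, 'v, 'a) qsheaf" and \<alpha> \<beta>
  assumes ex: "short_exact A Q M N P R \<alpha> \<beta>"
begin

private lemma
  shows N: "twisted_qsheaf A Q M N" and P: "twisted_qsheaf A Q M P" and R: "twisted_qsheaf A Q M R"
    and \<alpha>: "qmorphism A Q M N P \<alpha>" and \<beta>: "qmorphism A Q M P R \<beta>"
    and \<alpha>_inj: "i \<in> verts Q \<Longrightarrow> open U \<Longrightarrow> inj_on (\<alpha> i U) (sections (Ob N i) U)"
    and exact: "i \<in> verts Q \<Longrightarrow> open U \<Longrightarrow>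
      \<alpha> i U ` sections (Ob N i) U = {p \<in> sections (Ob P i) U. \<beta> i U p = \<zero>\<^bsub>Sec (Ob R i) U\<^esub>}"
  using ex unfolding short_exact_def by auto

private abbreviation "TR \<equiv> prod_qsheaf A Q M N R (\<lambda>i U n s. True)"

text \<open>The pullback along the identity is the graph of \<beta>; the first projection identifies
  it with \<open>P\<close>.\<close>

private abbreviation "PB \<equiv> prod_qsheaf A Q M P R (\<lambda>i U p s. \<beta> i U p = s)"

private lemma TR_Ob: "Ob TR i = prod_sheaf (Ob N i) (Ob R i) (\<lambda>U n s. True)"
  by (rule Ob_prod[OF N R]) (simp_all add: submodule_condition_True)

private lemma TR_twisted: "twisted_qsheaf A Q M TR"
  by (rule prod_twisted[OF N R]) (simp_all add: submodule_condition_True)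

private lemma TR_Ar: "a \<in> arcs Q \<Longrightarrow> open U \<Longrightarrow> n \<in> sections (Ob N (tail Q a)) U \<Longrightarrow>
    s \<in> sections (Ob R (tail Q a)) U \<Longrightarrow> m \<in> sections (M a) U \<Longrightarrow>
    Ar TR a U (pure A (Ob TR (tail Q a)) (M a) U (n, s) m) =
      (Ar N a U (pure A (Ob N (tail Q a)) (M a) U n m), Ar R a U (pure A (Ob R (tail Q a)) (M a) U s m))"
  by (rule Ar_prod_pure[OF N R]) (simp_all add: submodule_condition_True)

private lemma TR_snd: "qmorphism A Q M TR R (\<lambda>i U. snd)"
  by (rule prod_snd[OF N R]) (simp_all add: submodule_condition_True)

private lemma PB_condition: "i \<in> verts Q \<Longrightarrow> submodule_condition A (Ob P i) (Ob R i) (\<lambda>U p s. \<beta> i U p = s)"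
  by (rule submodule_condition_equalizer[OF Ob_presheaf[OF P] Ob_presheaf[OF R] Ob_sheaf[OF R]
        qmorphism_hom[OF \<beta>] sheaf_hom_id])

private lemma PB_arrow: "a \<in> arcs Q \<Longrightarrow> open U \<Longrightarrow> p \<in> sections (Ob P (tail Q a)) U \<Longrightarrow>
    s \<in> sections (Ob R (tail Q a)) U \<Longrightarrow> \<beta> (tail Q a) U p = s \<Longrightarrow> m \<in> sections (M a) U \<Longrightarrow>
    \<beta> (head Q a) U (Ar P a U (pure A (Ob P (tail Q a)) (M a) U p m)) =
      Ar R a U (pure A (Ob R (tail Q a)) (M a) U s m)"
  using qmorphism_pure[OF \<beta> P R] by simp

private lemma PB_Ob: "Ob PB i = prod_sheaf (Ob P i) (Ob R i) (\<lambda>U p s. \<beta> i U p = s)"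
  by (rule Ob_prod[OF P R PB_condition PB_arrow], assumption+)

private lemma PB_twisted: "twisted_qsheaf A Q M PB"
  by (rule prod_twisted[OF P R PB_condition PB_arrow], assumption+)

private lemma PB_fst: "qmorphism A Q M PB P (\<lambda>i U. fst)"
  by (rule prod_fst[OF P R PB_condition PB_arrow], assumption+)

private lemma PB_Ar: "a \<in> arcs Q \<Longrightarrow> open U \<Longrightarrow> p \<in> sections (Ob P (tail Q a)) U \<Longrightarrow>
    s \<in> sections (Ob R (tail Q a)) U \<Longrightarrow> \<beta> (tail Q a) U p = s \<Longrightarrow> m \<in> sections (M a) U \<Longrightarrow>
    Ar PB a U (pure A (Ob PB (tail Q a)) (M a) U (p, s) m) =
      (Ar P a U (pure A (Ob P (tail Q a)) (M a) U p m), Ar R a U (pure A (Ob R (tail Q a)) (M a) U s m))"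
  by (rule Ar_prod_pure[OF P R PB_condition PB_arrow], assumption+)

lemma arrow_zero:
  assumes S: "twisted_qsheaf A Q M S" and a: "a \<in> arcs Q" and U: "open U" and m: "m \<in> sections (M a) U"
  shows "Ar S a U (pure A (Ob S (tail Q a)) (M a) U \<zero>\<^bsub>Sec (Ob S (tail Q a)) U\<^esub> m) = \<zero>\<^bsub>Sec (Ob S (head Q a)) U\<^esub>"
proof -
  note E = Ob_presheaf[OF S arc_verts(1)[OF a]] and Ma = M_presheaf[OF a]
  show ?thesis
    using additive_map_zero[OF tensor_module_presheaf[OF E Ma] Ob_presheaf[OF S arc_verts(2)[OF a]]
        sheaf_hom_additive[OF Ar_hom[OF S a]] U subset_UNIV] pure_zero_left[OF E Ma U m] by simp
qed

private lemma TR_short_exact: "short_exact A Q M N TR R (\<lambda>i U n. (n, \<zero>\<^bsub>Sec (Ob R i) U\<^esub>)) (\<lambda>i U. snd)"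
  unfolding short_exact_def
proof (intro conjI N R TR_twisted TR_snd ballI allI impI)
  show "qmorphism A Q M N TR (\<lambda>i U n. (n, \<zero>\<^bsub>Sec (Ob R i) U\<^esub>))"
  proof (rule qmorphismI[OF N TR_twisted])
    show "sheaf_hom A (Ob N i) (Ob TR i) (\<lambda>U n. (n, \<zero>\<^bsub>Sec (Ob R i) U\<^esub>))" if "i \<in> verts Q" for i
      using Ob_presheaf[OF R that] unfolding sheaf_hom_on_def additive_map_on_def TR_Ob
      by (auto simp: prod_sheaf_simps presheaf_zero_closed presheaf_zero_add presheaf_Res_zero presheaf_smult_zero)
    fix a U n m assume a: "a \<in> arcs Q" and U: "open U" and n: "n \<in> sections (Ob N (tail Q a)) U"
      and m: "m \<in> sections (M a) U"
    show "(Ar N a U (pure A (Ob N (tail Q a)) (M a) U n m), \<zero>\<^bsub>Sec (Ob R (head Q a)) U\<^esub>) =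
        Ar TR a U (pure A (Ob TR (tail Q a)) (M a) U (n, \<zero>\<^bsub>Sec (Ob R (tail Q a)) U\<^esub>) m)"
      using TR_Ar[OF a U n presheaf_zero_closed[OF Ob_presheaf[OF R arc_verts(1)[OF a]] U] m] arrow_zero[OF R a U m]
      by simp
  qed
  fix i and U :: "'x set" assume i: "i \<in> verts Q" and U: "open U"
  note Np = Ob_presheaf[OF N i] and Rp = Ob_presheaf[OF R i]
  show "inj_on (\<lambda>n. (n, \<zero>\<^bsub>Sec (Ob R i) U\<^esub>)) (sections (Ob N i) U)" by (auto simp: inj_on_def)
  show "(\<lambda>n. (n, \<zero>\<^bsub>Sec (Ob R i) U\<^esub>)) ` sections (Ob N i) U =
      {p \<in> sections (Ob TR i) U. snd p = \<zero>\<^bsub>Sec (Ob R i) U\<^esub>}"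
    using presheaf_zero_closed[OF Rp U] by (auto simp: TR_Ob prod_sheaf_simps)
  fix s x assume "s \<in> sections (Ob R i) U" "x \<in> U"
  then show "\<exists>V p. open V \<and> x \<in> V \<and> V \<subseteq> U \<and> p \<in> sections (Ob TR i) V \<and> snd p = Res (Ob R i) U V s"
    using U presheaf_zero_closed[OF Np U] presheaf_Res_id[OF Rp U]
    by (intro exI[of _ U] exI[of _ "(\<zero>\<^bsub>Sec (Ob N i) U\<^esub>, s)"]) (auto simp: TR_Ob prod_sheaf_simps)
qed

text \<open>The inclusion of the second summand. Carried through an equivalence of extensions, it
  becomes the splitting of the given sequence.\<close>

private lemma TR_section: "qmorphism A Q M R TR (\<lambda>i U s. (\<zero>\<^bsub>Sec (Ob N i) U\<^esub>, s))"
proof (rule qmorphismI[OF R TR_twisted])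
  show "sheaf_hom A (Ob R i) (Ob TR i) (\<lambda>U s. (\<zero>\<^bsub>Sec (Ob N i) U\<^esub>, s))" if "i \<in> verts Q" for i
    using Ob_presheaf[OF N that] unfolding sheaf_hom_on_def additive_map_on_def TR_Ob
    by (auto simp: prod_sheaf_simps presheaf_zero_closed presheaf_zero_add presheaf_Res_zero presheaf_smult_zero)
  fix a U s m assume a: "a \<in> arcs Q" and U: "open U" and s: "s \<in> sections (Ob R (tail Q a)) U"
    and m: "m \<in> sections (M a) U"
  show "(\<zero>\<^bsub>Sec (Ob N (head Q a)) U\<^esub>, Ar R a U (pure A (Ob R (tail Q a)) (M a) U s m)) =
      Ar TR a U (pure A (Ob TR (tail Q a)) (M a) U (\<zero>\<^bsub>Sec (Ob N (tail Q a)) U\<^esub>, s) m)"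
    using TR_Ar[OF a U presheaf_zero_closed[OF Ob_presheaf[OF N arc_verts(1)[OF a]] U] s m] arrow_zero[OF N a U m]
    by simp
qed

text \<open>The equivalence sends \<open>(n, s)\<close> to \<alpha>(n) + \<sigma>(s), paired with
  \<open>s\<close>. Since \<beta> kills the first summand and undoes \<sigma>, the value lies in the
  graph of \<beta>; bijectivity is exactness of the sequence.\<close>

lemma split_imp_ext_equiv:
  assumes \<sigma>: "qmorphism A Q M R P \<sigma>"
    and \<beta>\<sigma>: "\<And>i U s. i \<in> verts Q \<Longrightarrow> open U \<Longrightarrow> s \<in> sections (Ob R i) U \<Longrightarrow> \<beta> i U (\<sigma> i U s) = s"
  shows "ext_equiv A Q M R N (TR, \<lambda>i U n. (n, \<zero>\<^bsub>Sec (Ob R i) U\<^esub>), \<lambda>i U. snd)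
    (PB, \<lambda>i U n. (\<alpha> i U n, \<zero>\<^bsub>Sec (Ob R i) U\<^esub>), \<lambda>i U. snd)"
proof -
  define h where "h = (\<lambda>i U p. \<alpha> i U (fst p) \<oplus>\<^bsub>Sec (Ob P i) U\<^esub> \<sigma> i U (snd p))"
  define \<theta> where "\<theta> = (\<lambda>i U p. (h i U p, snd p))"
  have TRi: "p \<in> sections (Ob TR i) U \<longleftrightarrow> fst p \<in> sections (Ob N i) U \<and> snd p \<in> sections (Ob R i) U" for i U p
    by (cases p) (auto simp: TR_Ob prod_sheaf_simps)
  have PBi: "p \<in> sections (Ob PB i) U \<longleftrightarrow> fst p \<in> sections (Ob P i) U \<and> snd p \<in> sections (Ob R i) U \<and>
      \<beta> i U (fst p) = snd p" for i U p
    by (cases p) (auto simp: PB_Ob prod_sheaf_simps)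
  have \<beta>\<alpha>: "\<beta> i U (\<alpha> i U n) = \<zero>\<^bsub>Sec (Ob R i) U\<^esub>"
    if "i \<in> verts Q" "open U" "n \<in> sections (Ob N i) U" for i U n
    using exact[OF that(1,2)] that(3) by blast
  have h_closed: "h i U p \<in> sections (Ob P i) U" and \<beta>h: "\<beta> i U (h i U p) = snd p"
    if i: "i \<in> verts Q" and U: "open U" and p: "p \<in> sections (Ob TR i) U" for i U p
  proof -
    note c = qmorphism_closed[OF \<alpha> i U] qmorphism_closed[OF \<sigma> i U]
    show "h i U p \<in> sections (Ob P i) U"
      unfolding h_def using p c by (intro presheaf_add_closed[OF Ob_presheaf[OF P i] U]) (auto simp: TRi)
    show "\<beta> i U (h i U p) = snd p"
      using p c by (simp add: h_def TRi qmorphism_add[OF \<beta> i U] \<beta>\<alpha>[OF i U] \<beta>\<sigma>[OF i U]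
          presheaf_zero_add[OF Ob_presheaf[OF R i] U])
  qed
  have h_hom: "sheaf_hom A (Ob TR i) (Ob P i) (h i)" if i: "i \<in> verts Q" for i
  proof -
    note Pp = Ob_presheaf[OF P i]
    have fs: "sheaf_hom A (Ob TR i) (Ob N i) (\<lambda>U. fst)" "sheaf_hom A (Ob TR i) (Ob R i) (\<lambda>U. snd)"
      unfolding TR_Ob by (rule prod_sheaf_fst prod_sheaf_snd)+
    note k = sheaf_hom_comp[OF fs(1) qmorphism_hom[OF \<alpha> i]] sheaf_hom_comp[OF fs(2) qmorphism_hom[OF \<sigma> i]]
    note ka = k[THEN sheaf_hom_additive]
    show ?thesis
      unfolding sheaf_hom_on_def h_def
      using additive_map_sum[OF Pp ka] sheaf_hom_smult[OF k(1)] sheaf_hom_smult[OF k(2)]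
        additive_map_closed[OF ka(1)] additive_map_closed[OF ka(2)]
      by (simp add: presheaf_smult_add[OF Pp])
  qed
  have \<theta>: "qmorphism A Q M TR PB \<theta>"
  proof (rule qmorphismI[OF TR_twisted PB_twisted])
    fix i assume i: "i \<in> verts Q"
    show "sheaf_hom A (Ob TR i) (Ob PB i) (\<theta> i)"
      unfolding sheaf_hom_on_def
    proof (intro conjI additive_mapI allI impI ballI)
      fix U p assume "open U" "p \<in> sections (Ob TR i) U"
      then show "\<theta> i U p \<in> sections (Ob PB i) U"
        using h_closed[OF i] \<beta>h[OF i] by (simp add: \<theta>_def PBi TRi)
    next
      fix U p q assume *: "open U" "p \<in> sections (Ob TR i) U" "q \<in> sections (Ob TR i) U"
      show "\<theta> i U (p \<oplus>\<^bsub>Sec (Ob TR i) U\<^esub> q) = \<theta> i U p \<oplus>\<^bsub>Sec (Ob PB i) U\<^esub> \<theta> i U q"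
        using additive_map_add[OF sheaf_hom_additive[OF h_hom[OF i]] *(1) subset_UNIV *(2,3)]
        by (cases p; cases q) (simp add: \<theta>_def PB_Ob TR_Ob prod_sheaf_simps)
    next
      fix U V p assume *: "open U" "open V" "V \<subseteq> U" "p \<in> sections (Ob TR i) U"
      show "\<theta> i V (Res (Ob TR i) U V p) = Res (Ob PB i) U V (\<theta> i U p)"
        using additive_map_Res[OF sheaf_hom_additive[OF h_hom[OF i]] *(1) subset_UNIV *(2-4)]
        by (cases p) (simp add: \<theta>_def PB_Ob TR_Ob prod_sheaf_simps)
    next
      fix U f p assume *: "open U \<and> U \<subseteq> UNIV" "f \<in> smooth_fun A U" "p \<in> sections (Ob TR i) U"
      show "\<theta> i U (f \<odot>\<^bsub>Sec (Ob TR i) U\<^esub> p) = f \<odot>\<^bsub>Sec (Ob PB i) U\<^esub> \<theta> i U p"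
        using sheaf_hom_smult[OF h_hom[OF i] conjunct1[OF *(1)] subset_UNIV *(2,3)]
        by (cases p) (simp add: \<theta>_def PB_Ob TR_Ob prod_sheaf_simps)
    qed
  next
    fix a U p m assume a: "a \<in> arcs Q" and U: "open U" and p: "p \<in> sections (Ob TR (tail Q a)) U"
      and m: "m \<in> sections (M a) U"
    note v = arc_verts[OF a]
    obtain n s where ns: "p = (n, s)" "n \<in> sections (Ob N (tail Q a)) U" "s \<in> sections (Ob R (tail Q a)) U"
      using p by (cases p) (auto simp: TRi)
    note Pv = Ob_presheaf[OF P v(1)] and Ma = M_presheaf[OF a]
    note c = qmorphism_closed[OF \<alpha> v(1) U ns(2)] qmorphism_closed[OF \<sigma> v(1) U ns(3)]
    note hp = h_closed[OF v(1) U p] \<beta>h[OF v(1) U p]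
    have "Ar P a U (pure A (Ob P (tail Q a)) (M a) U (h (tail Q a) U p) m) =
        Ar P a U (pure A (Ob P (tail Q a)) (M a) U (\<alpha> (tail Q a) U n) m) \<oplus>\<^bsub>Sec (Ob P (head Q a)) U\<^esub>
        Ar P a U (pure A (Ob P (tail Q a)) (M a) U (\<sigma> (tail Q a) U s) m)"
      using c m by (simp add: h_def ns(1) pure_add_left[OF Pv Ma U] pure_closed[OF Pv Ma U]
          additive_map_add[OF sheaf_hom_additive[OF Ar_hom[OF P a]] U subset_UNIV])
    also have "\<dots> = h (head Q a) U (Ar TR a U (pure A (Ob TR (tail Q a)) (M a) U p m))"
      using qmorphism_pure[OF \<alpha> N P a U ns(2) m] qmorphism_pure[OF \<sigma> R P a U ns(3) m]
      by (simp add: ns(1) TR_Ar[OF a U ns(2,3) m] h_def)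
    finally show "\<theta> (head Q a) U (Ar TR a U (pure A (Ob TR (tail Q a)) (M a) U p m)) =
        Ar PB a U (pure A (Ob PB (tail Q a)) (M a) U (\<theta> (tail Q a) U p) m)"
      using PB_Ar[OF a U hp(1) ns(3) _ m] hp(2) by (simp add: \<theta>_def ns(1) TR_Ar[OF a U ns(2,3) m])
  qed
  have bij: "bij_betw (\<theta> i U) (sections (Ob TR i) U) (sections (Ob PB i) U)"
    if i: "i \<in> verts Q" and U: "open U" for i U
  proof -
    note Pp = Ob_presheaf[OF P i]
    have ab: "abelian_group (Sec (Ob P i) U)"
      using presheaf_module[OF Pp U] by (simp add: Module.module_def)
    interpret G: abelian_group "Sec (Ob P i) U" by (rule ab)
    note c = qmorphism_closed[OF \<alpha> i U] qmorphism_closed[OF \<sigma> i U]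
    have "inj_on (\<theta> i U) (sections (Ob TR i) U)"
    proof (rule inj_onI)
      fix p q assume p: "p \<in> sections (Ob TR i) U" and q: "q \<in> sections (Ob TR i) U" and eq: "\<theta> i U p = \<theta> i U q"
      then have s: "snd p = snd q" and "h i U p = h i U q" by (auto simp: \<theta>_def)
      then have "\<alpha> i U (fst p) = \<alpha> i U (fst q)"
        using p q c by (simp add: h_def TRi)
      then have "fst p = fst q" using \<alpha>_inj[OF i U] p q by (auto simp: TRi inj_on_def)
      then show "p = q" using s by (simp add: prod_eq_iff)
    qed
    moreover have "\<theta> i U ` sections (Ob TR i) U = sections (Ob PB i) U"
    proof (intro equalityI subsetI)
      show "q \<in> sections (Ob PB i) U" if "q \<in> \<theta> i U ` sections (Ob TR i) U" for q
        using that qmorphism_closed[OF \<theta> i U] by blast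
      fix q assume "q \<in> sections (Ob PB i) U"
      then obtain p s where q: "q = (p, s)" "p \<in> sections (Ob P i) U" "s \<in> sections (Ob R i) U" "\<beta> i U p = s"
        by (cases q) (auto simp: PBi)
      \<comment> \<open>Subtracting the lift of its image moves \<open>p\<close> into the kernel of
        \<beta>, so exactness provides the component \<open>n\<close> of the preimage.\<close>
      define r where "r = p \<ominus>\<^bsub>Sec (Ob P i) U\<^esub> \<sigma> i U s"
      have r: "r \<in> sections (Ob P i) U" "r \<oplus>\<^bsub>Sec (Ob P i) U\<^esub> \<sigma> i U s = p"
        using q c by (simp_all add: r_def G.minus_eq G.a_assoc G.l_neg)
      have br: "\<beta> i U r \<in> sections (Ob R i) U" by (rule qmorphism_closed[OF \<beta> i U r(1)])
      have "\<beta> i U r \<oplus>\<^bsub>Sec (Ob R i) U\<^esub> s = s"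
        using qmorphism_add[OF \<beta> i U r(1) c(2)[OF q(3)]] \<beta>\<sigma>[OF i U q(3)] r(2) q(4) by simp
      then have "\<beta> i U r = \<zero>\<^bsub>Sec (Ob R i) U\<^esub>"
        using presheaf_add_eq_selfD[OF Ob_presheaf[OF R i] U q(3) br]
          presheaf_add_comm[OF Ob_presheaf[OF R i] U q(3) br] by simp
      then obtain n where n: "n \<in> sections (Ob N i) U" "\<alpha> i U n = r"
        using exact[OF i U] r(1) by (metis (mono_tags, lifting) imageE mem_Collect_eq)
      have "q = \<theta> i U (n, s)" by (simp add: \<theta>_def h_def q(1) n(2) r(2))
      moreover have "(n, s) \<in> sections (Ob TR i) U" using n(1) q(3) by (simp add: TRi)
      ultimately show "q \<in> \<theta> i U ` sections (Ob TR i) U" by blast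
    qed
    ultimately show ?thesis by (simp add: bij_betw_def)
  qed
  have "\<theta> i U (n, \<zero>\<^bsub>Sec (Ob R i) U\<^esub>) = (\<alpha> i U n, \<zero>\<^bsub>Sec (Ob R i) U\<^esub>)"
    if "i \<in> verts Q" "open U" "n \<in> sections (Ob N i) U" for i U n
    using additive_map_zero[OF Ob_presheaf[OF R] Ob_presheaf[OF P] sheaf_hom_additive[OF qmorphism_hom[OF \<sigma>]], OF that(1,1,1,2) subset_UNIV]
      presheaf_add_zero[OF Ob_presheaf[OF P that(1)] that(2) qmorphism_closed[OF \<alpha> that]]
    by (simp add: \<theta>_def h_def)
  then show ?thesis
    unfolding ext_equiv_def prod.case using \<theta> bij by (intro exI[of _ \<theta>]) (simp add: \<theta>_def)
qed

text \<open>The class of the trivial extension is not empty as a set: its middle term can be carried over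
  to the section type of \<open>Ext1\<close> along an injection. Hence an equality of classes yields an
  equivalence of extensions.\<close>

lemma split_iff_connecting_map:
  "(\<exists>\<sigma>. qmorphism A Q M R P \<sigma> \<and>
      (\<forall>i\<in>verts Q. \<forall>U. open U \<longrightarrow> (\<forall>s\<in>sections (Ob R i) U. \<beta> i U (\<sigma> i U s) = s))) \<longleftrightarrow>
   connecting_map A Q M N (P, \<alpha>, \<beta>) R (\<lambda>i U s. s) = Ext1_zero A Q M R N"
proof -
  let ?a0 = "\<lambda>i U n. (n, \<zero>\<^bsub>Sec (Ob R i) U\<^esub>)" and ?a1 = "\<lambda>i U n. (\<alpha> i U n, \<zero>\<^bsub>Sec (Ob R i) U\<^esub>)"
  let ?b = "\<lambda>(i::'v) (U::'x set). snd"
  have eq: "connecting_map A Q M N (P, \<alpha>, \<beta>) R (\<lambda>i U s. s) = ext_class A Q M R N (PB, ?a1, ?b)"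
    "Ext1_zero A Q M R N = ext_class A Q M R N (TR, ?a0, ?b)"
    by (simp_all add: connecting_map_def pullback_extension_def Ext1_zero_def trivial_extension_def)
  show ?thesis
    unfolding eq
  proof
    assume "\<exists>\<sigma>. qmorphism A Q M R P \<sigma> \<and>
      (\<forall>i\<in>verts Q. \<forall>U. open U \<longrightarrow> (\<forall>s\<in>sections (Ob R i) U. \<beta> i U (\<sigma> i U s) = s))"
    then obtain \<sigma> where s: "qmorphism A Q M R P \<sigma> \<and>
      (\<forall>i\<in>verts Q. \<forall>U. open U \<longrightarrow> (\<forall>s\<in>sections (Ob R i) U. \<beta> i U (\<sigma> i U s) = s))" by (rule exE)
    have e: "ext_equiv A Q M R N (TR, ?a0, ?b) (PB, ?a1, ?b)"
      by (rule split_imp_ext_equiv[OF conjunct1[OF s] conjunct2[OF s, rule_format]])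
    have "ext_class A Q M R N (TR, ?a0, ?b) = ext_class A Q M R N (PB, ?a1, ?b)"
      by (rule ext_class_cong[OF TR_twisted PB_twisted _ e])
        (auto simp: TR_Ob prod_sheaf_simps intro!: presheaf_zero_closed[OF Ob_presheaf[OF R]])
    then show "ext_class A Q M R N (PB, ?a1, ?b) = ext_class A Q M R N (TR, ?a0, ?b)" by (rule sym)
  next
    assume classes: "ext_class A Q M R N (PB, ?a1, ?b) = ext_class A Q M R N (TR, ?a0, ?b)"
    \<comment> \<open>Any injection of pairs into the section type of \<open>Ext1\<close> would
      serve. The pair is stored in a constant function; its singletons have the shape demanded by
      the type but are not meant as germs.\<close>
    define g :: "'n \<times> 's \<Rightarrow> ('x, 'n, 's) ext_sec" where "g = (\<lambda>p x. ({(UNIV, fst p)}, {(UNIV, snd p)}))"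
    have g: "inj g" by (auto simp: inj_def g_def fun_eq_iff prod_eq_iff)
    note Y = transport_extension[OF TR_short_exact g]
    let ?Y = "(transport_qsheaf g TR, \<lambda>i U n. g (?a0 i U n), \<lambda>i U p. ?b i U (inv_into UNIV g p))"
    \<comment> \<open>The class of the trivial extension contains its renamed copy. Without a known
      member, equality of the two classes would give no equivalence.\<close>
    have "?Y \<in> ext_class A Q M R N (TR, ?a0, ?b)" unfolding ext_class_def using Y by simp
    then have "?Y \<in> ext_class A Q M R N (PB, ?a1, ?b)" by (simp only: classes)
    then have "ext_equiv A Q M R N (PB, ?a1, ?b) ?Y" by (simp add: ext_class_def)
    then obtain \<theta> where "qmorphism A Q M PB (transport_qsheaf g TR) \<theta> \<and>
        (\<forall>i\<in>verts Q. \<forall>U. open U \<longrightarrow>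
           bij_betw (\<theta> i U) (sections (Ob PB i) U) (sections (Ob (transport_qsheaf g TR) i) U) \<and>
           (\<forall>n\<in>sections (Ob N i) U. \<theta> i U (?a1 i U n) = g (?a0 i U n)) \<and>
           (\<forall>p\<in>sections (Ob PB i) U. snd (inv_into UNIV g (\<theta> i U p)) = snd p))"
      unfolding ext_equiv_def prod.case by (rule exE)
    then have \<theta>: "qmorphism A Q M PB (transport_qsheaf g TR) \<theta>"
      "\<And>i U. i \<in> verts Q \<Longrightarrow> open U \<Longrightarrow>
        bij_betw (\<theta> i U) (sections (Ob PB i) U) (sections (Ob (transport_qsheaf g TR) i) U)"
      "\<And>i U p. i \<in> verts Q \<Longrightarrow> open U \<Longrightarrow> p \<in> sections (Ob PB i) U \<Longrightarrow> snd (inv_into UNIV g (\<theta> i U p)) = snd p"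
      by simp_all
    note twT = transport_twisted[OF TR_twisted g]
    define \<psi> where "\<psi> = (\<lambda>i U. inv_into (sections (Ob PB i) U) (\<theta> i U))"
    have \<psi>: "qmorphism A Q M (transport_qsheaf g TR) PB \<psi>"
      unfolding \<psi>_def by (rule qmorphism_inverse[OF PB_twisted twT \<theta>(1,2)])
    note e1 = qmorphism_comp[OF R TR_twisted twT TR_section transport_qmorphism[OF TR_twisted g]]
    note e2 = qmorphism_comp[OF R twT PB_twisted e1 \<psi>]
    note e3 = qmorphism_comp[OF R PB_twisted P e2 PB_fst]
    \<comment> \<open>The inclusion of \<open>R\<close> into the direct sum is renamed, carried into
      the pullback by the inverse of the equivalence, and projected to \<open>P\<close>. The
      condition defining the pullback turns preservation of the second component into the splitting
      equation.\<close>
    define \<sigma> where "\<sigma> = (\<lambda>i U s. fst (\<psi> i U (g (\<zero>\<^bsub>Sec (Ob N i) U\<^esub>, s))))"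
    have "\<beta> i U (\<sigma> i U s) = s" if i: "i \<in> verts Q" and U: "open U" and s: "s \<in> sections (Ob R i) U" for i U s
    proof -
      define q where "q = \<psi> i U (g (\<zero>\<^bsub>Sec (Ob N i) U\<^esub>, s))"
      have q: "q \<in> sections (Ob PB i) U" unfolding q_def by (rule qmorphism_closed[OF e2 i U s])
      have "\<theta> i U q = g (\<zero>\<^bsub>Sec (Ob N i) U\<^esub>, s)"
        unfolding q_def \<psi>_def
        by (rule bij_betw_inv_into_right[OF \<theta>(2)[OF i U] qmorphism_closed[OF e1 i U s]])
      then have "snd q = s" using \<theta>(3)[OF i U q] g by simp
      then show ?thesis using q by (auto simp: \<sigma>_def PB_Ob prod_sheaf_simps simp flip: q_def)
    qed
    then show "\<exists>\<sigma>. qmorphism A Q M R P \<sigma> \<and>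
      (\<forall>i\<in>verts Q. \<forall>U. open U \<longrightarrow> (\<forall>s\<in>sections (Ob R i) U. \<beta> i U (\<sigma> i U s) = s))"
      using e3 by (intro exI[of _ \<sigma>]) (simp add: \<sigma>_def)
  qed
qed

end

end

theorem proposition3p8:
  fixes A :: "('x::{t2_space,second_countable_topology}, 'b::real_normed_vector) atlas"
    and Q :: "('v, 'a) pre_digraph"
    and M :: "'a \<Rightarrow> ('x, 'm) mod_sheaf"
    and R :: "('x, 's, 'm, 'v, 'a) qsheaf"
    and D1 :: "'a \<Rightarrow> 'x set \<Rightarrow> 'm \<Rightarrow> ('x, 'x form, 'm) tensor_sec"
  assumes "smooth_manifold A"
    and "connected (UNIV :: 'x set)"
    and "fin_digraph Q"
    and "\<forall>a\<in>arcs Q. vector_bundle A (M a)"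
    and "twisted_qbundle A Q M R"
    and "\<forall>a\<in>arcs Q. connection A (M a) (D1 a)"
  shows
    "(split_short_exact A Q M
        (cotangent_qsheaf A Q M R) (jet_qsheaf A Q M R D1) R (jet_alpha R) jet_beta
      \<longleftrightarrow>
      (\<exists>D0 D1'. relative_connection A Q M R D0 D1' \<and>
         (\<forall>a\<in>arcs Q. \<forall>U. open U \<longrightarrow> (\<forall>m\<in>sections (M a) U. D1' a U m = D1 a U m))))
     \<and>
     ((\<exists>D0 D1'. relative_connection A Q M R D0 D1' \<and>
         (\<forall>a\<in>arcs Q. \<forall>U. open U \<longrightarrow> (\<forall>m\<in>sections (M a) U. D1' a U m = D1 a U m)))
      \<longleftrightarrow>
      atiyah_class A Q M R D1 = Ext1_zero A Q M R (cotangent_qsheaf A Q M R))"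
proof -
  interpret jet_sequence A Q M R D1
  proof (intro jet_sequence.intro twisted_quiver.intro smooth_mfd.intro twisted_quiver_axioms.intro
      jet_sequence_axioms.intro)
    show "smooth_manifold A" by (rule assms(1))
    show "wf_digraph Q" using assms(3) by (simp add: fin_digraph_def)
    show "module_sheaf A (M a)" if "a \<in> arcs Q" for a
      using assms(4) that by (simp add: vector_bundle_def)
    show "twisted_qsheaf A Q M R" using assms(5) by (simp add: twisted_qbundle_def)
    show "connection A (M a) (D1 a)" if "a \<in> arcs Q" for a using assms(6) that by simp
  qed
  show ?thesis
    \<comment> \<open>Every statement is rewritten into the existence of a relative connection
      extending \<open>D1\<close>. What remains of the first is short exactness of the jet sequence,
      which \<open>jet_short_exact\<close> provides.\<close>
    unfolding split_short_exact_def atiyah_class_def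
      split_iff_connecting_map[OF jet_short_exact, symmetric] split_iff_relative_connection
    using jet_short_exact by blast
qed

end
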